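(* Let $X$ be a real random variable with distribution function $F$ satisfying condition $\mathcal{C}_2(\gamma,a,\rho,A)$ (so $\gamma<0$), and let $x^\star$ be its finite right endpoint. Let $\tau_n\uparrow 1$ and $\alpha_n\uparrow 1$ be such that $n \overline{F}(\xi_{\tau_n})\to\infty$, $\overline{F}(\xi_{\tau_n})/(1-\alpha_n)\to 1$ and $\sqrt{n \overline{F}(\xi_{\tau_n})}\, A(1/\overline{F}(\xi_{\tau_n}))=O(1)$. Suppose that the data $(X_t)_{t\ge 1}$ satisfy one of the following: (i) $(X_t)_{t\geq 1}$ is a strictly stationary sequence of copies of $X$, whose distribution function $F$ is continuous, satisfying conditions $\mathcal{M}$ (with block sequences $(l_n)$, $(r_n)$) and $\mathcal{D}$; moreover $r_n \overline{F}(\xi_{\tau_n})\to 0$, and there is $\delta>0$ such that $\mathbb{E}(|\min(X,0)|^{2+\delta})<\infty$, $\sum_{l\geq 1} l^{2/\delta} \alpha(l)<\infty$ and $r_n\big(r_n/\sqrt{n\overline{F}(\xi_{\tau_n})}\big)^{\delta}\to 0$ (if $X$ is bounded, the assumption $\sum_{l\geq 1} l^{2/\delta} \alpha(l)<\infty$ can be weakened to $\sum_{l\geq 1}\alpha(l)<\infty$ and no integrability assumption is necessary); or (ii) the $X_t$ are i.i.d. copies of $X$ and $\mathbb{E}(|\min(X,0)|^2)<\infty$. Assume moreover that $\rho<0$ and that $p_n\downarrow 0$ is such that $n(1-\tau_n)\to\infty$, $(1-\tau_n)/p_n\to\infty$, $\sqrt{n(1-\tau_n)}/\log((1-\tau_n)/p_n)\to\infty$,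 $\sqrt{n(1-\tau_n)}\, (x^{\star}-q_{\tau_n})^{1/(1-\gamma)}=O(1)$, $\sqrt{n(1-\tau_n)}\, A((1-\tau_n)^{-1})=O(1)$, and that $\widehat{\sigma}_n$ and $\widehat{\gamma}_n$ are estimators such that \[ \sqrt{n \overline{F}(\xi_{\tau_n})} \left( \frac{\widehat{\sigma}_n}{a(1/\overline{F}(\xi_{\tau_n}))} - 1 \right) = O_{\mathbb{P}}(1) \quad\mbox{and}\quad \sqrt{n(1-\tau_n)}\, (\widehat{\gamma}_n-\gamma)\stackrel{d}{\longrightarrow} \Gamma, \] where $\Gamma$ is a nondegenerate limit. Let \[ \widehat{\xi}_{1-p_n}^{\star} = \widehat{\xi}_{\tau_n} + \widehat{\sigma}_n \frac{((1-\tau_n)/p_n)^{\widehat{\gamma}_n/(1-\widehat{\gamma}_n)}-1}{\widehat{\gamma}_n}. \] Then \[ \frac{\sqrt{n(1-\tau_n)}}{a(1/\overline{F}(\xi_{\tau_n}))} \big(\widehat{\xi}_{1-p_n}^{\star} - \xi_{1-p_n}\big) \stackrel{d}{\longrightarrow} \frac{\Gamma}{\gamma^2}. \]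
   Context: Notation. $F(x)=\mathbb{P}(X\le x)$, $\overline F=1-F$, $q_\tau=\inf\{x\in\mathbb{R}: F(x)\ge\tau\}$, $U(s)=q_{1-s^{-1}}$ ($s>1$), $x^\star=\sup\{x:F(x)<1\}$. All limits are as $n\to\infty$; $\stackrel{d}{\longrightarrow}$ is convergence in distribution. Expectiles. For $\tau\in(0,1)$, the $\tau$th expectile of $X$ is $\xi_\tau=\arg\min_{\theta\in\mathbb{R}}\mathbb{E}[\eta_\tau(X-\theta)-\eta_\tau(X)]$, where $\eta_\tau(x)=|\tau-\mathbf{1}\{x\le 0\}|\,x^2$. Given data $X_1,\ldots,X_n$ with common distribution function $F$, the empirical expectile is $\widehat\xi_{\tau}=\arg\min_{\theta\in\mathbb{R}}\sum_{t=1}^n\eta_{\tau}(X_t-\theta)$. Condition $\mathcal{C}_2(\gamma,a,\rho,A)$: there exist $\gamma<0$, $\rho\le 0$, a positive function $a(\cdot)$ and a measurable function $A(\cdot)$ having constant sign and converging to $0$ at infinity such that, for all $z>0$, \[ \lim_{s \to \infty} \frac{1}{A(s)} \left( \frac{U(sz)-U(s)}{a(s)}-\frac{z^{\gamma}-1}{\gamma} \right) = \int_1^z v^{\gamma-1} \left( \int_1^v u^{\rho-1}\, \mathrm{d}u \right) \mathrm{d}v. \] Under this condition $x^\star$ is finite. Mixing. For a strictly stationary sequence $(X_t)_{t\ge1}$, the $\alpha$-mixing coefficients are $\alpha(l)=\sup_{m\ge 1}\alpha_m(l)$, where $\alpha_m(l)=\sup|\mathbb{P}(G\cap H)-\mathbb{P}(G)\mathbb{P}(H)|$,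 the supremum being over $G\in\sigma(X_1,\ldots,X_m)$ and $H\in\sigma(X_{m+l},X_{m+l+1},\ldots)$. Condition $\mathcal{M}$: there exist sequences of positive integers $(l_n)$ and $(r_n)$, both tending to infinity, such that $l_n/r_n\to 0$, $r_n/n\to 0$ and $n\,\alpha(l_n)/r_n\to 0$ as $n\to\infty$. Condition $\mathcal{D}$: for any integer $t\geq 1$, there is a function $R_t$ on $[0,\infty]^2\setminus \{ (\infty, \infty) \}$ such that for all $(x,y)\in [0,\infty]^2\setminus \{ (\infty, \infty) \}$, \[ \lim_{s\to\infty} s\, \mathbb{P}( \overline{F}(X_1)\leq x/s,\ \overline{F}(X_{t+1})\leq y/s ) = R_t(x,y), \] and there exist a constant $K\geq 0$ and a nonnegative summable sequence $(\rho(t))_{t\geq 1}$ such that, for $s$ large enough, \[ \forall t\geq 1,\ \forall x,y\in (0,1],\quad s\, \mathbb{P}( \overline{F}(X_1)\leq x/s,\ \overline{F}(X_{t+1})\leq y/s )\leq \rho(t) \sqrt{xy} + \frac{K}{s} xy. \] *)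

theory Defs
  imports "HOL-Probability.Probability" "HOL-Library.Landau_Symbols"
begin

subsection \<open>Quantiles and expectiles\<close>

definition quantile :: "(real \<Rightarrow> real) \<Rightarrow> real \<Rightarrow> real" where
  "quantile F \<tau> = Inf {x. F x \<ge> \<tau>}"

definition tail_quantile :: "(real \<Rightarrow> real) \<Rightarrow> real \<Rightarrow> real" where
  "tail_quantile F s = quantile F (1 - 1 / s)"

text \<open>A real supremum: only meaningful if the right endpoint is finite, which is the case under the
  second-order condition below because there \<open>\<gamma> < 0\<close>.\<close>

definition right_endpoint :: "(real \<Rightarrow> real) \<Rightarrow> real" where
  "right_endpoint F = Sup {x. F x < 1}"

definition expectile_loss :: "real \<Rightarrow> real \<Rightarrow> real" where
  "expectile_loss \<tau> x = \<bar>\<tau> - indicator {..0} x\<bar> * x\<^sup>2"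

definition expectile :: "'a measure \<Rightarrow> ('a \<Rightarrow> real) \<Rightarrow> real \<Rightarrow> real" where
  "expectile M X \<tau> =
     arg_min (\<lambda>\<theta>. integral\<^sup>L M (\<lambda>\<omega>. expectile_loss \<tau> (X \<omega> - \<theta>) - expectile_loss \<tau> (X \<omega>)))
       (\<lambda>_. True)"

definition empirical_expectile :: "real \<Rightarrow> nat \<Rightarrow> (nat \<Rightarrow> real) \<Rightarrow> real" where
  "empirical_expectile \<tau> n x = arg_min (\<lambda>\<theta>. \<Sum>t=1..n. expectile_loss \<tau> (x t - \<theta>)) (\<lambda>_. True)"

subsection \<open>Second-order extended regular variation with negative index\<close>

text \<open>The iterated integral is an oriented one, since \<open>z < 1\<close> is allowed. The functions \<open>a\<close> and
  \<open>A\<close> live on \<open>(1, \<infinity>)\<close>, the domain of the tail quantile function.\<close>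

definition condition_C2 ::
  "(real \<Rightarrow> real) \<Rightarrow> real \<Rightarrow> (real \<Rightarrow> real) \<Rightarrow> real \<Rightarrow> (real \<Rightarrow> real) \<Rightarrow> bool" where
  "condition_C2 F \<gamma> a \<rho> A \<longleftrightarrow>
     \<gamma> < 0 \<and> \<rho> \<le> 0 \<and>
     (\<forall>s>1. a s > 0) \<and>
     A \<in> borel_measurable (restrict_space borel {1<..}) \<and>
     ((\<forall>s>1. A s > 0) \<or> (\<forall>s>1. A s < 0)) \<and>
     (A \<longlongrightarrow> 0) at_top \<and>
     (\<forall>z>0. ((\<lambda>s. 1 / A s *
           ((tail_quantile F (s * z) - tail_quantile F s) / a s - (z powr \<gamma> - 1) / \<gamma>))
        \<longlongrightarrow> (LBINT v=1..ereal z. v powr (\<gamma> - 1) * (LBINT u=1..ereal v. u powr (\<rho> - 1)))) at_top)"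

subsection \<open>Dependence structure of the data, indexed by the positive integers\<close>

definition copies_of :: "'a measure \<Rightarrow> ('a \<Rightarrow> real) \<Rightarrow> (nat \<Rightarrow> 'a \<Rightarrow> real) \<Rightarrow> bool" where
  "copies_of M X Z \<longleftrightarrow>
     (\<forall>t\<ge>1. Z t \<in> borel_measurable M \<and> distr M borel (Z t) = distr M borel X)"

definition strictly_stationary :: "'a measure \<Rightarrow> (nat \<Rightarrow> 'a \<Rightarrow> real) \<Rightarrow> bool" where
  "strictly_stationary M Z \<longleftrightarrow>
     (\<forall>J h. finite J \<longrightarrow> J \<subseteq> {1..} \<longrightarrow>
        distr M (Pi\<^sub>M J (\<lambda>_. borel)) (\<lambda>\<omega>. \<lambda>i\<in>J. Z (i + h) \<omega>) =
        distr M (Pi\<^sub>M J (\<lambda>_. borel)) (\<lambda>\<omega>. \<lambda>i\<in>J. Z i \<omega>))"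

definition generated_sigma :: "'a measure \<Rightarrow> (nat \<Rightarrow> 'a \<Rightarrow> real) \<Rightarrow> nat set \<Rightarrow> 'a set set" where
  "generated_sigma M Z I =
     sigma_sets (space M) {Z i -` B \<inter> space M | i B. i \<in> I \<and> B \<in> sets borel}"

definition alpha_mixing :: "'a measure \<Rightarrow> (nat \<Rightarrow> 'a \<Rightarrow> real) \<Rightarrow> nat \<Rightarrow> real" where
  "alpha_mixing M Z l =
     (SUP m\<in>{1..}. SUP (G, H)\<in>generated_sigma M Z {1..m} \<times> generated_sigma M Z {m + l..}.
        \<bar>measure M (G \<inter> H) - measure M G * measure M H\<bar>)"

definition condition_M ::
  "'a measure \<Rightarrow> (nat \<Rightarrow> 'a \<Rightarrow> real) \<Rightarrow> (nat \<Rightarrow> nat) \<Rightarrow> (nat \<Rightarrow> nat) \<Rightarrow> bool" where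
  "condition_M M Z l r \<longleftrightarrow>
     (\<forall>n. l n > 0 \<and> r n > 0) \<and>
     filterlim l at_top sequentially \<and> filterlim r at_top sequentially \<and>
     (\<lambda>n. real (l n) / real (r n)) \<longlonglongrightarrow> 0 \<and>
     (\<lambda>n. real (r n) / real n) \<longlonglongrightarrow> 0 \<and>
     (\<lambda>n. real n * alpha_mixing M Z (l n) / real (r n)) \<longlonglongrightarrow> 0"

text \<open>The tail dependence functions \<open>R t\<close> have extended arguments, hence \<^typ>\<open>ennreal\<close>.\<close>

definition condition_D :: "'a measure \<Rightarrow> (real \<Rightarrow> real) \<Rightarrow> (nat \<Rightarrow> 'a \<Rightarrow> real) \<Rightarrow> bool" where
  "condition_D M F Z \<longleftrightarrow>
     (\<forall>t\<ge>1. \<exists>R :: ennreal \<Rightarrow> ennreal \<Rightarrow> real. \<forall>x y. (x, y) \<noteq> (\<infinity>, \<infinity>) \<longrightarrow>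
        ((\<lambda>s. s * measure M {\<omega> \<in> space M. ennreal (1 - F (Z 1 \<omega>)) \<le> x / ennreal s \<and>
                                          ennreal (1 - F (Z (t + 1) \<omega>)) \<le> y / ennreal s})
          \<longlongrightarrow> R x y) at_top) \<and>
     (\<exists>(K :: real) (r :: nat \<Rightarrow> real). K \<ge> 0 \<and> (\<forall>t\<ge>1. r t \<ge> 0) \<and> summable r \<and>
        (\<forall>\<^sub>F s in at_top. \<forall>t\<ge>1. \<forall>x\<in>{0<..1}. \<forall>y\<in>{0<..1}.
           s * measure M {\<omega> \<in> space M. 1 - F (Z 1 \<omega>) \<le> x / s \<and> 1 - F (Z (t + 1) \<omega>) \<le> y / s}
             \<le> r t * sqrt (x * y) + K / s * (x * y)))"

subsection \<open>Stochastic convergence\<close>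

definition converges_in_distribution ::
  "'a measure \<Rightarrow> (nat \<Rightarrow> 'a \<Rightarrow> real) \<Rightarrow> 'b measure \<Rightarrow> ('b \<Rightarrow> real) \<Rightarrow> bool" where
  "converges_in_distribution M Y N \<Gamma> \<longleftrightarrow>
     weak_conv_m (\<lambda>n. distr M borel (Y n)) (distr N borel \<Gamma>)"

definition bounded_in_probability :: "'a measure \<Rightarrow> (nat \<Rightarrow> 'a \<Rightarrow> real) \<Rightarrow> bool" where
  "bounded_in_probability M Y \<longleftrightarrow>
     (\<forall>\<epsilon>>0. \<exists>K. \<forall>\<^sub>F n in sequentially. measure M {\<omega> \<in> space M. \<bar>Y n \<omega>\<bar> > K} < \<epsilon>)"

end

theory Submission imports Defs begin

text \<open>
  Write \<open>w = x\<^sup>* - \<xi>\<close> for the distance of an expectile to the endpoint and \<open>m n\<close> for the square root of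
  \<open>n (1 - \<tau> n)\<close>. The second-order condition gives \<open>x\<^sup>* - U s\<close> and \<open>a s\<close> as constant multiples of
  \<open>s\<close> to the power \<open>\<gamma>\<close>, up to a relative error \<open>O(A s)\<close>; inverting this and integrating the survival
  function turns the first-order equation of the expectile into
  \<open>w\<close> to the power \<open>1 - 1 / \<gamma>\<close> \<open>= C (1 - \<tau>) (1 + o(1))\<close> with explicit errors. Hence
  \<open>1 - \<tau> = o(\<phi>)\<close>, so \<open>m\<close> is of smaller order than the square root of \<open>n \<phi>\<close>, and at the scale \<open>m n\<close> both
  the empirical expectile and the scale estimator behave as if they were exact. For the empirical
  expectile a second-moment bound is enough, and it is only needed on blocks of length \<open>r n\<close>: the
  mixing condition makes the characteristic functions of separated blocks factorise, and condition D
  bounds the variance within a block. What remains is the extrapolation factor, a deterministic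
  function of the estimator of \<open>\<gamma>\<close>, whose derivative tends to \<open>1 / \<gamma>\<^sup>2\<close>.
\<close>

section \<open>Tail expansions under the second-order condition\<close>

text \<open>The obstacle at the source is that the second-order condition holds only pointwise in
  \<open>z\<close> and that \<open>a\<close> is an arbitrary positive function, so uniform estimates
  do not come for free. Along dyadic multiples \<open>2 ^ n * s\<close> all errors are summed by
  geometric series, and only \<open>A\<close>, which is measurable, needs a uniform bound. The power
  \<open>1 - 1 / \<gamma>\<close> of \<open>w\<close> arises because the survival function behaves
  like \<open>w\<close> to the power \<open>- 1 / \<gamma>\<close> and the excess integrates it once
  more. The same equation yields \<open>1 - \<tau> = O(w * \<phi>)\<close>, since the mean excess
  over \<open>\<xi>\<close> is at most \<open>w * \<phi>\<close>. Because the target scale is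
  \<open>m\<close> and not the square root of \<open>n * \<phi>\<close>, no limit law of the
  empirical expectile is needed: convergence to zero in probability is enough. This is why a
  variance bound on blocks replaces a central limit theorem for dependent data.\<close>

lemma geometric_increments:
  fixes f :: "nat \<Rightarrow> real"
  assumes inc: "\<And>n. \<bar>f (Suc n) - f n\<bar> \<le> c * \<theta> ^ n" and \<theta>: "0 \<le> \<theta>" "\<theta> < 1"
  shows "\<exists>l. f \<longlonglongrightarrow> l \<and> \<bar>l - f 0\<bar> \<le> c / (1 - \<theta>)"
proof -
  have geo: "(\<lambda>n. c * \<theta> ^ n) sums (c * (1 / (1 - \<theta>)))"
    using \<theta> by (intro sums_mult geometric_sums) auto
  have s: "summable (\<lambda>n. f (Suc n) - f n)"
    using inc by (intro summable_comparison_test[OF _ sums_summable[OF geo]]) auto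
  have sa: "summable (\<lambda>n. \<bar>f (Suc n) - f n\<bar>)"
    using inc by (intro summable_comparison_test[OF _ sums_summable[OF geo]]) auto
  let ?S = "\<Sum>n. f (Suc n) - f n"
  have "(\<lambda>n. \<Sum>i<n. f (Suc i) - f i) \<longlonglongrightarrow> ?S"
    using s by (rule summable_LIMSEQ)
  then have "(\<lambda>n. f n - f 0 + f 0) \<longlonglongrightarrow> ?S + f 0"
    by (intro tendsto_intros) (simp add: sum_lessThan_telescope)
  moreover have "\<bar>?S\<bar> \<le> c / (1 - \<theta>)"
  proof -
    have "\<bar>?S\<bar> \<le> (\<Sum>n. \<bar>f (Suc n) - f n\<bar>)"
      using sa by (rule summable_rabs)
    also have "\<dots> \<le> (\<Sum>n. c * \<theta> ^ n)"
      using inc by (intro suminf_le sa sums_summable[OF geo])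
    finally show ?thesis using sums_unique[OF geo] by simp
  qed
  ultimately show ?thesis by (intro exI[of _ "?S + f 0"]) auto
qed

lemma eventually_scale_at_top:
  fixes z :: real
  assumes "z > 0"
  shows "filterlim (\<lambda>s. s * z) at_top at_top"
  using assms by (intro filterlim_tendsto_pos_mult_at_top[OF _ _ filterlim_ident, of "\<lambda>_. z" z, simplified mult.commute])
    auto

text \<open>The limit in \<open>C2\<close> is the iterated integral in closed form; the negative
  signs of \<open>g\<close> and \<open>r\<close> keep the denominators \<open>g\<close>,
  \<open>r\<close> and \<open>g + r\<close> away from zero. Only \<open>z \<ge> 1\<close> is kept,
  because every later comparison moves towards the endpoint.\<close>

locale second_order_tail =
  fixes U a A :: "real \<Rightarrow> real" and g r :: real
  assumes g: "g < 0" and r: "r < 0"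
    and a_pos: "\<And>s. s > 1 \<Longrightarrow> a s > 0"
    and A_meas: "A \<in> borel_measurable (restrict_space borel {1<..})"
    and A_sign: "(\<forall>s>1. A s > 0) \<or> (\<forall>s>1. A s < 0)"
    and A_lim: "(A \<longlongrightarrow> 0) at_top"
    and U_mono: "\<And>s t. 1 < s \<Longrightarrow> s \<le> t \<Longrightarrow> U s \<le> U t"
    and C2: "\<And>z. z \<ge> 1 \<Longrightarrow>
      ((\<lambda>s. 1 / A s * ((U (s * z) - U s) / a s - (z powr g - 1) / g))
        \<longlongrightarrow> ((z powr (g + r) - 1) / (g + r) - (z powr g - 1) / g) / r) at_top"
begin

lemma A_nonzero: "s > 1 \<Longrightarrow> A s \<noteq> 0"
  using A_sign by (metis less_irrefl)

definition h :: "real \<Rightarrow> real" where "h z = (z powr g - 1) / g"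

definition Psi :: "real \<Rightarrow> real" where
  "Psi z = ((z powr (g + r) - 1) / (g + r) - (z powr g - 1) / g) / r"

definition \<delta> :: "real \<Rightarrow> real" where "\<delta> s = U (2 * s) - U s"

text \<open>The combination that annihilates the first-order part \<open>s powr g\<close> and keeps the second-order one.\<close>
definition P :: "real \<Rightarrow> real" where "P s = \<delta> (2 * s) - 2 powr g * \<delta> s"

text \<open>This is \<open>Psi 4 - (1 + 2 powr g) * Psi 2 + 2 powr g * Psi 1\<close>, the limit of
  \<open>P s / (a s * A s)\<close>. Its being nonzero is what lets the behaviour of \<open>A\<close>
  be recovered from \<open>P\<close>.\<close>

definition \<kappa> :: real where
  "\<kappa> = (2 powr (g + r) - 1) * (2 powr (g + r) - 2 powr g) / (r * (g + r))"

lemma \<kappa>_pos: "\<kappa> > 0"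
proof -
  have "2 powr (g + r) < (2::real) powr 0" "2 powr (g + r) < (2::real) powr g"
    using g r by (intro powr_less_mono; simp)+
  then show ?thesis
    unfolding \<kappa>_def using g r by (intro divide_pos_pos mult_neg_neg) auto
qed

lemma h2_pos: "h 2 > 0"
proof -
  have "2 powr g < (2::real) powr 0" using g by (intro powr_less_mono) auto
  then show ?thesis unfolding h_def using g by (intro divide_neg_neg) auto
qed

lemma increment_second:
  assumes "z \<ge> 1"
  shows "((\<lambda>s. ((U (s * z) - U s) / a s - h z) / A s) \<longlongrightarrow> Psi z) at_top"
  using C2[OF assms] by (simp add: h_def Psi_def)

lemma increment_first:
  assumes "z \<ge> 1"
  shows "((\<lambda>s. (U (s * z) - U s) / a s) \<longlongrightarrow> h z) at_top"
proof -
  have "((\<lambda>s. ((U (s * z) - U s) / a s - h z) / A s * A s + h z) \<longlongrightarrow> Psi z * 0 + h z) at_top"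
    by (intro tendsto_intros increment_second assms A_lim)
  moreover have "\<forall>\<^sub>F s in at_top. ((U (s * z) - U s) / a s - h z) / A s * A s + h z = (U (s * z) - U s) / a s"
    using eventually_gt_at_top[of 1] by eventually_elim (simp add: A_nonzero)
  ultimately show ?thesis by (auto intro: Lim_transform_eventually)
qed

text \<open>Both \<open>U (2 * s * z)\<close> and \<open>U (s * z)\<close> are compared with
  \<open>U s\<close>, so that only \<open>a s\<close> enters; then
  \<open>h (2 * z) - h z = z powr g * h 2\<close>.\<close>

lemma \<delta>_scaled:
  assumes "z \<ge> 1"
  shows "((\<lambda>s. \<delta> (s * z) / a s) \<longlongrightarrow> z powr g * h 2) at_top"
proof -
  have "((\<lambda>s. (U (s * (2 * z)) - U s) / a s - (U (s * z) - U s) / a s) \<longlongrightarrow> h (2 * z) - h z) at_top"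
    using assms by (intro tendsto_intros increment_first) auto
  moreover have "h (2 * z) - h z = z powr g * h 2"
    using assms g by (simp add: h_def powr_mult field_simps)
  ultimately show ?thesis
    by (simp add: \<delta>_def diff_divide_distrib mult_ac)
qed

text \<open>In terms of the shift \<open>T\<close> by a factor 2, \<open>P\<close> is
  \<open>(T - 1) * (T - 2 powr g)\<close> applied to \<open>U\<close>. Its weights 1,
  \<open>- (1 + 2 powr g)\<close>, \<open>2 powr g\<close> at the arguments \<open>4 * z\<close>,
  \<open>2 * z\<close>, \<open>z\<close> annihilate constants and the power \<open>z powr g\<close>,
  so the first-order terms and the matching terms of \<open>Psi\<close> vanish and only
  \<open>z powr (g + r)\<close> remains.\<close>

lemma P_scaled:
  assumes "z \<ge> 1"
  shows "((\<lambda>s. P (s * z) / (a s * A s)) \<longlongrightarrow> \<kappa> * z powr (g + r)) at_top"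
proof -
  let ?H = "\<lambda>z s. ((U (s * z) - U s) / a s - h z) / A s"
  have "((\<lambda>s. ?H (4 * z) s - (1 + 2 powr g) * ?H (2 * z) s + 2 powr g * ?H z s)
      \<longlongrightarrow> Psi (4 * z) - (1 + 2 powr g) * Psi (2 * z) + 2 powr g * Psi z) at_top"
    using assms by (intro tendsto_intros increment_second) auto
  moreover have "Psi (4 * z) - (1 + 2 powr g) * Psi (2 * z) + 2 powr g * Psi z = \<kappa> * z powr (g + r)"
  proof -
    have four: "(4::real) powr x = 2 powr x * 2 powr x" for x
      by (simp flip: powr_mult)
    have "g + r \<noteq> 0" using g r by simp
    then show ?thesis
      unfolding Psi_def \<kappa>_def using assms g r
      by (simp add: powr_mult four divide_simps) (simp add: algebra_simps)
  qed
  moreover have "\<forall>\<^sub>F s in at_top. ?H (4 * z) s - (1 + 2 powr g) * ?H (2 * z) s + 2 powr g * ?H z s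
      = P (s * z) / (a s * A s)"
    using eventually_gt_at_top[of 1]
  proof eventually_elim
    case (elim s)
    have four: "(4::real) powr x = 2 powr x * 2 powr x" for x
      by (simp flip: powr_mult)
    have hz: "h (4 * z) - (1 + 2 powr g) * h (2 * z) + 2 powr g * h z = 0"
      using assms g by (simp add: h_def powr_mult four field_simps)
    have "?H (4 * z) s - (1 + 2 powr g) * ?H (2 * z) s + 2 powr g * ?H z s
      = (((U (s * (4 * z)) - U s) - (1 + 2 powr g) * (U (s * (2 * z)) - U s) + 2 powr g * (U (s * z) - U s)) / a s
          - (h (4 * z) - (1 + 2 powr g) * h (2 * z) + 2 powr g * h z)) / A s"
      by (simp add: diff_divide_distrib add_divide_distrib algebra_simps)
    also have "\<dots> = P (s * z) / (a s * A s)"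
      unfolding hz P_def \<delta>_def by (simp add: algebra_simps)
    finally show ?case .
  qed
  ultimately show ?thesis by (auto intro: Lim_transform_eventually)
qed

text \<open>The increment \<open>\<delta> (s * z)\<close> is measured against \<open>a s\<close> and
  against \<open>a (s * z)\<close>; the quotient of the two limits is the claim. The behaviour of
  \<open>a\<close> can only be read off from increments of \<open>U\<close>.\<close>

lemma a_regular:
  assumes "z \<ge> 1"
  shows "((\<lambda>s. a (s * z) / a s) \<longlongrightarrow> z powr g) at_top"
proof -
  have lim: "filterlim (\<lambda>s. s * z) at_top at_top"
    using assms by (intro eventually_scale_at_top) auto
  have "((\<lambda>s. \<delta> (s * z) / a (s * z)) \<longlongrightarrow> h 2) at_top"
    using filterlim_compose[OF \<delta>_scaled[of 1] lim] by simp
  then have "((\<lambda>s. \<delta> (s * z) / a s / (\<delta> (s * z) / a (s * z))) \<longlongrightarrow> z powr g * h 2 / h 2) at_top"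
    using h2_pos by (intro tendsto_intros \<delta>_scaled assms) auto
  moreover have "\<forall>\<^sub>F s in at_top. \<delta> (s * z) / a s / (\<delta> (s * z) / a (s * z)) = a (s * z) / a s"
    using order_tendstoD(1)[OF \<open>((\<lambda>s. \<delta> (s * z) / a (s * z)) \<longlongrightarrow> h 2) at_top\<close> h2_pos]
    by eventually_elim auto
  ultimately show ?thesis using h2_pos by (auto intro: Lim_transform_eventually)
qed

text \<open>The comparison of \<open>a_regular\<close> with \<open>P\<close> in place of \<delta>:
  normalising \<open>P (s * z)\<close> at \<open>s\<close> and at \<open>s * z\<close> produces the
  product of the quotients of \<open>a\<close> and of \<open>A\<close>, and \<open>a_regular\<close>
  removes the first.\<close>

lemma A_regular:
  assumes "z \<ge> 1"
  shows "((\<lambda>s. A (s * z) / A s) \<longlongrightarrow> z powr r) at_top"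
proof -
  have lim: "filterlim (\<lambda>s. s * z) at_top at_top"
    using assms by (intro eventually_scale_at_top) auto
  have P1: "((\<lambda>s. P (s * z) / (a (s * z) * A (s * z))) \<longlongrightarrow> \<kappa>) at_top"
    using filterlim_compose[OF P_scaled[of 1] lim] by simp
  have "((\<lambda>s. P (s * z) / (a s * A s) / (P (s * z) / (a (s * z) * A (s * z))) / (a (s * z) / a s))
       \<longlongrightarrow> \<kappa> * z powr (g + r) / \<kappa> / z powr g) at_top"
    using \<kappa>_pos assms by (intro tendsto_intros P_scaled a_regular P1) auto
  moreover have "\<kappa> * z powr (g + r) / \<kappa> / z powr g = z powr r"
    using \<kappa>_pos assms by (simp add: powr_add)
  moreover have "\<forall>\<^sub>F s in at_top.
     P (s * z) / (a s * A s) / (P (s * z) / (a (s * z) * A (s * z))) / (a (s * z) / a s) = A (s * z) / A s"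
    using order_tendstoD(1)[OF P1 \<kappa>_pos] eventually_gt_at_top[of 1]
  proof eventually_elim
    case (elim s)
    have "s * z > 1" using elim assms by (metis less_1_mult mult.right_neutral nless_le)
    then show ?case using elim a_pos[of s] a_pos[of "s * z"] by (auto simp: field_simps)
  qed
  ultimately show ?thesis by (auto intro: Lim_transform_eventually)
qed

end

text \<open>\<open>V n\<close> collects the shifts whose increments have settled from index
  \<open>n\<close> on. Pointwise convergence makes these sets increase to the whole interval
  \<open>{0..2}\<close>, and continuity of measure from below replaces uniform convergence.
  Measurability of \<open>k\<close> makes \<open>V n\<close> measurable.\<close>

lemma measure_uniform_limit_set:
  fixes k :: "real \<Rightarrow> real" and x :: "nat \<Rightarrow> real"
  assumes [measurable]: "k \<in> borel_measurable borel"
    and lim: "\<And>u. u \<ge> 0 \<Longrightarrow> ((\<lambda>x. k (x + u) - k x) \<longlongrightarrow> \<rho> * u) at_top"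
    and x: "filterlim x at_top sequentially"
  defines "V \<equiv> \<lambda>n. {u \<in> {0..2}. \<forall>m\<ge>n. \<bar>k (x m + u) - k (x m) - \<rho> * u\<bar> \<le> 1}"
  shows "V n \<in> sets lborel" and "(\<lambda>n. measure lborel (V n)) \<longlonglongrightarrow> 2"
proof -
  have V_eq: "V n = {u \<in> space lborel. u \<in> {0..2} \<and> (\<forall>m\<in>{n..}. \<bar>k (x m + u) - k (x m) - \<rho> * u\<bar> \<le> 1)}" for n
    unfolding V_def by auto
  have V_meas: "V n \<in> sets lborel" for n
    unfolding V_eq by measurable
  then show "V n \<in> sets lborel" .
  have "incseq V"
    unfolding V_def by (intro incseq_SucI) auto
  moreover have "(\<Union>n. V n) = {0..2}"
  proof (intro equalityI subsetI)
    fix u :: real assume u: "u \<in> {0..2}"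
    have "(\<lambda>n. k (x n + u) - k (x n)) \<longlonglongrightarrow> \<rho> * u"
      using filterlim_compose[OF lim x] u by simp
    then have "\<forall>\<^sub>F n in sequentially. \<bar>k (x n + u) - k (x n) - \<rho> * u\<bar> < 1"
      using tendstoD[of _ "\<rho> * u" sequentially 1] by (simp add: dist_real_def)
    then obtain n where "\<forall>m\<ge>n. \<bar>k (x m + u) - k (x m) - \<rho> * u\<bar> < 1"
      by (auto simp: eventually_sequentially)
    then have "u \<in> V n" using u by (auto simp: V_def intro: less_imp_le)
    then show "u \<in> (\<Union>n. V n)" by blast
  qed (auto simp: V_def)
  ultimately have "(\<lambda>n. measure lborel (V n)) \<longlonglongrightarrow> measure lborel {0..2::real}"
    using Lim_measure_incseq[of V lborel] V_meas by (auto simp: fmeasurable_def)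
  then show "(\<lambda>n. measure lborel (V n)) \<longlonglongrightarrow> 2" by simp
qed

lemma large_sets_meet:
  fixes V W :: "real set"
  assumes lm: "V \<in> lmeasurable" "W \<in> lmeasurable" and sub: "V \<subseteq> {0..3}" "W \<subseteq> {0..3}"
    and big: "measure lebesgue V > 3/2" "measure lebesgue W > 3/2"
  shows "V \<inter> W \<noteq> {}"
proof
  assume "V \<inter> W = {}"
  then have "measure lebesgue (V \<union> W) = measure lebesgue V + measure lebesgue W"
    using fmeasurableD2[OF lm(1)] fmeasurableD2[OF lm(2)] lm
    by (intro measure_Union fmeasurableD) (simp_all only: infinity_ennreal_def not_False_eq_True)
  moreover have "measure lebesgue (V \<union> W) \<le> measure lebesgue {0..3::real}"
    using lm sub by (intro measure_mono_fmeasurable) auto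
  moreover have "measure lebesgue {0..3::real} = 3" by simp
  ultimately show False using big by linarith
qed

text \<open>The core of the uniform convergence theorem of regular variation: two subsets of an interval
  of length 3 whose measures exceed 3/2 must meet.\<close>
lemma regular_variation_increment_bounded:
  fixes k :: "real \<Rightarrow> real" and x y :: "nat \<Rightarrow> real"
  assumes k[measurable]: "k \<in> borel_measurable borel"
    and lim: "\<And>u. u \<ge> 0 \<Longrightarrow> ((\<lambda>x. k (x + u) - k x) \<longlongrightarrow> \<rho> * u) at_top"
    and x: "filterlim x at_top sequentially" and y: "\<And>n. y n - x n \<in> {0..1}"
  shows "\<forall>\<^sub>F n in sequentially. \<bar>k (y n) - k (x n)\<bar> \<le> 2 + 4 * \<bar>\<rho>\<bar>"
proof -
  have y_lim: "filterlim y at_top sequentially"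
    by (rule filterlim_at_top_mono[OF x]) (use y in \<open>auto\<close>)
  let ?V = "\<lambda>x n. {u \<in> {0..2::real}. \<forall>m\<ge>n. \<bar>k (x m + u) - k (x m) - \<rho> * u\<bar> \<le> 1}"
  note Vx = measure_uniform_limit_set[OF k lim x] and Vy = measure_uniform_limit_set[OF k lim y_lim]
  have "\<forall>\<^sub>F n in sequentially. measure lborel (?V x n) > 3/2"
    "\<forall>\<^sub>F n in sequentially. measure lborel (?V y n) > 3/2"
    using order_tendstoD(1)[OF Vx(2), of "3/2"] order_tendstoD(1)[OF Vy(2), of "3/2"] by auto
  then show ?thesis
  proof eventually_elim
    case (elim n)
    \<comment> \<open>The translate expresses the good shifts of \<open>y n\<close> as shifts of
      \<open>x n\<close>: a common point means \<open>x n + v = y n + w\<close>, so both increments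
      end at the same place. As \<open>y n - x n \<le> 1\<close>, it stays inside
      \<open>{0..3}\<close>.\<close>
    define W where "W = (\<lambda>u. y n - x n + u) ` ?V y n"
    have lm: "?V x n \<in> lmeasurable" "?V y n \<in> lmeasurable"
      using Vx(1)[of n] Vy(1)[of n]
      by (auto intro!: bounded_set_imp_lmeasurable intro: bounded_subset[of "{0..2}"] sets_completionI_sets)
    then have lmW: "W \<in> lmeasurable"
      unfolding W_def by (intro measurable_translation)
    have "measure lebesgue (?V x n) > 3/2" "measure lebesgue (?V y n) > 3/2"
      using elim Vx(1)[of n] Vy(1)[of n] by (auto simp: measure_completion)
    then have big: "measure lebesgue (?V x n) > 3/2" "measure lebesgue W > 3/2"
      by (auto simp: W_def measure_translation)
    have "?V x n \<inter> W \<noteq> {}"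
      by (rule large_sets_meet[OF lm(1) lmW _ _ big]) (use y[of n] in \<open>auto simp: W_def\<close>)
    then obtain v w where v: "v \<in> ?V x n" and w: "w \<in> ?V y n" and vw: "v = y n - x n + w"
      by (auto simp: W_def)
    have "\<bar>k (x n + v) - k (x n) - \<rho> * v\<bar> \<le> 1" "\<bar>k (y n + w) - k (y n) - \<rho> * w\<bar> \<le> 1"
      using v w by auto
    moreover have "x n + v = y n + w" using vw by simp
    moreover have "\<bar>\<rho> * v\<bar> \<le> 2 * \<bar>\<rho>\<bar>" "\<bar>\<rho> * w\<bar> \<le> 2 * \<bar>\<rho>\<bar>"
      using v w by (auto simp: abs_mult mult.commute[of _ "\<bar>\<rho>\<bar>"] intro!: mult_left_mono)
    ultimately show ?case by simp
  qed
qed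

section \<open>Bounds for \<open>A\<close> and the expansion of the tail quantile function\<close>

context second_order_tail
begin

text \<open>If no bound held, there would be points \<open>s n \<ge> n + 2\<close> and factors
  \<open>z n\<close> in \<open>{1..2}\<close> over which \<open>|A|\<close> grows by more than
  \<open>exp n\<close>. In logarithmic coordinates these are unbounded increments over lengths at
  most 1, against the lemma on bounded increments.\<close>

lemma A_locally_bounded: "\<exists>K s0. s0 > 1 \<and> (\<forall>s\<ge>s0. \<forall>z\<in>{1..2}. \<bar>A (s * z)\<bar> \<le> K * \<bar>A s\<bar>)"
proof (rule ccontr)
  assume contr: "\<not> ?thesis"
  then have "\<forall>n::nat. \<exists>s z. s \<ge> real n + 2 \<and> z \<in> {1..2} \<and> \<not> \<bar>A (s * z)\<bar> \<le> exp (real n) * \<bar>A s\<bar>"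
  proof (intro allI)
    fix n :: nat
    have "\<not> (\<forall>s\<ge>real n + 2. \<forall>z\<in>{1..2}. \<bar>A (s * z)\<bar> \<le> exp (real n) * \<bar>A s\<bar>)"
    proof
      assume "\<forall>s\<ge>real n + 2. \<forall>z\<in>{1..2}. \<bar>A (s * z)\<bar> \<le> exp (real n) * \<bar>A s\<bar>"
      moreover have "real n + 2 > 1" by simp
      ultimately show False using contr by blast
    qed
    then show "\<exists>s z. s \<ge> real n + 2 \<and> z \<in> {1..2} \<and> \<not> \<bar>A (s * z)\<bar> \<le> exp (real n) * \<bar>A s\<bar>"
      by blast
  qed
  then obtain s z where sz: "\<And>n::nat. s n \<ge> real n + 2" "\<And>n. z n \<in> {1..2}"
      "\<And>n. \<not> \<bar>A (s n * z n)\<bar> \<le> exp (real n) * \<bar>A (s n)\<bar>"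
    by metis
  \<comment> \<open>The value 0 at nonpositive arguments makes \<open>k\<close> Borel on the whole
    line, since \<open>A\<close> is known to be measurable on \<open>{1<..}\<close> only.\<close>
  define k where "k x = (if x > 0 then ln \<bar>A (exp x)\<bar> else 0)" for x
  have "k \<in> borel_measurable borel"
  proof -
    have "(\<lambda>x. if x \<in> {1<..} then A x else 0) \<in> borel_measurable borel"
      using A_meas by (intro measurable_If_restrict_space_iff[THEN iffD2]) (auto simp: greaterThan_def)
    then have "(\<lambda>x. if x \<in> {1<..} then A x else 0) \<circ> exp \<in> borel_measurable borel"
      by (intro measurable_comp) auto
    then have "(\<lambda>x. if x > 0 then ln \<bar>((\<lambda>x. if x \<in> {1<..} then A x else 0) \<circ> exp) x\<bar> else 0) \<in> borel_measurable borel"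
      by measurable
    also have "(\<lambda>x. if x > 0 then ln \<bar>((\<lambda>x. if x \<in> {1<..} then A x else 0) \<circ> exp) x\<bar> else 0) = k"
      by (auto simp: k_def fun_eq_iff)
    finally show ?thesis .
  qed
  moreover have "((\<lambda>x. k (x + u) - k x) \<longlongrightarrow> r * u) at_top" if "u \<ge> 0" for u
  proof -
    have "((\<lambda>s. A (s * exp u) / A s) \<longlongrightarrow> exp u powr r) at_top"
      using that by (intro A_regular) auto
    then have "((\<lambda>x. ln \<bar>A (exp x * exp u) / A (exp x)\<bar>) \<longlongrightarrow> ln \<bar>exp u powr r\<bar>) at_top"
      by (intro tendsto_intros filterlim_compose[OF _ exp_at_top]) auto
    moreover have "\<forall>\<^sub>F x in at_top. ln \<bar>A (exp x * exp u) / A (exp x)\<bar> = k (x + u) - k x"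
      using eventually_gt_at_top[of 0]
    proof eventually_elim
      case (elim x)
      have "A (exp x) \<noteq> 0" "A (exp (x + u)) \<noteq> 0" using elim that by (auto intro!: A_nonzero)
      then show ?case using elim that
        by (simp add: k_def exp_add abs_divide ln_div)
    qed
    moreover have "ln \<bar>exp u powr r\<bar> = r * u" by (simp add: powr_def)
    ultimately show ?thesis by (auto intro: Lim_transform_eventually)
  qed
  moreover have "filterlim (\<lambda>n. ln (s n)) at_top sequentially"
  proof -
    have "filterlim (\<lambda>n. real n) at_top sequentially" by (rule filterlim_real_sequentially)
    then have "filterlim s at_top sequentially"
      by (rule filterlim_at_top_mono) (intro always_eventually allI order_trans[OF _ sz(1)], simp)
    then show ?thesis by (rule filterlim_compose[OF ln_at_top])
  qed
  moreover have "ln (s n * z n) - ln (s n) \<in> {0..1}" for n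
  proof -
    have "s n > 0" "z n \<ge> 1" "z n \<le> 2" using sz(1)[of n] sz(2)[of n] by auto
    moreover have "ln (z n) \<le> z n - 1" using calculation by (intro ln_le_minus_one) auto
    moreover have "ln (z n) \<ge> 0" using calculation by simp
    ultimately have "ln (z n) \<le> 1" "ln (z n) \<ge> 0" "s n > 0" "z n > 0" by linarith+
    then show ?thesis by (simp add: ln_mult)
  qed
  ultimately have "\<forall>\<^sub>F n in sequentially. \<bar>k (ln (s n * z n)) - k (ln (s n))\<bar> \<le> 2 + 4 * \<bar>r\<bar>"
    by (rule regular_variation_increment_bounded)
  moreover have "\<forall>\<^sub>F n in sequentially. real n > 2 + 4 * \<bar>r\<bar>"
    using filterlim_real_sequentially by (simp add: filterlim_at_top_dense)
  ultimately have "\<forall>\<^sub>F n in sequentially. False"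
  proof eventually_elim
    case (elim n)
    have *: "s n > 1" "s n * z n > 1" using sz(1)[of n] sz(2)[of n] less_1_mult'[of "s n" "z n"] by auto
    then have nz: "A (s n) \<noteq> 0" "A (s n * z n) \<noteq> 0" by (auto intro!: A_nonzero)
    have "k (ln (s n * z n)) = ln \<bar>A (s n * z n)\<bar>" "k (ln (s n)) = ln \<bar>A (s n)\<bar>"
      using * by (auto simp: k_def)
    moreover have "ln \<bar>A (s n * z n)\<bar> > ln (exp (real n) * \<bar>A (s n)\<bar>)"
      using sz(3)[of n] nz by (subst ln_less_cancel_iff) auto
    moreover have "ln (exp (real n) * \<bar>A (s n)\<bar>) = real n + ln \<bar>A (s n)\<bar>"
      using nz by (simp add: ln_mult)
    ultimately show False using elim by linarith
  qed
  then show False by simp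
qed

text \<open>As \<open>2 powr r < 1\<close>, doubling the argument eventually cannot increase
  \<open>|A|\<close>. Moving the base point from \<open>s\<close> to \<open>2 * s\<close> therefore
  costs nothing, and the local bound is used only once, for the remaining factor in
  \<open>{1..2}\<close>; so \<open>K\<close> does not grow with \<open>t / s\<close>.\<close>

lemma A_tail_bounded: "\<exists>K s0. s0 > 1 \<and> K > 0 \<and> (\<forall>s\<ge>s0. \<forall>t\<ge>s. \<bar>A t\<bar> \<le> K * \<bar>A s\<bar>)"
proof -
  obtain K s0 where K: "s0 > 1" "\<And>s z. s \<ge> s0 \<Longrightarrow> z \<in> {1..2} \<Longrightarrow> \<bar>A (s * z)\<bar> \<le> K * \<bar>A s\<bar>"
    using A_locally_bounded by metis
  have "2 powr r < (2::real) powr 0" using r by (intro powr_less_mono) auto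
  then have "\<forall>\<^sub>F s in at_top. A (s * 2) / A s < 1"
    using order_tendstoD(2)[OF A_regular[of 2], of 1] by auto
  then have "\<forall>\<^sub>F s in at_top. A (s * 2) / A s < 1 \<and> s \<ge> s0"
    using eventually_ge_at_top[of s0] by eventually_elim auto
  then obtain s1 where s1: "\<And>s. s \<ge> s1 \<Longrightarrow> A (s * 2) / A s < 1 \<and> s \<ge> s0"
    by (auto simp: eventually_at_top_linorder)
  have dbl: "\<bar>A (s * 2)\<bar> \<le> \<bar>A s\<bar>" if "s \<ge> s1" for s
  proof -
    have "s > 1" "s * 2 > 1" using s1[OF that] K(1) by auto
    then have "(0 < A s \<and> 0 < A (s * 2)) \<or> (A s < 0 \<and> A (s * 2) < 0)"
      using A_sign by blast
    then have nz: "\<bar>A s\<bar> > 0" and sg: "A (s * 2) / A s = \<bar>A (s * 2)\<bar> / \<bar>A s\<bar>"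
      by auto
    then have "\<bar>A (s * 2)\<bar> / \<bar>A s\<bar> < 1" using s1[OF that] by simp
    then show ?thesis using nz by (simp add: pos_divide_less_eq)
  qed
  have main: "\<bar>A t\<bar> \<le> K * \<bar>A s\<bar>" if "s \<ge> s1" "s \<le> t" "t \<le> 2 ^ Suc n * s" for s t n
    using that
  proof (induction n arbitrary: s)
    case 0
    then have "s > 0" using s1[of s] K(1) by auto
    then have "\<bar>A (s * (t / s))\<bar> \<le> K * \<bar>A s\<bar>"
      using 0 s1[of s] by (intro K(2)) (auto simp: field_simps)
    then show ?case using \<open>s > 0\<close> by simp
  next
    case (Suc n)
    have "s > 0" using s1[of s] Suc.prems K(1) by auto
    show ?case
    proof (cases "t \<le> 2 * s")
      case True
      then have "\<bar>A (s * (t / s))\<bar> \<le> K * \<bar>A s\<bar>"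
        using Suc.prems s1[of s] \<open>s > 0\<close> by (intro K(2)) (auto simp: field_simps)
      then show ?thesis using \<open>s > 0\<close> by simp
    next
      case False
      have "K \<ge> 0"
      proof -
        have "\<bar>A (s * 1)\<bar> \<le> K * \<bar>A s\<bar>" using s1[of s] Suc.prems by (intro K(2)) auto
        moreover have "A s \<noteq> 0" using s1[of s] Suc.prems K(1) by (intro A_nonzero) auto
        ultimately show ?thesis by (smt (verit) mult_neg_pos mult.right_neutral zero_less_abs_iff)
      qed
      have "\<bar>A t\<bar> \<le> K * \<bar>A (2 * s)\<bar>"
        using False Suc.prems \<open>s > 0\<close> by (intro Suc.IH) auto
      also have "\<dots> \<le> K * \<bar>A s\<bar>"
        using dbl[of s] Suc.prems \<open>K \<ge> 0\<close> by (intro mult_left_mono) (auto simp: mult.commute)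
      finally show ?thesis .
    qed
  qed
  show ?thesis
  proof (intro exI conjI allI impI)
    show "max s0 s1 > 1" using K(1) by simp
    show "max K 1 > 0" by simp
    fix s t assume st: "max s0 s1 \<le> s" "s \<le> t"
    then have "s > 0" using K(1) by simp
    obtain n :: nat where "t / s < 2 ^ n" using real_arch_pow[of 2 "t / s"] by auto
    then have "t \<le> 2 ^ Suc n * s" using \<open>s > 0\<close> st by (simp add: field_simps)
    then have "\<bar>A t\<bar> \<le> K * \<bar>A s\<bar>" using st by (intro main) auto
    also have "\<dots> \<le> max K 1 * \<bar>A s\<bar>" by (intro mult_right_mono) auto
    finally show "\<bar>A t\<bar> \<le> max K 1 * \<bar>A s\<bar>" .
  qed
qed

lemma tail_constants:
  "\<exists>s0 K C1 C2 C3 \<theta> \<mu>. s0 > 1 \<and> K > 0 \<and> 0 < \<theta> \<and> \<theta> < 2 powr g \<and> 0 < \<mu> \<and> \<mu> < 1 \<and> C1 > 0 \<and> C2 > 0 \<and> C3 > 0 \<and>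
    (\<forall>s\<ge>s0. \<bar>P s\<bar> \<le> C1 * (a s * \<bar>A s\<bar>) \<and>
      \<bar>\<delta> s - h 2 * a s\<bar> \<le> C2 * (a s * \<bar>A s\<bar>) \<and> \<delta> s \<le> C3 * a s \<and>
      a (2 * s) \<le> \<mu> * a s \<and> a (2 * s) * \<bar>A (2 * s)\<bar> \<le> \<theta> * (a s * \<bar>A s\<bar>) \<and>
      (\<forall>t\<ge>s. \<bar>A t\<bar> \<le> K * \<bar>A s\<bar>))"
proof -
  \<comment> \<open>The ratio exceeds \<open>2 powr (g + r)\<close>, the limiting factor of
    \<open>a * A\<close> under doubling, but stays below \<open>2 powr g\<close>, so that geometric
    sums with ratio \<theta> still converge after division by the powers
    \<open>(2 powr g) ^ n\<close>. Likewise \<mu> lies between \<open>2 powr g\<close> and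
    1.\<close>
  define \<theta> where "\<theta> = (2 powr (g + r) + 2 powr g) / (2::real)"
  define \<mu> where "\<mu> = (2 powr g + 1) / (2::real)"
  have pw: "2 powr (g + r) < (2::real) powr g" "2 powr g < (2::real) powr 0"
    using g r by (intro powr_less_mono; simp)+
  have \<theta>: "2 powr (g + r) < \<theta>" "\<theta> < 2 powr g" "0 < \<theta>" and \<mu>: "2 powr g < \<mu>" "\<mu> < 1" "0 < \<mu>"
    using pw unfolding \<theta>_def \<mu>_def by (auto simp: field_simps add_pos_pos)
  obtain K s1 where K: "s1 > 1" "K > 0" "\<And>s t. s \<ge> s1 \<Longrightarrow> t \<ge> s \<Longrightarrow> \<bar>A t\<bar> \<le> K * \<bar>A s\<bar>"
    using A_tail_bounded by metis
  have 1: "\<forall>\<^sub>F s in at_top. \<bar>P s / (a s * A s)\<bar> < \<kappa> + 1"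
    using order_tendstoD(2)[OF tendsto_rabs[OF P_scaled[of 1]], of "\<kappa> + 1"] \<kappa>_pos by simp
  have 2: "\<forall>\<^sub>F s in at_top. \<bar>(\<delta> s / a s - h 2) / A s\<bar> < \<bar>Psi 2\<bar> + 1"
    using order_tendstoD(2)[OF tendsto_rabs[OF increment_second[of 2]], of "\<bar>Psi 2\<bar> + 1"]
    by (simp add: \<delta>_def mult.commute)
  have 3: "\<forall>\<^sub>F s in at_top. \<delta> s / a s < h 2 + 1"
    using order_tendstoD(2)[OF \<delta>_scaled[of 1], of "h 2 + 1"] by simp
  have 4: "\<forall>\<^sub>F s in at_top. a (s * 2) / a s < \<mu>"
    using order_tendstoD(2)[OF a_regular[of 2], of \<mu>] \<mu> by simp
  have "((\<lambda>s. (a (s * 2) / a s) * (A (s * 2) / A s)) \<longlongrightarrow> 2 powr g * 2 powr r) at_top"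
    by (intro tendsto_intros a_regular A_regular) auto
  then have 5: "\<forall>\<^sub>F s in at_top. (a (s * 2) / a s) * (A (s * 2) / A s) < \<theta>"
    using order_tendstoD(2)[of _ "2 powr g * 2 powr r" at_top \<theta>] \<theta> by (simp add: powr_add)
  have "\<forall>\<^sub>F s in at_top. \<bar>P s\<bar> \<le> (\<kappa> + 1) * (a s * \<bar>A s\<bar>) \<and>
      \<bar>\<delta> s - h 2 * a s\<bar> \<le> (\<bar>Psi 2\<bar> + 1) * (a s * \<bar>A s\<bar>) \<and> \<delta> s \<le> (h 2 + 1) * a s \<and>
      a (2 * s) \<le> \<mu> * a s \<and> a (2 * s) * \<bar>A (2 * s)\<bar> \<le> \<theta> * (a s * \<bar>A s\<bar>) \<and>
      (\<forall>t\<ge>s. \<bar>A t\<bar> \<le> K * \<bar>A s\<bar>)"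
    using 1 2 3 4 5 eventually_ge_at_top[of s1]
  proof eventually_elim
    case (elim s)
    have s: "s > 1" "2 * s > 1" using elim K(1) by auto
    have a: "a s > 0" "a (2 * s) > 0" and nz: "A s \<noteq> 0" "A (2 * s) \<noteq> 0"
      using s by (auto intro!: a_pos A_nonzero)
    have sg: "A (2 * s) / A s = \<bar>A (2 * s)\<bar> / \<bar>A s\<bar>"
    proof -
      have "(0 < A s \<and> 0 < A (2 * s)) \<or> (A s < 0 \<and> A (2 * s) < 0)" using A_sign s by blast
      then show ?thesis by auto
    qed
    have "\<bar>P s\<bar> < (\<kappa> + 1) * (a s * \<bar>A s\<bar>)"
      using elim(1) a nz by (simp add: abs_divide abs_mult pos_divide_less_eq)
    moreover have "\<bar>\<delta> s / a s - h 2\<bar> < (\<bar>Psi 2\<bar> + 1) * \<bar>A s\<bar>"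
      using elim(2) a nz by (simp add: abs_divide abs_mult pos_divide_less_eq)
    then have "\<bar>\<delta> s / a s - h 2\<bar> * a s < (\<bar>Psi 2\<bar> + 1) * \<bar>A s\<bar> * a s"
      using a by (intro mult_strict_right_mono)
    moreover have "\<bar>\<delta> s / a s - h 2\<bar> * a s = \<bar>(\<delta> s / a s - h 2) * a s\<bar>"
      using a by (simp add: abs_mult)
    moreover have "(\<delta> s / a s - h 2) * a s = \<delta> s - h 2 * a s"
      using a by (simp add: left_diff_distrib)
    moreover have "\<delta> s < (h 2 + 1) * a s" "a (2 * s) < \<mu> * a s"
      using elim(3,4) a by (simp_all add: pos_divide_less_eq mult.commute)
    moreover have "a (2 * s) * \<bar>A (2 * s)\<bar> < \<theta> * (a s * \<bar>A s\<bar>)"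
    proof -
      have "(a (2 * s) * \<bar>A (2 * s)\<bar>) / (a s * \<bar>A s\<bar>) < \<theta>"
        using elim(5) sg by (simp only: mult.commute[of s] times_divide_times_eq)
      then show ?thesis using a nz by (simp add: pos_divide_less_eq)
    qed
    ultimately show ?case using K(3) elim(6) by (auto simp: mult_ac)
  qed
  then obtain s2 where s2: "\<And>s. s \<ge> s2 \<Longrightarrow> \<bar>P s\<bar> \<le> (\<kappa> + 1) * (a s * \<bar>A s\<bar>) \<and>
      \<bar>\<delta> s - h 2 * a s\<bar> \<le> (\<bar>Psi 2\<bar> + 1) * (a s * \<bar>A s\<bar>) \<and> \<delta> s \<le> (h 2 + 1) * a s \<and>
      a (2 * s) \<le> \<mu> * a s \<and> a (2 * s) * \<bar>A (2 * s)\<bar> \<le> \<theta> * (a s * \<bar>A s\<bar>) \<and>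
      (\<forall>t\<ge>s. \<bar>A t\<bar> \<le> K * \<bar>A s\<bar>)"
    by (auto simp: eventually_at_top_linorder)
  show ?thesis
    by (rule exI[of _ "max s1 s2"], rule exI[of _ K], rule exI[of _ "\<kappa> + 1"], rule exI[of _ "\<bar>Psi 2\<bar> + 1"],
        rule exI[of _ "h 2 + 1"], rule exI[of _ \<theta>], rule exI[of _ \<mu>])
      (use K \<theta> \<mu> \<kappa>_pos h2_pos s2 in auto)
qed

text \<open>With \<open>D s = x - U s\<close>, the difference
  \<open>D (2 * s) - 2 powr g * D s\<close> is a telescoping sum of values of \<open>P\<close> and
  hence \<open>O(a * A)\<close>. Combined with \<open>\<delta> s = D s - D (2 * s)\<close> it gives
  \<open>D = - a / g\<close> up to \<open>O(a * A)\<close>, and iterated along powers of two it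
  makes \<open>D (2 ^ n * s) / (2 ^ n * s) powr g\<close> converge with relative error
  \<open>O(A)\<close>.\<close>

theorem tail_expansion:
  "\<exists>L c s0 x. L > 0 \<and> c > 0 \<and> s0 > 1 \<and> (U \<longlongrightarrow> x) at_top \<and>
    (\<forall>s\<ge>s0. \<bar>x - U s - L * s powr g\<bar> \<le> c * \<bar>A s\<bar> * s powr g \<and>
       \<bar>a s + g * L * s powr g\<bar> \<le> c * \<bar>A s\<bar> * s powr g \<and> (\<forall>t\<ge>s. \<bar>A t\<bar> \<le> c * \<bar>A s\<bar>)) \<and>
    (\<forall>s>1. U s < x)"
proof -
  obtain s0 K C1 C2 C3 \<theta> \<mu> where cs: "s0 > 1 \<and> K > 0 \<and> 0 < \<theta> \<and> \<theta> < 2 powr g \<and> 0 < \<mu> \<and> \<mu> < 1 \<and> C1 > 0 \<and> C2 > 0 \<and> C3 > 0 \<and>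
    (\<forall>s\<ge>s0. \<bar>P s\<bar> \<le> C1 * (a s * \<bar>A s\<bar>) \<and>
      \<bar>\<delta> s - h 2 * a s\<bar> \<le> C2 * (a s * \<bar>A s\<bar>) \<and> \<delta> s \<le> C3 * a s \<and>
      a (2 * s) \<le> \<mu> * a s \<and> a (2 * s) * \<bar>A (2 * s)\<bar> \<le> \<theta> * (a s * \<bar>A s\<bar>) \<and>
      (\<forall>t\<ge>s. \<bar>A t\<bar> \<le> K * \<bar>A s\<bar>))"
    using tail_constants by (elim exE) (rule that)
  from cs have c: "s0 > 1" "K > 0" "0 < \<theta>" "\<theta> < 2 powr g" "0 < \<mu>" "\<mu> < 1" "C1 > 0" "C2 > 0" "C3 > 0"
    by auto
  have P: "\<And>s. s \<ge> s0 \<Longrightarrow> \<bar>P s\<bar> \<le> C1 * (a s * \<bar>A s\<bar>)"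
    and d: "\<And>s. s \<ge> s0 \<Longrightarrow> \<bar>\<delta> s - h 2 * a s\<bar> \<le> C2 * (a s * \<bar>A s\<bar>)"
    and d': "\<And>s. s \<ge> s0 \<Longrightarrow> \<delta> s \<le> C3 * a s"
    and a: "\<And>s. s \<ge> s0 \<Longrightarrow> a (2 * s) \<le> \<mu> * a s"
    and B: "\<And>s. s \<ge> s0 \<Longrightarrow> a (2 * s) * \<bar>A (2 * s)\<bar> \<le> \<theta> * (a s * \<bar>A s\<bar>)"
    and K: "\<And>s t. s \<ge> s0 \<Longrightarrow> t \<ge> s \<Longrightarrow> \<bar>A t\<bar> \<le> K * \<bar>A s\<bar>"
    using cs by blast+
  have "2 powr g < (2::real) powr 0" using g by (intro powr_less_mono) auto
  then have tg: "2 powr g < (1::real)" "2 powr g > (0::real)" by auto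
  have \<theta>1: "\<theta> < 1" using c tg by simp
  have ge: "2 ^ n * s \<ge> s0" "2 ^ n * s > 1" if "s \<ge> s0" for s n
  proof -
    have "1 * s \<le> 2 ^ n * s" using that c by (intro mult_right_mono) auto
    then show "2 ^ n * s \<ge> s0" "2 ^ n * s > 1" using that c by linarith+
  qed
  have an: "a (2 ^ n * s) \<le> \<mu> ^ n * a s" if "s \<ge> s0" for s n
  proof (induction n)
    case (Suc n)
    have "a (2 ^ Suc n * s) \<le> \<mu> * a (2 ^ n * s)" using a[OF ge(1)[OF that, of n]] by (simp add: mult_ac)
    also have "\<dots> \<le> \<mu> * (\<mu> ^ n * a s)" using Suc c by (intro mult_left_mono) auto
    finally show ?case by simp
  qed simp
  define b where "b s = a s * \<bar>A s\<bar>" for s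
  have bn: "b (2 ^ n * s) \<le> \<theta> ^ n * b s" if "s \<ge> s0" for s n
  proof (induction n)
    case (Suc n)
    have "b (2 ^ Suc n * s) \<le> \<theta> * b (2 ^ n * s)" using B[OF ge(1)[OF that, of n]] by (simp add: mult_ac b_def)
    also have "\<dots> \<le> \<theta> * (\<theta> ^ n * b s)" using Suc c by (intro mult_left_mono) auto
    finally show ?case by simp
  qed simp
  have "\<bar>U (2 ^ Suc n * s0) - U (2 ^ n * s0)\<bar> \<le> C3 * a s0 * \<mu> ^ n" for n
  proof -
    have "U (2 ^ Suc n * s0) \<ge> U (2 ^ n * s0)" using ge[of s0 n] c by (intro U_mono) auto
    moreover have "\<delta> (2 ^ n * s0) \<le> C3 * a (2 ^ n * s0)" using ge[of s0 n] by (intro d') auto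
    moreover have "C3 * a (2 ^ n * s0) \<le> C3 * (\<mu> ^ n * a s0)" using an[of s0 n] c by (intro mult_left_mono) auto
    ultimately show ?thesis by (simp add: \<delta>_def mult_ac)
  qed
  then obtain x where x: "(\<lambda>n. U (2 ^ n * s0)) \<longlonglongrightarrow> x"
    using geometric_increments[of "\<lambda>n. U (2 ^ n * s0)" "C3 * a s0" \<mu>] c by auto
  have pow_lim: "filterlim (\<lambda>n. 2 ^ n * s) at_top sequentially" if "s > 0" for s :: real
  proof -
    have "filterlim (\<lambda>n. 2 ^ n :: real) at_top sequentially"
      by (rule filterlim_at_top_mono[OF filterlim_real_sequentially])
        (auto intro!: always_eventually less_imp_le of_nat_less_two_power)
    then show ?thesis using that by (rule filterlim_at_top_mult_tendsto_pos[OF tendsto_const, rotated])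
  qed
  have inc: "incseq (\<lambda>n. U (2 ^ n * s0))"
    using ge[of s0] c by (intro incseq_SucI U_mono) (auto intro: less_le_trans)
  have Ux: "U t \<le> x" if "t > 1" for t
  proof -
    have "\<forall>\<^sub>F n in sequentially. 2 ^ n * s0 \<ge> t"
      using pow_lim[of s0] c by (simp add: filterlim_at_top)
    then obtain n where "2 ^ n * s0 \<ge> t" by (auto simp: eventually_sequentially)
    then have "U t \<le> U (2 ^ n * s0)" using that by (intro U_mono)
    also have "\<dots> \<le> x" using inc x by (rule incseq_le)
    finally show ?thesis .
  qed
  have Ulim: "(U \<longlongrightarrow> x) at_top"
  proof (rule order_tendstoI)
    fix y assume "y < x"
    then obtain n where n: "U (2 ^ n * s0) > y"
      using order_tendstoD(1)[OF x] by (auto simp: eventually_sequentially)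
    show "\<forall>\<^sub>F s in at_top. y < U s"
      using eventually_ge_at_top[of "2 ^ n * s0"]
    proof eventually_elim
      case (elim s)
      then have "U (2 ^ n * s0) \<le> U s" using ge[of s0 n] c by (intro U_mono) auto
      then show ?case using n by simp
    qed
  next
    fix y assume "x < y"
    show "\<forall>\<^sub>F s in at_top. U s < y"
      using eventually_gt_at_top[of 1] by eventually_elim (use \<open>x < y\<close> Ux in \<open>auto intro: le_less_trans\<close>)
  qed
  define D where "D s = x - U s" for s
  have Dn: "(\<lambda>n. D (2 ^ n * s)) \<longlonglongrightarrow> 0" if "s > 0" for s
  proof -
    have "(\<lambda>n. D (2 ^ n * s)) \<longlonglongrightarrow> x - x"
      unfolding D_def by (intro tendsto_intros filterlim_compose[OF Ulim] pow_lim that)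
    then show ?thesis by simp
  qed
  define C4 where "C4 = C1 / (1 - \<theta>)"
  have "C4 > 0" using c \<theta>1 by (simp add: C4_def)
  have D2: "\<bar>D (2 * s) - 2 powr g * D s\<bar> \<le> C4 * b s" if "s \<ge> s0" for s
  proof -
    define f where "f n = D (2 ^ Suc n * s) - 2 powr g * D (2 ^ n * s)" for n
    have "s > 0" using that c by simp
    have "f \<longlonglongrightarrow> 0 - 2 powr g * 0"
      unfolding f_def by (intro tendsto_intros Dn \<open>s > 0\<close> LIMSEQ_Suc)
    moreover have "\<bar>f (Suc n) - f n\<bar> \<le> C1 * b s * \<theta> ^ n" for n
    proof -
      have "f (Suc n) - f n = - P (2 ^ n * s)"
        by (simp add: f_def P_def \<delta>_def D_def algebra_simps)
      then have "\<bar>f (Suc n) - f n\<bar> \<le> C1 * b (2 ^ n * s)" using P[OF ge(1)[OF that]] by (simp add: b_def)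
      also have "\<dots> \<le> C1 * (\<theta> ^ n * b s)" using bn[OF that] c by (intro mult_left_mono) auto
      finally show ?thesis by (simp add: mult_ac)
    qed
    then obtain l where "f \<longlonglongrightarrow> l" "\<bar>l - f 0\<bar> \<le> C1 * b s / (1 - \<theta>)"
      using geometric_increments[of f "C1 * b s" \<theta>] c \<theta>1 by auto
    ultimately have "\<bar>0 - f 0\<bar> \<le> C1 * b s / (1 - \<theta>)" by (metis LIMSEQ_unique diff_0_right mult_zero_right)
    then show ?thesis by (simp add: f_def C4_def)
  qed
  define C5 where "C5 = (C4 + C2) / (1 - 2 powr g)"
  have "C5 > 0" using c \<open>C4 > 0\<close> tg by (simp add: C5_def add_pos_pos)
  have Da: "\<bar>D s + a s / g\<bar> \<le> C5 * b s" if "s \<ge> s0" for s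
  proof -
    have "(1 - 2 powr g) * (D s + a s / g) = (D (2 * s) - 2 powr g * D s) + (\<delta> s - h 2 * a s)"
      using g by (simp add: D_def \<delta>_def h_def field_simps)
    then have "\<bar>(1 - 2 powr g) * (D s + a s / g)\<bar> \<le> C4 * b s + C2 * b s"
      using D2[OF that] d[OF that] unfolding b_def by linarith
    then have "(1 - 2 powr g) * \<bar>D s + a s / g\<bar> \<le> (C4 + C2) * b s"
      using tg by (simp add: abs_mult distrib_right)
    then show ?thesis using tg by (simp add: C5_def field_simps)
  qed
  define C6 where "C6 = C4 * 2 powr (- g) / (1 - \<theta> * 2 powr (- g))"
  have \<theta>g: "\<theta> * 2 powr (- g) < 1" "0 \<le> \<theta> * 2 powr (- g)"
    using c tg by (auto simp: powr_minus field_simps)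
  have "C6 > 0" using \<open>C4 > 0\<close> \<theta>g by (simp add: C6_def)
  have ex_l: "\<exists>l. (\<lambda>n. D (2 ^ n * s) / (2 ^ n * s) powr g) \<longlonglongrightarrow> l \<and> \<bar>l - D s / s powr g\<bar> \<le> C6 * b s / s powr g"
    if s: "s \<ge> s0" for s
  proof -
    define f where "f n = D (2 ^ n * s) / (2 ^ n * s) powr g" for n
    have s0: "s > 0" using that c by simp
    have "\<bar>f (Suc n) - f n\<bar> \<le> C4 * 2 powr (- g) * b s / s powr g * (\<theta> * 2 powr (- g)) ^ n" for n
    proof -
      define t where "t = 2 ^ n * s"
      have t: "t > 0" "t \<ge> s0" using s0 ge[OF s] by (auto simp: t_def)
      have tp: "t powr g = (2 powr g) ^ n * s powr g"
        using s0 by (simp add: t_def powr_mult powr_realpow[symmetric] powr_powr mult.commute)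
      have "f (Suc n) - f n = (D (2 * t) - 2 powr g * D t) * 2 powr (- g) / t powr g"
      proof -
        have "f n = D t / t powr g" "f (Suc n) = D (2 * t) / (2 * t) powr g"
          by (simp_all add: f_def t_def mult.assoc)
        then show ?thesis
          using t tg by (simp only: powr_mult powr_minus) (simp add: field_simps)
      qed
      then have "\<bar>f (Suc n) - f n\<bar> = \<bar>D (2 * t) - 2 powr g * D t\<bar> * 2 powr (- g) / t powr g"
        by (simp add: abs_mult abs_divide)
      also have "\<dots> \<le> C4 * (\<theta> ^ n * b s) * 2 powr (- g) / t powr g"
      proof (intro divide_right_mono mult_right_mono)
        have "\<bar>D (2 * t) - 2 powr g * D t\<bar> \<le> C4 * b t" using D2 t by blast
        also have "\<dots> \<le> C4 * (\<theta> ^ n * b s)" using bn[OF s] \<open>C4 > 0\<close> by (intro mult_left_mono) (auto simp: t_def)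
        finally show "\<bar>D (2 * t) - 2 powr g * D t\<bar> \<le> C4 * (\<theta> ^ n * b s)" .
      qed auto
      also have "\<dots> = C4 * 2 powr (- g) * b s / s powr g * (\<theta> * 2 powr (- g)) ^ n"
        using tg by (simp add: tp powr_minus power_mult_distrib power_inverse field_simps)
      finally show ?thesis .
    qed
    then obtain l where "f \<longlonglongrightarrow> l" "\<bar>l - f 0\<bar> \<le> C4 * 2 powr (- g) * b s / s powr g / (1 - \<theta> * 2 powr (- g))"
      using geometric_increments[of f _ "\<theta> * 2 powr (- g)"] \<theta>g by blast
    then show ?thesis unfolding f_def by (intro exI[of _ l]) (simp add: C6_def mult_ac)
  qed
  define l where "l s = lim (\<lambda>n. D (2 ^ n * s) / (2 ^ n * s) powr g)" for s
  have l: "(\<lambda>n. D (2 ^ n * s) / (2 ^ n * s) powr g) \<longlonglongrightarrow> l s"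
      "\<bar>l s - D s / s powr g\<bar> \<le> C6 * b s / s powr g" if "s \<ge> s0" for s
    using ex_l[OF that] limI unfolding l_def by blast+
  \<comment> \<open>The first bound on \<open>|A|\<close> absorbs \<open>C5 * b s\<close> into half
    of \<open>- a s / g\<close>, which gives \<open>a s \<le> - 2 * g * D s\<close>. The second
    makes the relative distance between \<open>l s\<close> and \<open>D s / s powr g\<close> at most
    1/2.\<close>
  define \<epsilon> where "\<epsilon> = min (1 / (2 * - g * C5)) (1 / (2 * C6 * - 2 * g))"
  have "\<epsilon> > 0" using g \<open>C5 > 0\<close> \<open>C6 > 0\<close> by (auto simp: \<epsilon>_def mult_pos_neg)
  then have "\<forall>\<^sub>F s in at_top. \<bar>A s\<bar> < \<epsilon>"
    using tendstoD[OF A_lim] by (simp add: dist_real_def)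
  then have "\<forall>\<^sub>F s in at_top. \<bar>A s\<bar> < \<epsilon> \<and> s \<ge> s0"
    using eventually_ge_at_top[of s0] by eventually_elim auto
  then obtain s1 where s1: "\<And>s. s \<ge> s1 \<Longrightarrow> \<bar>A s\<bar> < \<epsilon> \<and> s \<ge> s0"
    by (auto simp: eventually_at_top_linorder)
  have aD: "a s \<le> - 2 * g * D s" if "s \<ge> s1" for s
  proof -
    have ap: "a s > 0" using s1[OF that] c by (intro a_pos) auto
    have "C5 * b s \<le> a s * (1 / (2 * - g))"
    proof -
      have "C5 * \<bar>A s\<bar> \<le> C5 * (1 / (2 * - g * C5))"
        using s1[OF that] \<open>C5 > 0\<close> by (intro mult_left_mono) (auto simp: \<epsilon>_def)
      also have "\<dots> = 1 / (2 * - g)" using \<open>C5 > 0\<close> by simp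
      finally have "a s * (C5 * \<bar>A s\<bar>) \<le> a s * (1 / (2 * - g))" using ap by (intro mult_left_mono) auto
      then show ?thesis by (simp add: b_def mult_ac)
    qed
    moreover have "\<bar>D s + a s / g\<bar> \<le> C5 * b s" using s1[OF that] by (intro Da) auto
    ultimately have "D s \<ge> - a s / g - a s * (1 / (2 * - g))" by linarith
    also have "- a s / g - a s * (1 / (2 * - g)) = a s / (- 2 * g)" using g by (simp add: field_simps)
    finally show ?thesis using g by (simp add: field_simps)
  qed
  have Dpos: "D s > 0" if "s \<ge> s1" for s
  proof -
    have "a s > 0" using s1[OF that] c by (intro a_pos) auto
    then have "0 < - 2 * g * D s" using aD[OF that] by linarith
    then show ?thesis using g by (simp add: mult_less_0_iff zero_less_mult_iff)
  qed
  have lD: "\<bar>l s - D s / s powr g\<bar> \<le> C6 * (- 2 * g) * \<bar>A s\<bar> * (D s / s powr g)" if "s \<ge> s1" for s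
  proof -
    have "s > 0" using s1[OF that] c by auto
    have "\<bar>l s - D s / s powr g\<bar> \<le> C6 * b s / s powr g" using l(2) s1[OF that] by blast
    also have "\<dots> \<le> C6 * (- 2 * g * D s * \<bar>A s\<bar>) / s powr g"
      unfolding b_def using aD[OF that] \<open>C6 > 0\<close> by (intro divide_right_mono mult_left_mono mult_right_mono) auto
    finally show ?thesis by (simp add: mult_ac)
  qed
  have half: "D s / s powr g \<le> 2 * l s" if "s \<ge> s1" for s
  proof -
    have "s > 0" using s1[OF that] c by auto
    have "C6 * (- 2 * g) * \<bar>A s\<bar> \<le> C6 * (- 2 * g) * (1 / (2 * C6 * - 2 * g))"
      using s1[OF that] \<open>C6 > 0\<close> g by (intro mult_left_mono) (auto simp: \<epsilon>_def mult_nonneg_nonpos)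
    also have "\<dots> = 1/2" using \<open>C6 > 0\<close> g by simp
    finally have "C6 * (- 2 * g) * \<bar>A s\<bar> * (D s / s powr g) \<le> 1/2 * (D s / s powr g)"
      using Dpos[OF that] by (intro mult_right_mono) auto
    then show ?thesis using lD[OF that] by linarith
  qed
  have lpos: "l s > 0" if "s \<ge> s1" for s
  proof -
    have "s > 0" using s1[OF that] c by auto
    then have "D s / s powr g > 0" using Dpos[OF that] by simp
    then show ?thesis using half[OF that] by linarith
  qed
  \<comment> \<open>A dyadic limit could depend on its starting point. It does not, because
    \<open>D\<close> inherits regular variation from \<open>a\<close> through the limit
    \<open>- 1 / g\<close> of \<open>D / a\<close>.\<close>
  have leq: "l s = l s1" if "s \<ge> s1" for s
  proof -
    define z where "z = s / s1"
    have p: "s1 > 0" "s1 \<ge> s0" using s1[of s1] c by auto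
    have z: "z \<ge> 1" "s = s1 * z" using that p by (auto simp: z_def)
    have lim: "filterlim (\<lambda>n. 2 ^ n * s1) at_top sequentially" using p by (intro pow_lim)
    have Dap: "((\<lambda>s. D s / a s) \<longlongrightarrow> - 1 / g) at_top"
    proof (rule Lim_transform[OF tendsto_const], rule Lim_null_comparison)
      show "\<forall>\<^sub>F s in at_top. norm (D s / a s - - 1 / g) \<le> C5 * \<bar>A s\<bar>"
        using eventually_ge_at_top[of s0]
      proof eventually_elim
        case (elim s)
        have ap: "a s > 0" using elim c by (intro a_pos) auto
        have "D s / a s - - 1 / g = (D s + a s / g) / a s" using ap g by (simp add: field_simps)
        then have "norm (D s / a s - - 1 / g) = \<bar>D s + a s / g\<bar> / a s"
          using ap by (simp add: abs_divide)
        also have "\<dots> \<le> C5 * b s / a s" using Da[OF elim] ap by (intro divide_right_mono) auto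
        finally show ?case using ap by (simp add: b_def)
      qed
      have "((\<lambda>s. C5 * \<bar>A s\<bar>) \<longlongrightarrow> C5 * \<bar>0\<bar>) at_top" by (intro tendsto_intros A_lim)
      then show "((\<lambda>s. C5 * \<bar>A s\<bar>) \<longlongrightarrow> 0) at_top" by simp
    qed
    have "((\<lambda>s. D (s * z) / a (s * z) * (a (s * z) / a s) / (D s / a s)) \<longlongrightarrow> - 1 / g * z powr g / (- 1 / g)) at_top"
      using z g by (intro tendsto_intros a_regular Dap filterlim_compose[OF Dap] eventually_scale_at_top) auto
    moreover have "\<forall>\<^sub>F s in at_top. D (s * z) / a (s * z) * (a (s * z) / a s) / (D s / a s) = D (s * z) / D s"
      using eventually_gt_at_top[of 1]
    proof eventually_elim
      case (elim s)
      have "s * 1 \<le> s * z" using elim z by (intro mult_left_mono) auto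
      then have "s * z > 1" using elim by linarith
      then have "a s > 0" "a (s * z) > 0" using elim by (auto intro!: a_pos)
      then show ?case by (simp add: field_simps)
    qed
    ultimately have "((\<lambda>s. D (s * z) / D s) \<longlongrightarrow> z powr g) at_top"
      using g by (auto intro: Lim_transform_eventually)
    then have "(\<lambda>n. D (2 ^ n * s1 * z) / D (2 ^ n * s1) / z powr g) \<longlonglongrightarrow> z powr g / z powr g"
      using z by (intro tendsto_intros filterlim_compose[OF _ lim]) auto
    moreover have "(\<lambda>n. (D (2 ^ n * s) / (2 ^ n * s) powr g) / (D (2 ^ n * s1) / (2 ^ n * s1) powr g)) \<longlonglongrightarrow> l s / l s1"
      using lpos[of s1] p that by (intro tendsto_intros l) auto
    moreover have "(D (2 ^ n * s) / (2 ^ n * s) powr g) / (D (2 ^ n * s1) / (2 ^ n * s1) powr g)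
       = D (2 ^ n * s1 * z) / D (2 ^ n * s1) / z powr g" for n
      using z p by (simp add: powr_mult mult.assoc field_simps)
    ultimately have "l s / l s1 = z powr g / z powr g"
      by (simp add: LIMSEQ_unique)
    then show ?thesis using z lpos[of s1] by simp
  qed
  define L where "L = l s1"
  have Lpos: "L > 0" using lpos[of s1] by (simp add: L_def)
  have DL: "D s \<le> 2 * L * s powr g" if "s \<ge> s1" for s
    using half[OF that] leq[OF that] s1[OF that] c by (simp add: L_def field_simps)
  define c1 where "c1 = C6 * (- 2 * g) * (2 * L)"
  define c2 where "c2 = - g * C5 * (- 2 * g * (2 * L)) - g * c1"
  have c12: "c1 > 0" "c2 > 0"
    using \<open>C6 > 0\<close> \<open>C5 > 0\<close> Lpos g by (auto simp: c1_def c2_def mult_pos_neg mult_neg_pos mult_neg_neg add_pos_pos algebra_simps)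
  have e1: "\<bar>D s - L * s powr g\<bar> \<le> c1 * \<bar>A s\<bar> * s powr g" if "s \<ge> s1" for s
  proof -
    have "s > 0" using s1[OF that] c by auto
    have "\<bar>D s - L * s powr g\<bar> = \<bar>l s - D s / s powr g\<bar> * s powr g"
    proof -
      have "D s - L * s powr g = - (l s - D s / s powr g) * s powr g"
        using \<open>s > 0\<close> leq[OF that] by (simp add: L_def field_simps)
      then show ?thesis by (simp add: abs_mult del: minus_diff_eq)
    qed
    also have "\<dots> \<le> C6 * (- 2 * g) * \<bar>A s\<bar> * (D s / s powr g) * s powr g"
      using lD[OF that] by (intro mult_right_mono) auto
    also have "\<dots> = C6 * (- 2 * g) * \<bar>A s\<bar> * D s" using \<open>s > 0\<close> by simp
    also have "\<dots> \<le> C6 * (- 2 * g) * \<bar>A s\<bar> * (2 * L * s powr g)"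
      using DL[OF that] \<open>C6 > 0\<close> g by (intro mult_left_mono) (auto simp: mult_nonneg_nonpos mult_nonpos_nonneg)
    finally show ?thesis by (simp add: c1_def mult_ac)
  qed
  have e2: "\<bar>a s + g * L * s powr g\<bar> \<le> c2 * \<bar>A s\<bar> * s powr g" if "s \<ge> s1" for s
  proof -
    have "a s + g * L * s powr g = g * (D s + a s / g) - g * (D s - L * s powr g)"
      using g by (simp add: algebra_simps)
    then have "\<bar>a s + g * L * s powr g\<bar> \<le> \<bar>g\<bar> * \<bar>D s + a s / g\<bar> + \<bar>g\<bar> * \<bar>D s - L * s powr g\<bar>"
      by (simp only: abs_mult[symmetric] abs_triangle_ineq4)
    also have "\<dots> \<le> \<bar>g\<bar> * (C5 * b s) + \<bar>g\<bar> * (c1 * \<bar>A s\<bar> * s powr g)"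
      using Da[of s] e1[OF that] s1[OF that] by (intro add_mono mult_left_mono) auto
    also have "C5 * b s \<le> C5 * ((- 2 * g * (2 * L * s powr g)) * \<bar>A s\<bar>)"
    proof -
      have "a s \<le> - 2 * g * (2 * L * s powr g)"
        using aD[OF that] mult_left_mono[OF DL[OF that], of "- 2 * g"] g by linarith
      then show ?thesis unfolding b_def using \<open>C5 > 0\<close> by (intro mult_left_mono mult_right_mono) auto
    qed
    finally show ?thesis using g by (simp add: c2_def algebra_simps mult_left_mono)
  qed
  define cc where "cc = max (max c1 c2) K"
  have "cc > 0" using c12 by (auto simp: cc_def)
  have ccm: "c1 * y \<le> cc * y" "c2 * y \<le> cc * y" "K * y \<le> cc * y" if "y \<ge> 0" for y
    using that by (auto simp: cc_def intro!: mult_right_mono)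
  have "U s < x" if "s > 1" for s
  proof -
    have "U s \<le> U (max s s1)" using that by (intro U_mono) auto
    also have "\<dots> < x" using Dpos[of "max s s1"] by (simp add: D_def)
    finally show ?thesis .
  qed
  moreover have "\<bar>x - U s - L * s powr g\<bar> \<le> cc * \<bar>A s\<bar> * s powr g"
      "\<bar>a s + g * L * s powr g\<bar> \<le> cc * \<bar>A s\<bar> * s powr g" if "s \<ge> s1" for s
    using e1[OF that] e2[OF that] ccm[of "\<bar>A s\<bar> * s powr g"] by (auto simp: D_def mult.assoc)
  moreover have "\<bar>A t\<bar> \<le> cc * \<bar>A s\<bar>" if "s \<ge> s1" "t \<ge> s" for s t
    using K[of s t] s1[of s] that ccm[of "\<bar>A s\<bar>"] by auto
  moreover have "s1 > 1" using s1[of s1] c by auto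
  ultimately show ?thesis using Lpos \<open>cc > 0\<close> Ulim
    by (intro exI[of _ L] exI[of _ cc] exI[of _ s1] exI[of _ x] conjI allI impI)
qed

end

section \<open>The survival function near the endpoint\<close>

lemma iterated_powr_integral:
  fixes g r z :: real
  assumes z: "z \<ge> 1" and g: "g < 0" and r: "r < 0"
  shows "(LBINT v=1..ereal z. v powr (g - 1) * (LBINT u=1..ereal v. u powr (r - 1)))
    = ((z powr (g + r) - 1) / (g + r) - (z powr g - 1) / g) / r"
proof -
  have one: "(1::ereal) = ereal 1" by (simp add: one_ereal_def)
  have FTC: "(LBINT u=1..ereal v. f u) = Fn v - Fn 1"
    if "v \<ge> 1" "\<And>u. u > 0 \<Longrightarrow> (Fn has_real_derivative f u) (at u)" "continuous_on {1..v} f" for v and f Fn :: "real \<Rightarrow> real"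
    unfolding one using that
    by (intro interval_integral_FTC_finite)
      (auto simp: min_def max_def has_real_derivative_iff_has_vector_derivative intro: has_vector_derivative_at_within)
  have inner: "(LBINT u=1..ereal v. u powr (r - 1)) = (v powr r - 1) / r" if "v \<ge> 1" for v
  proof -
    have "(LBINT u=1..ereal v. u powr (r - 1)) = v powr r / r - 1 powr r / r"
      using that r by (intro FTC) (auto intro!: derivative_eq_intros continuous_intros simp: powr_diff)
    then show ?thesis by (simp add: diff_divide_distrib)
  qed
  have "(LBINT v=1..ereal z. v powr (g - 1) * (LBINT u=1..ereal v. u powr (r - 1)))
      = (LBINT v=1..ereal z. v powr (g - 1) * ((v powr r - 1) / r))"
    using z by (intro interval_integral_cong) (auto simp: einterval_def inner[unfolded one] one)
  also have "\<dots> = (z powr (g + r) / (g + r) - z powr g / g) / r - (1 powr (g + r) / (g + r) - 1 powr g / g) / r"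
  proof (rule FTC[OF z])
    fix v :: real assume v: "v > 0"
    have "((\<lambda>v. (v powr (g + r) / (g + r) - v powr g / g) / r) has_real_derivative
        ((g + r) * v powr (g + r - 1) / (g + r) - g * v powr (g - 1) / g) / r) (at v)"
      using v by (auto intro!: derivative_eq_intros)
    moreover have "((g + r) * v powr (g + r - 1) / (g + r) - g * v powr (g - 1) / g) / r = v powr (g - 1) * ((v powr r - 1) / r)"
    proof -
      have "v powr (g + r - 1) = v powr (g - 1) * v powr r" by (simp flip: powr_add add: algebra_simps)
      moreover have "g + r \<noteq> 0" using g r by simp
      ultimately show ?thesis using g r by (simp add: right_diff_distrib)
    qed
    ultimately show "((\<lambda>v. (v powr (g + r) / (g + r) - v powr g / g) / r) has_real_derivative
        v powr (g - 1) * ((v powr r - 1) / r)) (at v)"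
      by (simp only:)
  qed (use r in \<open>auto intro!: continuous_intros\<close>)
  also have "\<dots> = ((z powr (g + r) - 1) / (g + r) - (z powr g - 1) / g) / r"
    by (simp add: diff_divide_distrib)
  finally show ?thesis .
qed

text \<open>Mean value theorem on \<open>{1/2..3/2}\<close>, where \<open>|ln z| \<le> ln 2\<close>
  bounds the derivative; the constant depends on \<open>q\<close> only.\<close>

lemma powr_minus_one_bound:
  fixes u q :: real
  assumes "\<bar>u - 1\<bar> \<le> 1/2"
  shows "\<bar>u powr q - 1\<bar> \<le> \<bar>q\<bar> * exp (\<bar>q - 1\<bar> * ln 2) * \<bar>u - 1\<bar>"
proof -
  have "\<bar>u powr q - 1 powr q\<bar> \<le> \<bar>q\<bar> * exp (\<bar>q - 1\<bar> * ln 2) * \<bar>u - 1\<bar>"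
  proof (rule field_differentiable_bound[of "{1/2..3/2::real}" "\<lambda>x. x powr q" "\<lambda>x. q * x powr (q - 1)", unfolded real_norm_def])
    fix z :: real assume z: "z \<in> {1/2..3/2}"
    then show "((\<lambda>x. x powr q) has_field_derivative q * z powr (q - 1)) (at z within {1/2..3/2})"
      by (auto intro!: derivative_eq_intros)
    have "ln z \<le> ln 2" "ln z \<ge> ln (1/2)" using z by auto
    then have "\<bar>ln z\<bar> \<le> ln 2" by (simp add: ln_div abs_le_iff)
    then have "\<bar>q - 1\<bar> * \<bar>ln z\<bar> \<le> \<bar>q - 1\<bar> * ln 2" by (intro mult_left_mono) auto
    then have "(q - 1) * ln z \<le> \<bar>q - 1\<bar> * ln 2"
      using abs_ge_self[of "(q - 1) * ln z"] by (simp add: abs_mult)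
    then have "z powr (q - 1) \<le> exp (\<bar>q - 1\<bar> * ln 2)" using z by (simp add: powr_def)
    then show "\<bar>q * z powr (q - 1)\<bar> \<le> \<bar>q\<bar> * exp (\<bar>q - 1\<bar> * ln 2)"
      by (auto simp: abs_mult intro!: mult_left_mono)
  next
    have "1/2 \<le> u" "u \<le> 3/2" using abs_le_D1[OF assms] abs_le_D2[OF assms] by linarith+
    then show "u \<in> {1/2..3/2}" by simp
  qed auto
  then show ?thesis by simp
qed

section \<open>Quantile function and survival function as generalised inverses\<close>

context real_distribution
begin

text \<open>Right continuity of the distribution function makes the infimum attained; the strict
  bounds on \<tau> make the set nonempty and bounded below. The equivalence is a Galois connection
  and replaces inversion of \<open>F\<close> throughout.\<close>

lemma quantile_le_iff:
  assumes "0 < \<tau>" "\<tau> < 1"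
  shows "quantile (cdf M) \<tau> \<le> x \<longleftrightarrow> \<tau> \<le> cdf M x"
proof -
  let ?S = "{x. cdf M x \<ge> \<tau>}"
  have "\<forall>\<^sub>F x in at_top. cdf M x > \<tau>"
    using order_tendstoD(1)[OF cdf_lim_at_top_prob] assms by simp
  then obtain u where "cdf M u > \<tau>" by (auto simp: eventually_at_top_linorder)
  then have ne: "?S \<noteq> {}" by (auto intro!: exI[of _ u])
  have "\<forall>\<^sub>F x in at_bot. cdf M x < \<tau>"
    using order_tendstoD(2)[OF cdf_lim_at_bot] assms by simp
  then obtain l where l: "\<And>x. x \<le> l \<Longrightarrow> cdf M x < \<tau>" by (auto simp: eventually_at_bot_linorder)
  have bdd: "bdd_below ?S"
    using l by (intro bdd_belowI[of _ l]) (metis mem_Collect_eq linorder_le_cases not_less)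
  have "cdf M (Inf ?S) \<ge> \<tau>"
  proof (rule tendsto_lowerbound)
    show "(cdf M \<longlongrightarrow> cdf M (Inf ?S)) (at_right (Inf ?S))"
      using cdf_is_right_cont by (simp add: continuous_within)
    show "\<forall>\<^sub>F x in at_right (Inf ?S). \<tau> \<le> cdf M x"
      unfolding eventually_at_filter
    proof (intro always_eventually allI impI)
      fix x assume "x \<in> {Inf ?S<..}"
      then obtain y where "y \<in> ?S" "y < x" using ne bdd by (auto simp: cInf_less_iff)
      then show "\<tau> \<le> cdf M x" using cdf_nondecreasing[of y x] by auto
    qed
  qed simp
  then have "\<tau> \<le> cdf M x" if "Inf ?S \<le> x" using cdf_nondecreasing[OF that] by linarith
  moreover have "Inf ?S \<le> x" if "\<tau> \<le> cdf M x" using that bdd by (intro cInf_lower) auto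
  ultimately show ?thesis unfolding quantile_def by blast
qed

lemma tail_quantile_le_iff: "s > 1 \<Longrightarrow> tail_quantile (cdf M) s \<le> x \<longleftrightarrow> 1 - 1 / s \<le> cdf M x"
  unfolding tail_quantile_def by (intro quantile_le_iff) auto

end

locale second_order_distribution = real_distribution +
  fixes a A :: "real \<Rightarrow> real" and g r :: real
  assumes C2_cond: "condition_C2 (cdf M) g a r A" and r_neg: "r < 0"
begin

sublocale second_order_tail "tail_quantile (cdf M)" a A g r
proof
  have *: "s * t > 1" if "s > 1" "t \<ge> 1" for s t :: real
    using that by (metis less_1_mult mult.right_neutral nless_le)
  show "tail_quantile (cdf M) s \<le> tail_quantile (cdf M) t" if "1 < s" "s \<le> t" for s t
  proof -
    have "1 - 1 / s \<le> 1 - 1 / t" using that by (simp add: frac_le)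
    also have "\<dots> \<le> cdf M (tail_quantile (cdf M) t)" using that tail_quantile_le_iff[of t] by auto
    finally show ?thesis using that tail_quantile_le_iff[of s] by auto
  qed
  have g: "g < 0" using C2_cond by (auto simp: condition_C2_def)
  show "((\<lambda>s. 1 / A s * ((tail_quantile (cdf M) (s * z) - tail_quantile (cdf M) s) / a s - (z powr g - 1) / g))
    \<longlongrightarrow> ((z powr (g + r) - 1) / (g + r) - (z powr g - 1) / g) / r) at_top" if "z \<ge> 1" for z
    unfolding iterated_powr_integral[OF that g r_neg, symmetric] using C2_cond that
    by (auto simp only: condition_C2_def)
qed (use C2_cond r_neg in \<open>auto simp: condition_C2_def\<close>)

abbreviation "F \<equiv> cdf M"
abbreviation "U \<equiv> tail_quantile F"

definition xe :: real where "xe = right_endpoint F"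

lemma right_endpoint_eq:
  assumes "(U \<longlongrightarrow> x) at_top" "\<And>s. s > 1 \<Longrightarrow> U s < x"
  shows "F y < 1 \<longleftrightarrow> y < x" "right_endpoint F = x"
proof -
  have eq: "F y < 1 \<longleftrightarrow> y < x" for y
  proof
    assume y: "F y < 1"
    \<comment> \<open>Then \<open>1 - 1 / s\<close> is the midpoint between \<open>F y\<close> and
      1, hence strictly above \<open>F y\<close>, and the equivalence for \<open>U\<close> forces
      \<open>y < U s\<close>.\<close>
    define s where "s = 2 / (1 - F y)"
    have s: "s > 1" using y cdf_nonneg[of y] by (auto simp: s_def field_simps)
    have "\<not> U s \<le> y" unfolding tail_quantile_le_iff[OF s] using y by (simp add: s_def field_simps)
    then show "y < x" using assms(2)[OF s] by simp
  next
    assume "y < x"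
    then have "\<forall>\<^sub>F s in at_top. U s > y \<and> s > 1"
      using order_tendstoD(1)[OF assms(1)] eventually_gt_at_top[of 1] by (auto intro: eventually_conj)
    then obtain s where s: "U s > y" "s > 1" unfolding eventually_at_top_linorder by blast
    then have "\<not> 1 - 1 / s \<le> F y" using tail_quantile_le_iff[of s y] by simp
    then show "F y < 1" using s(2) by (auto simp: not_le intro: less_le_trans)
  qed
  show "F y < 1 \<longleftrightarrow> y < x" by (rule eq)
  have "{y. F y < 1} = {..<x}" using eq by auto
  then show "right_endpoint F = x" by (simp add: right_endpoint_def)
qed

lemma endpoint_facts:
  shows F_less_one_iff: "F y < 1 \<longleftrightarrow> y < xe" and U_less_xe: "s > 1 \<Longrightarrow> U s < xe" and U_lim: "(U \<longlongrightarrow> xe) at_top"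
    and expansion: "\<exists>L c s0. L > 0 \<and> c > 0 \<and> s0 > 1 \<and>
    (\<forall>s\<ge>s0. \<bar>xe - U s - L * s powr g\<bar> \<le> c * \<bar>A s\<bar> * s powr g \<and>
       \<bar>a s + g * L * s powr g\<bar> \<le> c * \<bar>A s\<bar> * s powr g \<and> (\<forall>t\<ge>s. \<bar>A t\<bar> \<le> c * \<bar>A s\<bar>))"
proof -
  obtain L c s0 x where *: "L > 0 \<and> c > 0 \<and> s0 > 1 \<and> (U \<longlongrightarrow> x) at_top \<and>
    (\<forall>s\<ge>s0. \<bar>x - U s - L * s powr g\<bar> \<le> c * \<bar>A s\<bar> * s powr g \<and>
       \<bar>a s + g * L * s powr g\<bar> \<le> c * \<bar>A s\<bar> * s powr g \<and> (\<forall>t\<ge>s. \<bar>A t\<bar> \<le> c * \<bar>A s\<bar>)) \<and>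
    (\<forall>s>1. U s < x)"
    using tail_expansion by (elim exE) (rule that)
  then have x: "(U \<longlongrightarrow> x) at_top" "\<And>s. s > 1 \<Longrightarrow> U s < x" by auto
  have xe: "x = xe" using right_endpoint_eq(2)[OF x] by (simp add: xe_def)
  show "F y < 1 \<longleftrightarrow> y < xe" "s > 1 \<Longrightarrow> U s < xe" "(U \<longlongrightarrow> xe) at_top"
    using right_endpoint_eq(1)[OF x] x by (auto simp: xe)
  show "\<exists>L c s0. L > 0 \<and> c > 0 \<and> s0 > 1 \<and>
    (\<forall>s\<ge>s0. \<bar>xe - U s - L * s powr g\<bar> \<le> c * \<bar>A s\<bar> * s powr g \<and>
       \<bar>a s + g * L * s powr g\<bar> \<le> c * \<bar>A s\<bar> * s powr g \<and> (\<forall>t\<ge>s. \<bar>A t\<bar> \<le> c * \<bar>A s\<bar>))"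
    using * unfolding xe by (intro exI[of _ L] exI[of _ c] exI[of _ s0]) simp
qed

text \<open>The generalised inverse of \<open>U\<close> near the endpoint:
  \<open>U (S y) \<le> y\<close>, and \<open>y < U t\<close> for every \<open>t > S y\<close>. It
  turns errors \<open>A s\<close> at the scale of \<open>U\<close> into errors
  \<open>A (S y)\<close> at a level \<open>y\<close>.\<close>

definition S :: "real \<Rightarrow> real" where "S y = 1 / (1 - F y)"

lemma S_mono: "x \<le> y \<Longrightarrow> y < xe \<Longrightarrow> S x \<le> S y"
  unfolding S_def using F_less_one_iff[of y] cdf_nondecreasing[of x y] by (intro divide_left_mono) auto

lemma S_ge: "t > 1 \<Longrightarrow> U t \<le> y \<Longrightarrow> y < xe \<Longrightarrow> S y \<ge> t"
  unfolding S_def using F_less_one_iff[of y] tail_quantile_le_iff[of t y] by (auto simp: field_simps)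

lemma U_S_le: "S y > 1 \<Longrightarrow> y < xe \<Longrightarrow> U (S y) \<le> y"
  using tail_quantile_le_iff[of "S y" y] F_less_one_iff[of y] by (simp add: S_def)

lemma U_gt: "S y > 1 \<Longrightarrow> y < xe \<Longrightarrow> t > S y \<Longrightarrow> y < U t"
  using tail_quantile_le_iff[of t y] F_less_one_iff[of y] by (simp add: S_def field_simps not_le[symmetric])

lemma U_expansion_limit: "\<exists>L>0. ((\<lambda>s. (xe - U s) / s powr g) \<longlongrightarrow> L) at_top"
proof -
  obtain L c s0 where *: "L > 0 \<and> c > 0 \<and> s0 > 1 \<and>
    (\<forall>s\<ge>s0. \<bar>xe - U s - L * s powr g\<bar> \<le> c * \<bar>A s\<bar> * s powr g \<and>
       \<bar>a s + g * L * s powr g\<bar> \<le> c * \<bar>A s\<bar> * s powr g \<and> (\<forall>t\<ge>s. \<bar>A t\<bar> \<le> c * \<bar>A s\<bar>))"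
    using expansion by (elim exE) (rule that)
  have "((\<lambda>s. (xe - U s) / s powr g) \<longlongrightarrow> L) at_top"
  proof (rule Lim_transform[OF tendsto_const], rule Lim_null_comparison)
    show "\<forall>\<^sub>F s in at_top. norm ((xe - U s) / s powr g - L) \<le> c * \<bar>A s\<bar>"
      using eventually_ge_at_top[of s0]
    proof eventually_elim
      case (elim s)
      have s: "s powr g > 0" using elim * by simp
      have "(xe - U s) / s powr g - L = (xe - U s - L * s powr g) / s powr g"
        using s by (simp add: field_simps)
      then have "norm ((xe - U s) / s powr g - L) = \<bar>xe - U s - L * s powr g\<bar> / s powr g"
        by (simp add: abs_divide)
      also have "\<dots> \<le> c * \<bar>A s\<bar> * s powr g / s powr g"
        using * elim by (intro divide_right_mono) auto
      finally show ?case using s by simp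
    qed
    have "((\<lambda>s. c * \<bar>A s\<bar>) \<longlongrightarrow> c * \<bar>0\<bar>) at_top" by (intro tendsto_intros A_lim)
    then show "((\<lambda>s. c * \<bar>A s\<bar>) \<longlongrightarrow> 0) at_top" by simp
  qed
  then show ?thesis using * by blast
qed

text \<open>Inverting the expansion of the tail quantile function: the survival function is a power of the
  distance to the endpoint, with a relative error controlled by \<open>A\<close> uniformly up to the endpoint.\<close>
theorem survival_expansion:
  "\<exists>L c x0. L > 0 \<and> c > 0 \<and> x0 < xe \<and> (\<forall>x. x0 \<le> x \<longrightarrow> x < xe \<longrightarrow>
     S x > 1 \<and> c * \<bar>A (S x)\<bar> \<le> 1/2 \<and> \<bar>xe - x + a (S x) / g\<bar> \<le> c * \<bar>A (S x)\<bar> * (xe - x) \<and>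
     (\<forall>y. x \<le> y \<longrightarrow> y < xe \<longrightarrow> \<bar>A (S y)\<bar> \<le> c * \<bar>A (S x)\<bar> \<and>
        \<bar>1 - F y - ((xe - y) / L) powr (- 1 / g)\<bar> \<le> c * \<bar>A (S x)\<bar> * ((xe - y) / L) powr (- 1 / g)))"
proof -
  obtain L c s0 where *: "L > 0 \<and> c > 0 \<and> s0 > 1 \<and>
    (\<forall>s\<ge>s0. \<bar>xe - U s - L * s powr g\<bar> \<le> c * \<bar>A s\<bar> * s powr g \<and>
       \<bar>a s + g * L * s powr g\<bar> \<le> c * \<bar>A s\<bar> * s powr g \<and> (\<forall>t\<ge>s. \<bar>A t\<bar> \<le> c * \<bar>A s\<bar>))"
    using expansion by (elim exE) (rule that)
  then have Lc: "L > 0" "c > 0" "s0 > 1" by auto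
  have D: "\<bar>xe - U s - L * s powr g\<bar> \<le> c * \<bar>A s\<bar> * s powr g"
      "\<bar>a s + g * L * s powr g\<bar> \<le> c * \<bar>A s\<bar> * s powr g" if "s \<ge> s0" for s using * that by auto
  have A: "\<bar>A t\<bar> \<le> c * \<bar>A s\<bar>" if "s \<ge> s0" "t \<ge> s" for s t using * that by auto
  define c1 where "c1 = max c (c * c)"
  have c1: "c1 > 0" "c1 \<ge> c" "c1 \<ge> c * c" using Lc by (auto simp: c1_def)
  have w: "\<bar>xe - y - L * S y powr g\<bar> \<le> c1 * \<bar>A (S y)\<bar> * S y powr g" if y: "U s0 \<le> y" "y < xe" for y
  proof -
    define s where "s = S y"
    have s: "s \<ge> s0" "s > 1" using S_ge[OF Lc(3) y] Lc by (auto simp: s_def)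
    have "xe - y \<le> xe - U s" using U_S_le[of y] y s by (simp add: s_def)
    also have "\<dots> \<le> L * s powr g + c * \<bar>A s\<bar> * s powr g" using D(1)[OF s(1)] by linarith
    finally have "xe - y - L * s powr g \<le> c * (\<bar>A s\<bar> * s powr g)" by (simp add: mult_ac)
    also have "\<dots> \<le> c1 * (\<bar>A s\<bar> * s powr g)" using c1 by (intro mult_right_mono) auto
    finally have up: "xe - y - L * s powr g \<le> c1 * \<bar>A s\<bar> * s powr g" by (simp add: mult_ac)
    \<comment> \<open>\<open>F\<close> may be flat near \<open>y\<close>, so \<open>U s\<close> may
      lie below \<open>y\<close> and gives only the upper bound. Every \<open>t > s\<close> has
      \<open>y < U t\<close>, and letting \<open>t\<close> decrease to \<open>s\<close> gives the
      lower one. As \<open>A\<close> need not be continuous, \<open>|A t|\<close> is first replaced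
      by \<open>c * |A s|\<close>, whence the factor \<open>c * c\<close>.\<close>
    have "(L - c * c * \<bar>A s\<bar>) * s powr g \<le> xe - y"
    proof (rule tendsto_upperbound)
      show "((\<lambda>t. (L - c * c * \<bar>A s\<bar>) * t powr g) \<longlongrightarrow> (L - c * c * \<bar>A s\<bar>) * s powr g) (at_right s)"
        using s by (intro tendsto_intros) auto
      show "\<forall>\<^sub>F t in at_right s. (L - c * c * \<bar>A s\<bar>) * t powr g \<le> xe - y"
        unfolding eventually_at_filter
      proof (intro always_eventually allI impI)
        fix t assume "t \<in> {s<..}"
        then have t: "t > s" "t \<ge> s0" using s by auto
        have "c * \<bar>A t\<bar> * t powr g \<le> c * (c * \<bar>A s\<bar>) * t powr g"
          using A[of s t] s t Lc by (intro mult_right_mono mult_left_mono) auto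
        moreover have "L * t powr g - c * \<bar>A t\<bar> * t powr g \<le> xe - U t" using D(1)[OF t(2)] by linarith
        moreover have "y < U t" using U_gt[of y t] s t y by (auto simp: s_def)
        ultimately show "(L - c * c * \<bar>A s\<bar>) * t powr g \<le> xe - y" by (simp add: algebra_simps)
      qed
    qed simp
    then have "- (c * c * (\<bar>A s\<bar> * s powr g)) \<le> xe - y - L * s powr g" by (simp add: algebra_simps)
    moreover have "c * c * (\<bar>A s\<bar> * s powr g) \<le> c1 * (\<bar>A s\<bar> * s powr g)" using c1 by (intro mult_right_mono) auto
    ultimately show ?thesis using up unfolding s_def[symmetric] abs_le_iff by (simp add: mult_ac)
  qed
  define b where "b = - 1 / g"
  have b: "b > 0" "g * - b = 1" "g * b = - 1" using g by (auto simp: b_def divide_neg_neg)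
  define Cb where "Cb = \<bar>- b\<bar> * exp (\<bar>- b - 1\<bar> * ln 2)"
  have Cb: "Cb \<ge> 0" by (simp add: Cb_def)
  \<comment> \<open>The sum of all constants that the estimates below produce, so that it dominates
    each of them. The smallness \<open>c2 * |A (S x)| \<le> 1/2\<close> then also keeps the ratio
    \<open>u\<close> below within 1/2 of 1.\<close>
  define c2 where "c2 = Cb * (c1 / L) * c + (2 / L) * (c1 + c / \<bar>g\<bar>) + c + 2 * (c1 / L) * c + 2 * (c1 / L)"
  have nn: "Cb * (c1 / L) * c \<ge> 0" "(2 / L) * (c1 + c / \<bar>g\<bar>) \<ge> 0" "2 * (c1 / L) * c > 0" "2 * (c1 / L) > 0"
    using Lc c1 Cb by auto
  then have c2: "c2 > 0" "c2 \<ge> Cb * (c1 / L) * c" "c2 \<ge> (2 / L) * (c1 + c / \<bar>g\<bar>)" "c2 \<ge> c" "c2 \<ge> 2 * (c1 / L) * c" "c2 \<ge> 2 * (c1 / L)"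
    using Lc unfolding c2_def by linarith+
  have "\<forall>\<^sub>F s in at_top. \<bar>A s\<bar> < 1 / (2 * c2)"
    using tendstoD[OF A_lim, of "1 / (2 * c2)"] c2 by (simp add: dist_real_def)
  then obtain s1 where s1: "\<And>s. s \<ge> s1 \<Longrightarrow> \<bar>A s\<bar> < 1 / (2 * c2)"
    by (auto simp: eventually_at_top_linorder)
  define s2 where "s2 = max s0 s1"
  have s2: "s2 > 1" "s2 \<ge> s0" "s2 \<ge> s1" using Lc by (auto simp: s2_def)
  have main: "S x > 1 \<and> c2 * \<bar>A (S x)\<bar> \<le> 1/2 \<and> \<bar>xe - x + a (S x) / g\<bar> \<le> c2 * \<bar>A (S x)\<bar> * (xe - x) \<and>
     (\<forall>y. x \<le> y \<longrightarrow> y < xe \<longrightarrow> \<bar>A (S y)\<bar> \<le> c2 * \<bar>A (S x)\<bar> \<and>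
        \<bar>1 - F y - ((xe - y) / L) powr b\<bar> \<le> c2 * \<bar>A (S x)\<bar> * ((xe - y) / L) powr b)"
    if x: "U s2 \<le> x" "x < xe" for x
  proof (intro conjI allI impI)
    define \<epsilon> where "\<epsilon> = \<bar>A (S x)\<bar>"
    have Sx: "S x \<ge> s2" using S_ge[OF s2(1) x] .
    show "S x > 1" using Sx s2 by simp
    have "\<epsilon> < 1 / (2 * c2)" unfolding \<epsilon>_def using Sx s2 by (intro s1) auto
    then have e: "c2 * \<epsilon> \<le> 1/2" using c2 by (simp add: field_simps)
    then show "c2 * \<bar>A (S x)\<bar> \<le> 1/2" by (simp add: \<epsilon>_def)
    have Us0: "U s0 \<le> x" using U_mono[of s0 s2] Lc s2 x by auto
    have e0: "\<epsilon> \<ge> 0" by (simp add: \<epsilon>_def)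
    have Ay: "\<bar>A (S y)\<bar> \<le> c * \<epsilon>" if "x \<le> y" "y < xe" for y
      unfolding \<epsilon>_def using Sx s2 S_mono[OF that] by (intro A) auto
    show "\<bar>A (S y)\<bar> \<le> c2 * \<bar>A (S x)\<bar>" if "x \<le> y" "y < xe" for y
      using Ay[OF that] mult_right_mono[OF c2(4) e0] by (simp add: \<epsilon>_def)
    show "\<bar>xe - x + a (S x) / g\<bar> \<le> c2 * \<bar>A (S x)\<bar> * (xe - x)"
    proof -
      define s where "s = S x"
      have sp: "s powr g > 0" using Sx s2 by (simp add: s_def)
      have w1: "\<bar>xe - x - L * s powr g\<bar> \<le> c1 * \<epsilon> * s powr g" using w[OF Us0 x(2)] by (simp add: s_def \<epsilon>_def)
      have a1: "\<bar>a s + g * L * s powr g\<bar> \<le> c * \<epsilon> * s powr g" using D(2)[of s] Sx s2 by (simp add: s_def \<epsilon>_def)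
      have "c1 * \<epsilon> \<le> L / 2"
      proof -
        have "2 * (c1 / L) * \<epsilon> \<le> c2 * \<epsilon>" using c2(6) e0 by (intro mult_right_mono)
        then have "2 * (c1 / L) * \<epsilon> \<le> 1/2" using e by linarith
        then have "4 * (c1 * \<epsilon>) \<le> L" using Lc by (simp add: field_simps)
        then show ?thesis using Lc by linarith
      qed
      then have "c1 * \<epsilon> * s powr g \<le> L / 2 * s powr g" using sp by (intro mult_right_mono) auto
      then have "L / 2 * s powr g \<le> xe - x" using w1 by (simp add: abs_le_iff)
      then have sw: "s powr g \<le> 2 / L * (xe - x)" using Lc by (simp add: field_simps)
      have "xe - x + a s / g = (xe - x - L * s powr g) + (a s + g * L * s powr g) / g"
        using g by (simp add: field_simps)
      then have "\<bar>xe - x + a s / g\<bar> \<le> \<bar>xe - x - L * s powr g\<bar> + \<bar>a s + g * L * s powr g\<bar> / \<bar>g\<bar>"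
        using abs_triangle_ineq[of "xe - x - L * s powr g" "(a s + g * L * s powr g) / g"] by (simp only: abs_divide)
      also have "\<dots> \<le> c1 * \<epsilon> * s powr g + c * \<epsilon> * s powr g / \<bar>g\<bar>"
        using w1 a1 by (intro add_mono divide_right_mono) auto
      also have "\<dots> = (c1 + c / \<bar>g\<bar>) * \<epsilon> * s powr g" using g by (simp add: algebra_simps)
      also have "\<dots> \<le> (c1 + c / \<bar>g\<bar>) * \<epsilon> * (2 / L * (xe - x))"
        using sw c1 Lc e0 by (intro mult_left_mono) auto
      also have "\<dots> = ((2 / L) * (c1 + c / \<bar>g\<bar>)) * (\<epsilon> * (xe - x))" by (simp only: mult_ac)
      also have "\<dots> \<le> c2 * (\<epsilon> * (xe - x))" using c2 e0 x by (intro mult_right_mono) auto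
      finally show ?thesis by (simp add: s_def \<epsilon>_def mult_ac)
    qed
    show "\<bar>1 - F y - ((xe - y) / L) powr b\<bar> \<le> c2 * \<bar>A (S x)\<bar> * ((xe - y) / L) powr b"
      if y: "x \<le> y" "y < xe" for y
    proof -
      define s where "s = S y"
      have s: "s \<ge> s2" "s > 1" using S_mono[OF y] Sx s2 by (auto simp: s_def)
      \<comment> \<open>The ratio of the true distance to its leading term. Since
        \<open>g * b = - 1\<close>, the survival probability \<open>1 / s\<close> is the
        \<open>b\<close>-th power of \<open>(xe - y) / L\<close> times \<open>u powr (- b)\<close>,
        so the whole relative error sits in \<open>u\<close>.\<close>
      define u where "u = (xe - y) / (L * s powr g)"
      have sp: "s powr g > 0" "L * s powr g > 0" using s Lc by auto
      have u1: "\<bar>u - 1\<bar> \<le> c1 / L * (c * \<epsilon>)"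
      proof -
        have "\<bar>u - 1\<bar> = \<bar>xe - y - L * s powr g\<bar> / (L * s powr g)"
        proof -
          have "u - 1 = (xe - y - L * s powr g) / (L * s powr g)" using sp Lc by (simp add: u_def field_simps)
          then show ?thesis using sp by (simp add: abs_divide)
        qed
        also have "\<dots> \<le> c1 * \<bar>A s\<bar> * s powr g / (L * s powr g)"
          using w[of y] y Us0 sp by (intro divide_right_mono) (auto simp: s_def)
        also have "\<dots> = c1 / L * \<bar>A s\<bar>" using sp by simp
        also have "\<dots> \<le> c1 / L * (c * \<epsilon>)" using Ay[OF y] Lc c1 by (intro mult_left_mono) (auto simp: s_def)
        finally show ?thesis .
      qed
      moreover have "c1 / L * (c * \<epsilon>) \<le> 1/2"
      proof -
        have "(2 * (c1 / L) * c) * \<epsilon> \<le> c2 * \<epsilon>" using c2 e0 by (intro mult_right_mono)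
        then show ?thesis using e by (simp add: mult_ac)
      qed
      ultimately have u2: "\<bar>u - 1\<bar> \<le> 1/2" by linarith
      have u: "u > 0" using abs_le_D2[OF u2] by linarith
      have Fy: "1 - F y = ((xe - y) / L) powr b * u powr (- b)"
      proof -
        have "1 - F y = 1 / s" by (simp add: s_def S_def)
        also have "\<dots> = (s powr g) powr b" using s b by (simp add: powr_powr powr_minus field_simps)
        also have "s powr g = ((xe - y) / L) * inverse u" using sp y Lc by (simp add: u_def)
        also have "(((xe - y) / L) * inverse u) powr b = ((xe - y) / L) powr b * (inverse u) powr b"
          using y Lc u by (intro powr_mult)
        also have "(inverse u) powr b = u powr (- b)" by (simp add: powr_minus inverse_powr)
        finally show ?thesis .
      qed
      then have "1 - F y - ((xe - y) / L) powr b = ((xe - y) / L) powr b * (u powr (- b) - 1)"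
        by (simp add: algebra_simps)
      then have eq: "\<bar>1 - F y - ((xe - y) / L) powr b\<bar> = ((xe - y) / L) powr b * \<bar>u powr (- b) - 1\<bar>"
        by (simp add: abs_mult)
      have "\<bar>u powr (- b) - 1\<bar> \<le> Cb * \<bar>u - 1\<bar>"
        unfolding Cb_def using powr_minus_one_bound[OF u2, of "- b"] by simp
      also have "\<dots> \<le> Cb * (c1 / L * (c * \<epsilon>))" using u1 Cb by (intro mult_left_mono)
      also have "\<dots> = (Cb * (c1 / L) * c) * \<epsilon>" by simp
      also have "\<dots> \<le> c2 * \<epsilon>" using c2 e0 by (intro mult_right_mono)
      finally have "((xe - y) / L) powr b * \<bar>u powr (- b) - 1\<bar> \<le> ((xe - y) / L) powr b * (c2 * \<epsilon>)"
        by (intro mult_left_mono) auto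
      then show ?thesis unfolding eq by (simp add: \<epsilon>_def mult_ac)
    qed
  qed
  show ?thesis
    unfolding b_def[symmetric]
    by (intro exI[of _ L] exI[of _ c2] exI[of _ "U s2"] conjI allI impI main Lc(1) c2(1) U_less_xe[OF s2(1)])
qed

end

section \<open>Expectiles near the endpoint\<close>

text \<open>\<open>arg_min\<close> chooses some minimiser, so it can be evaluated only where the
  minimiser is unique; a quadratic lower bound around \<open>x\<close> ensures this.\<close>

lemma arg_min_strongly_convex:
  fixes f :: "real \<Rightarrow> real"
  assumes "k > 0" and "\<And>y. f y \<ge> f x + k * (y - x)\<^sup>2"
  shows "arg_min f (\<lambda>_. True) = x"
  unfolding arg_min_def
proof (rule some_equality)
  have "f x \<le> f y" for y
  proof -
    have "0 \<le> k * (y - x)\<^sup>2" using assms(1) by simp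
    then show ?thesis using assms(2)[of y] by linarith
  qed
  then show "is_arg_min f (\<lambda>_. True) x" by (auto simp: is_arg_min_def not_less)
next
  fix y assume "is_arg_min f (\<lambda>_. True) y"
  then have "f y \<le> f x" by (auto simp: is_arg_min_def not_less)
  then have "k * (y - x)\<^sup>2 \<le> 0" using assms(2)[of y] by simp
  then show "y = x" using assms(1) by (simp add: mult_le_0_iff)
qed

text \<open>Half the derivative of \<open>expectile_loss\<close>: \<open>\<tau> * u\<close> for
  positive \<open>u\<close> and \<open>(1 - \<tau>) * u\<close> otherwise. In this form its mean
  splits into a mean excess and a mean.\<close>

definition expectile_score :: "real \<Rightarrow> real \<Rightarrow> real" where
  "expectile_score \<tau> u = (2 * \<tau> - 1) * max 0 u + (1 - \<tau>) * u"

text \<open>Strong convexity of a piecewise quadratic function whose two curvatures are given by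
  \<tau> and \<open>1 - \<tau>\<close>. If \<open>u\<close> and \<open>u - h\<close> lie on
  different sides of 0, then \<open>|u - h| \<le> |h|\<close>, and this absorbs the change of
  weight.\<close>

lemma expectile_loss_ge:
  assumes "0 < \<tau>" "\<tau> < 1"
  shows "expectile_loss \<tau> (u - h) \<ge> expectile_loss \<tau> u - 2 * h * expectile_score \<tau> u + min \<tau> (1 - \<tau>) * h\<^sup>2"
proof -
  define m where "m = min \<tau> (1 - \<tau>)"
  have m: "m \<le> \<tau>" "m \<le> 1 - \<tau>" by (auto simp: m_def)
  have loss: "expectile_loss \<tau> x = (if x \<le> 0 then (1 - \<tau>) * x\<^sup>2 else \<tau> * x\<^sup>2)" for x
    using assms by (auto simp: expectile_loss_def abs_if)
  have sc: "expectile_score \<tau> u = (if u \<le> 0 then (1 - \<tau>) * u else \<tau> * u)"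
    by (auto simp: expectile_score_def max_def algebra_simps)
  have key: "c' * v\<^sup>2 \<ge> c * u\<^sup>2 - 2 * h * (c * u) + m * h\<^sup>2"
    if "v = u - h" "v\<^sup>2 \<le> h\<^sup>2" "m \<le> c" "m \<le> c'" for c c' v
  proof -
    have "(c - m) * v\<^sup>2 \<le> (c - m) * h\<^sup>2" using that by (intro mult_left_mono) auto
    moreover have "m * v\<^sup>2 \<le> c' * v\<^sup>2" using that by (intro mult_right_mono) auto
    moreover have "c * v\<^sup>2 = c * u\<^sup>2 - 2 * h * (c * u) + c * h\<^sup>2"
      unfolding that(1) by (simp add: power2_eq_square algebra_simps)
    ultimately show ?thesis by (simp add: algebra_simps)
  qed
  have key': "c * (u - h)\<^sup>2 \<ge> c * u\<^sup>2 - 2 * h * (c * u) + m * h\<^sup>2" if "m \<le> c" for c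
  proof -
    have "m * h\<^sup>2 \<le> c * h\<^sup>2" using that by (intro mult_right_mono) auto
    then show ?thesis by (simp add: power2_eq_square algebra_simps)
  qed
  consider "u \<le> 0" "u - h \<le> 0" | "u > 0" "u - h > 0" | "u \<le> 0" "u - h > 0" | "u > 0" "u - h \<le> 0" by linarith
  then show ?thesis
  proof cases
    case 3
    then have "(u - h)\<^sup>2 \<le> h\<^sup>2" unfolding abs_le_square_iff[symmetric] by linarith
    then show ?thesis using 3 key[of "u - h" "1 - \<tau>" \<tau>] m by (simp add: loss sc m_def[symmetric])
  next
    case 4
    then have "(u - h)\<^sup>2 \<le> h\<^sup>2" unfolding abs_le_square_iff[symmetric] by linarith
    then show ?thesis using 4 key[of "u - h" \<tau> "1 - \<tau>"] m by (simp add: loss sc m_def[symmetric])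
  next
    case 1
    then show ?thesis using key'[of "1 - \<tau>"] m by (simp add: loss sc m_def[symmetric])
  next
    case 2
    then show ?thesis using key'[of \<tau>] m by (simp add: loss sc m_def[symmetric])
  qed
qed

lemma expectile_loss_measurable [measurable]: "expectile_loss \<tau> \<in> borel_measurable borel"
  unfolding expectile_loss_def[abs_def] by measurable

lemma expectile_score_measurable [measurable]: "expectile_score \<tau> \<in> borel_measurable borel"
  unfolding expectile_score_def[abs_def] by measurable

lemma expectile_distr:
  assumes [measurable]: "X \<in> borel_measurable M"
  shows "expectile M X \<tau> = expectile (distr M borel X) (\<lambda>x. x) \<tau>"
  unfolding expectile_def by (subst integral_distr) auto

section \<open>The mean excess near the endpoint\<close>

context second_order_distribution
begin

lemma AE_le_xe: "AE z in M. z \<le> xe"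
proof -
  have "F xe = 1" using F_less_one_iff[of xe] cdf_bounded_prob[of xe] by linarith
  then have "measure M {..xe} = 1" by (simp add: cdf_def)
  then have "AE z in M. z \<in> {..xe}" by (intro prob_eq_1[THEN iffD1]) auto
  then show ?thesis by simp
qed

lemma survival_eq: "measure M {y<..} = 1 - F y"
  using prob_compl[of "{..y}"] by (simp add: cdf_def Compl_eq_Diff_UNIV[symmetric] Compl_atMost)

text \<open>Layer-cake formula with the level written as \<open>xe - t\<close>. In terms of the
  distance \<open>t\<close> to the endpoint the survival function is close to a power, to be
  integrated from 0.\<close>

lemma excess_layer_cake:
  assumes "x \<le> xe"
  shows "(\<integral>\<^sup>+z. ennreal (max 0 (z - x)) \<partial>M) = (\<integral>\<^sup>+t. ennreal (1 - F (xe - t)) * indicator {0..xe - x} t \<partial>lborel)"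
proof -
  interpret pair_sigma_finite M lborel ..
  have "(\<integral>\<^sup>+z. ennreal (max 0 (z - x)) \<partial>M) = (\<integral>\<^sup>+z. (\<integral>\<^sup>+t. indicator {p. xe - fst p < snd p \<and> snd p \<le> xe - x} (z, t) \<partial>lborel) \<partial>M)"
  proof (rule nn_integral_cong_AE, use AE_le_xe in eventually_elim)
    case (elim z)
    have "(\<integral>\<^sup>+t. indicator {p. xe - fst p < snd p \<and> snd p \<le> xe - x} (z, t) \<partial>lborel)
        = (\<integral>\<^sup>+t. indicator {xe - z<..xe - x} t \<partial>lborel)"
      by (intro nn_integral_cong) (auto simp: indicator_def)
    also have "\<dots> = emeasure lborel {xe - z<..xe - x}" by simp
    also have "\<dots> = ennreal (max 0 (z - x))"
      by (cases "z \<ge> x") (auto simp: max_def)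
    finally show ?case by simp
  qed
  also have "\<dots> = (\<integral>\<^sup>+t. (\<integral>\<^sup>+z. indicator {p. xe - fst p < snd p \<and> snd p \<le> xe - x} (z, t) \<partial>M) \<partial>lborel)"
  proof (rule Fubini'[symmetric])
    have "{p \<in> space (borel \<Otimes>\<^sub>M borel). xe - fst p < snd p \<and> snd p \<le> xe - x} \<in> sets (borel \<Otimes>\<^sub>M borel)"
      by measurable
    then have "{p :: real \<times> real. xe - fst p < snd p \<and> snd p \<le> xe - x} \<in> sets (borel \<Otimes>\<^sub>M borel)"
      by (simp add: space_pair_measure)
    then have "{p :: real \<times> real. xe - fst p < snd p \<and> snd p \<le> xe - x} \<in> sets (M \<Otimes>\<^sub>M lborel)"
      by (simp cong: sets_pair_measure_cong)
    then show "(\<lambda>(z, t). indicator {p. xe - fst p < snd p \<and> snd p \<le> xe - x} (z, t) :: ennreal) \<in> borel_measurable (M \<Otimes>\<^sub>M lborel)"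
      by simp
  qed
  also have "\<dots> = (\<integral>\<^sup>+t. ennreal (1 - F (xe - t)) * indicator {0..xe - x} t \<partial>lborel)"
  proof (rule nn_integral_cong)
    fix t :: real
    have "(\<integral>\<^sup>+z. indicator {p. xe - fst p < snd p \<and> snd p \<le> xe - x} (z, t) \<partial>M)
      = (\<integral>\<^sup>+z. indicator {..xe - x} t * indicator {xe - t<..} z \<partial>M)"
      by (intro nn_integral_cong) (auto simp: indicator_def)
    also have "\<dots> = indicator {..xe - x} t * emeasure M {xe - t<..}"
      by (simp add: nn_integral_cmult)
    also have "\<dots> = indicator {..xe - x} t * ennreal (1 - F (xe - t))"
      by (simp add: emeasure_eq_measure survival_eq)
    also have "\<dots> = ennreal (1 - F (xe - t)) * indicator {0..xe - x} t"
    proof (cases "t \<ge> 0")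
      case False
      then have "F (xe - t) = 1" using F_less_one_iff[of "xe - t"] cdf_bounded_prob[of "xe - t"] by linarith
      then show ?thesis by simp
    qed (auto simp: indicator_def)
    finally show "(\<integral>\<^sup>+z. indicator {p. xe - fst p < snd p \<and> snd p \<le> xe - x} (z, t) \<partial>M)
      = ennreal (1 - F (xe - t)) * indicator {0..xe - x} t" .
  qed
  finally show ?thesis .
qed

definition excess :: "real \<Rightarrow> real" where "excess x = (\<integral>z. max 0 (z - x) \<partial>M)"

lemma excess_integrable [simp]: "integrable M (\<lambda>z. max 0 (z - x))"
proof (rule integrable_const_bound)
  show "AE z in M. norm (max 0 (z - x)) \<le> \<bar>xe - x\<bar>"
    using AE_le_xe by eventually_elim auto
qed auto

text \<open>\<open>K * w powr (b + 1)\<close> is the integral of \<open>(t / L) powr b\<close> over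
  \<open>{0..w}\<close>. A relative error that is uniform up to the endpoint passes through the
  integral unchanged; \<open>\<eta> \<le> 1\<close> keeps the lower integrand nonnegative, as the
  extended integral requires.\<close>

lemma excess_bounds:
  assumes x: "x < xe" and L: "L > 0" and b: "b > 0" and \<eta>: "0 \<le> \<eta>" "\<eta> \<le> 1"
    and F: "\<And>y. x \<le> y \<Longrightarrow> y < xe \<Longrightarrow> \<bar>1 - F y - ((xe - y) / L) powr b\<bar> \<le> \<eta> * ((xe - y) / L) powr b"
  defines "K \<equiv> (1 / L) powr b / (b + 1)"
  shows "\<bar>excess x - K * (xe - x) powr (b + 1)\<bar> \<le> \<eta> * (K * (xe - x) powr (b + 1))"
proof -
  define w where "w = xe - x"
  have w: "w > 0" using x by (simp add: w_def)
  have pw: "(\<integral>\<^sup>+t. ennreal (k * (t / L) powr b) * indicator {0..w} t \<partial>lborel) = ennreal (k * (K * w powr (b + 1)))"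
    if "k \<ge> 0" for k
  proof (rule nn_integral_has_integral_lebesgue')
    have "((\<lambda>t. (k * (1 / L) powr b) * t powr b) has_integral (k * (1 / L) powr b) * (w powr (b + 1) / (b + 1))) {0..w}"
      using b w by (intro has_integral_mult_right has_integral_powr_from_0) auto
    then show "((\<lambda>t. k * (t / L) powr b) has_integral k * (K * w powr (b + 1))) {0..w}"
      using L by (elim has_integral_eq_rhs[OF has_integral_eq, rotated]) (auto simp: K_def powr_divide powr_mult)
  qed (use that in auto)
  have up: "ennreal (excess x) \<le> ennreal ((1 + \<eta>) * (K * w powr (b + 1)))"
    and lo: "ennreal (excess x) \<ge> ennreal ((1 - \<eta>) * (K * w powr (b + 1)))"
  proof -
    have e: "ennreal (excess x) = (\<integral>\<^sup>+t. ennreal (1 - F (xe - t)) * indicator {0..w} t \<partial>lborel)"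
    proof -
      have "(\<integral>\<^sup>+z. ennreal (max 0 (z - x)) \<partial>M) = ennreal (excess x)"
        unfolding excess_def by (rule nn_integral_eq_integral) auto
      then show ?thesis using excess_layer_cake[of x] x by (simp only: w_def less_imp_le)
    qed
    have Ft: "1 - F (xe - t) \<le> (1 + \<eta>) * (t / L) powr b" "(1 - \<eta>) * (t / L) powr b \<le> 1 - F (xe - t)" if "0 \<le> t" "t \<le> w" for t
    proof -
      have "1 - F (xe - t) \<le> (1 + \<eta>) * (t / L) powr b \<and> (1 - \<eta>) * (t / L) powr b \<le> 1 - F (xe - t)"
      proof (cases "t = 0")
        case True
        then show ?thesis using F_less_one_iff[of xe] cdf_bounded_prob[of xe] by simp
      next
        case False
        then show ?thesis using F[of "xe - t"] that by (auto simp: w_def abs_le_iff algebra_simps)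
      qed
      then show "1 - F (xe - t) \<le> (1 + \<eta>) * (t / L) powr b" "(1 - \<eta>) * (t / L) powr b \<le> 1 - F (xe - t)" by auto
    qed
    have "ennreal (excess x) \<le> (\<integral>\<^sup>+t. ennreal ((1 + \<eta>) * (t / L) powr b) * indicator {0..w} t \<partial>lborel)"
      unfolding e by (intro nn_integral_mono) (auto simp: indicator_def intro!: ennreal_leI Ft)
    then show "ennreal (excess x) \<le> ennreal ((1 + \<eta>) * (K * w powr (b + 1)))"
      using pw[of "1 + \<eta>"] \<eta> by simp
    have "(\<integral>\<^sup>+t. ennreal ((1 - \<eta>) * (t / L) powr b) * indicator {0..w} t \<partial>lborel) \<le> ennreal (excess x)"
      unfolding e by (intro nn_integral_mono) (auto simp: indicator_def intro!: ennreal_leI Ft)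
    then show "ennreal (excess x) \<ge> ennreal ((1 - \<eta>) * (K * w powr (b + 1)))"
      using pw[of "1 - \<eta>"] \<eta> by simp
  qed
  have K: "K * w powr (b + 1) \<ge> 0" using b by (simp add: K_def)
  have e0: "excess x \<ge> 0" unfolding excess_def by (intro integral_nonneg_AE) auto
  have "excess x \<le> (1 + \<eta>) * (K * w powr (b + 1))"
    using up K \<eta> by (subst (asm) ennreal_le_iff) auto
  moreover have "(1 - \<eta>) * (K * w powr (b + 1)) \<le> excess x" using lo e0 by (subst (asm) ennreal_le_iff) auto
  ultimately show ?thesis unfolding w_def[symmetric] abs_le_iff by (simp add: algebra_simps)
qed

lemma survival_integrable: "integrable M (\<lambda>z. c * indicator {y<..} z :: real)"
  by (intro integrable_mult_right integrable_real_indicator) (auto simp: emeasure_eq_measure)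

text \<open>Every outcome above \<open>y\<close> loses the full \<open>y - x\<close>. This slope
  bound later produces the drift of the mean score on both sides of the expectile.\<close>

lemma excess_diff_ge:
  assumes "x \<le> y"
  shows "(y - x) * (1 - F y) \<le> excess x - excess y"
proof -
  have "(y - x) * (1 - F y) = (\<integral>z. (y - x) * indicator {y<..} z \<partial>M)"
    by (simp add: survival_eq)
  also have "\<dots> \<le> (\<integral>z. max 0 (z - x) - max 0 (z - y) \<partial>M)"
    by (rule integral_mono[OF survival_integrable Bochner_Integration.integrable_diff[OF excess_integrable excess_integrable]])
      (use assms in \<open>auto simp: indicator_def max_def\<close>)
  finally show ?thesis by (simp add: excess_def)
qed

lemma excess_diff_le:
  assumes "x \<le> y"
  shows "excess x - excess y \<le> y - x"
proof -
  have "excess x - excess y = (\<integral>z. max 0 (z - x) - max 0 (z - y) \<partial>M)"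
    by (simp add: excess_def)
  also have "\<dots> \<le> (\<integral>z. y - x \<partial>M)"
    by (rule integral_mono[OF Bochner_Integration.integrable_diff[OF excess_integrable excess_integrable]])
      (use assms in \<open>auto simp: max_def\<close>)
  finally show ?thesis using prob_space[unfolded space_eq_univ] by simp
qed

lemma excess_nonneg: "excess x \<ge> 0"
  unfolding excess_def by (intro integral_nonneg_AE) auto

lemma excess_xe: "excess xe = 0"
proof -
  have "excess xe = (\<integral>z. 0 \<partial>M)"
    unfolding excess_def by (intro integral_cong_AE) (use AE_le_xe in \<open>auto elim!: eventually_mono\<close>)
  then show ?thesis by simp
qed

lemma excess_le:
  assumes "x \<le> xe"
  shows "excess x \<le> (xe - x) * (1 - F x)"
proof -
  have "excess x \<le> (\<integral>z. (xe - x) * indicator {x<..} z \<partial>M)"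
    unfolding excess_def
    by (rule integral_mono_AE[OF excess_integrable survival_integrable])
      (use AE_le_xe in \<open>auto elim!: eventually_mono simp: indicator_def max_def\<close>)
  then show ?thesis by (simp add: survival_eq)
qed

lemma excess_pos: "x < xe \<Longrightarrow> excess x > 0"
proof -
  assume x: "x < xe"
  define y where "y = (x + xe) / 2"
  have "x < y" "y < xe" using x by (auto simp: y_def)
  then have "(y - x) * (1 - F y) > 0" using F_less_one_iff[of y] by simp
  then show ?thesis using excess_diff_ge[of x y] excess_nonneg[of y] \<open>x < y\<close> by linarith
qed

lemma excess_continuous: "continuous_on UNIV excess"
proof (rule continuous_onI)
  fix x e :: real assume "e > 0"
  have bnd: "\<bar>excess x - excess y\<bar> \<le> \<bar>x - y\<bar>" for x y
  proof -
    have *: "\<bar>excess x - excess y\<bar> \<le> \<bar>x - y\<bar>" if "x \<le> y" for x y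
    proof -
      have "(y - x) * (1 - F y) \<ge> 0" using that cdf_bounded_prob[of y] by simp
      then show ?thesis using excess_diff_ge[OF that] excess_diff_le[OF that] that by linarith
    qed
    show ?thesis using *[of x y] *[of y x] by linarith
  qed
  show "\<exists>d>0. \<forall>x'\<in>UNIV. dist x' x < d \<longrightarrow> dist (excess x') (excess x) \<le> e"
  proof (intro exI[of _ e] conjI ballI impI \<open>e > 0\<close>)
    fix x' assume "dist x' x < e"
    then show "dist (excess x') (excess x) \<le> e" using bnd[of x' x] by (simp add: dist_real_def)
  qed
qed

end

section \<open>The first-order equation of the expectile and its asymptotic solution\<close>

context second_order_distribution
begin

definition mean :: real where "mean = (\<integral>z. z \<partial>M)"

lemma integrable_id_of_square:
  assumes "integrable M (\<lambda>z. z\<^sup>2)"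
  shows "integrable M (\<lambda>z. z)"
proof (rule Bochner_Integration.integrable_bound[of M "\<lambda>z. 1 + z\<^sup>2"])
  show "AE z in M. norm z \<le> norm (1 + z\<^sup>2)"
  proof (rule AE_I2)
    fix z :: real
    have "0 \<le> (\<bar>z\<bar> - 1)\<^sup>2" by simp
    then have "2 * \<bar>z\<bar> \<le> 1 + z\<^sup>2" by (simp add: power2_eq_square algebra_simps)
    then show "norm z \<le> norm (1 + z\<^sup>2)" by simp
  qed
qed (use assms in auto)

lemma score_integrable:
  assumes "integrable M (\<lambda>z. z)"
  shows "integrable M (\<lambda>z. expectile_score \<tau> (z - \<theta>))"
  unfolding expectile_score_def
  by (intro Bochner_Integration.integrable_add integrable_mult_right excess_integrable
      Bochner_Integration.integrable_diff assms) auto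

lemma mean_score:
  assumes "integrable M (\<lambda>z. z)"
  shows "(\<integral>z. expectile_score \<tau> (z - \<theta>) \<partial>M) = (2 * \<tau> - 1) * excess \<theta> + (1 - \<tau>) * (mean - \<theta>)"
proof -
  have "(\<integral>z. z - \<theta> \<partial>M) = mean - \<theta>"
    using assms prob_space[unfolded space_eq_univ] by (simp add: mean_def)
  moreover have "(\<integral>z. expectile_score \<tau> (z - \<theta>) \<partial>M) = (\<integral>z. (2 * \<tau> - 1) * max 0 (z - \<theta>) \<partial>M) + (\<integral>z. (1 - \<tau>) * (z - \<theta>) \<partial>M)"
    unfolding expectile_score_def
    by (intro Bochner_Integration.integral_add integrable_mult_right excess_integrable
      Bochner_Integration.integrable_diff assms) auto
  ultimately show ?thesis
    by (simp only: integral_mult_right_zero excess_def)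
qed

lemma expectile_loss_integrable:
  assumes sq: "integrable M (\<lambda>z. z\<^sup>2)" and "0 < \<tau>" "\<tau> < 1"
  shows "integrable M (\<lambda>z. expectile_loss \<tau> (z - \<theta>))"
proof (rule Bochner_Integration.integrable_bound[of M "\<lambda>z. 2 * z\<^sup>2 + 2 * \<theta>\<^sup>2"])
  show "integrable M (\<lambda>z. 2 * z\<^sup>2 + 2 * \<theta>\<^sup>2)" using sq by auto
  show "AE z in M. norm (expectile_loss \<tau> (z - \<theta>)) \<le> norm (2 * z\<^sup>2 + 2 * \<theta>\<^sup>2)"
  proof (rule AE_I2)
    fix z :: real
    have "\<bar>\<tau> - indicator {..0} (z - \<theta>)\<bar> \<le> 1" using assms by (auto simp: indicator_def)
    then have "expectile_loss \<tau> (z - \<theta>) \<le> 1 * (z - \<theta>)\<^sup>2"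
      unfolding expectile_loss_def by (intro mult_right_mono) auto
    also have "(z - \<theta>)\<^sup>2 + (z + \<theta>)\<^sup>2 = 2 * z\<^sup>2 + 2 * \<theta>\<^sup>2" by (simp add: power2_eq_square algebra_simps)
    then have "1 * (z - \<theta>)\<^sup>2 \<le> 2 * z\<^sup>2 + 2 * \<theta>\<^sup>2" using zero_le_power2[of "z + \<theta>"] by linarith
    finally show "norm (expectile_loss \<tau> (z - \<theta>)) \<le> norm (2 * z\<^sup>2 + 2 * \<theta>\<^sup>2)"
      by (simp add: expectile_loss_def)
  qed
qed (auto intro: measurable_compose[OF _ expectile_loss_measurable])

text \<open>Integrating the strong convexity inequality of the loss leaves a linear term
  proportional to the mean score at \<theta>. By \<open>root\<close> this term vanishes, and the
  quadratic bound identifies \<theta> as the unique minimiser.\<close>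

lemma expectile_eqI:
  assumes sq: "integrable M (\<lambda>z. z\<^sup>2)" and \<tau>: "0 < \<tau>" "\<tau> < 1"
    and root: "(2 * \<tau> - 1) * excess \<theta> + (1 - \<tau>) * (mean - \<theta>) = 0"
  shows "expectile M (\<lambda>x. x) \<tau> = \<theta>"
  unfolding expectile_def
proof (rule arg_min_strongly_convex)
  show "0 < min \<tau> (1 - \<tau>)" using \<tau> by simp
  fix y
  note int = expectile_loss_integrable[OF sq \<tau>] expectile_loss_integrable[OF sq \<tau>, of 0, simplified]
  note id = integrable_id_of_square[OF sq]
  have "(\<integral>z. expectile_loss \<tau> (z - \<theta>) - expectile_loss \<tau> z \<partial>M) + min \<tau> (1 - \<tau>) * (y - \<theta>)\<^sup>2
      = (\<integral>z. expectile_loss \<tau> (z - \<theta>) - expectile_loss \<tau> z - 2 * (y - \<theta>) * expectile_score \<tau> (z - \<theta>)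
          + min \<tau> (1 - \<tau>) * (y - \<theta>)\<^sup>2 \<partial>M)"
    using int score_integrable[OF id, of \<tau> \<theta>] mean_score[OF id, of \<tau> \<theta>] root prob_space[unfolded space_eq_univ]
    by simp
  also have "\<dots> \<le> (\<integral>z. expectile_loss \<tau> (z - y) - expectile_loss \<tau> z \<partial>M)"
  proof (rule integral_mono)
    fix z
    show "expectile_loss \<tau> (z - \<theta>) - expectile_loss \<tau> z - 2 * (y - \<theta>) * expectile_score \<tau> (z - \<theta>)
          + min \<tau> (1 - \<tau>) * (y - \<theta>)\<^sup>2 \<le> expectile_loss \<tau> (z - y) - expectile_loss \<tau> z"
      using expectile_loss_ge[OF \<tau>, of "z - \<theta>" "y - \<theta>"] by simp
  qed (use int score_integrable[OF id, of \<tau> \<theta>] in auto)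
  finally show "(\<integral>z. expectile_loss \<tau> (z - \<theta>) - expectile_loss \<tau> z \<partial>M) + min \<tau> (1 - \<tau>) * (y - \<theta>)\<^sup>2
    \<le> (\<integral>z. expectile_loss \<tau> (z - y) - expectile_loss \<tau> z \<partial>M)" .
qed

text \<open>At least half of the mass lies at or below the median \<open>U 2\<close>, which is
  strictly less than \<open>xe\<close>.\<close>

lemma mean_less_xe:
  assumes "integrable M (\<lambda>z. z)"
  shows "mean < xe"
proof -
  have u: "U 2 < xe" by (rule U_less_xe) simp
  have F2: "F (U 2) \<ge> 1/2" using tail_quantile_le_iff[of 2 "U 2"] by simp
  have int: "integrable M (\<lambda>z. (xe - U 2) * indicator {..U 2} z :: real)"
    by (intro integrable_mult_right integrable_real_indicator) (auto simp: emeasure_eq_measure)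
  have "0 < (xe - U 2) * F (U 2)" using u F2 by (intro mult_pos_pos) auto
  also have "\<dots> = (\<integral>z. (xe - U 2) * indicator {..U 2} z \<partial>M)" by (simp add: cdf_def)
  also have "\<dots> \<le> (\<integral>z. xe - z \<partial>M)"
    by (rule integral_mono_AE[OF int]) (use assms u AE_le_xe in \<open>auto elim!: eventually_mono simp: indicator_def\<close>)
  also have "\<dots> = xe - mean" using assms prob_space[unfolded space_eq_univ] by (simp add: mean_def)
  finally show ?thesis by simp
qed

definition expectile_at :: "real \<Rightarrow> real" where "expectile_at \<tau> = expectile M (\<lambda>x. x) \<tau>"

text \<open>The mean score is nonnegative at the mean and negative at \<open>xe\<close>, where the
  excess vanishes; the intermediate value theorem gives a root, and every root is the
  expectile.\<close>

lemma expectile_root: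
  assumes sq: "integrable M (\<lambda>z. z\<^sup>2)" and \<tau>: "1/2 < \<tau>" "\<tau> < 1"
  shows "expectile_at \<tau> < xe" and "(2 * \<tau> - 1) * excess (expectile_at \<tau>) = (1 - \<tau>) * (expectile_at \<tau> - mean)"
proof -
  let ?G = "\<lambda>\<theta>. (2 * \<tau> - 1) * excess \<theta> + (1 - \<tau>) * (mean - \<theta>)"
  have m: "mean < xe" by (rule mean_less_xe[OF integrable_id_of_square[OF sq]])
  have "\<exists>\<theta>\<ge>mean. \<theta> \<le> xe \<and> ?G \<theta> = 0"
  proof (rule IVT2')
    show "?G xe \<le> 0" using m \<tau> by (simp add: excess_xe mult_nonneg_nonpos)
    show "0 \<le> ?G mean" using \<tau> excess_nonneg[of mean] by simp
    show "continuous_on {mean..xe} ?G"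
      by (intro continuous_intros continuous_on_subset[OF excess_continuous]) auto
  qed (use m in simp)
  then obtain \<theta> where \<theta>: "\<theta> \<le> xe" "?G \<theta> = 0" by auto
  have eq: "expectile_at \<tau> = \<theta>" unfolding expectile_at_def using sq \<tau> \<theta>(2) by (intro expectile_eqI) auto
  have "?G xe < 0" using m \<tau> by (simp add: excess_xe mult_pos_neg)
  then have "\<theta> \<noteq> xe" using \<theta>(2) by auto
  then show "expectile_at \<tau> < xe" using eq \<theta> by simp
  show "(2 * \<tau> - 1) * excess (expectile_at \<tau>) = (1 - \<tau>) * (expectile_at \<tau> - mean)"
    using \<theta>(2) by (simp add: eq algebra_simps)
qed

lemma excess_antimono: "x \<le> y \<Longrightarrow> excess y \<le> excess x"
proof -
  assume "x \<le> y"
  then have "0 \<le> (y - x) * (1 - F y)" using cdf_bounded_prob[of y] by (intro mult_nonneg_nonneg) auto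
  then show ?thesis using excess_diff_ge[OF \<open>x \<le> y\<close>] by linarith
qed

text \<open>At a fixed \<open>x\<close> below the endpoint the mean score tends to
  \<open>excess x > 0\<close> as \<tau> tends to 1. For \<tau> above 1/2 the mean score is
  decreasing in its argument, so its root lies to the right of \<open>x\<close>.\<close>

lemma expectile_gt:
  assumes sq: "integrable M (\<lambda>z. z\<^sup>2)" and x: "x < xe"
  shows "\<exists>\<tau>0<1. 1/2 \<le> \<tau>0 \<and> (\<forall>\<tau>. \<tau>0 < \<tau> \<longrightarrow> \<tau> < 1 \<longrightarrow> x < expectile_at \<tau>)"
proof -
  define G where "G \<tau> = (2 * \<tau> - 1) * excess x + (1 - \<tau>) * (mean - x)" for \<tau>
  have "(G \<longlongrightarrow> (2 * 1 - 1) * excess x + (1 - 1) * (mean - x)) (at_left 1)"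
    unfolding G_def by (intro tendsto_intros)
  then have "\<forall>\<^sub>F \<tau> in at_left 1. G \<tau> > 0"
    using excess_pos[OF x] by (intro order_tendstoD(1)[of _ "excess x"]) auto
  then obtain t where t: "t < 1" "\<And>\<tau>. t < \<tau> \<Longrightarrow> \<tau> < 1 \<Longrightarrow> G \<tau> > 0"
    by (auto simp: eventually_at_left_field)
  have "x < expectile_at \<tau>" if "max t (1/2) < \<tau>" "\<tau> < 1" for \<tau>
  proof (rule ccontr)
    assume "\<not> ?thesis"
    then have le: "expectile_at \<tau> \<le> x" by simp
    have "G \<tau> \<le> (2 * \<tau> - 1) * excess (expectile_at \<tau>) + (1 - \<tau>) * (mean - expectile_at \<tau>)"
      unfolding G_def using le that excess_antimono[OF le] by (intro add_mono mult_left_mono) auto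
    also have "\<dots> = 0" using expectile_root(2)[OF sq, of \<tau>] that by (simp add: algebra_simps)
    finally show False using t(2)[of \<tau>] that by simp
  qed
  then show ?thesis using t(1) by (intro exI[of _ "max t (1/2)"]) auto
qed

lemma A_S_small:
  assumes "e > 0"
  shows "\<exists>x1<xe. \<forall>x. x1 \<le> x \<longrightarrow> x < xe \<longrightarrow> \<bar>A (S x)\<bar> < e"
proof -
  have "\<forall>\<^sub>F s in at_top. \<bar>A s\<bar> < e" using tendstoD[OF A_lim assms] by (simp add: dist_real_def)
  then obtain s where s: "\<And>t. t \<ge> s \<Longrightarrow> \<bar>A t\<bar> < e" by (auto simp: eventually_at_top_linorder)
  show ?thesis
  proof (intro exI[of _ "U (max s 2)"] conjI allI impI)
    show "U (max s 2) < xe" by (rule U_less_xe) simp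
    fix x assume "U (max s 2) \<le> x" "x < xe"
    then have "S x \<ge> max s 2" by (intro S_ge) auto
    then show "\<bar>A (S x)\<bar> < e" by (intro s) simp
  qed
qed

text \<open>A doubling property: \<open>1 - F\<close> lies between 1/2 and 3/2 times a power of the
  distance to the endpoint, and doubling the distance costs \<open>2 powr b\<close>. It lets the
  score be studied near the expectile with the survival probability at the expectile as the only
  scale.\<close>

lemma survival_comparable:
  "\<exists>c x0. c > 0 \<and> x0 < xe \<and> (\<forall>x y. x0 \<le> x \<longrightarrow> x < xe \<longrightarrow> x0 \<le> y \<longrightarrow> y < xe \<longrightarrow> xe - y \<le> 2 * (xe - x) \<longrightarrow> 1 - F y \<le> c * (1 - F x))"
proof -
  define b where "b = - 1 / g"
  have b: "b > 0" using g by (simp add: b_def divide_neg_neg)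
  obtain L c x0 where *: "L > 0 \<and> c > 0 \<and> x0 < xe \<and> (\<forall>x. x0 \<le> x \<longrightarrow> x < xe \<longrightarrow>
     S x > 1 \<and> c * \<bar>A (S x)\<bar> \<le> 1/2 \<and> \<bar>xe - x + a (S x) / g\<bar> \<le> c * \<bar>A (S x)\<bar> * (xe - x) \<and>
     (\<forall>y. x \<le> y \<longrightarrow> y < xe \<longrightarrow> \<bar>A (S y)\<bar> \<le> c * \<bar>A (S x)\<bar> \<and>
        \<bar>1 - F y - ((xe - y) / L) powr b\<bar> \<le> c * \<bar>A (S x)\<bar> * ((xe - y) / L) powr b))"
    using survival_expansion[folded b_def] by (elim exE) (rule that)
  have bd: "1 - F x \<le> 3/2 * ((xe - x) / L) powr b" "1/2 * ((xe - x) / L) powr b \<le> 1 - F x" if "x0 \<le> x" "x < xe" for x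
  proof -
    have "\<bar>1 - F x - ((xe - x) / L) powr b\<bar> \<le> c * \<bar>A (S x)\<bar> * ((xe - x) / L) powr b" using * that by auto
    also have "\<dots> \<le> 1/2 * ((xe - x) / L) powr b" using * that by (intro mult_right_mono) auto
    finally show "1 - F x \<le> 3/2 * ((xe - x) / L) powr b" "1/2 * ((xe - x) / L) powr b \<le> 1 - F x"
      unfolding abs_le_iff by linarith+
  qed
  have "1 - F y \<le> 3 * 2 powr b * (1 - F x)"
    if "x0 \<le> x" "x < xe" "x0 \<le> y" "y < xe" "xe - y \<le> 2 * (xe - x)" for x y
  proof -
    have "1 - F y \<le> 3/2 * ((xe - y) / L) powr b" using bd that by blast
    moreover have "((xe - y) / L) powr b \<le> (2 * ((xe - x) / L)) powr b"
      using that * b by (intro powr_mono2) (auto simp: divide_right_mono)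
    moreover have "(2 * ((xe - x) / L)) powr b = 2 powr b * ((xe - x) / L) powr b"
      using that * by (intro powr_mult)
    moreover have "2 powr b * ((xe - x) / L) powr b \<le> 2 powr b * (2 * (1 - F x))"
      using bd[of x] that by (intro mult_left_mono) auto
    ultimately show ?thesis by (simp add: algebra_simps)
  qed
  moreover have "3 * 2 powr b > (0::real)" by simp
  ultimately show ?thesis using * by blast
qed

text \<open>In the first-order equation the excess at the expectile \<open>x\<close> is at most
  \<open>(xe - x) * (1 - F x)\<close>, while \<open>x - mean\<close> stays above half of
  \<open>xe - mean\<close>. The factor \<open>xe - x\<close> tends to 0, and it is the whole reason
  why \<open>1 - \<tau>\<close> is negligible against the survival probability.\<close>

lemma expectile_survival_bound:
  assumes sq: "integrable M (\<lambda>z. z\<^sup>2)"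
  shows "\<exists>c \<tau>0. c > 0 \<and> \<tau>0 < 1 \<and> 1/2 \<le> \<tau>0 \<and>
    (\<forall>\<tau>. \<tau>0 < \<tau> \<longrightarrow> \<tau> < 1 \<longrightarrow> 1 - \<tau> \<le> c * (xe - expectile_at \<tau>) * (1 - F (expectile_at \<tau>)))"
proof -
  define m where "m = xe - mean"
  have m: "m > 0" using mean_less_xe[OF integrable_id_of_square[OF sq]] by (simp add: m_def)
  obtain \<tau>0 where \<tau>0: "\<tau>0 < 1" "1/2 \<le> \<tau>0" "\<And>\<tau>. \<tau>0 < \<tau> \<Longrightarrow> \<tau> < 1 \<Longrightarrow> mean + m / 2 < expectile_at \<tau>"
  proof -
    have "mean + m / 2 < xe" using m by (simp add: m_def field_simps)
    then show thesis using expectile_gt[OF sq] that by blast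
  qed
  show ?thesis
  proof (rule exI[of _ "2 / m"], rule exI[of _ \<tau>0], intro conjI allI impI)
    fix \<tau> assume \<tau>: "\<tau>0 < \<tau>" "\<tau> < 1"
    let ?x = "expectile_at \<tau>"
    have lt: "?x < xe" using expectile_root(1)[OF sq] \<tau> \<tau>0 by auto
    have "(1 - \<tau>) * (m / 2) \<le> (1 - \<tau>) * (?x - mean)" using \<tau>0(3)[OF \<tau>] \<tau> by (intro mult_left_mono) auto
    also have "\<dots> = (2 * \<tau> - 1) * excess ?x" using expectile_root(2)[OF sq, of \<tau>] \<tau> \<tau>0 by simp
    also have "\<dots> \<le> 1 * excess ?x" using \<tau> excess_nonneg by (intro mult_right_mono) auto
    also have "\<dots> \<le> (xe - ?x) * (1 - F ?x)" using excess_le lt by simp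
    finally show "1 - \<tau> \<le> 2 / m * (xe - ?x) * (1 - F ?x)" using m by (simp add: field_simps)
  qed (use m \<tau>0 in auto)
qed

text \<open>The integrated survival expansion is inserted into the first-order equation. The three
  error terms have three sources: \<epsilon> from the survival function, \<open>w\<close> from
  replacing \<open>x - mean\<close> by its limit, and \<open>1 - \<tau>\<close> from replacing
  \<open>2 * \<tau> - 1\<close> by 1.\<close>

theorem expectile_expansion:
  assumes sq: "integrable M (\<lambda>z. z\<^sup>2)"
  shows "\<exists>C c \<tau>0. C > 0 \<and> c > 0 \<and> \<tau>0 < 1 \<and> 1/2 \<le> \<tau>0 \<and> (\<forall>\<tau>. \<tau>0 < \<tau> \<longrightarrow> \<tau> < 1 \<longrightarrow>
     (let x = expectile_at \<tau>; w = xe - x; \<epsilon> = \<bar>A (S x)\<bar> in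
       w > 0 \<and> S x > 1 \<and> \<bar>w powr (1 - 1 / g) / (C * (1 - \<tau>)) - 1\<bar> \<le> c * (\<epsilon> + w + (1 - \<tau>)) \<and>
       \<bar>w + a (S x) / g\<bar> \<le> c * \<epsilon> * w \<and> (\<forall>y. x \<le> y \<longrightarrow> y < xe \<longrightarrow> \<bar>A (S y)\<bar> \<le> c * \<epsilon>)))"
proof -
  define b where "b = - 1 / g"
  have b: "b > 0" "1 - 1 / g = b + 1" using g by (auto simp: b_def divide_neg_neg)
  obtain L c x0 where *: "L > 0 \<and> c > 0 \<and> x0 < xe \<and> (\<forall>x. x0 \<le> x \<longrightarrow> x < xe \<longrightarrow>
     S x > 1 \<and> c * \<bar>A (S x)\<bar> \<le> 1/2 \<and> \<bar>xe - x + a (S x) / g\<bar> \<le> c * \<bar>A (S x)\<bar> * (xe - x) \<and>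
     (\<forall>y. x \<le> y \<longrightarrow> y < xe \<longrightarrow> \<bar>A (S y)\<bar> \<le> c * \<bar>A (S x)\<bar> \<and>
        \<bar>1 - F y - ((xe - y) / L) powr b\<bar> \<le> c * \<bar>A (S x)\<bar> * ((xe - y) / L) powr b))"
    using survival_expansion[folded b_def] by (elim exE) (rule that)
  define m where "m = xe - mean"
  have m: "m > 0" using mean_less_xe[OF integrable_id_of_square[OF sq]] by (simp add: m_def)
  define K where "K = (1 / L) powr b / (b + 1)"
  have K: "K > 0" using * b by (simp add: K_def)
  \<comment> \<open>The leading part of the equation is
    \<open>K * w powr (b + 1) = m * (1 - \<tau>)\<close>, with \<open>m\<close> the limit of
    \<open>x - mean\<close>.\<close>
  define C where "C = m / K"
  have C: "C > 0" using m K by (simp add: C_def)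
  obtain \<tau>1 where \<tau>1: "\<tau>1 < 1" "1/2 \<le> \<tau>1" "\<And>\<tau>. \<tau>1 < \<tau> \<Longrightarrow> \<tau> < 1 \<Longrightarrow> x0 < expectile_at \<tau>"
    using expectile_gt[OF sq, of x0] * by auto
  define c' where "c' = 4 * c + 1 / m + 8"
  have c': "c' > 0" using m * by (simp add: c'_def add_pos_pos)
  show ?thesis
  proof (rule exI[of _ C], rule exI[of _ c'], rule exI[of _ "max \<tau>1 (7/8)"], intro conjI allI impI C c')
    fix \<tau> assume "max \<tau>1 (7/8) < \<tau>" and \<tau>l: "\<tau> < 1"
    then have \<tau>: "\<tau>1 < \<tau>" "7/8 < \<tau>" by auto
    define x where "x = expectile_at \<tau>"
    define w where "w = xe - x"
    define \<epsilon> where "\<epsilon> = \<bar>A (S x)\<bar>"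
    have x: "x0 \<le> x" "x < xe" using \<tau>1(3)[OF \<tau>(1) \<tau>l] expectile_root(1)[OF sq _ \<tau>l] \<tau> by (auto simp: x_def)
    have w: "w > 0" using x by (simp add: w_def)
    have e: "\<epsilon> \<ge> 0" "c * \<epsilon> \<le> 1/2" using * x by (auto simp: \<epsilon>_def)
    have ex: "\<bar>excess x - K * w powr (b + 1)\<bar> \<le> c * \<epsilon> * (K * w powr (b + 1))"
      unfolding K_def w_def \<epsilon>_def using * x b e
      by (intro excess_bounds) (auto simp: \<epsilon>_def)
    define R where "R = w powr (b + 1) / (C * (1 - \<tau>))"
    have Rw: "K * w powr (b + 1) = R * m * (1 - \<tau>)"
      using K m \<tau>l by (simp add: R_def C_def field_simps)
    have R: "R > 0" using w C \<tau>l by (simp add: R_def)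
    have root: "(2 * \<tau> - 1) * excess x = (1 - \<tau>) * (m - w)"
      using expectile_root(2)[OF sq _ \<tau>l] \<tau> by (simp add: x_def m_def w_def)
    have "\<bar>(2 * \<tau> - 1) * excess x - (2 * \<tau> - 1) * (R * m * (1 - \<tau>))\<bar> \<le> c * \<epsilon> * (R * m * (1 - \<tau>))"
    proof -
      have "\<bar>(2 * \<tau> - 1) * (excess x - R * m * (1 - \<tau>))\<bar> \<le> 1 * (c * \<epsilon> * (R * m * (1 - \<tau>)))"
        unfolding abs_mult using ex \<tau> \<tau>l unfolding Rw by (intro mult_mono) auto
      then show ?thesis by (simp add: right_diff_distrib)
    qed
    then have "\<bar>(1 - \<tau>) * ((m - w) - (2 * \<tau> - 1) * (R * m))\<bar> \<le> (1 - \<tau>) * (c * \<epsilon> * (R * m))"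
      unfolding root by (simp add: algebra_simps)
    then have "\<bar>(m - w) - (2 * \<tau> - 1) * (R * m)\<bar> \<le> c * \<epsilon> * (R * m)"
      using \<tau>l by (simp add: abs_mult)
    then have "\<bar>m * (1 - w / m - (2 * \<tau> - 1) * R)\<bar> \<le> m * (c * \<epsilon> * R)"
      using m by (simp add: algebra_simps)
    then have h: "\<bar>1 - w / m - (2 * \<tau> - 1) * R\<bar> \<le> c * \<epsilon> * R"
      using m by (simp add: abs_mult)
    \<comment> \<open>The error in the equation is relative to \<open>R\<close> itself, so
      \<open>R\<close> is bounded first. As \<open>2 * \<tau> - 1 \<ge> 3/4\<close> by
      \<open>7/8 < \<tau>\<close> and the error is at most \<open>R / 2\<close>, the equation leaves
      \<open>R / 4 \<le> 1\<close>.\<close>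
    have R4: "R \<le> 4"
    proof (rule ccontr)
      assume "\<not> ?thesis"
      moreover have "c * \<epsilon> * R \<le> 1/2 * R" using e R by (intro mult_right_mono) auto
      moreover have "(2 * \<tau> - 1) * R \<ge> 3/4 * R" using \<tau> R by (intro mult_right_mono) auto
      moreover have "w / m > 0" using w m by simp
      ultimately show False using h unfolding abs_le_iff by linarith
    qed
    have R1: "\<bar>R - 1\<bar> \<le> c' * (\<epsilon> + w + (1 - \<tau>))"
    proof -
      have "R - 1 = - (1 - w / m - (2 * \<tau> - 1) * R) - w / m + 2 * (1 - \<tau>) * R" by (simp add: algebra_simps)
      moreover have "c * \<epsilon> * R \<le> c * \<epsilon> * 4" using R4 e * by (intro mult_left_mono) auto
      moreover have "2 * (1 - \<tau>) * R \<le> 2 * (1 - \<tau>) * 4"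
        using R4 \<tau>l by (intro mult_left_mono) auto
      moreover have "0 \<le> 2 * (1 - \<tau>) * R" using R \<tau>l by simp
      moreover have "w / m > 0" using w m by simp
      ultimately have "\<bar>R - 1\<bar> \<le> 4 * c * \<epsilon> + w / m + 8 * (1 - \<tau>)" using h unfolding abs_le_iff by linarith
      also have "\<dots> \<le> c' * \<epsilon> + c' * w + c' * (1 - \<tau>)"
      proof (intro add_mono)
        show "4 * c * \<epsilon> \<le> c' * \<epsilon>" using e m * by (intro mult_right_mono) (auto simp: c'_def)
        have "1 / m * w \<le> c' * w" using w m * by (intro mult_right_mono) (auto simp: c'_def)
        then show "w / m \<le> c' * w" by simp
        show "8 * (1 - \<tau>) \<le> c' * (1 - \<tau>)" using \<tau>l m * by (intro mult_right_mono) (auto simp: c'_def)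
      qed
      finally show ?thesis by (simp add: distrib_left)
    qed
    have cc: "c \<le> c'" using m * by (auto simp: c'_def)
    have wa: "\<bar>w + a (S x) / g\<bar> \<le> c' * \<epsilon> * w"
    proof -
      have "\<bar>w + a (S x) / g\<bar> \<le> c * \<epsilon> * w" using * x by (auto simp: w_def \<epsilon>_def)
      also have "\<dots> \<le> c' * \<epsilon> * w" using cc e w by (intro mult_right_mono) auto
      finally show ?thesis .
    qed
    have Ay: "\<bar>A (S y)\<bar> \<le> c' * \<epsilon>" if "x \<le> y" "y < xe" for y
    proof -
      have "\<bar>A (S y)\<bar> \<le> c * \<epsilon>" using * x that by (auto simp: \<epsilon>_def)
      also have "\<dots> \<le> c' * \<epsilon>" using cc e by (intro mult_right_mono) auto
      finally show ?thesis .
    qed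
    have "S x > 1" using * x by auto
    then show "let x = expectile_at \<tau>; w = xe - x; \<epsilon> = \<bar>A (S x)\<bar> in
       w > 0 \<and> S x > 1 \<and> \<bar>w powr (1 - 1 / g) / (C * (1 - \<tau>)) - 1\<bar> \<le> c' * (\<epsilon> + w + (1 - \<tau>)) \<and>
       \<bar>w + a (S x) / g\<bar> \<le> c' * \<epsilon> * w \<and> (\<forall>y. x \<le> y \<longrightarrow> y < xe \<longrightarrow> \<bar>A (S y)\<bar> \<le> c' * \<epsilon>)"
      unfolding Let_def x_def[symmetric] w_def[symmetric] \<epsilon>_def[symmetric] b(2) R_def[symmetric]
      using w R1 wa Ay by blast
  qed (use \<tau>1 in auto)
qed

lemma expectile_mono:
  assumes sq: "integrable M (\<lambda>z. z\<^sup>2)" and "1/2 < \<tau>" "\<tau> \<le> \<tau>'" "\<tau>' < 1"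
  shows "expectile_at \<tau> \<le> expectile_at \<tau>'"
proof (rule ccontr)
  let ?x = "expectile_at \<tau>" and ?y = "expectile_at \<tau>'"
  assume "\<not> ?thesis"
  then have lt: "?y < ?x" by simp
  have r: "(2 * \<tau> - 1) * excess ?x = (1 - \<tau>) * (?x - mean)" "(2 * \<tau>' - 1) * excess ?y = (1 - \<tau>') * (?y - mean)"
    using expectile_root(2)[OF sq] assms by auto
  have "0 \<le> (2 * \<tau> - 1) * excess ?x" using assms excess_nonneg by simp
  then have xm: "0 \<le> ?x - mean" using r assms by (simp add: zero_le_mult_iff)
  have "(2 * \<tau>' - 1) * excess ?y < (1 - \<tau>') * (?x - mean)" unfolding r using lt assms by simp
  also have "\<dots> \<le> (1 - \<tau>) * (?x - mean)" using assms xm by (intro mult_right_mono) auto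
  also have "\<dots> = (2 * \<tau> - 1) * excess ?x" using r by simp
  also have "\<dots> \<le> (2 * \<tau>' - 1) * excess ?y"
    using assms excess_antimono[of ?y ?x] lt excess_nonneg by (intro mult_mono) auto
  finally show False by simp
qed

lemma expectile_tail_small:
  assumes sq: "integrable M (\<lambda>z. z\<^sup>2)" and e: "e > 0"
  shows "\<exists>\<tau>0<1. 1/2 \<le> \<tau>0 \<and> (\<forall>\<tau>. \<tau>0 < \<tau> \<longrightarrow> \<tau> < 1 \<longrightarrow>
    \<bar>A (S (expectile_at \<tau>))\<bar> + (xe - expectile_at \<tau>) + (1 - \<tau>) < e)"
proof -
  obtain x1 where x1: "x1 < xe" "\<And>x. x1 \<le> x \<Longrightarrow> x < xe \<Longrightarrow> \<bar>A (S x)\<bar> < e / 3"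
    using A_S_small[of "e / 3"] e by auto
  obtain \<tau>1 where \<tau>1: "\<tau>1 < 1" "1/2 \<le> \<tau>1" "\<And>\<tau>. \<tau>1 < \<tau> \<Longrightarrow> \<tau> < 1 \<Longrightarrow> max x1 (xe - e / 3) < expectile_at \<tau>"
  proof -
    have "max x1 (xe - e / 3) < xe" using x1 e by simp
    then show thesis using expectile_gt[OF sq] that by blast
  qed
  have "\<bar>A (S (expectile_at \<tau>))\<bar> + (xe - expectile_at \<tau>) + (1 - \<tau>) < e"
    if "max \<tau>1 (1 - e / 3) < \<tau>" "\<tau> < 1" for \<tau>
  proof -
    have "max x1 (xe - e / 3) < expectile_at \<tau>" using \<tau>1(3) that by simp
    moreover have "expectile_at \<tau> < xe" using expectile_root(1)[OF sq] that \<tau>1 by auto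
    ultimately show ?thesis using x1(2)[of "expectile_at \<tau>"] that by simp
  qed
  then show ?thesis using \<tau>1 e by (intro exI[of _ "max \<tau>1 (1 - e / 3)"]) (auto simp: le_max_iff_disj)
qed

text \<open>Dividing the expansions at the two levels cancels \<open>C\<close>, and the power
  \<open>q = 1 / (1 - 1 / g)\<close> produces the exponent \<open>- q = g / (1 - g)\<close> of the
  extrapolation formula. All errors can be expressed at the smaller level, because \<open>w\<close>
  and, up to a constant, \<open>|A|\<close> are smaller nearer to the endpoint.\<close>

theorem expectile_ratio:
  assumes sq: "integrable M (\<lambda>z. z\<^sup>2)"
  shows "\<exists>c \<tau>0. c > 0 \<and> \<tau>0 < 1 \<and> 1/2 \<le> \<tau>0 \<and> (\<forall>\<tau> \<tau>'. \<tau>0 < \<tau> \<longrightarrow> \<tau> \<le> \<tau>' \<longrightarrow> \<tau>' < 1 \<longrightarrow>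
     \<bar>(xe - expectile_at \<tau>') / (xe - expectile_at \<tau>) - ((1 - \<tau>) / (1 - \<tau>')) powr (g / (1 - g))\<bar>
       \<le> c * (\<bar>A (S (expectile_at \<tau>))\<bar> + (xe - expectile_at \<tau>) + (1 - \<tau>)) * ((1 - \<tau>) / (1 - \<tau>')) powr (g / (1 - g)))"
proof -
  obtain C c \<tau>1 where *: "C > 0 \<and> c > 0 \<and> \<tau>1 < 1 \<and> 1/2 \<le> \<tau>1 \<and> (\<forall>\<tau>. \<tau>1 < \<tau> \<longrightarrow> \<tau> < 1 \<longrightarrow>
     (let x = expectile_at \<tau>; w = xe - x; \<epsilon> = \<bar>A (S x)\<bar> in
       w > 0 \<and> S x > 1 \<and> \<bar>w powr (1 - 1 / g) / (C * (1 - \<tau>)) - 1\<bar> \<le> c * (\<epsilon> + w + (1 - \<tau>)) \<and>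
       \<bar>w + a (S x) / g\<bar> \<le> c * \<epsilon> * w \<and> (\<forall>y. x \<le> y \<longrightarrow> y < xe \<longrightarrow> \<bar>A (S y)\<bar> \<le> c * \<epsilon>)))"
    using expectile_expansion[OF sq] by (elim exE) (rule that)
  then have C: "C > 0" "c > 0" "\<tau>1 < 1" "1/2 \<le> \<tau>1" by auto
  define w where "w \<tau> = xe - expectile_at \<tau>" for \<tau>
  define \<epsilon> where "\<epsilon> \<tau> = \<bar>A (S (expectile_at \<tau>))\<bar>" for \<tau>
  have ex: "w \<tau> > 0" "\<bar>w \<tau> powr (1 - 1 / g) / (C * (1 - \<tau>)) - 1\<bar> \<le> c * (\<epsilon> \<tau> + w \<tau> + (1 - \<tau>))"
    "\<And>y. expectile_at \<tau> \<le> y \<Longrightarrow> y < xe \<Longrightarrow> \<bar>A (S y)\<bar> \<le> c * \<epsilon> \<tau>" if "\<tau>1 < \<tau>" "\<tau> < 1" for \<tau>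
    using * that unfolding Let_def w_def \<epsilon>_def by blast+
  \<comment> \<open>One factor \<open>c\<close> comes from the expansion at \<tau>', the factor
    \<open>1 + c\<close> from bounding \<open>\<epsilon> \<tau>'\<close> by
    \<open>c * \<epsilon> \<tau>\<close>.\<close>
  define c2 where "c2 = c * (1 + c)"
  have c2: "c2 > 0" "c2 \<ge> c" using C by (auto simp: c2_def)
  obtain \<tau>2 where \<tau>2: "\<tau>2 < 1" "\<And>\<tau>. \<tau>2 < \<tau> \<Longrightarrow> \<tau> < 1 \<Longrightarrow> \<epsilon> \<tau> + w \<tau> + (1 - \<tau>) < 1 / (8 * c2)"
    using expectile_tail_small[OF sq, of "1 / (8 * c2)"] c2 unfolding w_def \<epsilon>_def by auto
  define q where "q = 1 / (1 - 1 / g)"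
  have q: "(1 - 1 / g) * q = 1" "- q = g / (1 - g)"
    using g by (auto simp: q_def field_simps)
  define Cq where "Cq = \<bar>q\<bar> * exp (\<bar>q - 1\<bar> * ln 2)"
  have Cq: "Cq \<ge> 0" by (simp add: Cq_def)
  have main: "\<bar>w \<tau>' / w \<tau> - ((1 - \<tau>) / (1 - \<tau>')) powr (g / (1 - g))\<bar>
       \<le> (Cq * 3 * c2 + 1) * (\<epsilon> \<tau> + w \<tau> + (1 - \<tau>)) * ((1 - \<tau>) / (1 - \<tau>')) powr (g / (1 - g))"
    if \<tau>: "max \<tau>1 \<tau>2 < \<tau>" "\<tau> \<le> \<tau>'" "\<tau>' < 1" for \<tau> \<tau>'
  proof -
    define d where "d = (1 - \<tau>) / (1 - \<tau>')"
    define \<eta> where "\<eta> = \<epsilon> \<tau> + w \<tau> + (1 - \<tau>)"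
    define R where "R \<tau> = w \<tau> powr (1 - 1 / g) / (C * (1 - \<tau>))" for \<tau>
    have wp: "w \<tau> > 0" "w \<tau>' > 0" using ex(1) \<tau> by auto
    have Rp: "R \<tau> > 0" "R \<tau>' > 0" using wp C \<tau> by (auto simp: R_def)
    have e0: "\<epsilon> \<tau> \<ge> 0" "\<eta> \<ge> 0" using wp \<tau> by (auto simp: \<epsilon>_def \<eta>_def add_nonneg_nonneg)
    have \<eta>: "c2 * \<eta> \<le> 1/8" using \<tau>2(2)[of \<tau>] \<tau> c2 by (simp add: \<eta>_def field_simps)
    have mono: "expectile_at \<tau> \<le> expectile_at \<tau>'" using \<tau> C by (intro expectile_mono[OF sq]) auto
    have w': "w \<tau>' \<le> w \<tau>" using mono by (simp add: w_def)
    have \<epsilon>': "\<epsilon> \<tau>' \<le> c * \<epsilon> \<tau>" unfolding \<epsilon>_def[of \<tau>'] using ex(3)[of \<tau>] mono wp \<tau> by (auto simp: w_def)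
    have "c * \<eta> \<le> c2 * \<eta>" using c2 e0 by (intro mult_right_mono)
    moreover have "\<bar>R \<tau> - 1\<bar> \<le> c * \<eta>" using ex(2)[of \<tau>] \<tau> by (simp add: R_def \<eta>_def)
    ultimately have R1: "\<bar>R \<tau> - 1\<bar> \<le> c2 * \<eta>" by linarith
    have "\<bar>R \<tau>' - 1\<bar> \<le> c * (\<epsilon> \<tau>' + w \<tau>' + (1 - \<tau>'))" using ex(2)[of \<tau>'] \<tau> by (simp add: R_def)
    also have "\<dots> \<le> c * ((1 + c) * \<eta>)"
    proof (intro mult_left_mono)
      have "0 \<le> c * (w \<tau> + (1 - \<tau>))" using wp \<tau> C by (intro mult_nonneg_nonneg add_nonneg_nonneg) auto
      then have "c * \<epsilon> \<tau> + w \<tau> + (1 - \<tau>) \<le> (1 + c) * \<eta>" using e0 by (simp add: \<eta>_def algebra_simps)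
      then show "\<epsilon> \<tau>' + w \<tau>' + (1 - \<tau>') \<le> (1 + c) * \<eta>" using w' \<epsilon>' \<tau> by linarith
    qed (use C in simp)
    finally have R2: "\<bar>R \<tau>' - 1\<bar> \<le> c2 * \<eta>" by (simp add: c2_def)
    define u where "u = R \<tau>' / R \<tau>"
    have u: "\<bar>u - 1\<bar> \<le> 3 * c2 * \<eta>"
    proof -
      have "u - 1 = (R \<tau>' - R \<tau>) / R \<tau>" using Rp by (simp add: u_def field_simps)
      then have "\<bar>u - 1\<bar> = \<bar>R \<tau>' - R \<tau>\<bar> / R \<tau>" using Rp by (simp add: abs_divide)
      also have "\<dots> \<le> (2 * (c2 * \<eta>)) / (7/8)" using R1 R2 \<eta> unfolding abs_le_iff by (intro frac_le) linarith+
      also have "\<dots> \<le> 3 * c2 * \<eta>" using c2 e0 by simp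
      finally show ?thesis .
    qed
    have "3 * c2 * \<eta> \<le> 1/2" using \<eta> by linarith
    then have u2: "\<bar>u - 1\<bar> \<le> 1/2" using u by linarith
    have up: "u > 0" using Rp by (simp add: u_def)
    have d: "d > 0" using \<tau> by (simp add: d_def)
    have "(w \<tau>' / w \<tau>) powr (1 - 1 / g) = u * inverse d"
    proof -
      have "(w \<tau>' / w \<tau>) powr (1 - 1 / g) = w \<tau>' powr (1 - 1 / g) / w \<tau> powr (1 - 1 / g)"
        using wp by (intro powr_divide)
      moreover have "w \<tau> powr (1 - 1 / g) = R \<tau> * (C * (1 - \<tau>))" "w \<tau>' powr (1 - 1 / g) = R \<tau>' * (C * (1 - \<tau>'))"
        using C \<tau> by (auto simp: R_def)
      ultimately show ?thesis using C \<tau> Rp by (simp add: u_def d_def)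
    qed
    then have "((w \<tau>' / w \<tau>) powr (1 - 1 / g)) powr q = u powr q * (inverse d) powr q"
      using up d by (simp only: powr_mult less_imp_le inverse_nonnegative_iff_nonnegative)
    then have "w \<tau>' / w \<tau> = u powr q * d powr (- q)"
      using wp d by (simp add: powr_powr q(1) inverse_powr powr_minus)
    then have "w \<tau>' / w \<tau> - d powr (- q) = (u powr q - 1) * d powr (- q)" by (simp add: algebra_simps)
    then have "\<bar>w \<tau>' / w \<tau> - d powr (- q)\<bar> = \<bar>u powr q - 1\<bar> * d powr (- q)" by (simp add: abs_mult)
    also have "\<dots> \<le> (Cq * (3 * c2 * \<eta>)) * d powr (- q)"
    proof (intro mult_right_mono)
      have "\<bar>u powr q - 1\<bar> \<le> Cq * \<bar>u - 1\<bar>" unfolding Cq_def by (rule powr_minus_one_bound[OF u2])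
      also have "\<dots> \<le> Cq * (3 * c2 * \<eta>)" using u Cq by (intro mult_left_mono)
      finally show "\<bar>u powr q - 1\<bar> \<le> Cq * (3 * c2 * \<eta>)" .
    qed simp
    also have "\<dots> \<le> (Cq * 3 * c2 + 1) * \<eta> * d powr (- q)"
      using e0 by (intro mult_right_mono) (auto simp: algebra_simps)
    finally show ?thesis by (simp add: d_def \<eta>_def q(2))
  qed
  show ?thesis
  proof (rule exI[of _ "Cq * 3 * c2 + 1"], rule exI[of _ "max \<tau>1 \<tau>2"], intro conjI allI impI)
    show "0 < Cq * 3 * c2 + 1" using Cq c2 by (simp add: add_nonneg_pos)
  qed (use main C \<tau>2(1) in \<open>auto simp: w_def \<epsilon>_def\<close>)
qed

text \<open>With \<open>D\<close> the distance of the quantile to the endpoint, the tail quantile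
  expansion gives \<open>1 - \<tau> \<le> (2 / L * D) powr b\<close>, and the expectile expansion
  gives \<open>w powr (b + 1) \<le> 2 * C * (1 - \<tau>)\<close>. The resulting exponent is
  \<open>b / (b + 1) = 1 / (1 - g)\<close>, so a rate assumed for the quantile becomes one for
  \<open>w\<close>.\<close>

theorem expectile_quantile_distance:
  assumes sq: "integrable M (\<lambda>z. z\<^sup>2)"
  shows "\<exists>c \<tau>0. c > 0 \<and> \<tau>0 < 1 \<and> 1/2 \<le> \<tau>0 \<and> (\<forall>\<tau>. \<tau>0 < \<tau> \<longrightarrow> \<tau> < 1 \<longrightarrow>
     xe - expectile_at \<tau> \<le> c * (xe - quantile F \<tau>) powr (1 / (1 - g)))"
proof -
  obtain C c \<tau>1 where *: "C > 0 \<and> c > 0 \<and> \<tau>1 < 1 \<and> 1/2 \<le> \<tau>1 \<and> (\<forall>\<tau>. \<tau>1 < \<tau> \<longrightarrow> \<tau> < 1 \<longrightarrow>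
     (let x = expectile_at \<tau>; w = xe - x; \<epsilon> = \<bar>A (S x)\<bar> in
       w > 0 \<and> S x > 1 \<and> \<bar>w powr (1 - 1 / g) / (C * (1 - \<tau>)) - 1\<bar> \<le> c * (\<epsilon> + w + (1 - \<tau>)) \<and>
       \<bar>w + a (S x) / g\<bar> \<le> c * \<epsilon> * w \<and> (\<forall>y. x \<le> y \<longrightarrow> y < xe \<longrightarrow> \<bar>A (S y)\<bar> \<le> c * \<epsilon>)))"
    using expectile_expansion[OF sq] by (elim exE) (rule that)
  then have C: "C > 0" "c > 0" "\<tau>1 < 1" "1/2 \<le> \<tau>1" by auto
  obtain \<tau>2 where \<tau>2: "\<tau>2 < 1" "\<And>\<tau>. \<tau>2 < \<tau> \<Longrightarrow> \<tau> < 1 \<Longrightarrow>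
      \<bar>A (S (expectile_at \<tau>))\<bar> + (xe - expectile_at \<tau>) + (1 - \<tau>) < 1 / c"
    using expectile_tail_small[OF sq, of "1 / c"] C by auto
  obtain L where L: "L > 0" "((\<lambda>s. (xe - U s) / s powr g) \<longlongrightarrow> L) at_top"
    using U_expansion_limit by blast
  have "\<forall>\<^sub>F s in at_top. (xe - U s) / s powr g > L / 2"
    using order_tendstoD(1)[OF L(2), of "L / 2"] L by simp
  then obtain s0 where s0: "\<And>s. s \<ge> s0 \<Longrightarrow> (xe - U s) / s powr g > L / 2"
    by (auto simp: eventually_at_top_linorder)
  define b where "b = - 1 / g"
  have b: "b > 0" "1 - 1 / g = b + 1" "- g * b = 1" using g by (auto simp: b_def divide_neg_neg)
  define q where "q = 1 / (b + 1)"
  have q: "(b + 1) * q = 1" "q > 0" "b * q = 1 / (1 - g)"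
    using b g by (auto simp: q_def b_def field_simps)
  define k where "k = (2 * C) powr q * ((2 / L) powr b) powr q"
  define \<tau>0 where "\<tau>0 = max (max \<tau>1 \<tau>2) (1 - 1 / max s0 2)"
  have main: "xe - expectile_at \<tau> \<le> k * (xe - quantile F \<tau>) powr (1 / (1 - g))" if \<tau>: "\<tau>0 < \<tau>" "\<tau> < 1" for \<tau>
  proof -
    define w where "w = xe - expectile_at \<tau>"
    have tt: "\<tau>1 < \<tau>" "\<tau>2 < \<tau>" "1 - 1 / max s0 2 < \<tau>" using \<tau> by (auto simp: \<tau>0_def)
    define s where "s = 1 / (1 - \<tau>)"
    have s: "s \<ge> max s0 2"
    proof -
      define m where "m = max s0 2"
      have "m > 0" "1 - 1 / m < \<tau>" using tt(3) by (auto simp: m_def)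
      then have "m \<le> s" using \<tau>(2) by (simp add: s_def field_simps)
      then show ?thesis by (simp add: m_def)
    qed
    have Us: "U s = quantile F \<tau>" using \<tau> by (simp add: s_def tail_quantile_def)
    define D where "D = xe - quantile F \<tau>"
    have D0: "D > 0" using U_less_xe[of s] s by (simp add: D_def Us)
    have "D / s powr g > L / 2" using s0[of s] s by (simp add: D_def Us)
    then have "s powr g < 2 / L * D" using L s by (simp add: field_simps)
    then have "(s powr g) powr b \<le> (2 / L * D) powr b" using b by (intro powr_mono2) auto
    moreover have "(s powr g) powr b = 1 - \<tau>"
    proof -
      have "g * b = -1" using b by simp
      then show ?thesis using \<tau> by (simp add: powr_powr s_def powr_minus powr_one)
    qed
    ultimately have t1: "1 - \<tau> \<le> (2 / L * D) powr b" by simp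
    have w: "w > 0" "\<bar>w powr (b + 1) / (C * (1 - \<tau>)) - 1\<bar> \<le> c * (\<bar>A (S (expectile_at \<tau>))\<bar> + w + (1 - \<tau>))"
      using * tt(1) \<tau>(2) unfolding Let_def w_def b(2) by blast+
    have "c * (\<bar>A (S (expectile_at \<tau>))\<bar> + w + (1 - \<tau>)) \<le> 1"
      using \<tau>2(2)[OF tt(2) \<tau>(2)] C by (simp add: w_def field_simps)
    then have "w powr (b + 1) / (C * (1 - \<tau>)) \<le> 2" using w(2) unfolding abs_le_iff by linarith
    then have "w powr (b + 1) \<le> 2 * C * (1 - \<tau>)" using C \<tau> by (simp add: field_simps)
    also have "\<dots> \<le> 2 * C * (2 / L * D) powr b" using t1 C by (intro mult_left_mono) auto
    finally have "(w powr (b + 1)) powr q \<le> (2 * C * (2 / L * D) powr b) powr q"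
      using q by (intro powr_mono2) auto
    also have "(w powr (b + 1)) powr q = w" using w q by (simp add: powr_powr)
    also have "(2 * C * (2 / L * D) powr b) powr q = k * (D powr b) powr q"
    proof -
      have "(2 / L * D) powr b = (2 / L) powr b * D powr b" using L D0 by (intro powr_mult)
      then show ?thesis using C by (simp add: k_def powr_mult mult_ac)
    qed
    also have "(D powr b) powr q = D powr (1 / (1 - g))" by (simp add: powr_powr q)
    finally show ?thesis by (simp add: w_def D_def)
  qed
  show ?thesis
  proof (rule exI[of _ k], rule exI[of _ \<tau>0], intro conjI allI impI)
    show "k > 0" using C L by (simp add: k_def)
  qed (use main C \<tau>2(1) in \<open>auto simp: \<tau>0_def le_max_iff_disj\<close>)
qed

end

section \<open>Convergence in probability of mixing block sums\<close>

definition to_zero_in_probability :: "'a measure \<Rightarrow> (nat \<Rightarrow> 'a \<Rightarrow> real) \<Rightarrow> bool" where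
  "to_zero_in_probability M Y \<longleftrightarrow>
     (\<forall>\<epsilon>>0. (\<lambda>n. measure M {\<omega> \<in> space M. \<bar>Y n \<omega>\<bar> > \<epsilon>}) \<longlonglongrightarrow> 0)"

section \<open>Covariances and characteristic functions under mixing\<close>

context prob_space
begin

lemma bounded_integrable:
  fixes f :: "'a \<Rightarrow> real"
  assumes "f \<in> borel_measurable M" "\<And>x. \<bar>f x\<bar> \<le> B"
  shows "integrable M f"
  using assms by (intro integrable_const_bound[of _ B]) auto

text \<open>With \<open>W\<close> the conditional expectation of \<open>V\<close> given
  \<open>G\<close> minus the mean of \<open>V\<close>, the covariance of \<open>U\<close> and
  \<open>V\<close> is the mean of \<open>U * W\<close>. Among all \<open>G\<close>-measurable
  factors bounded by 1 this is largest for \<open>sgn W\<close>.\<close>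

lemma covariance_sign_bound:
  assumes G: "subalgebra M G"
    and U: "U \<in> borel_measurable G" "\<And>x. \<bar>U x\<bar> \<le> (1::real)"
    and V: "V \<in> borel_measurable M" "\<And>x. \<bar>V x\<bar> \<le> (1::real)"
  shows "\<exists>W. W \<in> borel_measurable G \<and>
    \<bar>expectation (\<lambda>x. U x * V x) - expectation U * expectation V\<bar>
      \<le> expectation (\<lambda>x. sgn (W x) * V x) - expectation (\<lambda>x. sgn (W x)) * expectation V"
proof -
  interpret finite_measure_subalgebra M G
    using G by unfold_locales
  define C where "C = real_cond_exp M G V"
  define W where "W x = C x - expectation V" for x
  have [measurable]: "C \<in> borel_measurable G" "C \<in> borel_measurable M" by (auto simp: C_def)
  have W: "W \<in> borel_measurable G" "W \<in> borel_measurable M" by (auto simp: W_def[abs_def])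
  note [measurable] = W V(1)
  have VI: "integrable M V" using V by (rule bounded_integrable)
  then have CI: "integrable M C" unfolding C_def by (rule real_cond_exp_int)
  then have WI: "integrable M W" unfolding W_def by auto
  have key: "expectation (\<lambda>x. f x * V x) - expectation f * expectation V = expectation (\<lambda>x. f x * W x)"
      "integrable M (\<lambda>x. f x * W x)"
    if f: "f \<in> borel_measurable G" "\<And>x. \<bar>f x\<bar> \<le> 1" for f
  proof -
    have fM[measurable]: "f \<in> borel_measurable M" using measurable_from_subalg[OF G f(1)] .
    have fI: "integrable M f" using fM f(2) by (rule bounded_integrable)
    have "\<bar>f x * V x\<bar> \<le> 1" for x
      using mult_mono[of "\<bar>f x\<bar>" 1 "\<bar>V x\<bar>" 1] f(2)[of x] V(2)[of x] by (simp add: abs_mult)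
    then have fV: "integrable M (\<lambda>x. f x * V x)" by (intro bounded_integrable[of _ 1]) auto
    note C = real_cond_exp_intg[OF fV f(1) V(1), folded C_def]
    have eq: "f x * W x = f x * C x - f x * expectation V" for x by (simp add: W_def right_diff_distrib)
    show "expectation (\<lambda>x. f x * V x) - expectation f * expectation V = expectation (\<lambda>x. f x * W x)"
      unfolding eq using C fI by simp
    show "integrable M (\<lambda>x. f x * W x)" unfolding eq using C fI by simp
  qed
  have sgn: "(\<lambda>x. sgn (W x)) \<in> borel_measurable G" "\<And>x. \<bar>sgn (W x)\<bar> \<le> 1"
    using W by (auto simp: sgn_if)
  have "\<bar>expectation (\<lambda>x. U x * V x) - expectation U * expectation V\<bar> = \<bar>expectation (\<lambda>x. U x * W x)\<bar>"
    using key(1)[OF U] by simp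
  also have "\<dots> \<le> expectation (\<lambda>x. \<bar>U x * W x\<bar>)" by (rule integral_abs_bound)
  also have "\<dots> \<le> expectation (\<lambda>x. sgn (W x) * W x)"
  proof (rule integral_mono)
    fix x
    have "\<bar>U x\<bar> * \<bar>W x\<bar> \<le> 1 * \<bar>W x\<bar>" using U(2) by (intro mult_right_mono) auto
    moreover have "sgn (W x) * W x = \<bar>W x\<bar>" by (simp add: abs_sgn mult.commute)
    ultimately show "\<bar>U x * W x\<bar> \<le> sgn (W x) * W x" by (simp only: abs_mult mult_1)
  qed (use key(2)[OF U] key(2)[OF sgn] in auto)
  also have "\<dots> = expectation (\<lambda>x. sgn (W x) * V x) - expectation (\<lambda>x. sgn (W x)) * expectation V"
    using key(1)[OF sgn] by simp
  finally show ?thesis using W(1) by blast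
qed

text \<open>The classical bound for \<open>\<alpha>\<close>-mixing: replacing each factor in turn by the sign of a conditional
  expectation reduces the claim to indicator functions.\<close>
lemma covariance_mixing_bound:
  assumes G: "subalgebra M G" and H: "subalgebra M H"
    and mix: "\<And>A B. A \<in> sets G \<Longrightarrow> B \<in> sets H \<Longrightarrow> \<bar>prob (A \<inter> B) - prob A * prob B\<bar> \<le> \<alpha>"
    and U: "U \<in> borel_measurable G" "\<And>x. \<bar>U x\<bar> \<le> (1::real)"
    and V: "V \<in> borel_measurable H" "\<And>x. \<bar>V x\<bar> \<le> (1::real)"
  shows "\<bar>expectation (\<lambda>x. U x * V x) - expectation U * expectation V\<bar> \<le> 4 * \<alpha>"
proof -
  have VM: "V \<in> borel_measurable M" using measurable_from_subalg[OF H V(1)] .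
  obtain W where W: "W \<in> borel_measurable G"
    and 1: "\<bar>expectation (\<lambda>x. U x * V x) - expectation U * expectation V\<bar>
      \<le> expectation (\<lambda>x. sgn (W x) * V x) - expectation (\<lambda>x. sgn (W x)) * expectation V"
    using covariance_sign_bound[OF G U VM V(2)] by blast
  have sW: "(\<lambda>x. sgn (W x)) \<in> borel_measurable M" "\<And>x. \<bar>sgn (W x)\<bar> \<le> 1"
    using measurable_from_subalg[OF G W] by (auto simp: sgn_if)
  obtain T where T: "T \<in> borel_measurable H"
    and 2: "\<bar>expectation (\<lambda>x. V x * sgn (W x)) - expectation V * expectation (\<lambda>x. sgn (W x))\<bar>
      \<le> expectation (\<lambda>x. sgn (T x) * sgn (W x)) - expectation (\<lambda>x. sgn (T x)) * expectation (\<lambda>x. sgn (W x))"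
    using covariance_sign_bound[OF H V sW] by blast
  define A where "A = {x \<in> space M. W x > 0}"
  define A' where "A' = {x \<in> space M. W x < 0}"
  define B where "B = {x \<in> space M. T x > 0}"
  define B' where "B' = {x \<in> space M. T x < 0}"
  have sp: "space G = space M" "space H = space M" using G H by (auto simp: subalgebra_def)
  have setsG: "A \<in> sets G" "A' \<in> sets G"
    using W unfolding A_def A'_def sp(1)[symmetric] by measurable
  have setsH: "B \<in> sets H" "B' \<in> sets H"
    using T unfolding B_def B'_def sp(2)[symmetric] by measurable
  have setsM: "A \<in> events" "A' \<in> events" "B \<in> events" "B' \<in> events"
    using setsG setsH G H by (auto simp: subalgebra_def)
  have ind: "integrable M (indicator E :: 'a \<Rightarrow> real)" "expectation (indicator E) = prob E" if "E \<in> events" for E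
    using that by (auto simp: emeasure_eq_measure)
  have sgnW: "sgn (W x) = indicator A x - indicator A' x" if "x \<in> space M" for x
    using that by (auto simp: A_def A'_def sgn_if)
  have sgnT: "sgn (T x) = indicator B x - indicator B' x" if "x \<in> space M" for x
    using that by (auto simp: B_def B'_def sgn_if)
  have EW: "expectation (\<lambda>x. sgn (W x)) = prob A - prob A'"
  proof -
    have "expectation (\<lambda>x. sgn (W x)) = expectation (\<lambda>x. indicator A x - indicator A' x)"
      by (intro Bochner_Integration.integral_cong) (auto simp: sgnW)
    then show ?thesis using ind setsM by simp
  qed
  have ET: "expectation (\<lambda>x. sgn (T x)) = prob B - prob B'"
  proof -
    have "expectation (\<lambda>x. sgn (T x)) = expectation (\<lambda>x. indicator B x - indicator B' x)"
      by (intro Bochner_Integration.integral_cong) (auto simp: sgnT)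
    then show ?thesis using ind setsM by simp
  qed
  have ETW: "expectation (\<lambda>x. sgn (T x) * sgn (W x)) = prob (A \<inter> B) - prob (A' \<inter> B) - prob (A \<inter> B') + prob (A' \<inter> B')"
  proof -
    have "expectation (\<lambda>x. sgn (T x) * sgn (W x)) = expectation (\<lambda>x. indicator (A \<inter> B) x - indicator (A' \<inter> B) x - indicator (A \<inter> B') x + indicator (A' \<inter> B') x)"
      by (intro Bochner_Integration.integral_cong) (auto simp: sgnW sgnT indicator_inter_arith algebra_simps)
    then show ?thesis using ind setsM by (simp add: sets.Int)
  qed
  \<comment> \<open>A sign is a difference of two indicators, so the covariance of two signs is a
    signed sum of four covariances of events, each at most \<alpha> in absolute value; hence the
    factor 4.\<close>
  have "expectation (\<lambda>x. sgn (T x) * sgn (W x)) - expectation (\<lambda>x. sgn (T x)) * expectation (\<lambda>x. sgn (W x))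
    = (prob (A \<inter> B) - prob A * prob B) - (prob (A' \<inter> B) - prob A' * prob B)
      - (prob (A \<inter> B') - prob A * prob B') + (prob (A' \<inter> B') - prob A' * prob B')"
    unfolding EW ET ETW by (simp add: algebra_simps)
  also have "\<dots> \<le> 4 * \<alpha>"
    using mix[OF setsG(1) setsH(1)] mix[OF setsG(2) setsH(1)] mix[OF setsG(1) setsH(2)] mix[OF setsG(2) setsH(2)]
    unfolding abs_le_iff by linarith
  finally show ?thesis using 1 2 by (simp add: mult.commute)
qed

lemma iexp_integrable: "X \<in> borel_measurable M \<Longrightarrow> integrable M (\<lambda>x. iexp (X x))"
  by (intro integrable_const_bound[of _ 1]) auto

lemma expectation_iexp:
  assumes [measurable]: "X \<in> borel_measurable M"
  shows "(CLINT x|M. iexp (X x)) = Complex (expectation (\<lambda>x. cos (X x))) (expectation (\<lambda>x. sin (X x)))"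
proof -
  have I: "integrable M (\<lambda>x. iexp (X x))" by (rule iexp_integrable) fact
  show ?thesis
    by (rule complex_eqI) (simp_all add: integral_Re[OF I, symmetric] integral_Im[OF I, symmetric] Re_exp Im_exp)
qed

text \<open>The addition theorems turn the real and the imaginary part into two covariances of sines
  and cosines each: four terms of size \<open>4 * \<alpha>\<close>.\<close>

lemma char_mixing_bound:
  assumes G: "subalgebra M G" and H: "subalgebra M H"
    and mix: "\<And>A B. A \<in> sets G \<Longrightarrow> B \<in> sets H \<Longrightarrow> \<bar>prob (A \<inter> B) - prob A * prob B\<bar> \<le> \<alpha>"
    and X: "X \<in> borel_measurable G" and Y: "Y \<in> borel_measurable H"
  shows "cmod ((CLINT x|M. iexp (X x + Y x)) - (CLINT x|M. iexp (X x)) * (CLINT x|M. iexp (Y x))) \<le> 16 * \<alpha>"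
proof -
  note [measurable] = measurable_from_subalg[OF G X] measurable_from_subalg[OF H Y]
  have b: "\<bar>expectation (\<lambda>x. f (X x) * h (Y x)) - expectation (\<lambda>x. f (X x)) * expectation (\<lambda>x. h (Y x))\<bar> \<le> 4 * \<alpha>"
    if "f \<in> {cos, sin}" "h \<in> {cos, sin}" for f h :: "real \<Rightarrow> real"
    using that by (intro covariance_mixing_bound[OF G H mix]) (use X Y in auto)
  have I: "integrable M (\<lambda>x. f (X x) * h (Y x))" if "f \<in> {cos, sin}" "h \<in> {cos, sin}" for f h :: "real \<Rightarrow> real"
  proof (rule bounded_integrable[of _ 1])
    have "\<bar>f u\<bar> \<le> 1" "\<bar>h u\<bar> \<le> 1" for u using that by auto
    then show "\<bar>f (X x) * h (Y x)\<bar> \<le> 1" for x by (simp add: abs_mult mult_le_one)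
  qed (use that in auto)
  define c where "c f h = expectation (\<lambda>x. f (X x) * h (Y x)) - expectation (\<lambda>x. f (X x)) * expectation (\<lambda>x. h (Y x))"
    for f h :: "real \<Rightarrow> real"
  have c: "\<bar>c cos cos\<bar> \<le> 4 * \<alpha>" "\<bar>c sin sin\<bar> \<le> 4 * \<alpha>" "\<bar>c sin cos\<bar> \<le> 4 * \<alpha>" "\<bar>c cos sin\<bar> \<le> 4 * \<alpha>"
    unfolding c_def by (rule b; simp)+
  have "expectation (\<lambda>x. cos (X x + Y x)) = expectation (\<lambda>x. cos (X x) * cos (Y x)) - expectation (\<lambda>x. sin (X x) * sin (Y x))"
    unfolding cos_add using I[of cos cos] I[of sin sin] by (intro Bochner_Integration.integral_diff) auto
  moreover have "expectation (\<lambda>x. sin (X x + Y x)) = expectation (\<lambda>x. sin (X x) * cos (Y x)) + expectation (\<lambda>x. cos (X x) * sin (Y x))"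
    unfolding sin_add using I[of sin cos] I[of cos sin] by (intro Bochner_Integration.integral_add) auto
  ultimately have "(CLINT x|M. iexp (X x + Y x)) - (CLINT x|M. iexp (X x)) * (CLINT x|M. iexp (Y x))
    = Complex (c cos cos - c sin sin) (c sin cos + c cos sin)"
    using expectation_iexp[of X] expectation_iexp[of Y] expectation_iexp[of "\<lambda>x. X x + Y x"]
    by (simp add: complex_eq_iff c_def)
  moreover have "cmod (Complex (c cos cos - c sin sin) (c sin cos + c cos sin))
      \<le> \<bar>c cos cos - c sin sin\<bar> + \<bar>c sin cos + c cos sin\<bar>"
    using cmod_le[of "Complex (c cos cos - c sin sin) (c sin cos + c cos sin)"] by simp
  moreover have "\<dots> \<le> 16 * \<alpha>" using c by linarith
  ultimately show ?thesis by (simp only: order_trans)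
qed

text \<open>Centring removes the linear term of the exponential, so only the second-order Taylor
  remainder is left.\<close>

lemma char_second_moment_bound:
  assumes X: "X \<in> borel_measurable M" and I: "integrable M (\<lambda>x. (X x)\<^sup>2)" and z: "expectation X = 0" "integrable M X"
  shows "cmod ((CLINT x|M. iexp (X x)) - 1) \<le> expectation (\<lambda>x. (X x)\<^sup>2)"
proof -
  have "(CLINT x|M. iexp (X x)) - 1 = (CLINT x|M. iexp (X x) - 1 - \<i> * complex_of_real (X x))"
    using iexp_integrable[OF X] z by (simp add: prob_space integral_complex_of_real)
  also have "cmod \<dots> \<le> expectation (\<lambda>x. cmod (iexp (X x) - 1 - \<i> * complex_of_real (X x)))"
    by (rule integral_norm_bound)
  also have "\<dots> \<le> expectation (\<lambda>x. (X x)\<^sup>2)"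
  proof (rule integral_mono)
    fix x
    have "cmod (iexp (X x) - 1 - \<i> * complex_of_real (X x)) \<le> \<bar>X x\<bar> ^ 2 / 2"
      using iexp_approx1[of "X x" 1] by (simp add: numeral_2_eq_2 diff_diff_eq)
    also have "\<dots> \<le> (X x)\<^sup>2" by simp
    finally show "cmod (iexp (X x) - 1 - \<i> * complex_of_real (X x)) \<le> (X x)\<^sup>2" .
  qed (use I iexp_integrable[OF X] z in auto)
  finally show ?thesis .
qed

text \<open>Splitting off the last summand costs \<open>a\<close> for the imperfect factorisation
  and \<open>b\<close> for its own distance to 1; the errors add up because the characteristic
  function of the rest has modulus at most 1.\<close>

lemma char_sum_bound:
  fixes B :: "nat \<Rightarrow> 'a \<Rightarrow> real"
  assumes meas: "\<And>i. B i \<in> borel_measurable M"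
    and step: "\<And>i. cmod ((CLINT x|M. iexp ((\<Sum>j<i. B j x) + B i x)) - (CLINT x|M. iexp (\<Sum>j<i. B j x)) * (CLINT x|M. iexp (B i x))) \<le> a"
    and small: "\<And>i. cmod ((CLINT x|M. iexp (B i x)) - 1) \<le> b"
  shows "cmod ((CLINT x|M. iexp (\<Sum>j<k. B j x)) - 1) \<le> k * (a + b)"
proof (induction k)
  case 0
  show ?case by (simp add: prob_space)
next
  case (Suc k)
  let ?S = "CLINT x|M. iexp (\<Sum>j<k. B j x)" and ?B = "CLINT x|M. iexp (B k x)"
  have S1: "cmod ?S \<le> 1"
  proof -
    have "cmod ?S \<le> expectation (\<lambda>x. cmod (iexp (\<Sum>j<k. B j x)))" by (rule integral_norm_bound)
    then show ?thesis by (simp add: prob_space)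
  qed
  have "(CLINT x|M. iexp (\<Sum>j<Suc k. B j x)) - 1
      = ((CLINT x|M. iexp ((\<Sum>j<k. B j x) + B k x)) - ?S * ?B) + ?S * (?B - 1) + (?S - 1)"
    by (simp add: algebra_simps)
  also have "cmod \<dots> \<le> a + 1 * b + k * (a + b)"
  proof (intro norm_triangle_mono)
    show "cmod (?S * (?B - 1)) \<le> 1 * b"
      unfolding norm_mult using S1 small[of k] by (intro mult_mono) auto
  qed (rule step, rule Suc.IH)
  finally show ?case by (simp add: algebra_simps)
qed

text \<open>The constant 1 is the characteristic function of the point mass at 0, so Levy continuity
  gives weak convergence to it. Its distribution function jumps only at 0, hence \<epsilon> and
  \<open>- \<epsilon>\<close> are continuity points.\<close>

lemma to_zero_in_probability_char:
  fixes X :: "nat \<Rightarrow> 'a \<Rightarrow> real"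
  assumes meas[measurable]: "\<And>n. X n \<in> borel_measurable M"
    and lim: "\<And>t. (\<lambda>n. CLINT x|M. iexp (t * X n x)) \<longlonglongrightarrow> 1"
  shows "to_zero_in_probability M X"
proof -
  define R :: "real measure" where "R = return borel 0"
  have cdfR: "cdf R = (\<lambda>x. if 0 \<le> x then 1 else 0)"
    by (auto simp: cdf_def R_def measure_return indicator_def)
  have rdR: "real_distribution R"
    unfolding R_def real_distribution_def real_distribution_axioms_def by (auto intro: prob_space_return)
  have "weak_conv_m (\<lambda>n. distr M borel (X n)) R"
  proof (rule levy_continuity)
    show "real_distribution (distr M borel (X n))" for n by (rule real_distribution_distr) simp
    show "(\<lambda>n. char (distr M borel (X n)) t) \<longlonglongrightarrow> char R t" for t
      using lim[of t] by (simp add: char_def integral_distr R_def integral_return)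
  qed fact
  then have conv: "(\<lambda>n. cdf (distr M borel (X n)) x) \<longlonglongrightarrow> (if 0 \<le> x then 1 else 0)" if "x \<noteq> 0" for x
  proof -
    have "isCont (cdf R) x"
      unfolding isCont_def
    proof (rule tendsto_eventually)
      have "\<forall>\<^sub>F y in nhds x. (0 \<le> y) = (0 \<le> x)"
      proof (cases "x > 0")
        case True
        then show ?thesis using eventually_nhds_in_open[of "{0<..}" x] by (auto elim!: eventually_mono)
      next
        case False
        then have "x < 0" using that by simp
        then show ?thesis using eventually_nhds_in_open[of "{..<0}" x] by (auto elim!: eventually_mono)
      qed
      then show "\<forall>\<^sub>F y in at x. cdf R y = cdf R x"
        unfolding eventually_at_filter cdfR by (auto elim!: eventually_mono)
    qed
    then show ?thesis using \<open>weak_conv_m _ R\<close> unfolding weak_conv_m_def weak_conv_def cdfR by simp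
  qed
  show ?thesis
    unfolding to_zero_in_probability_def
  proof (intro allI impI)
    fix \<epsilon> :: real assume e: "\<epsilon> > 0"
    have "(\<lambda>n. 1 - cdf (distr M borel (X n)) \<epsilon> + cdf (distr M borel (X n)) (- \<epsilon>)) \<longlonglongrightarrow> 1 - 1 + 0"
      using conv[of \<epsilon>] conv[of "- \<epsilon>"] e by (intro tendsto_intros) auto
    then have lim0: "(\<lambda>n. 1 - cdf (distr M borel (X n)) \<epsilon> + cdf (distr M borel (X n)) (- \<epsilon>)) \<longlonglongrightarrow> 0" by simp
    show "(\<lambda>n. prob {\<omega> \<in> space M. \<epsilon> < \<bar>X n \<omega>\<bar>}) \<longlonglongrightarrow> 0"
    proof (rule tendsto_sandwich[OF _ _ tendsto_const lim0])
      show "\<forall>\<^sub>F n in sequentially. prob {\<omega> \<in> space M. \<epsilon> < \<bar>X n \<omega>\<bar>} \<le> 1 - cdf (distr M borel (X n)) \<epsilon> + cdf (distr M borel (X n)) (- \<epsilon>)"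
      proof (rule always_eventually, rule allI)
        fix n
        have c: "cdf (distr M borel (X n)) x = prob {\<omega> \<in> space M. X n \<omega> \<le> x}" for x
          by (simp add: cdf_def measure_distr vimage_def Int_def conj_commute)
        have "{\<omega> \<in> space M. \<epsilon> < X n \<omega>} = space M - {\<omega> \<in> space M. X n \<omega> \<le> \<epsilon>}" by auto
        then have "prob {\<omega> \<in> space M. \<epsilon> < X n \<omega>} = 1 - prob {\<omega> \<in> space M. X n \<omega> \<le> \<epsilon>}"
          by (simp add: prob_compl)
        moreover have "prob {\<omega> \<in> space M. \<epsilon> < \<bar>X n \<omega>\<bar>} \<le> prob ({\<omega> \<in> space M. \<epsilon> < X n \<omega>} \<union> {\<omega> \<in> space M. X n \<omega> \<le> - \<epsilon>})"
          by (intro finite_measure_mono) auto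
        moreover have "\<dots> \<le> prob {\<omega> \<in> space M. \<epsilon> < X n \<omega>} + prob {\<omega> \<in> space M. X n \<omega> \<le> - \<epsilon>}"
          by (intro measure_Un_le) auto
        ultimately show "prob {\<omega> \<in> space M. \<epsilon> < \<bar>X n \<omega>\<bar>} \<le> 1 - cdf (distr M borel (X n)) \<epsilon> + cdf (distr M borel (X n)) (- \<epsilon>)"
          by (simp add: c)
      qed
    qed auto
  qed
qed

lemma to_zero_in_probability_add:
  assumes [measurable]: "\<And>n. X n \<in> borel_measurable M" "\<And>n. Y n \<in> borel_measurable M"
    and X: "to_zero_in_probability M X" and Y: "to_zero_in_probability M Y"
  shows "to_zero_in_probability M (\<lambda>n \<omega>. X n \<omega> + Y n \<omega>)"
  unfolding to_zero_in_probability_def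
proof (intro allI impI)
  fix \<epsilon> :: real assume e: "\<epsilon> > 0"
  have lim: "(\<lambda>n. prob {\<omega> \<in> space M. \<epsilon> / 2 < \<bar>X n \<omega>\<bar>} + prob {\<omega> \<in> space M. \<epsilon> / 2 < \<bar>Y n \<omega>\<bar>}) \<longlonglongrightarrow> 0 + 0"
    using X[unfolded to_zero_in_probability_def, rule_format, of "\<epsilon> / 2"]
      Y[unfolded to_zero_in_probability_def, rule_format, of "\<epsilon> / 2"] e by (intro tendsto_add) simp_all
  show "(\<lambda>n. prob {\<omega> \<in> space M. \<epsilon> < \<bar>X n \<omega> + Y n \<omega>\<bar>}) \<longlonglongrightarrow> 0"
  proof (rule tendsto_sandwich[OF _ _ tendsto_const])
    show "\<forall>\<^sub>F n in sequentially. prob {\<omega> \<in> space M. \<epsilon> < \<bar>X n \<omega> + Y n \<omega>\<bar>}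
        \<le> prob {\<omega> \<in> space M. \<epsilon> / 2 < \<bar>X n \<omega>\<bar>} + prob {\<omega> \<in> space M. \<epsilon> / 2 < \<bar>Y n \<omega>\<bar>}"
    proof (rule always_eventually, rule allI)
      fix n
      have "prob {\<omega> \<in> space M. \<epsilon> < \<bar>X n \<omega> + Y n \<omega>\<bar>} \<le> prob ({\<omega> \<in> space M. \<epsilon> / 2 < \<bar>X n \<omega>\<bar>} \<union> {\<omega> \<in> space M. \<epsilon> / 2 < \<bar>Y n \<omega>\<bar>})"
        by (intro finite_measure_mono) auto
      also have "\<dots> \<le> prob {\<omega> \<in> space M. \<epsilon> / 2 < \<bar>X n \<omega>\<bar>} + prob {\<omega> \<in> space M. \<epsilon> / 2 < \<bar>Y n \<omega>\<bar>}"
        by (intro measure_Un_le) auto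
      finally show "prob {\<omega> \<in> space M. \<epsilon> < \<bar>X n \<omega> + Y n \<omega>\<bar>}
        \<le> prob {\<omega> \<in> space M. \<epsilon> / 2 < \<bar>X n \<omega>\<bar>} + prob {\<omega> \<in> space M. \<epsilon> / 2 < \<bar>Y n \<omega>\<bar>}" .
    qed
  qed (use lim in auto)
qed

end

text \<open>An upper bound at a single gap in place of the suprema in \<open>alpha_mixing\<close>.
  It covers both data regimes: mixing, and independence with gap 1 and bound 0.\<close>

definition mixing_bound :: "'a measure \<Rightarrow> (nat \<Rightarrow> 'a \<Rightarrow> real) \<Rightarrow> nat \<Rightarrow> real \<Rightarrow> bool" where
  "mixing_bound M Z l \<alpha> \<longleftrightarrow>
     (\<forall>m\<ge>1. \<forall>G\<in>generated_sigma M Z {1..m}. \<forall>H\<in>generated_sigma M Z {m + l..}.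
        \<bar>measure M (G \<inter> H) - measure M G * measure M H\<bar> \<le> \<alpha>)"

lemma mixing_bound_nonneg:
  assumes "mixing_bound M Z l \<alpha>"
  shows "\<alpha> \<ge> 0"
proof -
  have "{} \<in> generated_sigma M Z I" for I by (simp add: generated_sigma_def sigma_sets.Empty)
  then have "\<bar>measure M ({} \<inter> {}) - measure M {} * measure M {}\<bar> \<le> \<alpha>"
    using assms unfolding mixing_bound_def by blast
  then show ?thesis by simp
qed

text \<open>The family \<open>generated_sigma\<close> bundled as a measure, so that measurability
  and conditional expectation with respect to it can be expressed.\<close>

definition index_algebra :: "'a measure \<Rightarrow> (nat \<Rightarrow> 'a \<Rightarrow> real) \<Rightarrow> nat set \<Rightarrow> 'a measure" where
  "index_algebra M Z I = sigma (space M) {Z i -` B \<inter> space M | i B. i \<in> I \<and> B \<in> sets borel}"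

lemma sets_index_algebra: "sets (index_algebra M Z I) = generated_sigma M Z I"
  unfolding index_algebra_def generated_sigma_def by (intro sets_measure_of) auto

lemma space_index_algebra: "space (index_algebra M Z I) = space M"
  unfolding index_algebra_def by (intro space_measure_of) auto

lemma subalgebra_index_algebra:
  assumes "\<And>i. i \<in> I \<Longrightarrow> Z i \<in> borel_measurable M"
  shows "subalgebra M (index_algebra M Z I)"
  unfolding subalgebra_def space_index_algebra sets_index_algebra generated_sigma_def
  using assms by (auto intro!: sets.sigma_sets_subset measurable_sets)

lemma measurable_index_algebra: "i \<in> I \<Longrightarrow> Z i \<in> borel_measurable (index_algebra M Z I)"
  by (rule measurableI) (auto simp: space_index_algebra sets_index_algebra generated_sigma_def intro!: sigma_sets.Basic)

text \<open>The parameter \<open>q\<close> selects the parity of the blocks. Intersecting with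
  \<open>{1..n}\<close> lets a truncated or empty last block be treated like a full one.\<close>

lemma (in prob_space) block_char_bound:
  fixes Z :: "nat \<Rightarrow> 'a \<Rightarrow> real" and r n k q :: nat and \<alpha> \<beta> :: real
  assumes Z: "\<And>t. t \<ge> 1 \<Longrightarrow> Z t \<in> borel_measurable M"
    and f[measurable]: "f \<in> borel_measurable borel"
    and r: "r \<ge> 1" and mix: "mixing_bound M Z r \<alpha>"
    and sq: "\<And>t. t \<ge> 1 \<Longrightarrow> integrable M (\<lambda>x. (f (Z t x))\<^sup>2)"
    and mean0: "\<And>t. t \<ge> 1 \<Longrightarrow> expectation (\<lambda>x. f (Z t x)) = 0"
    and var: "\<And>c. expectation (\<lambda>x. (\<Sum>t\<in>{c<..c + r} \<inter> {1..n}. f (Z t x))\<^sup>2) \<le> \<beta>"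
  defines "B \<equiv> \<lambda>(j::nat) x. \<Sum>t\<in>{j * r<..j * r + r} \<inter> {1..n}. f (Z t x)"
  shows "cmod ((CLINT x|M. iexp (\<Sum>i<k. B (2 * i + q) x)) - 1) \<le> k * (16 * \<alpha> + \<beta>)"
proof (rule char_sum_bound)
  have fZ: "(\<lambda>x. f (Z t x)) \<in> borel_measurable M" if "t \<ge> 1" for t
    using Z[OF that] by (rule measurable_compose) fact
  have Bm: "B j \<in> borel_measurable M" for j
    unfolding B_def by (intro borel_measurable_sum fZ) auto
  then show "B (2 * i + q) \<in> borel_measurable M" for i .
  have int: "integrable M (\<lambda>x. f (Z t x))" if "t \<ge> 1" for t
    by (rule square_integrable_imp_integrable[OF fZ sq]) (use that in auto)
  have alg: "(\<lambda>x. f (Z t x)) \<in> borel_measurable (index_algebra M Z I)" if "t \<in> I" for t I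
    by (rule measurable_compose[OF measurable_index_algebra[OF that] f])
  show "cmod ((CLINT x|M. iexp (B (2 * i + q) x)) - 1) \<le> \<beta>" for i
  proof -
    have sum_sq: "integrable M (\<lambda>x. (\<Sum>t\<in>I. f (Z t x))\<^sup>2)" if "finite I" "I \<subseteq> {1..}" for I
    proof (rule Bochner_Integration.integrable_bound[of M "\<lambda>x. of_nat (card I) * (\<Sum>t\<in>I. (f (Z t x))\<^sup>2)"])
      show "integrable M (\<lambda>x. of_nat (card I) * (\<Sum>t\<in>I. (f (Z t x))\<^sup>2))"
        using that by (intro integrable_mult_right Bochner_Integration.integrable_sum sq) auto
      show "(\<lambda>x. (\<Sum>t\<in>I. f (Z t x))\<^sup>2) \<in> borel_measurable M"
        using that by (intro borel_measurable_power borel_measurable_sum fZ) auto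
      show "AE x in M. norm ((\<Sum>t\<in>I. f (Z t x))\<^sup>2) \<le> norm (of_nat (card I) * (\<Sum>t\<in>I. (f (Z t x))\<^sup>2))"
        using sum_squared_le_sum_of_squares[of _ I]
        by (intro AE_I2) (simp add: sum_nonneg mult.commute abs_of_nonneg)
    qed
    have "cmod ((CLINT x|M. iexp (B (2 * i + q) x)) - 1) \<le> expectation (\<lambda>x. (B (2 * i + q) x)\<^sup>2)"
    proof (rule char_second_moment_bound)
      show "integrable M (\<lambda>x. (B (2 * i + q) x)\<^sup>2)" unfolding B_def by (intro sum_sq) auto
      show "integrable M (B (2 * i + q))" unfolding B_def by (intro Bochner_Integration.integrable_sum int) auto
      show "expectation (B (2 * i + q)) = 0"
        unfolding B_def by (subst Bochner_Integration.integral_sum) (auto intro!: int sum.neutral mean0)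
    qed fact
    also have "\<dots> \<le> \<beta>" unfolding B_def by (rule var)
    finally show ?thesis .
  qed
  show "cmod ((CLINT x|M. iexp ((\<Sum>j<i. B (2 * j + q) x) + B (2 * i + q) x))
     - (CLINT x|M. iexp (\<Sum>j<i. B (2 * j + q) x)) * (CLINT x|M. iexp (B (2 * i + q) x))) \<le> 16 * \<alpha>" for i
  proof (cases i)
    case 0
    then show ?thesis using mixing_bound_nonneg[OF mix] by (simp add: prob_space)
  next
    case (Suc i')
    \<comment> \<open>\<open>m\<close> is the last index of the preceding block of the same parity.
      The next one begins after \<open>m + r\<close>, so the skipped block of the other parity is
      the gap of length \<open>r\<close>.\<close>
    define m where "m = (2 * i' + q + 1) * r"
    have m: "m \<ge> 1" using r by (simp add: m_def)
    show ?thesis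
    proof (rule char_mixing_bound)
      show "subalgebra M (index_algebra M Z {1..m})" "subalgebra M (index_algebra M Z {m + r..})"
        using r by (auto intro!: subalgebra_index_algebra Z)
      show "\<bar>prob (G \<inter> H) - prob G * prob H\<bar> \<le> \<alpha>"
        if "G \<in> sets (index_algebra M Z {1..m})" "H \<in> sets (index_algebra M Z {m + r..})" for G H
        using mix that m unfolding mixing_bound_def sets_index_algebra by blast
      show "(\<lambda>x. \<Sum>j<i. B (2 * j + q) x) \<in> borel_measurable (index_algebra M Z {1..m})"
        unfolding B_def
      proof (intro borel_measurable_sum alg)
        fix j t assume "j \<in> {..<i}" and t: "t \<in> {(2 * j + q) * r<..(2 * j + q) * r + r} \<inter> {1..n}"
        then have "2 * j + q + 1 \<le> 2 * i' + q + 1" using Suc by simp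
        then have "(2 * j + q + 1) * r \<le> m" unfolding m_def by (rule mult_right_mono) simp
        then show "t \<in> {1..m}" using t by (auto simp: algebra_simps)
      qed
      show "B (2 * i + q) \<in> borel_measurable (index_algebra M Z {m + r..})"
        unfolding B_def
      proof (intro borel_measurable_sum alg)
        fix t assume t: "t \<in> {(2 * i + q) * r<..(2 * i + q) * r + r} \<inter> {1..n}"
        have "(2 * i + q) * r = m + r" using Suc by (simp add: m_def algebra_simps)
        then show "t \<in> {m + r..}" using t by auto
      qed
    qed
  qed
qed

section \<open>Assembling the blocks\<close>

lemma sum_blocks:
  fixes h :: "nat \<Rightarrow> real"
  shows "(\<Sum>j<k. \<Sum>t\<in>{j * r<..j * r + r} \<inter> {1..n}. h t) = (\<Sum>t\<in>{0<..k * r} \<inter> {1..n}. h t)"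
proof (induction k)
  case (Suc k)
  have "{0<..Suc k * r} \<inter> {1..n} = ({0<..k * r} \<inter> {1..n}) \<union> ({k * r<..k * r + r} \<inter> {1..n})" by auto
  moreover have "sum h (({0<..k * r} \<inter> {1..n}) \<union> ({k * r<..k * r + r} \<inter> {1..n}))
      = sum h ({0<..k * r} \<inter> {1..n}) + sum h ({k * r<..k * r + r} \<inter> {1..n})"
    by (intro sum.union_disjoint) auto
  ultimately show ?case using Suc by (simp only: sum.lessThan_Suc)
qed simp

lemma sum_even_odd:
  fixes h :: "nat \<Rightarrow> real"
  shows "(\<Sum>i<k. h (2 * i)) + (\<Sum>i<k. h (2 * i + 1)) = (\<Sum>j<2 * k. h j)"
  by (induction k) (auto simp: algebra_simps)

text \<open>Splitting into blocks of length \<open>r\<close> and treating the even and the odd blocks separately leaves gaps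
  of length \<open>r\<close>, over which the characteristic functions nearly factorise.\<close>
theorem (in prob_space) block_sum_to_zero:
  fixes Z :: "nat \<Rightarrow> 'a \<Rightarrow> real" and r :: "nat \<Rightarrow> nat" and f :: "nat \<Rightarrow> real \<Rightarrow> real"
    and \<alpha> \<beta> :: "nat \<Rightarrow> real"
  assumes Z: "\<And>t. t \<ge> 1 \<Longrightarrow> Z t \<in> borel_measurable M"
    and f: "\<And>n. f n \<in> borel_measurable borel"
    and ev: "\<forall>\<^sub>F n in sequentially. r n \<ge> 1 \<and> mixing_bound M Z (r n) (\<alpha> n) \<and>
      (\<forall>t\<ge>1. integrable M (\<lambda>x. (f n (Z t x))\<^sup>2) \<and> expectation (\<lambda>x. f n (Z t x)) = 0) \<and>
      (\<forall>c. expectation (\<lambda>x. (\<Sum>t\<in>{c<..c + r n} \<inter> {1..n}. f n (Z t x))\<^sup>2) \<le> \<beta> n)"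
    and small: "(\<lambda>n. (real n / real (r n) + 1) * \<alpha> n) \<longlonglongrightarrow> 0" "(\<lambda>n. (real n / real (r n) + 1) * \<beta> n) \<longlonglongrightarrow> 0"
  shows "to_zero_in_probability M (\<lambda>n x. \<Sum>t=1..n. f n (Z t x))"
proof -
  define B where "B n (j::nat) x = (\<Sum>t\<in>{j * r n<..j * r n + r n} \<inter> {1..n}. f n (Z t x))" for n j x
  \<comment> \<open>The number of blocks of each parity. Already \<open>N n\<close> blocks reach
    beyond \<open>n\<close>, so the \<open>2 * N n\<close> blocks cover \<open>{1..n}\<close>; those
    past \<open>n\<close> are empty.\<close>
  define N where "N n = n div r n + 1" for n
  define T where "T q n x = (\<Sum>i<N n. B n (2 * i + q) x)" for q n x
  have fZ: "(\<lambda>x. f n (Z t x)) \<in> borel_measurable M" if "t \<ge> 1" for t n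
    by (rule measurable_compose[OF Z[OF that] f])
  have Tm: "T q n \<in> borel_measurable M" for q n
    unfolding T_def B_def by (intro borel_measurable_sum fZ) auto
  have T: "to_zero_in_probability M (T q)" for q
  proof (rule to_zero_in_probability_char)
    fix t :: real
    have lim0: "(\<lambda>n. 16 * ((real n / real (r n) + 1) * \<alpha> n) + t\<^sup>2 * ((real n / real (r n) + 1) * \<beta> n)) \<longlonglongrightarrow> 16 * 0 + t\<^sup>2 * 0"
      by (intro tendsto_intros small)
    show "(\<lambda>n. CLINT x|M. iexp (t * T q n x)) \<longlonglongrightarrow> 1"
    proof (rule Lim_transform[OF tendsto_const], rule Lim_null_comparison)
      show "(\<lambda>n. 16 * ((real n / real (r n) + 1) * \<alpha> n) + t\<^sup>2 * ((real n / real (r n) + 1) * \<beta> n)) \<longlonglongrightarrow> 0"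
        using lim0 by simp
      show "\<forall>\<^sub>F n in sequentially. norm ((CLINT x|M. iexp (t * T q n x)) - 1)
          \<le> 16 * ((real n / real (r n) + 1) * \<alpha> n) + t\<^sup>2 * ((real n / real (r n) + 1) * \<beta> n)"
        using ev
      proof eventually_elim
        case (elim n)
        have tT: "t * T q n x = (\<Sum>i<N n. \<Sum>s\<in>{(2 * i + q) * r n<..(2 * i + q) * r n + r n} \<inter> {1..n}. t * f n (Z s x))" for x
          by (simp add: T_def B_def sum_distrib_left)
        have bnd: "cmod ((CLINT x|M. iexp (\<Sum>i<N n. \<Sum>s\<in>{(2 * i + q) * r n<..(2 * i + q) * r n + r n} \<inter> {1..n}. t * f n (Z s x))) - 1)
            \<le> N n * (16 * \<alpha> n + t\<^sup>2 * \<beta> n)"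
        proof (rule block_char_bound[where f = "\<lambda>x. t * f n x"])
          show "expectation (\<lambda>x. (\<Sum>s\<in>{c<..c + r n} \<inter> {1..n}. t * f n (Z s x))\<^sup>2) \<le> t\<^sup>2 * \<beta> n" for c
            using elim by (simp add: sum_distrib_left[symmetric] power_mult_distrib mult_left_mono)
        qed (use Z f elim in \<open>auto simp: power_mult_distrib\<close>)
        have nonneg: "16 * \<alpha> n + t\<^sup>2 * \<beta> n \<ge> 0"
        proof -
          have "\<alpha> n \<ge> 0" using elim mixing_bound_nonneg by blast
          moreover have "0 \<le> expectation (\<lambda>x. (\<Sum>t\<in>{0<..0 + r n} \<inter> {1..n}. f n (Z t x))\<^sup>2)" by simp
          then have "\<beta> n \<ge> 0" using elim by (meson order_trans)
          ultimately show ?thesis by simp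
        qed
        have "real (N n) \<le> real n / real (r n) + 1"
        proof -
          have "real (n div r n * r n) \<le> real n" by (simp only: of_nat_le_iff div_times_less_eq_dividend)
          then show ?thesis using elim by (simp add: N_def pos_le_divide_eq)
        qed
        then have "N n * (16 * \<alpha> n + t\<^sup>2 * \<beta> n) \<le> (real n / real (r n) + 1) * (16 * \<alpha> n + t\<^sup>2 * \<beta> n)"
          using nonneg by (rule mult_right_mono)
        then show ?case using bnd unfolding tT by (simp add: algebra_simps)
      qed
    qed
  qed (rule Tm)
  have sum: "to_zero_in_probability M (\<lambda>n x. T 0 n x + T 1 n x)"
    by (intro to_zero_in_probability_add T Tm)
  have eq: "T 0 n x + T 1 n x = (\<Sum>t=1..n. f n (Z t x))" if "r n \<ge> 1" for n x
  proof -
    have "T 0 n x + T 1 n x = (\<Sum>j<2 * N n. B n j x)"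
      unfolding T_def using sum_even_odd[of "\<lambda>j. B n j x" "N n"] by simp
    also have "\<dots> = (\<Sum>t\<in>{0<..2 * N n * r n} \<inter> {1..n}. f n (Z t x))"
      unfolding B_def by (rule sum_blocks)
    also have "{0<..2 * N n * r n} \<inter> {1..n} = {1..n}"
    proof -
      have "n \<le> N n * r n"
      proof -
        have "n mod r n < r n" using that by simp
        then have "n \<le> n div r n * r n + r n" using div_mult_mod_eq[of n "r n"] by linarith
        then show ?thesis by (simp add: N_def)
      qed
      then show ?thesis by auto
    qed
    finally show ?thesis .
  qed
  show ?thesis
    unfolding to_zero_in_probability_def
  proof (intro allI impI)
    fix \<epsilon> :: real assume "\<epsilon> > 0"
    then have "(\<lambda>n. prob {\<omega> \<in> space M. \<epsilon> < \<bar>T 0 n \<omega> + T 1 n \<omega>\<bar>}) \<longlonglongrightarrow> 0"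
      using sum by (simp add: to_zero_in_probability_def)
    moreover have "\<forall>\<^sub>F n in sequentially. prob {\<omega> \<in> space M. \<epsilon> < \<bar>T 0 n \<omega> + T 1 n \<omega>\<bar>}
        = prob {\<omega> \<in> space M. \<epsilon> < \<bar>\<Sum>t=1..n. f n (Z t \<omega>)\<bar>}"
      using ev by eventually_elim (simp only: eq)
    ultimately show "(\<lambda>n. prob {\<omega> \<in> space M. \<epsilon> < \<bar>\<Sum>t=1..n. f n (Z t \<omega>)\<bar>}) \<longlonglongrightarrow> 0"
      by (rule Lim_transform_eventually)
  qed
qed

section \<open>Dependence conditions and the empirical score\<close>

lemma stationary_joint_tail:
  assumes Z: "\<And>t. t \<ge> 1 \<Longrightarrow> Z t \<in> borel_measurable M" and stat: "strictly_stationary M Z"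
    and s: "s \<ge> (1::nat)" and t: "t \<ge> 1"
  shows "measure M {\<omega> \<in> space M. Z s \<omega> > x \<and> Z (s + t) \<omega> > x}
    = measure M {\<omega> \<in> space M. Z 1 \<omega> > x \<and> Z (t + 1) \<omega> > x}"
proof -
  let ?J = "{1, t + 1}"
  let ?P = "Pi\<^sub>M ?J (\<lambda>_. borel :: real measure)"
  let ?A = "{f \<in> space ?P. f 1 > x \<and> f (t + 1) > x}"
  have A: "?A \<in> sets ?P" by measurable
  have meas: "(\<lambda>\<omega>. \<lambda>i\<in>?J. Z (i + h) \<omega>) \<in> measurable M ?P" for h
    by (intro measurable_restrict Z) auto
  have *: "measure (distr M ?P (\<lambda>\<omega>. \<lambda>i\<in>?J. Z (i + h) \<omega>)) ?A
      = measure M {\<omega> \<in> space M. Z (1 + h) \<omega> > x \<and> Z (t + 1 + h) \<omega> > x}" for h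
  proof -
    have "(\<lambda>\<omega>. \<lambda>i\<in>?J. Z (i + h) \<omega>) -` ?A \<inter> space M = {\<omega> \<in> space M. Z (1 + h) \<omega> > x \<and> Z (t + 1 + h) \<omega> > x}"
      by (auto simp: space_PiM)
    then show ?thesis using measure_distr[OF meas A] by simp
  qed
  have "distr M ?P (\<lambda>\<omega>. \<lambda>i\<in>?J. Z (i + (s - 1)) \<omega>) = distr M ?P (\<lambda>\<omega>. \<lambda>i\<in>?J. Z (i + 0) \<omega>)"
    using stat unfolding strictly_stationary_def by simp
  then show ?thesis using *[of "s - 1"] *[of 0] s by (simp add: add.commute)
qed

text \<open>A real supremum bounds its elements only if the set is bounded, which holds since
  covariances of events are at most 1 in absolute value. Widening the gap from \<open>l\<close> to
  \<open>r\<close> shrinks the future sigma-algebra, so the coefficient at the short gap serves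
  blocks that are a full length \<open>r\<close> apart.\<close>

lemma (in prob_space) mixing_bound_alpha_mixing:
  assumes Z: "\<And>t. t \<ge> 1 \<Longrightarrow> Z t \<in> borel_measurable M" and l: "l \<le> r"
  shows "mixing_bound M Z r (alpha_mixing M Z l)"
proof -
  let ?f = "\<lambda>(G, H). \<bar>prob (G \<inter> H) - prob G * prob H\<bar>"
  let ?A = "\<lambda>m. generated_sigma M Z {1..m} \<times> generated_sigma M Z {m + l..}"
  have f1: "?f x \<le> 1" for x
  proof (cases x)
    case (Pair G H)
    have "prob G * prob H \<le> 1" by (intro mult_le_one) auto
    moreover have "0 \<le> prob G * prob H" by simp
    moreover have "0 \<le> prob (G \<inter> H)" "prob (G \<inter> H) \<le> 1" by auto
    ultimately have "\<bar>prob (G \<inter> H) - prob G * prob H\<bar> \<le> 1" by linarith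
    then show ?thesis using Pair by simp
  qed
  have bdd: "bdd_above (?f ` X)" for X using f1 by (intro bdd_aboveI2)
  have ne: "?A m \<noteq> {}" for m
    unfolding generated_sigma_def using sigma_sets.Empty by blast
  have "bdd_above ((\<lambda>m. SUP x\<in>?A m. ?f x) ` {1..})"
    by (intro bdd_aboveI2[of _ _ 1] cSUP_least ne f1)
  then have le: "?f x \<le> alpha_mixing M Z l" if "m \<ge> 1" "x \<in> ?A m" for m x
    unfolding alpha_mixing_def
    using that by (intro cSUP_upper2[where x = m] cSUP_upper bdd) auto
  show ?thesis
    unfolding mixing_bound_def
  proof (intro allI impI ballI)
    fix m G H assume m: "1 \<le> m" and G: "G \<in> generated_sigma M Z {1..m}" and H: "H \<in> generated_sigma M Z {m + r..}"
    have "generated_sigma M Z {m + r..} \<subseteq> generated_sigma M Z {m + l..}"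
      unfolding generated_sigma_def
    proof (rule sigma_sets_mono', safe)
      fix i and B :: "real set" assume "m + r \<le> i" "B \<in> sets borel"
      then show "\<exists>j C. Z i -` B \<inter> space M = Z j -` C \<inter> space M \<and> j \<in> {m + l..} \<and> C \<in> sets borel"
        using l by (intro exI[of _ i] exI[of _ B]) auto
    qed
    then show "\<bar>prob (G \<inter> H) - prob G * prob H\<bar> \<le> alpha_mixing M Z l"
      using le[OF m, of "(G, H)"] G H by auto
  qed
qed

text \<open>Grouping independent variables into past and future keeps the generated sigma-algebras
  independent, already at gap 1.\<close>

lemma (in prob_space) mixing_bound_indep:
  assumes ind: "indep_vars (\<lambda>_. borel) Z {1..}"
  shows "mixing_bound M Z 1 0"
  unfolding mixing_bound_def
proof (intro allI impI ballI)
  fix m G H assume m: "(1::nat) \<le> m" and G: "G \<in> generated_sigma M Z {1..m}" and H: "H \<in> generated_sigma M Z {m + 1..}"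
  define E where "E i = {Z i -` B \<inter> space M |B. B \<in> sets (borel :: real measure)}" for i
  define I where "I b = (if b then {1..m} else {m + 1..})" for b
  have gen: "generated_sigma M Z J = sigma_sets (space M) (\<Union>i\<in>J. E i)" for J
    unfolding generated_sigma_def E_def by (intro arg_cong2[where f = sigma_sets]) auto
  have "indep_sets (\<lambda>b. sigma_sets (space M) (\<Union>i\<in>I b. E i)) UNIV"
  proof (rule indep_sets_collect_sigma)
    have "(\<Union>b\<in>UNIV. I b) = {1..}" using m by (auto simp: I_def UNIV_bool)
    then show "indep_sets E (\<Union>b\<in>UNIV. I b)" using ind unfolding indep_vars_def2 E_def by simp
    show "Int_stable (E i)" for i
    proof (rule Int_stableI)
      fix a b assume "a \<in> E i" "b \<in> E i"
      then obtain B C where "a = Z i -` B \<inter> space M" "b = Z i -` C \<inter> space M" "B \<in> sets borel" "C \<in> sets borel"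
        by (auto simp: E_def)
      then show "a \<inter> b \<in> E i" unfolding E_def by (intro CollectI exI[of _ "B \<inter> C"]) auto
    qed
    show "disjoint_family_on I UNIV" by (auto simp: disjoint_family_on_def I_def)
  qed
  then have "prob (\<Inter>b\<in>UNIV. (if b then G else H)) = (\<Prod>b\<in>UNIV. prob (if b then G else H))"
    by (rule indep_setsD) (use G H in \<open>auto simp: gen I_def\<close>)
  then have "prob (G \<inter> H) = prob G * prob H" by (simp add: UNIV_bool Int_commute mult.commute)
  then show "\<bar>prob (G \<inter> H) - prob G * prob H\<bar> \<le> 0" by simp
qed

section \<open>Second moments of block scores and the sample equation of the expectile\<close>

lemma expectile_score_split: "expectile_score \<tau> u = \<tau> * max 0 u - (1 - \<tau>) * max 0 (- u)"
  by (auto simp: expectile_score_def max_def algebra_simps)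

text \<open>The score splits into a part above and a part below \<open>x\<close>. The upper part is
  at most \<open>W\<close> and lives on exceedances, so its square counts pairs of exceedances: the
  diagonal plus twice the pairs with \<open>s < t\<close>. The lower part carries the small weight
  \<open>1 - \<tau>\<close>, so the crude Cauchy-Schwarz bound of order \<open>r * r\<close>
  suffices for it.\<close>

lemma (in prob_space) block_score_second_moment:
  fixes Z :: "nat \<Rightarrow> 'a \<Rightarrow> real" and r n c :: nat and x W p V C \<tau> :: real
  assumes Z: "\<And>t. t \<ge> 1 \<Longrightarrow> Z t \<in> borel_measurable M" and \<tau>: "0 < \<tau>" "\<tau> < 1"
    and W: "\<And>t. t \<ge> 1 \<Longrightarrow> AE \<omega> in M. Z t \<omega> - x \<le> W"  "W \<ge> 0"
    and p: "\<And>t. t \<ge> 1 \<Longrightarrow> prob {\<omega> \<in> space M. Z t \<omega> > x} \<le> p"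
    and joint: "\<And>s. s \<ge> 1 \<Longrightarrow> (\<Sum>k\<in>{1..<r}. prob {\<omega> \<in> space M. Z s \<omega> > x \<and> Z (s + k) \<omega> > x}) \<le> C * p"
    and sq: "\<And>t. t \<ge> 1 \<Longrightarrow> integrable M (\<lambda>\<omega>. (Z t \<omega> - x)\<^sup>2)"
    and V: "\<And>t. t \<ge> 1 \<Longrightarrow> expectation (\<lambda>\<omega>. (Z t \<omega> - x)\<^sup>2) \<le> V"
  defines "I \<equiv> {c<..c + r} \<inter> {1..n}"
  shows "integrable M (\<lambda>\<omega>. (\<Sum>t\<in>I. expectile_score \<tau> (Z t \<omega> - x))\<^sup>2)"
    and "expectation (\<lambda>\<omega>. (\<Sum>t\<in>I. expectile_score \<tau> (Z t \<omega> - x))\<^sup>2)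
      \<le> 2 * W\<^sup>2 * (r * (1 + 2 * C) * p) + 2 * (1 - \<tau>)\<^sup>2 * (r * (r * V))"
proof -
  have I: "finite I" "\<And>t. t \<in> I \<Longrightarrow> t \<ge> 1" by (auto simp: I_def)
  have "card I \<le> card {c<..c + r}" unfolding I_def by (intro card_mono) auto
  then have cI: "card I \<le> r" by simp
  define ind where "ind t \<omega> = (indicator {\<omega> \<in> space M. Z t \<omega> > x} \<omega> :: real)" for t \<omega>
  have sets: "{\<omega> \<in> space M. Z t \<omega> > x} \<in> events" if "t \<ge> 1" for t
    using Z[OF that] by measurable
  have sets2: "{\<omega> \<in> space M. Z s \<omega> > x \<and> Z t \<omega> > x} \<in> events" if "s \<ge> 1" "t \<ge> 1" for s t
    using Z[OF that(1)] Z[OF that(2)] by measurable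
  have ind2: "ind s \<omega> * ind t \<omega> = indicator {\<omega> \<in> space M. Z s \<omega> > x \<and> Z t \<omega> > x} \<omega>" for s t \<omega>
    by (auto simp: ind_def indicator_def)
  have ind2I: "integrable M (\<lambda>\<omega>. ind s \<omega> * ind t \<omega>)" if "s \<ge> 1" "t \<ge> 1" for s t
    unfolding ind2 using sets2[OF that] by (intro integrable_real_indicator) (auto simp: emeasure_eq_measure)
  define J where "J s t = prob {\<omega> \<in> space M. Z s \<omega> > x \<and> Z t \<omega> > x}" for s t
  have J0: "J s t \<ge> 0" and Jsym: "J s t = J t s" for s t by (auto simp: J_def conj_commute)
  have EJ: "expectation (\<lambda>\<omega>. ind s \<omega> * ind t \<omega>) = J s t" if "s \<ge> 1" "t \<ge> 1" for s t
    unfolding ind2 J_def using sets2[OF that] by simp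
  \<comment> \<open>Pairs are reindexed by their lag \<open>t - s\<close>, which inside one block
    lies in \<open>{1..<r}\<close>, so the assumed bound for a fixed first index applies.\<close>
  have after: "(\<Sum>t\<in>I \<inter> {s<..}. J s t) \<le> C * p" if s: "s \<in> I" for s
  proof -
    have "(\<Sum>t\<in>I \<inter> {s<..}. J s t) = (\<Sum>k\<in>(\<lambda>t. t - s) ` (I \<inter> {s<..}). J s (s + k))"
      by (subst sum.reindex) (auto simp: inj_on_def intro!: sum.cong)
    also have "\<dots> \<le> (\<Sum>k\<in>{1..<r}. J s (s + k))"
      by (intro sum_mono2 J0) (use s in \<open>auto simp: I_def\<close>)
    also have "\<dots> \<le> C * p" unfolding J_def using I(2)[OF s] by (rule joint)
    finally show ?thesis .
  qed
  have dbl: "(\<Sum>s\<in>I. \<Sum>t\<in>I. J s t) \<le> r * (1 + 2 * C) * p"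
  proof -
    have split: "(\<Sum>t\<in>I. J s t) = J s s + (\<Sum>t\<in>I \<inter> {s<..}. J s t) + (\<Sum>t\<in>I \<inter> {..<s}. J s t)" if "s \<in> I" for s
    proof -
      have "I = {s} \<union> (I \<inter> {s<..}) \<union> (I \<inter> {..<s})" using that by auto
      then have "(\<Sum>t\<in>I. J s t) = (\<Sum>t\<in>{s} \<union> (I \<inter> {s<..}) \<union> (I \<inter> {..<s}). J s t)" by simp
      also have "\<dots> = (\<Sum>t\<in>{s} \<union> (I \<inter> {s<..}). J s t) + (\<Sum>t\<in>I \<inter> {..<s}. J s t)"
        using I by (intro sum.union_disjoint) auto
      also have "(\<Sum>t\<in>{s} \<union> (I \<inter> {s<..}). J s t) = J s s + (\<Sum>t\<in>I \<inter> {s<..}. J s t)"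
        using I by (subst sum.union_disjoint) auto
      finally show ?thesis .
    qed
    have swap: "(\<Sum>s\<in>I. \<Sum>t\<in>I \<inter> {..<s}. J s t) = (\<Sum>s\<in>I. \<Sum>t\<in>I \<inter> {s<..}. J s t)"
    proof -
      have "(\<Sum>s\<in>I. \<Sum>t\<in>I \<inter> {..<s}. J s t) = (\<Sum>s\<in>I. \<Sum>t\<in>I. if t < s then J s t else 0)"
        using I by (intro sum.cong sum.inter_restrict[THEN trans]) (auto simp: lessThan_def)
      also have "\<dots> = (\<Sum>t\<in>I. \<Sum>s\<in>I. if t < s then J s t else 0)" by (rule sum.swap)
      also have "\<dots> = (\<Sum>t\<in>I. \<Sum>s\<in>I \<inter> {t<..}. J t s)"
        using I by (intro sum.cong refl sum.inter_restrict[THEN trans, symmetric]) (auto simp: Jsym intro!: sum.cong)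
      finally show ?thesis .
    qed
    have "(\<Sum>s\<in>I. \<Sum>t\<in>I. J s t) = (\<Sum>s\<in>I. J s s + 2 * (\<Sum>t\<in>I \<inter> {s<..}. J s t))"
      by (simp add: split sum.distrib swap flip: sum_distrib_left)
    also have "\<dots> \<le> (\<Sum>s\<in>I. p + 2 * (C * p))"
    proof (intro sum_mono add_mono mult_left_mono after)
      show "J s s \<le> p" if "s \<in> I" for s using p[OF I(2)[OF that]] by (simp add: J_def)
    qed auto
    also have "\<dots> = card I * ((1 + 2 * C) * p)" by (simp add: algebra_simps)
    also have "\<dots> \<le> r * ((1 + 2 * C) * p)"
    proof (intro mult_right_mono)
      have "0 \<le> prob {\<omega> \<in> space M. Z 1 \<omega> > x}" by simp
      also have "\<dots> \<le> p" by (rule p) simp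
      finally have "p \<ge> 0" .
      moreover have "0 \<le> (\<Sum>k\<in>{1..<r}. prob {\<omega> \<in> space M. Z 1 \<omega> > x \<and> Z (1 + k) \<omega> > x})" by (intro sum_nonneg) auto
      then have "0 \<le> C * p" using joint[of 1] by linarith
      ultimately show "0 \<le> (1 + 2 * C) * p" by (simp add: algebra_simps)
    qed (use cI in simp)
    finally show ?thesis by (simp add: mult.assoc)
  qed
  have bound: "AE \<omega> in M. (\<Sum>t\<in>I. expectile_score \<tau> (Z t \<omega> - x))\<^sup>2
      \<le> 2 * W\<^sup>2 * (\<Sum>s\<in>I. \<Sum>t\<in>I. ind s \<omega> * ind t \<omega>) + 2 * (1 - \<tau>)\<^sup>2 * (r * (\<Sum>t\<in>I. (Z t \<omega> - x)\<^sup>2))"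
  proof -
    have "AE \<omega> in M. \<forall>t\<in>I. Z t \<omega> - x \<le> W"
      using I W(1) by (intro AE_finite_allI) auto
    then show ?thesis
    proof (rule AE_mp, intro AE_I2 impI)
      fix \<omega> assume om: "\<omega> \<in> space M" and w: "\<forall>t\<in>I. Z t \<omega> - x \<le> W"
      define P where "P = (\<Sum>t\<in>I. max 0 (Z t \<omega> - x))"
      define Q where "Q = (\<Sum>t\<in>I. max 0 (- (Z t \<omega> - x)))"
      have sc: "(\<Sum>t\<in>I. expectile_score \<tau> (Z t \<omega> - x)) = \<tau> * P - (1 - \<tau>) * Q"
        unfolding P_def Q_def sum_distrib_left sum_subtractf[symmetric] by (intro sum.cong refl expectile_score_split)
      have "0 \<le> (\<tau> * P + (1 - \<tau>) * Q)\<^sup>2" by simp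
      then have "(\<tau> * P - (1 - \<tau>) * Q)\<^sup>2 \<le> 2 * (\<tau>\<^sup>2 * P\<^sup>2) + 2 * ((1 - \<tau>)\<^sup>2 * Q\<^sup>2)"
        by (simp add: power2_eq_square algebra_simps)
      moreover have "\<tau>\<^sup>2 * P\<^sup>2 \<le> W\<^sup>2 * (\<Sum>s\<in>I. \<Sum>t\<in>I. ind s \<omega> * ind t \<omega>)"
      proof -
        have P0: "P \<ge> 0" unfolding P_def by (intro sum_nonneg) auto
        have "P \<le> W * (\<Sum>t\<in>I. ind t \<omega>)"
          unfolding P_def sum_distrib_left using om w W(2)
          by (intro sum_mono) (auto simp: ind_def indicator_def max_def)
        then have "P\<^sup>2 \<le> (W * (\<Sum>t\<in>I. ind t \<omega>))\<^sup>2" using P0 by (rule power_mono)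
        moreover have "\<tau>\<^sup>2 * P\<^sup>2 \<le> 1 * P\<^sup>2" using \<tau> by (intro mult_right_mono power_le_one) auto
        ultimately show ?thesis by (simp add: power_mult_distrib power2_eq_square[of "sum _ _"] sum_product)
      qed
      moreover have "Q\<^sup>2 \<le> r * (\<Sum>t\<in>I. (Z t \<omega> - x)\<^sup>2)"
      proof -
        have "Q\<^sup>2 \<le> (\<Sum>t\<in>I. (max 0 (- (Z t \<omega> - x)))\<^sup>2) * card I"
          unfolding Q_def by (rule sum_squared_le_sum_of_squares)
        also have "\<dots> \<le> (\<Sum>t\<in>I. (Z t \<omega> - x)\<^sup>2) * r"
          using cI by (intro mult_mono sum_mono sum_nonneg) (auto simp: max_def power2_commute)
        finally show ?thesis by (simp add: mult.commute)
      qed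
      then have "(1 - \<tau>)\<^sup>2 * Q\<^sup>2 \<le> (1 - \<tau>)\<^sup>2 * (r * (\<Sum>t\<in>I. (Z t \<omega> - x)\<^sup>2))" by (intro mult_left_mono) auto
      ultimately show "(\<Sum>t\<in>I. expectile_score \<tau> (Z t \<omega> - x))\<^sup>2
        \<le> 2 * W\<^sup>2 * (\<Sum>s\<in>I. \<Sum>t\<in>I. ind s \<omega> * ind t \<omega>) + 2 * (1 - \<tau>)\<^sup>2 * (r * (\<Sum>t\<in>I. (Z t \<omega> - x)\<^sup>2))"
        unfolding sc mult.assoc by linarith
    qed
  qed
  let ?R = "\<lambda>\<omega>. 2 * W\<^sup>2 * (\<Sum>s\<in>I. \<Sum>t\<in>I. ind s \<omega> * ind t \<omega>) + 2 * (1 - \<tau>)\<^sup>2 * (r * (\<Sum>t\<in>I. (Z t \<omega> - x)\<^sup>2))"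
  have I1: "integrable M (\<lambda>\<omega>. \<Sum>s\<in>I. \<Sum>t\<in>I. ind s \<omega> * ind t \<omega>)"
    using I by (intro Bochner_Integration.integrable_sum ind2I) auto
  have I2: "integrable M (\<lambda>\<omega>. \<Sum>t\<in>I. (Z t \<omega> - x)\<^sup>2)"
    using I by (intro Bochner_Integration.integrable_sum sq) auto
  have RI: "integrable M ?R"
    by (intro Bochner_Integration.integrable_add integrable_mult_right I1 I2)
  have meas: "(\<lambda>\<omega>. (\<Sum>t\<in>I. expectile_score \<tau> (Z t \<omega> - x))\<^sup>2) \<in> borel_measurable M"
  proof (intro borel_measurable_power borel_measurable_sum)
    fix t assume "t \<in> I"
    then have [measurable]: "Z t \<in> borel_measurable M" using Z I by auto
    show "(\<lambda>\<omega>. expectile_score \<tau> (Z t \<omega> - x)) \<in> borel_measurable M" by measurable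
  qed
  show int: "integrable M (\<lambda>\<omega>. (\<Sum>t\<in>I. expectile_score \<tau> (Z t \<omega> - x))\<^sup>2)"
    by (rule Bochner_Integration.integrable_bound[OF RI meas]) (use bound in \<open>auto elim!: eventually_mono\<close>)
  have "expectation (\<lambda>\<omega>. (\<Sum>t\<in>I. expectile_score \<tau> (Z t \<omega> - x))\<^sup>2) \<le> expectation ?R"
    by (rule integral_mono_AE[OF int RI bound])
  also have "expectation ?R = 2 * W\<^sup>2 * expectation (\<lambda>\<omega>. \<Sum>s\<in>I. \<Sum>t\<in>I. ind s \<omega> * ind t \<omega>)
      + 2 * (1 - \<tau>)\<^sup>2 * (r * expectation (\<lambda>\<omega>. \<Sum>t\<in>I. (Z t \<omega> - x)\<^sup>2))"
    using I1 I2 by (subst Bochner_Integration.integral_add) auto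
  also have "expectation (\<lambda>\<omega>. \<Sum>s\<in>I. \<Sum>t\<in>I. ind s \<omega> * ind t \<omega>) = (\<Sum>s\<in>I. \<Sum>t\<in>I. J s t)"
    using I by (simp add: Bochner_Integration.integral_sum Bochner_Integration.integrable_sum ind2I EJ)
  also have "expectation (\<lambda>\<omega>. \<Sum>t\<in>I. (Z t \<omega> - x)\<^sup>2) = (\<Sum>t\<in>I. expectation (\<lambda>\<omega>. (Z t \<omega> - x)\<^sup>2))"
    using I by (intro Bochner_Integration.integral_sum sq) auto
  also have "2 * W\<^sup>2 * (\<Sum>s\<in>I. \<Sum>t\<in>I. J s t) + 2 * (1 - \<tau>)\<^sup>2 * (r * (\<Sum>t\<in>I. expectation (\<lambda>\<omega>. (Z t \<omega> - x)\<^sup>2)))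
     \<le> 2 * W\<^sup>2 * (r * (1 + 2 * C) * p) + 2 * (1 - \<tau>)\<^sup>2 * (r * (r * V))"
  proof (intro add_mono mult_left_mono dbl)
    have "(\<Sum>t\<in>I. expectation (\<lambda>\<omega>. (Z t \<omega> - x)\<^sup>2)) \<le> card I * V"
      by (intro sum_bounded_above V I)
    also have "\<dots> \<le> r * V"
    proof (intro mult_right_mono)
      have "0 \<le> expectation (\<lambda>\<omega>. (Z 1 \<omega> - x)\<^sup>2)" by simp
      then show "0 \<le> V" using V[of 1] by linarith
    qed (use cI in simp)
    finally show "(\<Sum>t\<in>I. expectation (\<lambda>\<omega>. (Z t \<omega> - x)\<^sup>2)) \<le> r * V" .
  qed auto
  finally show "expectation (\<lambda>\<omega>. (\<Sum>t\<in>I. expectile_score \<tau> (Z t \<omega> - x))\<^sup>2)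
      \<le> 2 * W\<^sup>2 * (r * (1 + 2 * C) * p) + 2 * (1 - \<tau>)\<^sup>2 * (r * (r * V))" .
qed

lemma expectile_score_mono:
  assumes "0 < \<tau>" "\<tau> < 1" "v \<le> u"
  shows "min \<tau> (1 - \<tau>) * (u - v) \<le> expectile_score \<tau> u - expectile_score \<tau> v"
proof -
  define k where "k = min \<tau> (1 - \<tau>)"
  have k: "k \<le> \<tau>" "k \<le> 1 - \<tau>" by (auto simp: k_def)
  have "k * (max 0 u - max 0 v) \<le> \<tau> * (max 0 u - max 0 v)" using assms k by (intro mult_right_mono) (auto simp: max_def)
  moreover have "k * (max 0 (- v) - max 0 (- u)) \<le> (1 - \<tau>) * (max 0 (- v) - max 0 (- u))"
    using assms k by (intro mult_right_mono) (auto simp: max_def)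
  moreover have "u - v = (max 0 u - max 0 v) + (max 0 (- v) - max 0 (- u))" by (auto simp: max_def)
  then have "k * (u - v) = k * (max 0 u - max 0 v) + k * (max 0 (- v) - max 0 (- u))" by (simp only: distrib_left)
  ultimately show ?thesis unfolding expectile_score_split k_def[symmetric] by (simp add: algebra_simps)
qed

text \<open>The summed score is nonnegative at the sample minimum and nonpositive at the maximum. A
  root of it is the unique minimiser, because the quadratic lower bounds of the individual losses
  add up.\<close>

lemma empirical_expectile_root:
  fixes z :: "nat \<Rightarrow> real"
  assumes \<tau>: "0 < \<tau>" "\<tau> < 1" and n: "n \<ge> 1"
  shows "(\<Sum>t=1..n. expectile_score \<tau> (z t - empirical_expectile \<tau> n z)) = 0"
proof -
  define \<psi> where "\<psi> x = (\<Sum>t=1..n. expectile_score \<tau> (z t - x))" for x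
  define l where "l = Min (z ` {1..n})"
  define u where "u = Max (z ` {1..n})"
  have lu: "l \<le> z t" "z t \<le> u" if "t \<in> {1..n}" for t
    using that by (auto simp: l_def u_def intro!: Min_le Max_ge)
  have s0: "expectile_score \<tau> 0 = 0" by (simp add: expectile_score_def)
  have pos: "expectile_score \<tau> y \<ge> 0" if "y \<ge> 0" for y
    using that \<tau> by (auto simp: expectile_score_split max_def)
  have neg: "expectile_score \<tau> y \<le> 0" if "y \<le> 0" for y
    using that \<tau> by (auto simp: expectile_score_split max_def mult_le_0_iff)
  have "\<exists>x\<ge>l. x \<le> u \<and> \<psi> x = 0"
  proof (rule IVT2')
    show "\<psi> u \<le> 0" unfolding \<psi>_def by (intro sum_nonpos neg) (use lu in auto)
    show "0 \<le> \<psi> l" unfolding \<psi>_def by (intro sum_nonneg pos) (use lu in auto)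
    show "l \<le> u" using lu[of 1] n by auto
    show "continuous_on {l..u} \<psi>"
      unfolding \<psi>_def expectile_score_def by (intro continuous_intros)
  qed
  then obtain x where x: "\<psi> x = 0" by auto
  have "empirical_expectile \<tau> n z = x"
    unfolding empirical_expectile_def
  proof (rule arg_min_strongly_convex)
    show "0 < real n * min \<tau> (1 - \<tau>)" using \<tau> n by simp
    fix y
    have "(\<Sum>t=1..n. expectile_loss \<tau> (z t - x) - 2 * (y - x) * expectile_score \<tau> (z t - x) + min \<tau> (1 - \<tau>) * (y - x)\<^sup>2)
        \<le> (\<Sum>t=1..n. expectile_loss \<tau> (z t - y))"
      using expectile_loss_ge[OF \<tau>, of "z _ - x" "y - x"] by (intro sum_mono) simp
    moreover have "(\<Sum>t=1..n. expectile_loss \<tau> (z t - x) - 2 * (y - x) * expectile_score \<tau> (z t - x) + min \<tau> (1 - \<tau>) * (y - x)\<^sup>2)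
        = (\<Sum>t=1..n. expectile_loss \<tau> (z t - x)) - 2 * (y - x) * \<psi> x + n * (min \<tau> (1 - \<tau>) * (y - x)\<^sup>2)"
      by (simp add: \<psi>_def sum.distrib sum_subtractf sum_distrib_left)
    ultimately show "(\<Sum>t=1..n. expectile_loss \<tau> (z t - x)) + real n * min \<tau> (1 - \<tau>) * (y - x)\<^sup>2
        \<le> (\<Sum>t=1..n. expectile_loss \<tau> (z t - y))" using x by (simp add: mult.assoc)
  qed
  then show ?thesis using x by (simp add: \<psi>_def)
qed

text \<open>The summed score is strictly decreasing in its argument with its root at the empirical
  expectile. Events about a minimiser thus become signs of sums at fixed points, which yields
  measurability and reduces consistency to a statement about sums.\<close>

lemma empirical_expectile_less_iff:
  fixes z :: "nat \<Rightarrow> real"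
  assumes \<tau>: "0 < \<tau>" "\<tau> < 1" and n: "n \<ge> 1"
  shows "x < empirical_expectile \<tau> n z \<longleftrightarrow> 0 < (\<Sum>t=1..n. expectile_score \<tau> (z t - x))"
    and "empirical_expectile \<tau> n z < x \<longleftrightarrow> (\<Sum>t=1..n. expectile_score \<tau> (z t - x)) < 0"
proof -
  let ?e = "empirical_expectile \<tau> n z"
  define \<psi> where "\<psi> x = (\<Sum>t=1..n. expectile_score \<tau> (z t - x))" for x
  have dec: "\<psi> y < \<psi> x" if "x < y" for x y
    unfolding \<psi>_def
  proof (rule sum_strict_mono)
    fix t
    have "0 < min \<tau> (1 - \<tau>) * (y - x)" using that \<tau> by simp
    then show "expectile_score \<tau> (z t - y) < expectile_score \<tau> (z t - x)"
      using expectile_score_mono[OF \<tau>, of "z t - y" "z t - x"] that by simp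
  qed (use n in auto)
  have root: "\<psi> ?e = 0" using empirical_expectile_root[OF \<tau> n, of z] by (simp add: \<psi>_def)
  show "x < ?e \<longleftrightarrow> 0 < (\<Sum>t=1..n. expectile_score \<tau> (z t - x))"
    using dec[of x ?e] dec[of ?e x] root unfolding \<psi>_def[symmetric] by (cases x ?e rule: linorder_cases) auto
  show "?e < x \<longleftrightarrow> (\<Sum>t=1..n. expectile_score \<tau> (z t - x)) < 0"
    using dec[of x ?e] dec[of ?e x] root unfolding \<psi>_def[symmetric] by (cases x ?e rule: linorder_cases) auto
qed

lemma empirical_expectile_measurable:
  assumes Z: "\<And>t. t \<ge> 1 \<Longrightarrow> Z t \<in> borel_measurable M" and \<tau>: "0 < \<tau>" "\<tau> < 1"
  shows "(\<lambda>\<omega>. empirical_expectile \<tau> n (\<lambda>t. Z t \<omega>)) \<in> borel_measurable M"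
proof (cases "n \<ge> 1")
  case True
  show ?thesis
  proof (rule borel_measurableI_greater)
    fix x
    have "(\<lambda>\<omega>. \<Sum>t=1..n. expectile_score \<tau> (Z t \<omega> - x)) \<in> borel_measurable M"
    proof (rule borel_measurable_sum)
      fix t assume "t \<in> {1..n}"
      then have [measurable]: "Z t \<in> borel_measurable M" using Z by auto
      show "(\<lambda>\<omega>. expectile_score \<tau> (Z t \<omega> - x)) \<in> borel_measurable M" by measurable
    qed
    then show "{\<omega> \<in> space M. x < empirical_expectile \<tau> n (\<lambda>t. Z t \<omega>)} \<in> sets M"
      unfolding empirical_expectile_less_iff(1)[OF \<tau> True] by measurable
  qed
next
  case False
  \<comment> \<open>For \<open>n = 0\<close> the objective is constantly zero, so the chosen
    minimiser does not depend on the data.\<close>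
  then show ?thesis by (simp add: empirical_expectile_def)
qed

section \<open>Consistency of the empirical expectile\<close>

context second_order_distribution
begin

lemma survival_small:
  assumes "e > 0"
  shows "\<exists>x1<xe. \<forall>x. x1 \<le> x \<longrightarrow> x < xe \<longrightarrow> 1 - F x \<le> e"
proof (intro exI[of _ "U (max 2 (1 / e))"] conjI allI impI)
  show "U (max 2 (1 / e)) < xe" by (rule U_less_xe) simp
  fix x assume x: "U (max 2 (1 / e)) \<le> x" "x < xe"
  have "S x \<ge> max 2 (1 / e)" by (intro S_ge x) simp
  then have "1 / e \<le> 1 / (1 - F x)" by (simp add: S_def)
  moreover have "1 - F x > 0" using F_less_one_iff[of x] x by simp
  ultimately show "1 - F x \<le> e" using assms by (simp add: field_simps)
qed

text \<open>The last two items carry the orders of magnitude for everything below: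
  \<open>1 - \<tau>\<close> against the distance \<open>w = xe - \<xi>\<close> times the survival
  probability, and \<open>a (S \<xi>)\<close> comparable to \<open>w\<close>, because
  \<open>w + a (S \<xi>) / g\<close> is eventually at most \<open>w / 2\<close> in absolute
  value.\<close>

lemma expectile_sequence_facts:
  fixes \<tau> :: "nat \<Rightarrow> real"
  assumes sq: "integrable M (\<lambda>z. z\<^sup>2)" and \<tau>: "\<And>n. 0 < \<tau> n \<and> \<tau> n < 1" "\<tau> \<longlonglongrightarrow> 1"
  defines "\<xi> \<equiv> \<lambda>n. expectile_at (\<tau> n)"
  shows "\<And>x. x < xe \<Longrightarrow> \<forall>\<^sub>F n in sequentially. x < \<xi> n \<and> \<xi> n < xe \<and> 1/2 < \<tau> n"
    and "(\<lambda>n. xe - \<xi> n) \<longlonglongrightarrow> 0" and "(\<lambda>n. 1 - F (\<xi> n)) \<longlonglongrightarrow> 0"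
    and "\<exists>c>0. \<forall>\<^sub>F n in sequentially. 1 - \<tau> n \<le> c * (xe - \<xi> n) * (1 - F (\<xi> n))"
    and "\<forall>\<^sub>F n in sequentially. a (S (\<xi> n)) \<ge> (- g / 2) * (xe - \<xi> n) \<and> a (S (\<xi> n)) \<le> (- 2 * g) * (xe - \<xi> n)"
proof -
  have ev: "\<forall>\<^sub>F n in sequentially. t < \<tau> n" if "t < 1" for t
    using order_tendstoD(1)[OF \<tau>(2) that] .
  show 1: "\<forall>\<^sub>F n in sequentially. x < \<xi> n \<and> \<xi> n < xe \<and> 1/2 < \<tau> n" if x: "x < xe" for x
  proof -
    obtain \<tau>0 where t: "\<tau>0 < 1" "1/2 \<le> \<tau>0" "\<And>t. \<tau>0 < t \<Longrightarrow> t < 1 \<Longrightarrow> x < expectile_at t"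
      using expectile_gt[OF sq x] by auto
    show ?thesis
      using ev[OF t(1)]
      by eventually_elim (use t \<tau> expectile_root(1)[OF sq] in \<open>force simp: \<xi>_def\<close>)
  qed
  show w: "(\<lambda>n. xe - \<xi> n) \<longlonglongrightarrow> 0"
  proof (rule tendstoI)
    fix e :: real assume "e > 0"
    then have "xe - e < xe" by simp
    from 1[OF this] show "\<forall>\<^sub>F n in sequentially. dist (xe - \<xi> n) 0 < e"
      by eventually_elim (simp add: dist_real_def)
  qed
  show "(\<lambda>n. 1 - F (\<xi> n)) \<longlonglongrightarrow> 0"
  proof (rule tendstoI)
    fix e :: real assume e: "e > 0"
    obtain x1 where x1: "x1 < xe" "\<And>x. x1 \<le> x \<Longrightarrow> x < xe \<Longrightarrow> 1 - F x \<le> e / 2"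
      using survival_small[of "e / 2"] e by auto
    show "\<forall>\<^sub>F n in sequentially. dist (1 - F (\<xi> n)) 0 < e"
      using 1[OF x1(1)]
    proof eventually_elim
      case (elim n)
      then have "1 - F (\<xi> n) \<le> e / 2" by (intro x1) auto
      then show ?case using e cdf_bounded_prob[of "\<xi> n"] by (simp add: dist_real_def)
    qed
  qed
  obtain c \<tau>0 where c: "c > 0" "\<tau>0 < 1" "\<And>\<tau>. \<tau>0 < \<tau> \<Longrightarrow> \<tau> < 1 \<Longrightarrow> 1 - \<tau> \<le> c * (xe - expectile_at \<tau>) * (1 - F (expectile_at \<tau>))"
    using expectile_survival_bound[OF sq] by metis
  have "\<forall>\<^sub>F n in sequentially. 1 - \<tau> n \<le> c * (xe - \<xi> n) * (1 - F (\<xi> n))"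
    using ev[OF c(2)] by eventually_elim (use c \<tau> in \<open>auto simp: \<xi>_def\<close>)
  then show "\<exists>c>0. \<forall>\<^sub>F n in sequentially. 1 - \<tau> n \<le> c * (xe - \<xi> n) * (1 - F (\<xi> n))" using c(1) by blast
  obtain L c x0 where *: "L > 0 \<and> c > 0 \<and> x0 < xe \<and> (\<forall>x. x0 \<le> x \<longrightarrow> x < xe \<longrightarrow>
     S x > 1 \<and> c * \<bar>A (S x)\<bar> \<le> 1/2 \<and> \<bar>xe - x + a (S x) / g\<bar> \<le> c * \<bar>A (S x)\<bar> * (xe - x) \<and>
     (\<forall>y. x \<le> y \<longrightarrow> y < xe \<longrightarrow> \<bar>A (S y)\<bar> \<le> c * \<bar>A (S x)\<bar> \<and>
        \<bar>1 - F y - ((xe - y) / L) powr (- 1 / g)\<bar> \<le> c * \<bar>A (S x)\<bar> * ((xe - y) / L) powr (- 1 / g)))"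
    using survival_expansion by (elim exE) (rule that)
  have x0: "x0 < xe" using * by simp
  show "\<forall>\<^sub>F n in sequentially. a (S (\<xi> n)) \<ge> (- g / 2) * (xe - \<xi> n) \<and> a (S (\<xi> n)) \<le> (- 2 * g) * (xe - \<xi> n)"
    using 1[OF x0]
  proof eventually_elim
    case (elim n)
    define w where "w = xe - \<xi> n"
    define v where "v = a (S (\<xi> n))"
    have w: "w > 0" using elim by (simp add: w_def)
    have "\<bar>w + v / g\<bar> \<le> c * \<bar>A (S (\<xi> n))\<bar> * w" using * elim by (auto simp: w_def v_def)
    also have "\<dots> \<le> 1/2 * w" using * elim w by (intro mult_right_mono) auto
    finally have "\<bar>w + v / g\<bar> \<le> 1/2 * w" .
    then have "v / g \<le> - (w / 2)" "v / g \<ge> - (3 / 2 * w)" unfolding abs_le_iff by linarith+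
    then have "v \<ge> g * - (w / 2)" "v \<le> g * - (3 / 2 * w)"
      using g by (simp_all add: neg_divide_le_eq neg_le_divide_eq mult.commute)
    moreover have "g * - (3 / 2 * w) \<le> g * - (2 * w)" using g w by (intro mult_left_mono_neg) auto
    ultimately show ?case unfolding w_def[symmetric] v_def[symmetric] by (simp add: algebra_simps)
  qed
qed

text \<open>Write \<open>w = xe - \<xi>\<close>, \<open>v = a (S \<xi>)\<close> and \<open>m\<close>
  for the square root of \<open>n * (1 - \<tau>)\<close>. A displacement by
  \<open>\<epsilon> * v / m\<close> shifts the mean score by about
  \<open>\<phi> * \<epsilon> * v / m\<close>, and \<open>k\<close> is chosen so that this moves the
  normalised sum by about \<epsilon>. At this scale the exceedances contribute variance of order
  \<open>(1 - \<tau>) / \<phi> = O(w)\<close> and the lower part one of order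
  \<open>w * rl * \<phi>\<close>; both vanish.\<close>

lemma score_sum_to_zero:
  fixes \<Omega> :: "'b measure" and Z :: "nat \<Rightarrow> 'b \<Rightarrow> real" and \<tau> \<alpha> x :: "nat \<Rightarrow> real" and rl :: "nat \<Rightarrow> nat"
  assumes \<Omega>: "prob_space \<Omega>"
    and Z: "\<And>t. t \<ge> 1 \<Longrightarrow> Z t \<in> borel_measurable \<Omega>" "\<And>t. t \<ge> 1 \<Longrightarrow> distr \<Omega> borel (Z t) = M"
    and sq: "integrable M (\<lambda>z. z\<^sup>2)" and \<tau>: "\<And>n. 0 < \<tau> n \<and> \<tau> n < 1" "\<tau> \<longlonglongrightarrow> 1"
  defines "\<xi> \<equiv> \<lambda>n. expectile_at (\<tau> n)"
  defines "\<phi> \<equiv> \<lambda>n. 1 - F (\<xi> n)"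
  defines "k \<equiv> \<lambda>n. sqrt (real n * (1 - \<tau> n)) / (real n * \<phi> n * a (S (\<xi> n)))"
  defines "\<mu> \<equiv> \<lambda>n. (2 * \<tau> n - 1) * excess (x n) + (1 - \<tau> n) * (mean - x n)"
  assumes rl: "\<forall>\<^sub>F n in sequentially. 1 \<le> rl n \<and> rl n \<le> n \<and> mixing_bound \<Omega> Z (rl n) (\<alpha> n)"
    and \<alpha>: "(\<lambda>n. (real n / real (rl n) + 1) * \<alpha> n) \<longlonglongrightarrow> 0"
    and rl\<phi>: "(\<lambda>n. real (rl n) * \<phi> n) \<longlonglongrightarrow> 0"
    and joint: "\<exists>C. \<forall>\<^sub>F n in sequentially. \<forall>s\<ge>1.
       (\<Sum>j\<in>{1..<rl n}. measure \<Omega> {\<omega> \<in> space \<Omega>. Z s \<omega> > x n \<and> Z (s + j) \<omega> > x n}) \<le> C * (1 - F (x n))"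
    and x0: "x0 < xe" and x: "\<forall>\<^sub>F n in sequentially. x0 \<le> x n \<and> x n < xe \<and> xe - x n \<le> 2 * (xe - \<xi> n)"
    and c0: "\<forall>\<^sub>F n in sequentially. 1 - F (x n) \<le> c0 * \<phi> n"
  shows "to_zero_in_probability \<Omega> (\<lambda>n \<omega>. \<Sum>t=1..n. k n * (expectile_score (\<tau> n) (Z t \<omega> - x n) - \<mu> n))"
proof -
  interpret P: prob_space \<Omega> by fact
  define w where "w n = xe - \<xi> n" for n
  define v where "v n = a (S (\<xi> n))" for n
  have xi: "expectile_at (\<tau> n) = \<xi> n" for n by (simp add: \<xi>_def)
  note facts = expectile_sequence_facts[OF sq \<tau>, unfolded xi]
  obtain c where c: "c > 0" "\<forall>\<^sub>F n in sequentially. 1 - \<tau> n \<le> c * w n * \<phi> n"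
    using facts(4) unfolding w_def \<phi>_def by auto
  have vw: "\<forall>\<^sub>F n in sequentially. v n \<ge> (- g / 2) * w n"
    using facts(5) unfolding v_def w_def by (auto elim: eventually_mono)
  have w_pos: "\<forall>\<^sub>F n in sequentially. w n > 0 \<and> \<phi> n > 0 \<and> 1/2 < \<tau> n"
    using facts(1)[OF x0]
  proof eventually_elim
    case (elim n)
    then show ?case using F_less_one_iff[of "\<xi> n"] by (simp add: w_def \<phi>_def)
  qed
  have w0: "w \<longlonglongrightarrow> 0" using facts(2) by (simp add: w_def[abs_def])
  obtain C where C: "\<forall>\<^sub>F n in sequentially. \<forall>s\<ge>1.
       (\<Sum>j\<in>{1..<rl n}. measure \<Omega> {\<omega> \<in> space \<Omega>. Z s \<omega> > x n \<and> Z (s + j) \<omega> > x n}) \<le> C * (1 - F (x n))"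
    using joint by blast
  \<comment> \<open>Bounds the second moment about \<open>x n\<close> uniformly in \<open>n\<close>,
    as \<open>x n\<close> stays between \<open>x0\<close> and \<open>xe\<close>.\<close>
  define V where "V = 2 * (\<integral>z. z\<^sup>2 \<partial>M) + 2 * (\<bar>x0\<bar> + \<bar>xe\<bar>)\<^sup>2"
  have id: "integrable M (\<lambda>z. z)" by (rule integrable_id_of_square[OF sq])
  have E: "(\<integral>\<omega>. h (Z t \<omega>) \<partial>\<Omega>) = (\<integral>z. h z \<partial>M)" "integrable \<Omega> (\<lambda>\<omega>. h (Z t \<omega>)) \<longleftrightarrow> integrable M h"
    if "t \<ge> 1" "h \<in> borel_measurable borel" for t and h :: "real \<Rightarrow> real"
  proof -
    show "(\<integral>\<omega>. h (Z t \<omega>) \<partial>\<Omega>) = (\<integral>z. h z \<partial>M)"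
      unfolding Z(2)[OF that(1), symmetric] using Z(1)[OF that(1)] that by (intro integral_distr[symmetric]) auto
    show "integrable \<Omega> (\<lambda>\<omega>. h (Z t \<omega>)) \<longleftrightarrow> integrable M h"
      unfolding Z(2)[OF that(1), symmetric] using Z(1)[OF that(1)] that by (intro integrable_distr_eq[symmetric]) auto
  qed
  define W where "W n = xe - x n" for n
  define \<beta> where "\<beta> n = (k n)\<^sup>2 * (2 * (W n)\<^sup>2 * (rl n * (1 + 2 * C) * (1 - F (x n))) + 2 * (1 - \<tau> n)\<^sup>2 * (rl n * (rl n * V)))" for n
  define f where "f n z = k n * (expectile_score (\<tau> n) (z - x n) - \<mu> n)" for n z
  have "to_zero_in_probability \<Omega> (\<lambda>n \<omega>. \<Sum>t=1..n. f n (Z t \<omega>))"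
  proof (rule P.block_sum_to_zero[OF Z(1)])
    show "f n \<in> borel_measurable borel" for n unfolding f_def by measurable
    show "(\<lambda>n. (real n / real (rl n) + 1) * \<alpha> n) \<longlonglongrightarrow> 0" by fact
    show "\<forall>\<^sub>F n in sequentially. 1 \<le> rl n \<and> mixing_bound \<Omega> Z (rl n) (\<alpha> n) \<and>
      (\<forall>t\<ge>1. integrable \<Omega> (\<lambda>x. (f n (Z t x))\<^sup>2) \<and> P.expectation (\<lambda>x. f n (Z t x)) = 0) \<and>
      (\<forall>c. P.expectation (\<lambda>x. (\<Sum>t\<in>{c<..c + rl n} \<inter> {1..n}. f n (Z t x))\<^sup>2) \<le> \<beta> n)"
      using rl C x w_pos
    proof eventually_elim
      case (elim n)
      have mz: "(\<lambda>z. (z - x n)\<^sup>2) \<in> borel_measurable borel" by measurable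
      have sqx: "integrable M (\<lambda>z. (z - x n)\<^sup>2)"
        unfolding power2_diff using sq id by (intro Bochner_Integration.integrable_add Bochner_Integration.integrable_diff) auto
      have V: "(\<integral>z. (z - x n)\<^sup>2 \<partial>M) \<le> V"
      proof -
        have "(\<integral>z. (z - x n)\<^sup>2 \<partial>M) \<le> (\<integral>z. 2 * z\<^sup>2 + 2 * (\<bar>x0\<bar> + \<bar>xe\<bar>)\<^sup>2 \<partial>M)"
        proof (rule integral_mono[OF sqx])
          show "integrable M (\<lambda>z. 2 * z\<^sup>2 + 2 * (\<bar>x0\<bar> + \<bar>xe\<bar>)\<^sup>2)" using sq by auto
          fix z
          have "\<bar>x n\<bar> \<le> \<bar>\<bar>x0\<bar> + \<bar>xe\<bar>\<bar>" using elim by linarith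
          then have "(x n)\<^sup>2 \<le> (\<bar>x0\<bar> + \<bar>xe\<bar>)\<^sup>2" by (rule abs_le_square_iff[THEN iffD1])
          moreover have "0 \<le> (z + x n)\<^sup>2" by simp
          then have "(z - x n)\<^sup>2 \<le> 2 * z\<^sup>2 + 2 * (x n)\<^sup>2" by (simp add: power2_eq_square algebra_simps)
          ultimately show "(z - x n)\<^sup>2 \<le> 2 * z\<^sup>2 + 2 * (\<bar>x0\<bar> + \<bar>xe\<bar>)\<^sup>2" by linarith
        qed
        also have "\<dots> = V" using sq prob_space[unfolded space_eq_univ] by (simp add: V_def)
        finally show ?thesis .
      qed
      have mscore: "(\<lambda>z. expectile_score (\<tau> n) (z - x n)) \<in> borel_measurable borel" by measurable
      have sI: "integrable \<Omega> (\<lambda>\<omega>. expectile_score (\<tau> n) (Z t \<omega> - x n))"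
        and sE: "P.expectation (\<lambda>\<omega>. expectile_score (\<tau> n) (Z t \<omega> - x n)) = \<mu> n" if "t \<ge> 1" for t
        using E(1)[OF that mscore] E(2)[OF that mscore] score_integrable[OF id] mean_score[OF id] by (auto simp: \<mu>_def)
      have tail: "P.prob {\<omega> \<in> space \<Omega>. Z t \<omega> > x n} = 1 - F (x n)" if "t \<ge> 1" for t
      proof -
        have "1 - F (x n) = measure (distr \<Omega> borel (Z t)) {x n<..}" using survival_eq Z(2)[OF that] by simp
        also have "\<dots> = P.prob (Z t -` {x n<..} \<inter> space \<Omega>)" using Z(1)[OF that] by (intro measure_distr) auto
        also have "Z t -` {x n<..} \<inter> space \<Omega> = {\<omega> \<in> space \<Omega>. Z t \<omega> > x n}" by auto
        finally show ?thesis by simp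
      qed
      have AE: "AE \<omega> in \<Omega>. Z t \<omega> - x n \<le> W n" if "t \<ge> 1" for t
      proof -
        have "AE z in distr \<Omega> borel (Z t). z \<le> xe" unfolding Z(2)[OF that] by (rule AE_le_xe)
        then have "AE \<omega> in \<Omega>. Z t \<omega> \<le> xe" using Z(1)[OF that] by (subst (asm) AE_distr_iff) auto
        then show ?thesis by eventually_elim (simp add: W_def)
      qed
      have sm: "integrable \<Omega> (\<lambda>\<omega>. (\<Sum>t\<in>{b<..b + q} \<inter> {1..n'}. expectile_score (\<tau> n) (Z t \<omega> - x n))\<^sup>2)"
        and sm': "P.expectation (\<lambda>\<omega>. (\<Sum>t\<in>{b<..b + q} \<inter> {1..n'}. expectile_score (\<tau> n) (Z t \<omega> - x n))\<^sup>2)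
          \<le> 2 * (W n)\<^sup>2 * (q * (1 + 2 * C) * (1 - F (x n))) + 2 * (1 - \<tau> n)\<^sup>2 * (q * (q * V))"
        if q: "q \<le> rl n" for b q n' :: nat
      proof -
        have j: "(\<Sum>j\<in>{1..<q}. P.prob {\<omega> \<in> space \<Omega>. Z s \<omega> > x n \<and> Z (s + j) \<omega> > x n}) \<le> C * (1 - F (x n))" if "s \<ge> 1" for s
        proof -
          have "(\<Sum>j\<in>{1..<q}. P.prob {\<omega> \<in> space \<Omega>. Z s \<omega> > x n \<and> Z (s + j) \<omega> > x n})
              \<le> (\<Sum>j\<in>{1..<rl n}. P.prob {\<omega> \<in> space \<Omega>. Z s \<omega> > x n \<and> Z (s + j) \<omega> > x n})"
            using q by (intro sum_mono2) auto
          also have "\<dots> \<le> C * (1 - F (x n))" using elim that by blast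
          finally show ?thesis .
        qed
        note * = P.block_score_second_moment[OF Z(1) _ _ AE _ _ j, where V = V]
        show "integrable \<Omega> (\<lambda>\<omega>. (\<Sum>t\<in>{b<..b + q} \<inter> {1..n'}. expectile_score (\<tau> n) (Z t \<omega> - x n))\<^sup>2)"
          by (rule *(1)) (use \<tau> elim V E[OF _ mz] sqx tail in \<open>auto simp: W_def\<close>)
        show "P.expectation (\<lambda>\<omega>. (\<Sum>t\<in>{b<..b + q} \<inter> {1..n'}. expectile_score (\<tau> n) (Z t \<omega> - x n))\<^sup>2)
          \<le> 2 * (W n)\<^sup>2 * (q * (1 + 2 * C) * (1 - F (x n))) + 2 * (1 - \<tau> n)\<^sup>2 * (q * (q * V))"
          by (rule *(2)) (use \<tau> elim V E[OF _ mz] sqx tail in \<open>auto simp: W_def\<close>)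
      qed
      have sI2: "integrable \<Omega> (\<lambda>\<omega>. (expectile_score (\<tau> n) (Z t \<omega> - x n))\<^sup>2)" if "t \<ge> 1" for t
      proof -
        \<comment> \<open>Square integrability of a single score is the block estimate for a block
          of length 1.\<close>
        have "{t - 1<..t - 1 + 1} \<inter> {1..t} = {t}" using that by auto
        then show ?thesis using sm[of 1 "t - 1" t] elim by simp
      qed
      show ?case
      proof (intro conjI allI impI)
        fix t :: nat assume t: "1 \<le> t"
        show "P.expectation (\<lambda>x. f n (Z t x)) = 0"
          unfolding f_def using sI[OF t] sE[OF t] by (simp add: P.prob_space)
        show "integrable \<Omega> (\<lambda>x. (f n (Z t x))\<^sup>2)"
          unfolding f_def power_mult_distrib power2_diff
          by (intro integrable_mult_right Bochner_Integration.integrable_add Bochner_Integration.integrable_diff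
              sI2[OF t] integrable_mult_left sI[OF t]) auto
      next
        fix b :: nat
        define I where "I = {b<..b + rl n} \<inter> {1..n}"
        define Y where "Y \<omega> = (\<Sum>t\<in>I. expectile_score (\<tau> n) (Z t \<omega> - x n))" for \<omega>
        have I1: "t \<ge> 1" if "t \<in> I" for t using that by (auto simp: I_def)
        have YI: "integrable \<Omega> Y" unfolding Y_def by (intro Bochner_Integration.integrable_sum sI I1)
        have EY: "P.expectation Y = card I * \<mu> n"
        proof -
          have "P.expectation Y = (\<Sum>t\<in>I. P.expectation (\<lambda>\<omega>. expectile_score (\<tau> n) (Z t \<omega> - x n)))"
            unfolding Y_def by (intro Bochner_Integration.integral_sum sI I1)
          also have "\<dots> = (\<Sum>t\<in>I. \<mu> n)" by (intro sum.cong refl sE I1)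
          finally show ?thesis by simp
        qed
        have "(\<Sum>t\<in>I. f n (Z t \<omega>)) = k n * (Y \<omega> - P.expectation Y)" for \<omega>
          unfolding EY Y_def f_def by (simp add: sum_distrib_left[symmetric] sum_subtractf)
        then have "P.expectation (\<lambda>\<omega>. (\<Sum>t\<in>I. f n (Z t \<omega>))\<^sup>2) = (k n)\<^sup>2 * P.variance Y"
          by (simp add: power_mult_distrib)
        \<comment> \<open>Centring only lowers the second moment, so the estimate for the raw block
          sum also bounds the variance.\<close>
        also have "P.variance Y = P.expectation (\<lambda>\<omega>. (Y \<omega>)\<^sup>2) - (P.expectation Y)\<^sup>2"
        proof (rule P.variance_eq[OF YI])
          show "integrable \<Omega> (\<lambda>\<omega>. (Y \<omega>)\<^sup>2)" unfolding Y_def I_def by (rule sm) simp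
        qed
        also have "(k n)\<^sup>2 * \<dots> \<le> \<beta> n"
          unfolding \<beta>_def
        proof (intro mult_left_mono)
          have "P.expectation (\<lambda>\<omega>. (Y \<omega>)\<^sup>2) \<le> 2 * (W n)\<^sup>2 * (rl n * (1 + 2 * C) * (1 - F (x n))) + 2 * (1 - \<tau> n)\<^sup>2 * (rl n * (rl n * V))"
            unfolding Y_def I_def by (rule sm') simp
          then show "P.expectation (\<lambda>\<omega>. (Y \<omega>)\<^sup>2) - (P.expectation Y)\<^sup>2
            \<le> 2 * (W n)\<^sup>2 * (rl n * (1 + 2 * C) * (1 - F (x n))) + 2 * (1 - \<tau> n)\<^sup>2 * (rl n * (rl n * V))"
            using zero_le_power2[of "P.expectation Y"] by linarith
        qed simp
        finally show "P.expectation (\<lambda>x. (\<Sum>t\<in>{b<..b + rl n} \<inter> {1..n}. f n (Z t x))\<^sup>2) \<le> \<beta> n"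
          by (simp add: I_def)
      qed (use elim in auto)
    qed
    \<comment> \<open>\<open>K1\<close> and \<open>K2\<close> collect the constants of the
      exceedance part and of the lower part. The factor \<open>4 / g\<^sup>2\<close> bounds the
      square of \<open>w / v\<close>, and the number of blocks enters through
      \<open>n / rl + 1 \<le> 2 * n / rl\<close>.\<close>
    define K1 where "K1 = 4 * \<bar>1 + 2 * C\<bar> * 4 * \<bar>c0\<bar> * (4 / g\<^sup>2) * c"
    define K2 where "K2 = 4 * \<bar>V\<bar> * c * c\<^sup>2 * (4 / g\<^sup>2)"
    show "(\<lambda>n. (real n / real (rl n) + 1) * \<beta> n) \<longlonglongrightarrow> 0"
    proof (rule Lim_null_comparison)
      have "(\<lambda>n. K1 * w n + K2 * w n * (real (rl n) * \<phi> n)) \<longlonglongrightarrow> K1 * 0 + K2 * 0 * 0"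
        by (intro tendsto_intros w0 rl\<phi>)
      then show "(\<lambda>n. K1 * w n + K2 * w n * (real (rl n) * \<phi> n)) \<longlonglongrightarrow> 0" by simp
      show "\<forall>\<^sub>F n in sequentially. norm ((real n / real (rl n) + 1) * \<beta> n) \<le> K1 * w n + K2 * w n * (real (rl n) * \<phi> n)"
        using rl x c0 c(2) vw w_pos
      proof eventually_elim
        case (elim n)
        let ?N = "real n" and ?R = "real (rl n)" and ?t = "1 - \<tau> n" and ?p = "1 - F (x n)"
        have NR: "?R \<ge> 1" "?N \<ge> ?R" "?N > 0" using elim by auto
        have t: "?t > 0" "?t \<le> c * w n * \<phi> n" using \<tau> elim by auto
        have w: "w n > 0" "\<phi> n > 0" using elim by auto
        have v: "v n > 0"
        proof -
          have "0 < - g / 2 * w n" using w g by (intro mult_pos_pos) auto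
          then show ?thesis using elim by linarith
        qed
        have p: "0 \<le> ?p" "?p \<le> \<bar>c0\<bar> * \<phi> n"
        proof -
          show "0 \<le> ?p" using cdf_bounded_prob[of "x n"] by simp
          have "c0 * \<phi> n \<le> \<bar>c0\<bar> * \<phi> n" using w by (intro mult_right_mono) auto
          then show "?p \<le> \<bar>c0\<bar> * \<phi> n" using elim by linarith
        qed
        have W: "0 \<le> W n" "W n \<le> 2 * w n" using elim by (auto simp: W_def w_def)
        have wv: "(w n)\<^sup>2 / (v n)\<^sup>2 \<le> 4 / g\<^sup>2"
        proof -
          have "w n \<le> 2 / (- g) * v n" using elim g by (simp add: field_simps)
          then have "w n / v n \<le> 2 / (- g)" using v by (simp add: divide_le_eq)
          then have "(w n / v n)\<^sup>2 \<le> (2 / (- g))\<^sup>2" using w v by (intro power_mono) auto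
          then show ?thesis by (simp add: power_divide)
        qed
        have k2: "(k n)\<^sup>2 = ?t / (?N * (\<phi> n)\<^sup>2 * (v n)\<^sup>2)"
        proof -
          have "(sqrt (?N * ?t))\<^sup>2 = ?N * ?t" using t by simp
          then show ?thesis unfolding k_def power_divide v_def[symmetric]
            using NR(3) by (simp add: power_mult_distrib power2_eq_square)
        qed
        have NN: "?N / ?R + 1 \<le> 2 * ?N / ?R" using NR by (simp add: field_simps)
        define b1 where "b1 = 2 * (W n)\<^sup>2 * (?R * \<bar>1 + 2 * C\<bar> * ?p)"
        define b2 where "b2 = 2 * ?t\<^sup>2 * (?R * (?R * \<bar>V\<bar>))"
        have b: "b1 \<ge> 0" "b2 \<ge> 0" using p NR by (auto simp: b1_def b2_def)
        have "\<bar>2 * (W n)\<^sup>2 * (?R * (1 + 2 * C) * ?p) + 2 * ?t\<^sup>2 * (?R * (?R * V))\<bar> \<le> b1 + b2"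
          unfolding b1_def b2_def using p NR by (intro order_trans[OF abs_triangle_ineq]) (simp add: abs_mult)
        then have "norm ((?N / ?R + 1) * \<beta> n) \<le> (2 * ?N / ?R) * ((k n)\<^sup>2 * (b1 + b2))"
          unfolding real_norm_def abs_mult \<beta>_def using NN NR
          by (intro mult_mono mult_nonneg_nonneg) (auto simp: abs_mult)
        also have "\<dots> = (2 * ?N / ?R) * ((k n)\<^sup>2 * b1) + (2 * ?N / ?R) * ((k n)\<^sup>2 * b2)"
          by (simp only: distrib_left)
        also have "(2 * ?N / ?R) * ((k n)\<^sup>2 * b1) = 4 * \<bar>1 + 2 * C\<bar> * ((W n)\<^sup>2 * ?p * ?t / ((\<phi> n)\<^sup>2 * (v n)\<^sup>2))"
        proof -
          have "2 * N / R * (t / (N * q * v) * (2 * y * (R * C * p))) = 4 * C * (y * p * t / (q * v))"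
            if "N > 0" "R > 0" for N R t q v y C p :: real
            using that by (simp add: field_simps)
          then show ?thesis unfolding k2 b1_def using NR by simp
        qed
        also have "\<dots> \<le> 4 * \<bar>1 + 2 * C\<bar> * ((2 * w n)\<^sup>2 * (\<bar>c0\<bar> * \<phi> n) * (c * w n * \<phi> n) / ((\<phi> n)\<^sup>2 * (v n)\<^sup>2))"
          using W p t c w by (intro mult_left_mono divide_right_mono mult_mono power_mono) auto
        also have "\<dots> = 4 * \<bar>1 + 2 * C\<bar> * 4 * \<bar>c0\<bar> * c * w n * ((w n)\<^sup>2 / (v n)\<^sup>2)"
          using w v by (simp add: power2_eq_square field_simps)
        also have "\<dots> \<le> 4 * \<bar>1 + 2 * C\<bar> * 4 * \<bar>c0\<bar> * c * w n * (4 / g\<^sup>2)"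
          using wv w c by (intro mult_left_mono) auto
        also have "\<dots> = K1 * w n" by (simp add: K1_def)
        also have "(2 * ?N / ?R) * ((k n)\<^sup>2 * b2) = 4 * \<bar>V\<bar> * (?R * (?t * (?t\<^sup>2 / ((\<phi> n)\<^sup>2 * (v n)\<^sup>2))))"
        proof -
          have "2 * N / R * (t / (N * q * v) * (2 * t\<^sup>2 * (R * (R * V)))) = 4 * V * (R * (t * (t\<^sup>2 / (q * v))))"
            if "N > 0" "R > 0" for N R t q v V :: real
            using that by (simp add: field_simps power2_eq_square)
          then show ?thesis unfolding k2 b2_def using NR by simp
        qed
        also have "\<dots> \<le> 4 * \<bar>V\<bar> * (?R * ((c * w n * \<phi> n) * ((c * w n * \<phi> n)\<^sup>2 / ((\<phi> n)\<^sup>2 * (v n)\<^sup>2))))"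
          using t w c NR by (intro mult_left_mono mult_mono divide_right_mono power_mono) auto
        also have "\<dots> = 4 * \<bar>V\<bar> * c * c\<^sup>2 * w n * (?R * \<phi> n) * ((w n)\<^sup>2 / (v n)\<^sup>2)"
          using w v by (simp add: power2_eq_square field_simps)
        also have "\<dots> \<le> 4 * \<bar>V\<bar> * c * c\<^sup>2 * w n * (?R * \<phi> n) * (4 / g\<^sup>2)"
          using wv w c NR by (intro mult_left_mono) auto
        also have "\<dots> = K2 * w n * (?R * \<phi> n)" by (simp add: K2_def)
        finally show ?case by simp
      qed
    qed
  qed
  then show ?thesis by (simp add: f_def)
qed

end

context second_order_distribution
begin

text \<open>It suffices to look at the sign of the empirical score at the two points \<open>\<xi> n \<plusminus> \<epsilon> v n / m n\<close>, where
  its mean is bounded away from zero on the scale on which its fluctuations vanish.\<close>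
theorem expectile_consistency:
  fixes \<Omega> :: "'b measure" and Z :: "nat \<Rightarrow> 'b \<Rightarrow> real" and \<tau> \<alpha> :: "nat \<Rightarrow> real" and rl :: "nat \<Rightarrow> nat"
  assumes \<Omega>: "prob_space \<Omega>"
    and Z: "\<And>t. t \<ge> 1 \<Longrightarrow> Z t \<in> borel_measurable \<Omega>" "\<And>t. t \<ge> 1 \<Longrightarrow> distr \<Omega> borel (Z t) = M"
    and sq: "integrable M (\<lambda>z. z\<^sup>2)" and \<tau>: "\<And>n. 0 < \<tau> n \<and> \<tau> n < 1" "\<tau> \<longlonglongrightarrow> 1"
  defines "\<xi> \<equiv> \<lambda>n. expectile_at (\<tau> n)"
  defines "\<phi> \<equiv> \<lambda>n. 1 - F (\<xi> n)"
  assumes n_tau: "filterlim (\<lambda>n. real n * (1 - \<tau> n)) at_top sequentially"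
    and r: "\<forall>\<^sub>F n in sequentially. 1 \<le> rl n \<and> rl n \<le> n \<and> mixing_bound \<Omega> Z (rl n) (\<alpha> n)"
    and \<alpha>: "(\<lambda>n. (real n / real (rl n) + 1) * \<alpha> n) \<longlonglongrightarrow> 0"
    and r\<phi>: "(\<lambda>n. real (rl n) * \<phi> n) \<longlonglongrightarrow> 0"
    and joint: "\<And>x c0. \<forall>\<^sub>F n in sequentially. x n < xe \<and> 1 - F (x n) \<le> c0 * \<phi> n \<Longrightarrow>
      \<exists>C. \<forall>\<^sub>F n in sequentially. \<forall>s\<ge>1.
       (\<Sum>j\<in>{1..<rl n}. measure \<Omega> {\<omega> \<in> space \<Omega>. Z s \<omega> > x n \<and> Z (s + j) \<omega> > x n}) \<le> C * (1 - F (x n))"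
  shows "to_zero_in_probability \<Omega> (\<lambda>n \<omega>. sqrt (real n * (1 - \<tau> n)) / a (S (\<xi> n)) *
      (empirical_expectile (\<tau> n) n (\<lambda>t. Z t \<omega>) - \<xi> n))"
  unfolding to_zero_in_probability_def
proof (intro allI impI)
  fix \<epsilon> :: real assume \<epsilon>: "\<epsilon> > 0"
  interpret P: prob_space \<Omega> by fact
  define w where "w n = xe - \<xi> n" for n
  define v where "v n = a (S (\<xi> n))" for n
  define m where "m n = sqrt (real n * (1 - \<tau> n))" for n
  have xi: "expectile_at (\<tau> n) = \<xi> n" for n by (simp add: \<xi>_def)
  note facts = expectile_sequence_facts[OF sq \<tau>, unfolded xi]
  obtain c0 x0 where c0: "c0 > 0" "x0 < xe"
    and cmp: "\<And>x y. x0 \<le> x \<Longrightarrow> x < xe \<Longrightarrow> x0 \<le> y \<Longrightarrow> y < xe \<Longrightarrow> xe - y \<le> 2 * (xe - x) \<Longrightarrow> 1 - F y \<le> c0 * (1 - F x)"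
    using survival_comparable by metis
  have m_lim: "filterlim m at_top sequentially"
    unfolding m_def by (rule filterlim_compose[OF sqrt_at_top n_tau])
  define k where "k n = m n / (real n * \<phi> n * v n)" for n
  define \<mu> where "\<mu> x n = (2 * \<tau> n - 1) * excess (x n) + (1 - \<tau> n) * (mean - x n)" for x n
  define d where "d n = \<epsilon> * v n / m n" for n
  define xp where "xp n = \<xi> n + d n" for n
  define xm where "xm n = \<xi> n - d n" for n
  have "(\<lambda>n. 4 * \<epsilon> * - g / m n) \<longlonglongrightarrow> 0"
    using m_lim by (intro tendsto_divide_0[OF tendsto_const] filterlim_at_top_imp_at_infinity)
  then have "\<forall>\<^sub>F n in sequentially. 4 * \<epsilon> * - g / m n < 1" by (rule order_tendstoD) simp
  moreover have "\<forall>\<^sub>F n in sequentially. m n > 0" using m_lim by (simp add: filterlim_at_top_dense)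
  \<comment> \<open>Beyond the midpoint of \<open>x0\<close> and \<open>xe\<close> one has
    \<open>\<xi> - w \<ge> x0\<close>, so the left test point also stays in the region where
    survival probabilities are comparable.\<close>
  moreover have "x0 + (xe - x0) / 2 < xe" using c0 by (simp add: field_simps)
  note facts(1)[OF this]
  ultimately have ev: "\<forall>\<^sub>F n in sequentially. m n > 0 \<and> v n > 0 \<and> w n > 0 \<and> \<phi> n > 0 \<and> 3/4 < \<tau> n \<and> n \<ge> 1 \<and>
      0 < d n \<and> d n \<le> w n / 2 \<and> x0 \<le> \<xi> n \<and> x0 \<le> \<xi> n - w n"
    using facts(5) eventually_ge_at_top[of 1] order_tendstoD(1)[OF \<tau>(2), of "3/4", simplified]
  proof eventually_elim
    case (elim n)
    have w: "w n > 0" using elim by (simp add: w_def)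
    have "0 < - g / 2 * w n" using w g by (intro mult_pos_pos) auto
    then have v: "v n > 0" using elim by (simp add: v_def w_def)
    have "\<epsilon> * v n \<le> \<epsilon> * (- 2 * g * w n)" using elim \<epsilon> by (intro mult_left_mono) (auto simp: v_def w_def)
    then have "\<epsilon> * v n / m n \<le> \<epsilon> * (- 2 * g * w n) / m n" using elim by (intro divide_right_mono) auto
    also have "\<dots> = (4 * \<epsilon> * - g / m n) * (w n / 2)" by simp
    also have "\<dots> \<le> 1 * (w n / 2)" using elim w by (intro mult_right_mono) auto
    finally have "\<epsilon> * v n / m n \<le> w n / 2" by simp
    moreover have "\<phi> n > 0" using F_less_one_iff[of "\<xi> n"] elim by (simp add: \<phi>_def)
    moreover have "2 * x0 + (xe - x0) < 2 * \<xi> n" using elim(3) by (simp add: field_simps)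
    moreover have "d n > 0" using \<epsilon> v elim by (simp add: d_def)
    ultimately show ?case using elim w v c0(2) by (auto simp: w_def d_def)
  qed
  have root: "\<forall>\<^sub>F n in sequentially. (2 * \<tau> n - 1) * excess (\<xi> n) + (1 - \<tau> n) * (mean - \<xi> n) = 0"
    using ev
  proof eventually_elim
    case (elim n)
    then show ?case using expectile_root(2)[OF sq, of "\<tau> n"] \<tau>(1)[of n] by (simp add: xi algebra_simps)
  qed
  have zero: "to_zero_in_probability \<Omega> (\<lambda>n \<omega>. \<Sum>t=1..n. k n * (expectile_score (\<tau> n) (Z t \<omega> - x n) - \<mu> x n))"
    if x: "\<forall>\<^sub>F n in sequentially. x0 \<le> x n \<and> x n < xe \<and> xe - x n \<le> 2 * w n" for x
  proof -
    have cx: "\<forall>\<^sub>F n in sequentially. x n < xe \<and> 1 - F (x n) \<le> c0 * \<phi> n"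
      using x ev
    proof eventually_elim
      case (elim n)
      then show ?case using cmp[of "\<xi> n" "x n"] by (simp add: \<phi>_def w_def)
    qed
    show ?thesis
      unfolding k_def \<mu>_def m_def v_def \<phi>_def \<xi>_def
    proof (rule score_sum_to_zero[OF \<Omega> Z sq \<tau> r \<alpha> _ _ c0(2)])
      show "(\<lambda>n. real (rl n) * (1 - F (expectile_at (\<tau> n)))) \<longlonglongrightarrow> 0" using r\<phi> by (simp add: \<phi>_def \<xi>_def)
      show "\<exists>C. \<forall>\<^sub>F n in sequentially. \<forall>s\<ge>1.
       (\<Sum>j\<in>{1..<rl n}. measure \<Omega> {\<omega> \<in> space \<Omega>. Z s \<omega> > x n \<and> Z (s + j) \<omega> > x n}) \<le> C * (1 - F (x n))"
        by (rule joint[OF cx])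
      show "\<forall>\<^sub>F n in sequentially. x0 \<le> x n \<and> x n < xe \<and> xe - x n \<le> 2 * (xe - expectile_at (\<tau> n))"
        using x by (simp add: w_def \<xi>_def)
      show "\<forall>\<^sub>F n in sequentially. 1 - F (x n) \<le> c0 * (1 - F (expectile_at (\<tau> n)))"
        using cx by (auto simp: \<phi>_def \<xi>_def elim: eventually_mono)
    qed
  qed
  \<comment> \<open>With \<open>b = max c0 1\<close> the normalised drift at either test point is at
    least \<open>\<epsilon> / (2 * b) = 2 * \<eta>\<close>, so a score of the wrong sign forces a
    fluctuation larger than \<eta>.\<close>
  define \<eta> where "\<eta> = \<epsilon> / (4 * max c0 1)"
  have \<eta>: "\<eta> > 0" using \<epsilon> by (simp add: \<eta>_def)
  define Ep where "Ep n = {\<omega> \<in> space \<Omega>. \<eta> < \<bar>\<Sum>t=1..n. k n * (expectile_score (\<tau> n) (Z t \<omega> - xp n) - \<mu> xp n)\<bar>}" for n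
  define Em where "Em n = {\<omega> \<in> space \<Omega>. \<eta> < \<bar>\<Sum>t=1..n. k n * (expectile_score (\<tau> n) (Z t \<omega> - xm n) - \<mu> xm n)\<bar>}" for n
  have sets: "{\<omega> \<in> space \<Omega>. \<eta> < \<bar>\<Sum>t=1..n. c * (expectile_score t' (Z t \<omega> - x) - d)\<bar>} \<in> P.events" for n c t' x d
  proof -
    have "(\<lambda>\<omega>. \<Sum>t=1..n. c * (expectile_score t' (Z t \<omega> - x) - d)) \<in> borel_measurable \<Omega>"
    proof (rule borel_measurable_sum)
      fix t assume "t \<in> {1..n}"
      then have [measurable]: "Z t \<in> borel_measurable \<Omega>" using Z by auto
      show "(\<lambda>\<omega>. c * (expectile_score t' (Z t \<omega> - x) - d)) \<in> borel_measurable \<Omega>" by measurable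
    qed
    then show ?thesis by measurable
  qed
  have "to_zero_in_probability \<Omega> (\<lambda>n \<omega>. \<Sum>t=1..n. k n * (expectile_score (\<tau> n) (Z t \<omega> - xp n) - \<mu> xp n))"
  proof (rule zero, use ev in eventually_elim)
    case (elim n)
    then have "w n > 0" "0 < d n" "2 * d n \<le> w n" "x0 \<le> \<xi> n" "x0 \<le> \<xi> n - w n" by auto
    then show ?case unfolding xp_def w_def by (simp_all add: right_diff_distrib distrib_left)
  qed
  moreover have "to_zero_in_probability \<Omega> (\<lambda>n \<omega>. \<Sum>t=1..n. k n * (expectile_score (\<tau> n) (Z t \<omega> - xm n) - \<mu> xm n))"
  proof (rule zero, use ev in eventually_elim)
    case (elim n)
    then have "w n > 0" "0 < d n" "2 * d n \<le> w n" "x0 \<le> \<xi> n" "x0 \<le> \<xi> n - w n" by auto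
    then show ?case unfolding xm_def w_def by (simp_all add: right_diff_distrib distrib_left)
  qed
  ultimately have lim: "(\<lambda>n. P.prob (Ep n) + P.prob (Em n)) \<longlonglongrightarrow> 0 + 0"
    using \<eta> unfolding to_zero_in_probability_def Ep_def Em_def by (intro tendsto_add) auto
  let ?B = "\<lambda>n. {\<omega> \<in> space \<Omega>. \<epsilon> < \<bar>sqrt (real n * (1 - \<tau> n)) / a (S (\<xi> n)) * (empirical_expectile (\<tau> n) n (\<lambda>t. Z t \<omega>) - \<xi> n)\<bar>}"
  show "(\<lambda>n. P.prob (?B n)) \<longlonglongrightarrow> 0"
  proof (rule tendsto_sandwich[OF _ _ tendsto_const])
    show "(\<lambda>n. P.prob (Ep n) + P.prob (Em n)) \<longlonglongrightarrow> 0" using lim by simp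
    show "\<forall>\<^sub>F n in sequentially. P.prob (?B n) \<le> P.prob (Ep n) + P.prob (Em n)"
      using ev root
    proof eventually_elim
      case (elim n)
      have \<tau>n: "0 < \<tau> n" "\<tau> n < 1" "n \<ge> 1" using \<tau>(1)[of n] elim by auto
      define b where "b = max c0 1"
      have b: "b \<ge> c0" "b \<ge> 1" by (auto simp: b_def)
      have dn: "d n > 0" and t: "2 * \<tau> n - 1 \<ge> 1/2" using elim by auto
      have kn: "k n > 0" using elim by (simp add: k_def)
      have nk: "real n * (k n * (1/2 * (d n * (\<phi> n / b)))) = 2 * \<eta>"
        using elim b by (simp add: k_def d_def \<eta>_def b_def)
      have xp: "\<xi> n < xp n" "xp n < xe" "xe - \<xi> n \<le> 2 * (xe - xp n)" "x0 \<le> xp n"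
      proof -
        have "w n > 0" "2 * d n \<le> w n" "x0 \<le> \<xi> n" using elim by auto
        then show "\<xi> n < xp n" "xp n < xe" "xe - \<xi> n \<le> 2 * (xe - xp n)" "x0 \<le> xp n"
          using dn unfolding xp_def w_def by (simp_all add: right_diff_distrib distrib_left)
      qed
      \<comment> \<open>To the right of the expectile the survival probability has dropped, and the
        doubling property recovers it up to the factor \<open>b\<close>. To the left the slope bound
        yields \<open>\<phi> n\<close> directly, which is then weakened to
        \<open>\<phi> n / b\<close> for symmetry.\<close>
      have mp: "\<mu> xp n \<le> - (1/2 * (d n * (\<phi> n / b)))"
      proof -
        have "\<phi> n \<le> c0 * (1 - F (xp n))" unfolding \<phi>_def using cmp[of "xp n" "\<xi> n"] xp elim by simp
        also have "\<dots> \<le> b * (1 - F (xp n))" using cdf_bounded_prob[of "xp n"] b by (intro mult_right_mono) auto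
        finally have "\<phi> n / b \<le> 1 - F (xp n)" using b by (simp add: divide_le_eq mult.commute)
        then have "d n * (\<phi> n / b) \<le> (xp n - \<xi> n) * (1 - F (xp n))"
          using dn by (simp add: xp_def mult_left_mono del: times_divide_eq_right)
        also have "\<dots> \<le> excess (\<xi> n) - excess (xp n)" using xp by (intro excess_diff_ge) auto
        finally have ex: "d n * (\<phi> n / b) \<le> excess (\<xi> n) - excess (xp n)" .
        have "0 \<le> d n * (\<phi> n / b)" using dn elim b by simp
        then have "1/2 * (d n * (\<phi> n / b)) \<le> (2 * \<tau> n - 1) * (excess (\<xi> n) - excess (xp n))"
          using t ex by (intro mult_mono) auto
        moreover have "\<mu> xp n = - ((2 * \<tau> n - 1) * (excess (\<xi> n) - excess (xp n))) - (1 - \<tau> n) * (xp n - \<xi> n)"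
          using elim(2) by (simp add: \<mu>_def algebra_simps)
        moreover have "0 \<le> (1 - \<tau> n) * (xp n - \<xi> n)" using \<tau>n xp by simp
        ultimately show ?thesis by linarith
      qed
      have mm: "\<mu> xm n \<ge> 1/2 * (d n * (\<phi> n / b))"
      proof -
        have "\<phi> n / b \<le> \<phi> n / 1" using elim b by (intro divide_left_mono) auto
        then have "d n * (\<phi> n / b) \<le> (\<xi> n - xm n) * (1 - F (\<xi> n))"
          using dn by (simp add: xm_def \<phi>_def mult_left_mono del: times_divide_eq_right)
        also have "\<dots> \<le> excess (xm n) - excess (\<xi> n)" using dn by (intro excess_diff_ge) (auto simp: xm_def)
        finally have ex: "d n * (\<phi> n / b) \<le> excess (xm n) - excess (\<xi> n)" .
        have "0 \<le> d n * (\<phi> n / b)" using dn elim b by simp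
        then have "1/2 * (d n * (\<phi> n / b)) \<le> (2 * \<tau> n - 1) * (excess (xm n) - excess (\<xi> n))"
          using t ex by (intro mult_mono) auto
        moreover have "\<mu> xm n = (2 * \<tau> n - 1) * (excess (xm n) - excess (\<xi> n)) + (1 - \<tau> n) * (\<xi> n - xm n)"
          using elim(2) by (simp add: \<mu>_def algebra_simps)
        moreover have "0 \<le> (1 - \<tau> n) * (\<xi> n - xm n)" using \<tau>n dn by (simp add: xm_def)
        ultimately show ?thesis by linarith
      qed
      have sum_eq: "(\<Sum>t=1..n. k n * (expectile_score (\<tau> n) (Z t \<omega> - x) - y))
          = k n * (\<Sum>t=1..n. expectile_score (\<tau> n) (Z t \<omega> - x)) - real n * (k n * y)" for \<omega> x y
        by (simp add: sum_distrib_left[symmetric] sum_subtractf right_diff_distrib)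
      have sub: "?B n \<subseteq> Ep n \<union> Em n"
      proof
        fix \<omega> assume B: "\<omega> \<in> ?B n"
        define e where "e = empirical_expectile (\<tau> n) n (\<lambda>t. Z t \<omega>)"
        have "\<epsilon> < \<bar>m n / v n * (e - \<xi> n)\<bar>" using B by (simp add: m_def v_def e_def)
        then have "\<epsilon> < m n / v n * \<bar>e - \<xi> n\<bar>" using elim by (simp add: abs_mult)
        then have "d n < \<bar>e - \<xi> n\<bar>" using elim by (simp add: d_def field_simps)
        then consider "xp n < e" | "e < xm n" unfolding xp_def xm_def by linarith
        then show "\<omega> \<in> Ep n \<union> Em n"
        proof cases
          case 1
          then have "0 < (\<Sum>t=1..n. expectile_score (\<tau> n) (Z t \<omega> - xp n))"
            unfolding e_def empirical_expectile_less_iff(1)[OF \<tau>n] .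
          then have "0 < k n * (\<Sum>t=1..n. expectile_score (\<tau> n) (Z t \<omega> - xp n))" using kn by simp
          moreover have "real n * (k n * \<mu> xp n) \<le> real n * (k n * - (1/2 * (d n * (\<phi> n / b))))"
            using mp kn by (intro mult_left_mono) auto
          then have "real n * (k n * \<mu> xp n) \<le> - (2 * \<eta>)" using nk by simp
          ultimately have "\<eta> < (\<Sum>t=1..n. k n * (expectile_score (\<tau> n) (Z t \<omega> - xp n) - \<mu> xp n))"
            unfolding sum_eq using \<eta> by linarith
          then show ?thesis using B unfolding Ep_def by auto
        next
          case 2
          then have "(\<Sum>t=1..n. expectile_score (\<tau> n) (Z t \<omega> - xm n)) < 0"
            unfolding e_def empirical_expectile_less_iff(2)[OF \<tau>n] .
          then have "k n * (\<Sum>t=1..n. expectile_score (\<tau> n) (Z t \<omega> - xm n)) < 0" using kn by (simp add: mult_pos_neg)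
          moreover have "real n * (k n * (1/2 * (d n * (\<phi> n / b)))) \<le> real n * (k n * \<mu> xm n)"
            using mm kn by (intro mult_left_mono) auto
          then have "2 * \<eta> \<le> real n * (k n * \<mu> xm n)" using nk by simp
          ultimately have "(\<Sum>t=1..n. k n * (expectile_score (\<tau> n) (Z t \<omega> - xm n) - \<mu> xm n)) < - \<eta>"
            unfolding sum_eq using \<eta> by linarith
          then show ?thesis using B unfolding Em_def by auto
        qed
      qed
      have EE: "Ep n \<in> P.events" "Em n \<in> P.events" unfolding Ep_def Em_def by (rule sets)+
      have "P.prob (?B n) \<le> P.prob (Ep n \<union> Em n)"
        using sub EE by (intro P.finite_measure_mono sets.Un)
      also have "\<dots> \<le> P.prob (Ep n) + P.prob (Em n)"
        by (intro measure_Un_le EE)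
      finally show ?case .
    qed
  qed auto
qed

end

section \<open>Slutsky and the extrapolation factor\<close>

context prob_space
begin

lemma iexp_diff_bound: "cmod (iexp a - iexp b) \<le> \<bar>a - b\<bar>" "cmod (iexp a - iexp b) \<le> 2"
proof -
  have "iexp a - iexp b = iexp b * (iexp (a - b) - 1)"
    by (simp add: right_diff_distrib flip: exp_add)
  then have "cmod (iexp a - iexp b) = cmod (iexp (a - b) - 1)" by (simp add: norm_mult)
  also have "\<dots> \<le> \<bar>a - b\<bar>" using iexp_approx1[of "a - b" 0] by simp
  finally show "cmod (iexp a - iexp b) \<le> \<bar>a - b\<bar>" .
  show "cmod (iexp a - iexp b) \<le> 2" using norm_triangle_ineq4[of "iexp a" "iexp b"] by simp
qed

text \<open>The distance of \<open>iexp a\<close> and \<open>iexp b\<close> is at most both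
  \<open>|a - b|\<close> and 2. The first bound is used where the perturbation is small, the second
  on the remaining event, whose probability vanishes.\<close>

lemma slutsky:
  assumes N: "prob_space N" and T[measurable]: "\<And>n. T n \<in> borel_measurable M" and Y[measurable]: "\<And>n. Y n \<in> borel_measurable M"
    and \<Gamma>[measurable]: "\<Gamma> \<in> borel_measurable N"
    and conv: "converges_in_distribution M T N \<Gamma>"
    and zero: "to_zero_in_probability M (\<lambda>n \<omega>. Y n \<omega> - c * T n \<omega>)"
  shows "converges_in_distribution M Y N (\<lambda>\<omega>. c * \<Gamma> \<omega>)"
  unfolding converges_in_distribution_def
proof (rule levy_continuity)
  interpret N: prob_space N by fact
  show "real_distribution (distr M borel (Y n))" for n by (rule real_distribution_distr) simp
  show "real_distribution (distr N borel (\<lambda>\<omega>. c * \<Gamma> \<omega>))" by (rule N.real_distribution_distr) simp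
  fix t :: real
  have chY: "char (distr M borel (Y n)) t = (CLINT x|M. iexp (t * Y n x))" for n
    by (simp add: char_def integral_distr)
  have chT: "char (distr M borel (T n)) (t * c) = (CLINT x|M. iexp (t * (c * T n x)))" for n
    by (simp add: char_def integral_distr mult.assoc)
  have ch\<Gamma>: "char (distr N borel (\<lambda>\<omega>. c * \<Gamma> \<omega>)) t = char (distr N borel \<Gamma>) (t * c)"
    by (simp add: char_def integral_distr mult.assoc)
  have limT: "(\<lambda>n. char (distr M borel (T n)) (t * c)) \<longlonglongrightarrow> char (distr N borel \<Gamma>) (t * c)"
    using conv unfolding converges_in_distribution_def
    by (intro levy_continuity1 real_distribution_distr N.real_distribution_distr) auto
  have "(\<lambda>n. char (distr M borel (Y n)) t - char (distr M borel (T n)) (t * c)) \<longlonglongrightarrow> 0"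
  proof (rule tendstoI)
    fix e :: real assume e: "e > 0"
    \<comment> \<open>The summand 1 covers \<open>t = 0\<close>. The small perturbations then
      contribute at most \<open>e / 2\<close> and the exceptional event less than
      \<open>2 * (e / 8)\<close>.\<close>
    define \<epsilon> where "\<epsilon> = e / (2 * (\<bar>t\<bar> + 1))"
    have \<epsilon>: "\<epsilon> > 0" "\<bar>t\<bar> * \<epsilon> \<le> e / 2"
      using e by (auto simp: \<epsilon>_def field_simps)
    have "(\<lambda>n. prob {\<omega> \<in> space M. \<epsilon> < \<bar>Y n \<omega> - c * T n \<omega>\<bar>}) \<longlonglongrightarrow> 0"
      using zero \<epsilon> unfolding to_zero_in_probability_def by blast
    then have "\<forall>\<^sub>F n in sequentially. prob {\<omega> \<in> space M. \<epsilon> < \<bar>Y n \<omega> - c * T n \<omega>\<bar>} < e / 8"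
      by (rule order_tendstoD) (use e in simp)
    then show "\<forall>\<^sub>F n in sequentially. dist (char (distr M borel (Y n)) t - char (distr M borel (T n)) (t * c)) 0 < e"
    proof eventually_elim
      case (elim n)
      define B where "B = {\<omega> \<in> space M. \<epsilon> < \<bar>Y n \<omega> - c * T n \<omega>\<bar>}"
      have B: "B \<in> events" unfolding B_def by measurable
      have "char (distr M borel (Y n)) t - char (distr M borel (T n)) (t * c)
          = (CLINT x|M. iexp (t * Y n x) - iexp (t * (c * T n x)))"
        unfolding chY chT by (intro Bochner_Integration.integral_diff[symmetric] iexp_integrable) auto
      also have "cmod \<dots> \<le> expectation (\<lambda>x. cmod (iexp (t * Y n x) - iexp (t * (c * T n x))))"
        by (rule integral_norm_bound)
      also have "\<dots> \<le> expectation (\<lambda>x. \<bar>t\<bar> * \<epsilon> + 2 * indicator B x)"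
      proof (rule integral_mono)
        show "integrable M (\<lambda>x. cmod (iexp (t * Y n x) - iexp (t * (c * T n x))))"
          by (intro integrable_norm Bochner_Integration.integrable_diff iexp_integrable) auto
        show "integrable M (\<lambda>x. \<bar>t\<bar> * \<epsilon> + 2 * indicator B x)" using B by (auto simp: emeasure_eq_measure)
        fix x assume x: "x \<in> space M"
        show "cmod (iexp (t * Y n x) - iexp (t * (c * T n x))) \<le> \<bar>t\<bar> * \<epsilon> + 2 * indicator B x"
        proof (cases "x \<in> B")
          case True
          have "0 \<le> \<bar>t\<bar> * \<epsilon>" using \<epsilon> by simp
          then show ?thesis using True iexp_diff_bound(2)[of "t * Y n x" "t * (c * T n x)"] by simp
        next
          case False
          have "cmod (iexp (t * Y n x) - iexp (t * (c * T n x))) \<le> \<bar>t * Y n x - t * (c * T n x)\<bar>" by (rule iexp_diff_bound)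
          also have "\<dots> = \<bar>t\<bar> * \<bar>Y n x - c * T n x\<bar>" by (simp add: abs_mult flip: right_diff_distrib)
          also have "\<dots> \<le> \<bar>t\<bar> * \<epsilon>" using False x by (intro mult_left_mono) (auto simp: B_def)
          finally show ?thesis using False by simp
        qed
      qed
      also have "\<dots> = \<bar>t\<bar> * \<epsilon> + 2 * prob B" using B by (simp add: prob_space emeasure_eq_measure)
      also have "\<dots> < e" using elim \<epsilon> e unfolding B_def by linarith
      finally show ?case by simp
    qed
  qed
  from tendsto_add[OF this limT] show "(\<lambda>n. char (distr M borel (Y n)) t) \<longlonglongrightarrow> char (distr N borel (\<lambda>\<omega>. c * \<Gamma> \<omega>)) t"
    unfolding ch\<Gamma> by simp
qed

text \<open>The limiting distribution function may jump at the chosen \<open>K\<close>. The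
  continuous ramp \<open>f\<close> between the tail indicators at \<open>K\<close> and
  \<open>K + 1\<close> has converging integrals regardless.\<close>

lemma converges_imp_bounded_in_probability:
  assumes N: "prob_space N" and T[measurable]: "\<And>n. T n \<in> borel_measurable M"
    and \<Gamma>[measurable]: "\<Gamma> \<in> borel_measurable N"
    and conv: "converges_in_distribution M T N \<Gamma>"
  shows "bounded_in_probability M T"
  unfolding bounded_in_probability_def
proof (intro allI impI)
  fix \<epsilon> :: real assume e: "\<epsilon> > 0"
  interpret N: prob_space N by fact
  interpret G: real_distribution "distr N borel \<Gamma>" by (rule N.real_distribution_distr) simp
  have "\<forall>\<^sub>F x in at_top. cdf (distr N borel \<Gamma>) x > 1 - \<epsilon> / 2"
    using order_tendstoD(1)[OF G.cdf_lim_at_top_prob] e by simp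
  then obtain u where u: "\<And>x. x \<ge> u \<Longrightarrow> cdf (distr N borel \<Gamma>) x > 1 - \<epsilon> / 2" by (auto simp: eventually_at_top_linorder)
  have "\<forall>\<^sub>F x in at_bot. cdf (distr N borel \<Gamma>) x < \<epsilon> / 2"
    using order_tendstoD(2)[OF G.cdf_lim_at_bot, of "\<epsilon> / 2"] e by simp
  then obtain l where l: "\<And>x. x \<le> l \<Longrightarrow> cdf (distr N borel \<Gamma>) x < \<epsilon> / 2" by (auto simp: eventually_at_bot_linorder)
  define K where "K = max u (- l)"
  define f where "f x = min 1 (max 0 (\<bar>x\<bar> - K))" for x :: real
  have fm[measurable]: "f \<in> borel_measurable borel" unfolding f_def[abs_def] by measurable
  have "(\<lambda>n. \<integral>x. f x \<partial>distr M borel (T n)) \<longlonglongrightarrow> (\<integral>x. f x \<partial>distr N borel \<Gamma>)"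
  proof (rule weak_conv_imp_integral_bdd_continuous_conv)
    show "weak_conv_m (\<lambda>n. distr M borel (T n)) (distr N borel \<Gamma>)"
      using conv by (simp add: converges_in_distribution_def)
    show "isCont f x" for x unfolding f_def by (intro continuous_intros)
    show "norm (f x) \<le> 1" for x by (auto simp: f_def)
  qed (auto intro: real_distribution_distr N.real_distribution_distr)
  moreover have "(\<integral>x. f x \<partial>distr N borel \<Gamma>) < \<epsilon>"
  proof -
    have "(\<integral>x. f x \<partial>distr N borel \<Gamma>) \<le> (\<integral>x. indicator {..- K} x + indicator {K<..} x \<partial>distr N borel \<Gamma>)"
    proof (rule integral_mono)
      show "integrable (distr N borel \<Gamma>) f" by (rule G.integrable_const_bound[of _ 1]) (auto simp: f_def)
      show "integrable (distr N borel \<Gamma>) (\<lambda>x. indicator {..- K} x + indicator {K<..} x :: real)"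
        by (intro Bochner_Integration.integrable_add integrable_real_indicator) (auto simp: G.emeasure_eq_measure)
      show "f x \<le> indicator {..- K} x + indicator {K<..} x" for x
        by (auto simp: f_def indicator_def)
    qed
    also have "\<dots> = cdf (distr N borel \<Gamma>) (- K) + G.prob {K<..}"
      by (subst Bochner_Integration.integral_add) (auto simp: cdf_def G.emeasure_eq_measure)
    also have "G.prob {K<..} = 1 - cdf (distr N borel \<Gamma>) K"
      using G.prob_compl[of "{..K}"] by (simp add: cdf_def Compl_eq_Diff_UNIV[symmetric] Compl_atMost)
    finally have "(\<integral>x. f x \<partial>distr N borel \<Gamma>) \<le> cdf (distr N borel \<Gamma>) (- K) + (1 - cdf (distr N borel \<Gamma>) K)" .
    moreover have "K \<ge> u" "- K \<le> l" by (auto simp: K_def)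
    ultimately show ?thesis using u[of K] l[of "- K"] by linarith
  qed
  ultimately have "\<forall>\<^sub>F n in sequentially. (\<integral>x. f x \<partial>distr M borel (T n)) < \<epsilon>" by (rule order_tendstoD)
  then have "\<forall>\<^sub>F n in sequentially. prob {\<omega> \<in> space M. \<bar>T n \<omega>\<bar> > K + 1} < \<epsilon>"
  proof eventually_elim
    case (elim n)
    have "prob {\<omega> \<in> space M. \<bar>T n \<omega>\<bar> > K + 1} = expectation (indicator {\<omega> \<in> space M. \<bar>T n \<omega>\<bar> > K + 1})"
      by simp
    also have "\<dots> \<le> expectation (\<lambda>\<omega>. f (T n \<omega>))"
    proof (rule integral_mono)
      show "integrable M (indicator {\<omega> \<in> space M. \<bar>T n \<omega>\<bar> > K + 1} :: 'a \<Rightarrow> real)"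
        by (intro integrable_real_indicator) (auto simp: emeasure_eq_measure)
      show "integrable M (\<lambda>\<omega>. f (T n \<omega>))" by (rule integrable_const_bound[of _ 1]) (auto simp: f_def)
    qed (auto simp: f_def indicator_def)
    also have "\<dots> = (\<integral>x. f x \<partial>distr M borel (T n))" by (rule integral_distr[symmetric]) auto
    finally show ?case using elim by simp
  qed
  then show "\<exists>K. \<forall>\<^sub>F n in sequentially. prob {\<omega> \<in> space M. K < \<bar>T n \<omega>\<bar>} < \<epsilon>" by blast
qed

end

text \<open>Mean value theorem in \<open>y\<close> on an interval around \<open>g\<close> that stays
  away from 0. Both \<open>z / (1 - z)\<close> and \<open>1 / |z|\<close> are largest at
  \<open>z = g / 2\<close>, so the bound keeps a negative exponent of \<open>d\<close>, which beats
  \<open>ln d\<close>.\<close>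

lemma power_factor_derivative_bound:
  fixes d g y :: real
  assumes g: "g < 0" and y: "3 / 2 * g \<le> y" "y \<le> g / 2" and d: "d \<ge> 1"
  shows "\<bar>d powr (y / (1 - y)) / y - d powr (g / (1 - g)) / g\<bar>
     \<le> d powr ((g / 2) / (1 - g / 2)) * (ln d * (2 / - g) + 4 / g\<^sup>2) * \<bar>y - g\<bar>"
proof -
  define h where "h y = d powr (y / (1 - y)) / y" for y
  have gI: "g \<in> {3/2 * g..g / 2}" using g by simp
  have "\<bar>h y - h g\<bar> \<le> d powr ((g / 2) / (1 - g / 2)) * (ln d * (2 / - g) + 4 / g\<^sup>2) * \<bar>y - g\<bar>"
  proof (rule field_differentiable_bound[of "{3/2 * g..g / 2}" h
        "\<lambda>z. d powr (z / (1 - z)) * (ln d / ((1 - z)\<^sup>2 * z) - 1 / z\<^sup>2)", unfolded real_norm_def])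
    fix z assume z: "z \<in> {3/2 * g..g / 2}"
    then have z0: "z < 0" "z \<le> g / 2" using g by auto
    have "((\<lambda>z. z / (1 - z)) has_real_derivative (1 / (1 - z)\<^sup>2)) (at z within {3/2 * g..g / 2})"
      using z0 by (auto intro!: derivative_eq_intros simp: field_simps power2_eq_square)
    then have "((\<lambda>z. d powr (z / (1 - z))) has_real_derivative d powr (z / (1 - z)) * (ln d * (1 / (1 - z)\<^sup>2))) (at z within {3/2 * g..g / 2})"
    proof -
      assume D: "((\<lambda>z. z / (1 - z)) has_real_derivative (1 / (1 - z)\<^sup>2)) (at z within {3/2 * g..g / 2})"
      have "((\<lambda>z. exp (z / (1 - z) * ln d)) has_real_derivative exp (z / (1 - z) * ln d) * (1 / (1 - z)\<^sup>2 * ln d)) (at z within {3/2 * g..g / 2})"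
        by (rule DERIV_chain'[OF DERIV_cmult_right[OF D] DERIV_exp])
      then show ?thesis using d by (simp add: powr_def mult.commute)
    qed
    then have "((\<lambda>z. d powr (z / (1 - z)) / z) has_real_derivative
       (d powr (z / (1 - z)) * (ln d * (1 / (1 - z)\<^sup>2)) * z - d powr (z / (1 - z)) * 1) / (z * z)) (at z within {3/2 * g..g / 2})"
      using z0 by (intro DERIV_divide DERIV_ident) auto
    moreover have "(d powr (z / (1 - z)) * (ln d * (1 / (1 - z)\<^sup>2)) * z - d powr (z / (1 - z)) * 1) / (z * z)
      = d powr (z / (1 - z)) * (ln d / ((1 - z)\<^sup>2 * z) - 1 / z\<^sup>2)"
    proof -
      have "(P * (l * (1 / q)) * z - P * 1) / (z * z) = P * (l / (q * z) - 1 / z\<^sup>2)" if "q \<noteq> 0" for P l q :: real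
        using that z0 by (simp add: field_simps power2_eq_square)
      then show ?thesis using z0 by simp
    qed
    ultimately show "(h has_field_derivative d powr (z / (1 - z)) * (ln d / ((1 - z)\<^sup>2 * z) - 1 / z\<^sup>2)) (at z within {3/2 * g..g / 2})"
      unfolding h_def by simp
    have "z / (1 - z) \<le> (g / 2) / (1 - g / 2)"
    proof -
      have "z * (1 - g / 2) \<le> (g / 2) * (1 - z)" using z0 by (simp add: algebra_simps)
      then show ?thesis using z0 g by (simp add: divide_le_eq pos_le_divide_eq field_simps)
    qed
    then have 1: "d powr (z / (1 - z)) \<le> d powr ((g / 2) / (1 - g / 2))" using d by (intro powr_mono) auto
    have zz: "- g / 2 \<le> \<bar>z\<bar>" using z0 by simp
    have "\<bar>ln d / ((1 - z)\<^sup>2 * z)\<bar> \<le> ln d * (2 / - g)"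
    proof -
      have "1 * (- g / 2) \<le> (1 - z)\<^sup>2 * \<bar>z\<bar>" using zz z0 g by (intro mult_mono) (auto simp: one_le_power)
      then have "ln d / ((1 - z)\<^sup>2 * \<bar>z\<bar>) \<le> ln d / (- g / 2)" using d g z0 by (intro divide_left_mono mult_pos_pos) auto
      then show ?thesis using d by (simp add: abs_mult)
    qed
    moreover have "\<bar>1 / z\<^sup>2\<bar> \<le> 4 / g\<^sup>2"
    proof -
      have "(- g / 2)\<^sup>2 \<le> \<bar>z\<bar>\<^sup>2" using zz g by (intro power_mono) auto
      then have "1 / z\<^sup>2 \<le> 1 / (g / 2)\<^sup>2" using g z0 by (intro divide_left_mono mult_pos_pos) auto
      then show ?thesis by (simp add: power_divide)
    qed
    ultimately have "\<bar>ln d / ((1 - z)\<^sup>2 * z) - 1 / z\<^sup>2\<bar> \<le> ln d * (2 / - g) + 4 / g\<^sup>2" by linarith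
    then show "\<bar>d powr (z / (1 - z)) * (ln d / ((1 - z)\<^sup>2 * z) - 1 / z\<^sup>2)\<bar>
        \<le> d powr ((g / 2) / (1 - g / 2)) * (ln d * (2 / - g) + 4 / g\<^sup>2)"
      unfolding abs_mult using 1 by (intro mult_mono) auto
  qed (use gI y in auto)
  then show ?thesis by (simp add: h_def)
qed

section \<open>The extrapolation factor as a function of the tail index\<close>

definition extrapolation_factor :: "real \<Rightarrow> real \<Rightarrow> real" where
  "extrapolation_factor d y = (d powr (y / (1 - y)) - 1) / y"

text \<open>Half of the negative exponent is spent on the logarithm, which is at most a constant
  times \<open>d powr (- \<kappa> / 2)\<close>.\<close>

lemma powr_times_ln_tendsto_0:
  fixes d :: "nat \<Rightarrow> real"
  assumes "\<kappa> < 0" and d: "filterlim d at_top sequentially"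
  shows "(\<lambda>n. d n powr \<kappa> * (ln (d n) * b + c)) \<longlonglongrightarrow> 0"
proof -
  have 1: "(\<lambda>n. d n powr \<kappa>) \<longlonglongrightarrow> 0" "(\<lambda>n. d n powr (\<kappa> / 2)) \<longlonglongrightarrow> 0"
    using assms by (auto intro!: tendsto_neg_powr)
  have "(\<lambda>n. d n powr \<kappa> * ln (d n)) \<longlonglongrightarrow> 0"
  proof (rule Lim_null_comparison)
    have "(\<lambda>n. 2 / - \<kappa> * d n powr (\<kappa> / 2)) \<longlonglongrightarrow> 2 / - \<kappa> * 0" by (intro tendsto_intros 1)
    then show "(\<lambda>n. 2 / - \<kappa> * d n powr (\<kappa> / 2)) \<longlonglongrightarrow> 0" by simp
    have "\<forall>\<^sub>F n in sequentially. d n \<ge> 1" using d by (simp add: filterlim_at_top)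
    then show "\<forall>\<^sub>F n in sequentially. norm (d n powr \<kappa> * ln (d n)) \<le> 2 / - \<kappa> * d n powr (\<kappa> / 2)"
    proof eventually_elim
      case (elim n)
      have "ln (d n) \<le> d n powr (- \<kappa> / 2) / (- \<kappa> / 2)" using elim assms by (intro ln_powr_bound) auto
      then have "d n powr \<kappa> * ln (d n) \<le> d n powr \<kappa> * (d n powr (- \<kappa> / 2) / (- \<kappa> / 2))" by (intro mult_left_mono) auto
      also have "\<dots> = (d n powr \<kappa> * d n powr (- \<kappa> / 2)) / (- \<kappa> / 2)" by simp
      also have "d n powr \<kappa> * d n powr (- \<kappa> / 2) = d n powr (\<kappa> / 2)"
        by (simp flip: powr_add)
      finally show ?case using elim by (simp add: abs_mult mult.commute)
    qed
  qed
  then have "(\<lambda>n. d n powr \<kappa> * ln (d n) * b + d n powr \<kappa> * c) \<longlonglongrightarrow> 0 * b + 0 * c"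
    by (intro tendsto_intros 1)
  then show ?thesis by (simp add: algebra_simps)
qed

text \<open>Since \<open>d n \<longlonglongrightarrow> \<infinity>\<close> and the exponent is negative, only the term \<open>- 1 / y\<close> of the extrapolation factor
  contributes to its derivative, which explains the factor \<open>1 / g\<^sup>2\<close> in the limit.\<close>
lemma extrapolation_factor_linearization:
  fixes d m :: "nat \<Rightarrow> real"
  assumes g: "g < 0" and d: "filterlim d at_top sequentially" and m: "filterlim m at_top sequentially"
    and e: "e > 0" and K: "K > 0"
  shows "\<forall>\<^sub>F n in sequentially. \<forall>u. \<bar>u\<bar> \<le> K \<longrightarrow>
     \<bar>m n * (extrapolation_factor (d n) (g + u / m n) - extrapolation_factor (d n) g) - u / g\<^sup>2\<bar> \<le> e \<and>
     \<bar>extrapolation_factor (d n) (g + u / m n)\<bar> \<le> 4 / - g"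
proof -
  define h where "h n = d n powr ((g / 2) / (1 - g / 2)) * (ln (d n) * (2 / - g) + 4 / g\<^sup>2)" for n
  have h: "h \<longlonglongrightarrow> 0"
    unfolding h_def using g d by (intro powr_times_ln_tendsto_0) (auto simp: divide_neg_pos)
  have "(\<lambda>n. K * h n + K\<^sup>2 * 2 / (g\<^sup>2 * - g) / m n) \<longlonglongrightarrow> K * 0 + 0"
    by (intro tendsto_intros h tendsto_divide_0[OF tendsto_const] filterlim_at_top_imp_at_infinity m)
  then have "\<forall>\<^sub>F n in sequentially. K * h n + K\<^sup>2 * 2 / (g\<^sup>2 * - g) / m n < e"
    by (rule order_tendstoD) (use e in simp)
  moreover have "\<forall>\<^sub>F n in sequentially. m n > 2 * K / - g" "\<forall>\<^sub>F n in sequentially. m n > 0"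
    "\<forall>\<^sub>F n in sequentially. d n > 1"
    using m d by (simp_all add: filterlim_at_top_dense)
  ultimately show ?thesis
  proof eventually_elim
    case (elim n)
    show ?case
    proof (intro allI impI)
      fix u assume u: "\<bar>u\<bar> \<le> K"
      define y where "y = g + u / m n"
      have "\<bar>u / m n\<bar> \<le> - g / 2"
      proof -
        have "K \<le> - g / 2 * m n" using elim(2) g by (simp add: field_simps)
        then have "\<bar>u\<bar> \<le> - g / 2 * m n" using u by linarith
        then show ?thesis using elim(3) by (simp add: abs_divide divide_le_eq)
      qed
      then have "u / m n \<le> - g / 2" "- (u / m n) \<le> - g / 2" unfolding abs_le_iff by blast+
      then have y: "3 / 2 * g \<le> y" "y \<le> g / 2" unfolding y_def by linarith+
      have y0: "y < 0" using y g by simp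
      have uy: "u = m n * (y - g)" using elim(3) by (simp add: y_def)
      have "m n * (extrapolation_factor (d n) y - extrapolation_factor (d n) g) - u / g\<^sup>2
        = m n * (d n powr (y / (1 - y)) / y - d n powr (g / (1 - g)) / g) + (m n * (1 / g - 1 / y) - u / g\<^sup>2)"
        by (simp add: extrapolation_factor_def diff_divide_distrib algebra_simps)
      \<comment> \<open>The exact remainder of linearising \<open>- 1 / y\<close> at
        \<open>g\<close>. It is quadratic in \<open>u\<close>, so one factor \<open>1 / m n\<close>
        is left over.\<close>
      also have "m n * (1 / g - 1 / y) - u / g\<^sup>2 = - (u\<^sup>2 / (m n * g\<^sup>2 * y))"
        unfolding uy using y0 g elim(3) by (simp add: field_simps power2_eq_square)
      also have "\<bar>m n * (d n powr (y / (1 - y)) / y - d n powr (g / (1 - g)) / g) + - (u\<^sup>2 / (m n * g\<^sup>2 * y))\<bar>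
        \<le> K * h n + K\<^sup>2 * 2 / (g\<^sup>2 * - g) / m n"
      proof (rule order_trans[OF abs_triangle_ineq], rule add_mono)
        have "\<bar>d n powr (y / (1 - y)) / y - d n powr (g / (1 - g)) / g\<bar> \<le> h n * \<bar>y - g\<bar>"
          unfolding h_def using elim by (intro power_factor_derivative_bound g y) auto
        then have "m n * \<bar>d n powr (y / (1 - y)) / y - d n powr (g / (1 - g)) / g\<bar> \<le> m n * (h n * \<bar>y - g\<bar>)"
          using elim by (intro mult_left_mono) auto
        also have "\<dots> = h n * \<bar>u\<bar>" using elim(3) by (simp add: uy abs_mult)
        also have "\<dots> \<le> h n * K"
        proof (intro mult_left_mono u)
          have "0 \<le> ln (d n) * (2 / - g)" using elim(4) g by (intro mult_nonneg_nonneg) auto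
          moreover have "0 \<le> 4 / g\<^sup>2" by simp
          ultimately have "0 \<le> ln (d n) * (2 / - g) + 4 / g\<^sup>2" by (rule add_nonneg_nonneg)
          then show "0 \<le> h n" unfolding h_def by (rule mult_nonneg_nonneg[OF powr_ge_zero])
        qed
        finally show "\<bar>m n * (d n powr (y / (1 - y)) / y - d n powr (g / (1 - g)) / g)\<bar> \<le> K * h n"
          using elim(3) by (simp add: abs_mult mult.commute)
        have "\<bar>- (u\<^sup>2 / (m n * g\<^sup>2 * y))\<bar> = u\<^sup>2 / (m n * g\<^sup>2 * - y)"
          using elim(3) y0 by (simp add: abs_divide abs_mult)
        also have "\<dots> \<le> K\<^sup>2 / (m n * g\<^sup>2 * (- g / 2))"
        proof (rule frac_le)
          show "u\<^sup>2 \<le> K\<^sup>2" using u K by (metis abs_le_square_iff abs_of_pos)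
          show "0 < m n * g\<^sup>2 * (- g / 2)" using elim(3) g by (intro mult_pos_pos) auto
          show "m n * g\<^sup>2 * (- g / 2) \<le> m n * g\<^sup>2 * - y" using elim(3) y by (intro mult_left_mono) auto
        qed auto
        finally show "\<bar>- (u\<^sup>2 / (m n * g\<^sup>2 * y))\<bar> \<le> K\<^sup>2 * 2 / (g\<^sup>2 * - g) / m n"
          by (simp add: mult_ac)
      qed
      also have "\<dots> \<le> e" using elim(1) by simp
      finally have 1: "\<bar>m n * (extrapolation_factor (d n) y - extrapolation_factor (d n) g) - u / g\<^sup>2\<bar> \<le> e" .
      have "d n powr (y / (1 - y)) \<le> d n powr 0" using y0 elim by (intro powr_mono) (auto simp: divide_le_0_iff)
      then have "\<bar>d n powr (y / (1 - y)) - 1\<bar> \<le> 1" using elim(4) by (simp add: abs_le_iff)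
      then have "\<bar>extrapolation_factor (d n) y\<bar> \<le> 1 / (- g / 2)"
        unfolding extrapolation_factor_def abs_divide using y g by (intro frac_le) auto
      also have "\<dots> \<le> 4 / - g" using g by (simp add: field_simps)
      finally show "\<bar>m n * (extrapolation_factor (d n) (g + u / m n) - extrapolation_factor (d n) g) - u / g\<^sup>2\<bar> \<le> e \<and>
         \<bar>extrapolation_factor (d n) (g + u / m n)\<bar> \<le> 4 / - g"
        using 1 by (simp add: y_def)
    qed
  qed
qed

section \<open>Bias\<close>

context second_order_distribution
begin

text \<open>The distances of both expectiles to the endpoint have relative errors of the order of
  \<open>x\<^sup>* - \<xi>\<close>, which need not vanish after scaling, but they only enter multiplied by the
  vanishing ratio of the two distances.\<close>
theorem expectile_bias_to_zero:
  fixes \<tau> p :: "nat \<Rightarrow> real"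
  assumes sq: "integrable M (\<lambda>z. z\<^sup>2)" and \<tau>: "\<And>n. 0 < \<tau> n \<and> \<tau> n < 1" "\<tau> \<longlonglongrightarrow> 1"
    and p: "\<And>n. 0 < p n \<and> p n < 1"
  defines "\<xi> \<equiv> \<lambda>n. expectile_at (\<tau> n)"
  defines "\<phi> \<equiv> \<lambda>n. 1 - F (\<xi> n)"
  assumes tau_p: "filterlim (\<lambda>n. (1 - \<tau> n) / p n) at_top sequentially"
    and bias: "(\<lambda>n. sqrt (real n * \<phi> n) * A (1 / \<phi> n)) \<in> O(\<lambda>_. 1)"
    and endpoint: "(\<lambda>n. sqrt (real n * (1 - \<tau> n)) * (xe - quantile F (\<tau> n)) powr (1 / (1 - g))) \<in> O(\<lambda>_. 1)"
  shows "(\<lambda>n. sqrt (real n * (1 - \<tau> n)) * (extrapolation_factor ((1 - \<tau> n) / p n) g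
      - (expectile_at (1 - p n) - \<xi> n) / a (1 / \<phi> n))) \<longlonglongrightarrow> 0"
proof -
  define w where "w n = xe - \<xi> n" for n
  define w' where "w' n = xe - expectile_at (1 - p n)" for n
  define v where "v n = a (1 / \<phi> n)" for n
  define m where "m n = sqrt (real n * (1 - \<tau> n))" for n
  define d where "d n = (1 - \<tau> n) / p n" for n
  define D where "D n = d n powr (g / (1 - g))" for n
  define \<epsilon> where "\<epsilon> n = \<bar>A (1 / \<phi> n)\<bar>" for n
  have xi: "expectile_at (\<tau> n) = \<xi> n" for n by (simp add: \<xi>_def)
  have S: "S (\<xi> n) = 1 / \<phi> n" for n by (simp add: S_def \<phi>_def)
  note facts = expectile_sequence_facts[OF sq \<tau>, unfolded xi S]
  have ev\<tau>: "\<forall>\<^sub>F n in sequentially. t < \<tau> n" if "t < 1" for t using order_tendstoD(1)[OF \<tau>(2) that] .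
  have d1: "\<forall>\<^sub>F n in sequentially. d n > 1" using tau_p by (simp add: d_def filterlim_at_top_dense)
  obtain c1 where c1: "c1 > 0" "\<forall>\<^sub>F n in sequentially. 1 - \<tau> n \<le> c1 * w n * \<phi> n"
    using facts(4) unfolding w_def \<phi>_def by auto
  obtain c2 t2 where c2: "c2 > 0" "t2 < 1" "\<And>\<tau> \<tau>'. t2 < \<tau> \<Longrightarrow> \<tau> \<le> \<tau>' \<Longrightarrow> \<tau>' < 1 \<Longrightarrow>
     \<bar>(xe - expectile_at \<tau>') / (xe - expectile_at \<tau>) - ((1 - \<tau>) / (1 - \<tau>')) powr (g / (1 - g))\<bar>
       \<le> c2 * (\<bar>A (S (expectile_at \<tau>))\<bar> + (xe - expectile_at \<tau>) + (1 - \<tau>)) * ((1 - \<tau>) / (1 - \<tau>')) powr (g / (1 - g))"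
    using expectile_ratio[OF sq] by metis
  obtain c3 t3 where c3: "c3 > 0" "t3 < 1" "\<And>\<tau>. t3 < \<tau> \<Longrightarrow> \<tau> < 1 \<Longrightarrow>
     xe - expectile_at \<tau> \<le> c3 * (xe - quantile F \<tau>) powr (1 / (1 - g))"
    using expectile_quantile_distance[OF sq] by metis
  obtain L c4 x0 where *: "L > 0 \<and> c4 > 0 \<and> x0 < xe \<and> (\<forall>x. x0 \<le> x \<longrightarrow> x < xe \<longrightarrow>
     S x > 1 \<and> c4 * \<bar>A (S x)\<bar> \<le> 1/2 \<and> \<bar>xe - x + a (S x) / g\<bar> \<le> c4 * \<bar>A (S x)\<bar> * (xe - x) \<and>
     (\<forall>y. x \<le> y \<longrightarrow> y < xe \<longrightarrow> \<bar>A (S y)\<bar> \<le> c4 * \<bar>A (S x)\<bar> \<and>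
        \<bar>1 - F y - ((xe - y) / L) powr (- 1 / g)\<bar> \<le> c4 * \<bar>A (S x)\<bar> * ((xe - y) / L) powr (- 1 / g)))"
    using survival_expansion by (elim exE) (rule that)
  then have x0: "x0 < xe" and c4: "c4 > 0" by auto
  obtain K1 where K1: "K1 > 0" "\<forall>\<^sub>F n in sequentially. sqrt (real n * \<phi> n) * \<epsilon> n \<le> K1"
  proof -
    from bias obtain c where "c > 0" "\<forall>\<^sub>F n in sequentially. norm (sqrt (real n * \<phi> n) * A (1 / \<phi> n)) \<le> c * norm (1 :: real)"
      by (rule landau_o.bigE)
    moreover have "\<phi> n \<ge> 0" for n using cdf_bounded_prob[of "\<xi> n"] by (simp add: \<phi>_def)
    ultimately show thesis by (intro that[of c]) (auto simp: abs_mult \<epsilon>_def elim: eventually_mono)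
  qed
  obtain K2 where K2: "K2 > 0" "\<forall>\<^sub>F n in sequentially. m n * (xe - quantile F (\<tau> n)) powr (1 / (1 - g)) \<le> K2"
  proof -
    from endpoint obtain c where "c > 0" "\<forall>\<^sub>F n in sequentially. norm (m n * (xe - quantile F (\<tau> n)) powr (1 / (1 - g))) \<le> c * norm (1 :: real)"
      unfolding m_def[symmetric] by (rule landau_o.bigE)
    moreover have "m n \<ge> 0" for n
      unfolding m_def using \<tau>(1)[of n] by (intro real_sqrt_ge_zero mult_nonneg_nonneg) auto
    ultimately show thesis by (intro that[of c]) (auto simp: abs_mult elim!: eventually_mono)
  qed
  define K3 where "K3 = c2 * (K1 + c3 * K2 + c1 * (c3 * K2)) / - g"
  define K4 where "K4 = 2 * c4 / - g * K1"
  have w0: "w \<longlonglongrightarrow> 0" using facts(2) by (simp add: w_def[abs_def])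
  have "(\<lambda>n. c1 * w n) \<longlonglongrightarrow> c1 * 0" by (intro tendsto_intros w0)
  then have cw: "\<forall>\<^sub>F n in sequentially. c1 * w n < 1" by (rule order_tendstoD) simp
  have D0: "D \<longlonglongrightarrow> 0"
    unfolding D_def d_def using tau_p g by (intro tendsto_neg_powr) (auto simp: divide_neg_pos)
  show ?thesis
  proof (rule Lim_null_comparison)
    have "(\<lambda>n. K3 * D n + K4 * sqrt (c1 * w n)) \<longlonglongrightarrow> K3 * 0 + K4 * sqrt (c1 * 0)"
      by (intro tendsto_intros D0 w0)
    then show "(\<lambda>n. K3 * D n + K4 * sqrt (c1 * w n)) \<longlonglongrightarrow> 0" by simp
    show "\<forall>\<^sub>F n in sequentially. norm (sqrt (real n * (1 - \<tau> n)) * (extrapolation_factor ((1 - \<tau> n) / p n) g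
      - (expectile_at (1 - p n) - \<xi> n) / a (1 / \<phi> n))) \<le> K3 * D n + K4 * sqrt (c1 * w n)"
      using d1 cw c1(2) K1(2) K2(2) ev\<tau>[OF c2(2)] ev\<tau>[OF c3(2)] facts(1)[OF x0] facts(5)
    proof eventually_elim
      case (elim n)
      have \<tau>n: "0 < 1 - \<tau> n" "1/2 < \<tau> n" using \<tau>(1)[of n] elim by auto
      have pn: "p n > 0" "p n < 1 - \<tau> n" using p[of n] elim(1) by (auto simp: d_def field_simps)
      have w: "w n > 0" using elim by (simp add: w_def)
      have \<phi>: "0 < \<phi> n" "\<phi> n \<le> 1" using F_less_one_iff[of "\<xi> n"] elim cdf_nonneg[of "\<xi> n"] by (auto simp: \<phi>_def)
      have "0 < - g / 2 * w n" using w g by (intro mult_pos_pos) auto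
      then have v: "v n > 0" "v n \<ge> - g / 2 * w n" using elim by (auto simp: v_def w_def)
      have w': "0 < w' n" "w' n \<le> w n"
        using expectile_root(1)[OF sq, of "1 - p n"] expectile_mono[OF sq, of "\<tau> n" "1 - p n"] pn \<tau>n
        by (auto simp: w'_def w_def xi)
      have m0: "m n \<ge> 0" unfolding m_def using \<tau>n by (intro real_sqrt_ge_zero mult_nonneg_nonneg) auto
      have \<epsilon>0: "\<epsilon> n \<ge> 0" by (simp add: \<epsilon>_def)
      have t1: "1 - \<tau> n \<le> c1 * w n"
      proof -
        have "c1 * w n * \<phi> n \<le> c1 * w n * 1" using c1 w \<phi> by (intro mult_left_mono) auto
        then show ?thesis using elim by linarith
      qed
      have mw: "m n * w n \<le> c3 * K2"
      proof -
        have "w n \<le> c3 * (xe - quantile F (\<tau> n)) powr (1 / (1 - g))"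
          unfolding w_def xi[symmetric] using elim \<tau>(1)[of n] by (intro c3(3)) auto
        then have "m n * w n \<le> m n * (c3 * (xe - quantile F (\<tau> n)) powr (1 / (1 - g)))" using m0 by (rule mult_left_mono)
        also have "\<dots> = c3 * (m n * (xe - quantile F (\<tau> n)) powr (1 / (1 - g)))" by simp
        also have "\<dots> \<le> c3 * K2" using elim c3 by (intro mult_left_mono) auto
        finally show ?thesis .
      qed
      \<comment> \<open>Since \<open>1 - \<tau>\<close> is at most \<open>c1 * w * \<phi>\<close>,
        passing from \<open>m\<close> to the square root of \<open>n * \<phi>\<close> gains the
        factor \<open>sqrt (c1 * w)\<close>. The first bound makes the error in the scale
        \<open>a\<close> vanish; the second only feeds the bounded quantity
        \<open>m * \<eta>\<close>.\<close>
      have me: "m n * \<epsilon> n \<le> sqrt (c1 * w n) * K1" "m n * \<epsilon> n \<le> K1"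
      proof -
        have "1 - \<tau> n \<le> \<phi> n * (c1 * w n)" using elim by (simp add: mult_ac)
        then have "m n \<le> sqrt (real n * (\<phi> n * (c1 * w n)))"
          unfolding m_def by (intro real_sqrt_le_mono mult_left_mono) auto
        also have "\<dots> = sqrt (c1 * w n) * sqrt (real n * \<phi> n)" by (simp add: real_sqrt_mult)
        finally have "m n * \<epsilon> n \<le> sqrt (c1 * w n) * sqrt (real n * \<phi> n) * \<epsilon> n" using \<epsilon>0 by (rule mult_right_mono)
        also have "\<dots> = sqrt (c1 * w n) * (sqrt (real n * \<phi> n) * \<epsilon> n)" by simp
        also have "\<dots> \<le> sqrt (c1 * w n) * K1" using elim c1 w by (intro mult_left_mono) auto
        finally show "m n * \<epsilon> n \<le> sqrt (c1 * w n) * K1" .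
        have "c1 * w n * \<phi> n \<le> 1 * \<phi> n" using elim \<phi> by (intro mult_right_mono) auto
        then have "1 - \<tau> n \<le> \<phi> n" using elim by linarith
        then have "m n \<le> sqrt (real n * \<phi> n)" unfolding m_def by (intro real_sqrt_le_mono mult_left_mono) auto
        then have "m n * \<epsilon> n \<le> sqrt (real n * \<phi> n) * \<epsilon> n" using \<epsilon>0 by (rule mult_right_mono)
        then show "m n * \<epsilon> n \<le> K1" using elim by linarith
      qed
      define \<eta> where "\<eta> = \<epsilon> n + w n + (1 - \<tau> n)"
      have m\<eta>: "m n * \<eta> \<le> K1 + c3 * K2 + c1 * (c3 * K2)"
      proof -
        have "m n * (1 - \<tau> n) \<le> m n * (c1 * w n)" using t1 m0 by (rule mult_left_mono)
        also have "\<dots> = c1 * (m n * w n)" by simp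
        also have "\<dots> \<le> c1 * (c3 * K2)" using mw c1 by (intro mult_left_mono) auto
        finally show ?thesis using me mw by (simp add: \<eta>_def distrib_left)
      qed
      have ratio: "\<bar>w' n / w n - D n\<bar> \<le> c2 * \<eta> * D n"
      proof -
        have "\<bar>(xe - expectile_at (1 - p n)) / (xe - expectile_at (\<tau> n)) - ((1 - \<tau> n) / (1 - (1 - p n))) powr (g / (1 - g))\<bar>
          \<le> c2 * (\<bar>A (S (expectile_at (\<tau> n)))\<bar> + (xe - expectile_at (\<tau> n)) + (1 - \<tau> n)) * ((1 - \<tau> n) / (1 - (1 - p n))) powr (g / (1 - g))"
          using elim pn by (intro c2(3)) auto
        then show ?thesis unfolding xi S by (simp add: w_def w'_def D_def d_def \<eta>_def \<epsilon>_def)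
      qed
      have wv: "\<bar>w n / v n + 1 / g\<bar> \<le> 2 * c4 / - g * \<epsilon> n"
      proof -
        have "x0 \<le> \<xi> n" "\<xi> n < xe" using elim by auto
        then have "\<bar>xe - \<xi> n + a (S (\<xi> n)) / g\<bar> \<le> c4 * \<bar>A (S (\<xi> n))\<bar> * (xe - \<xi> n)" using * by blast
        then have "\<bar>w n + v n / g\<bar> \<le> c4 * \<epsilon> n * w n" unfolding S by (simp add: w_def v_def \<epsilon>_def)
        moreover have "w n / v n + 1 / g = (w n + v n / g) / v n" using v by (simp add: field_simps)
        ultimately have "\<bar>w n / v n + 1 / g\<bar> \<le> c4 * \<epsilon> n * w n / v n"
          using v by (simp add: abs_divide divide_right_mono)
        also have "\<dots> = c4 * \<epsilon> n * (w n / v n)" by simp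
        also have "\<dots> \<le> c4 * \<epsilon> n * (2 / - g)"
        proof (intro mult_left_mono)
          have "w n \<le> 2 / - g * v n" using v(2) g by (simp add: field_simps)
          then show "w n / v n \<le> 2 / - g" using v(1) by (simp add: divide_le_eq)
        qed (use c4 \<epsilon>0 in auto)
        finally show ?thesis by (simp add: mult_ac)
      qed
      \<comment> \<open>Both errors are isolated exactly, from
        \<open>(w - w') / v = w / v * (1 - w' / w)\<close>. The first concerns the ratio of
        distances and carries the factor \<open>D\<close>, which tends to 0, so bounded
        \<open>m * \<eta>\<close> suffices. The second concerns \<open>w / v\<close> and its limit
        \<open>- 1 / g\<close> and is of order \<open>m * \<epsilon>\<close>.\<close>
      have "extrapolation_factor (d n) g - (expectile_at (1 - p n) - \<xi> n) / v n
        = (D n - w' n / w n) / g - (w n / v n + 1 / g) * (1 - w' n / w n)"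
      proof -
        have "(expectile_at (1 - p n) - \<xi> n) / v n = w n / v n * (1 - w' n / w n)"
          using w v by (simp add: w_def w'_def field_simps)
        then show ?thesis unfolding extrapolation_factor_def D_def[symmetric]
          using g by (simp add: diff_divide_distrib algebra_simps)
      qed
      also have "\<bar>\<dots>\<bar> \<le> (c2 * \<eta> * D n) / - g + (2 * c4 / - g * \<epsilon> n) * 1"
      proof (rule order_trans[OF abs_triangle_ineq4], rule add_mono)
        show "\<bar>(D n - w' n / w n) / g\<bar> \<le> c2 * \<eta> * D n / - g"
          unfolding abs_divide using ratio g by (simp add: abs_minus_commute divide_right_mono_neg)
        have "\<bar>1 - w' n / w n\<bar> \<le> 1" using w w' by (simp add: abs_le_iff)
        then show "\<bar>(w n / v n + 1 / g) * (1 - w' n / w n)\<bar> \<le> (2 * c4 / - g * \<epsilon> n) * 1"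
          unfolding abs_mult using wv by (intro mult_mono) auto
      qed
      finally have "m n * \<bar>extrapolation_factor (d n) g - (expectile_at (1 - p n) - \<xi> n) / v n\<bar>
        \<le> m n * ((c2 * \<eta> * D n) / - g + (2 * c4 / - g * \<epsilon> n) * 1)" using m0 by (rule mult_left_mono)
      also have "\<dots> = (c2 * (m n * \<eta>) / - g) * D n + 2 * c4 / - g * (m n * \<epsilon> n)"
        by (simp add: algebra_simps)
      also have "\<dots> \<le> K3 * D n + 2 * c4 / - g * (sqrt (c1 * w n) * K1)"
      proof (intro add_mono mult_left_mono mult_right_mono me)
        show "c2 * (m n * \<eta>) / - g \<le> K3"
          unfolding K3_def using m\<eta> c2 g by (intro divide_right_mono mult_left_mono) auto
        show "0 \<le> 2 * c4 / - g" using c4 g by (intro divide_nonneg_pos) auto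
      qed (simp add: D_def)
      also have "\<dots> = K3 * D n + K4 * sqrt (c1 * w n)" by (simp add: K4_def)
      finally show ?case using m0 unfolding m_def[symmetric] d_def[symmetric] v_def[symmetric] real_norm_def abs_mult by simp
    qed
  qed
qed

text \<open>With \<open>u = 1 - F (x n)\<close>, condition D at \<open>s = 1 / u\<close> and
  \<open>x = y = 1\<close> bounds the joint exceedance probability at lag \<open>t\<close> by
  \<open>u * (q t + K * u)\<close>. Over fewer than \<open>rl\<close> lags \<open>q\<close> sums to
  a constant, and \<open>rl * u\<close> is bounded because \<open>u \<le> c0 * \<phi>\<close>.
  Stationarity carries the bound to every starting index.\<close>

lemma condition_D_joint_tail:
  fixes \<Omega> :: "'b measure" and Z :: "nat \<Rightarrow> 'b \<Rightarrow> real"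
  assumes \<Omega>: "prob_space \<Omega>" and Z: "\<And>t. t \<ge> 1 \<Longrightarrow> Z t \<in> borel_measurable \<Omega>"
    and stat: "strictly_stationary \<Omega> Z" and D: "condition_D \<Omega> F Z"
    and \<phi>: "\<phi> \<longlonglongrightarrow> 0" and r\<phi>: "(\<lambda>n. real (rl n) * \<phi> n) \<longlonglongrightarrow> 0"
    and x: "\<forall>\<^sub>F n in sequentially. x n < xe \<and> 1 - F (x n) \<le> c0 * \<phi> n"
  shows "\<exists>C. \<forall>\<^sub>F n in sequentially. \<forall>s\<ge>1.
       (\<Sum>j\<in>{1..<rl n}. measure \<Omega> {\<omega> \<in> space \<Omega>. Z s \<omega> > x n \<and> Z (s + j) \<omega> > x n}) \<le> C * (1 - F (x n))"
proof -
  interpret P: prob_space \<Omega> by fact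
  obtain K q where K: "K \<ge> 0" "\<And>t. t \<ge> (1::nat) \<Longrightarrow> q t \<ge> (0::real)" "summable q"
    and ev: "\<forall>\<^sub>F s in at_top. \<forall>t\<ge>1. \<forall>x\<in>{0<..1}. \<forall>y\<in>{0<..1}.
           s * measure \<Omega> {\<omega> \<in> space \<Omega>. 1 - F (Z 1 \<omega>) \<le> x / s \<and> 1 - F (Z (t + 1) \<omega>) \<le> y / s}
             \<le> q t * sqrt (x * y) + K / s * (x * y)"
    using D unfolding condition_D_def by blast
  define u where "u n = 1 - F (x n)" for n
  have u_pos: "\<forall>\<^sub>F n in sequentially. u n > 0"
    using x by eventually_elim (use F_less_one_iff in \<open>auto simp: u_def\<close>)
  have u0: "u \<longlonglongrightarrow> 0"
  proof (rule Lim_null_comparison)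
    have "(\<lambda>n. c0 * \<phi> n) \<longlonglongrightarrow> c0 * 0" by (intro tendsto_intros \<phi>)
    then show "(\<lambda>n. c0 * \<phi> n) \<longlonglongrightarrow> 0" by simp
    show "\<forall>\<^sub>F n in sequentially. norm (u n) \<le> c0 * \<phi> n"
      using x u_pos by eventually_elim (auto simp: u_def)
  qed
  have "filterlim (\<lambda>n. inverse (u n)) at_top sequentially"
    by (rule filterlim_inverse_at_top[OF u0 u_pos])
  from eventually_compose_filterlim[OF ev this]
  have ev2: "\<forall>\<^sub>F n in sequentially. \<forall>t\<ge>1. \<forall>x\<in>{0<..1}. \<forall>y\<in>{0<..1}.
           inverse (u n) * measure \<Omega> {\<omega> \<in> space \<Omega>. 1 - F (Z 1 \<omega>) \<le> x / inverse (u n) \<and> 1 - F (Z (t + 1) \<omega>) \<le> y / inverse (u n)}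
             \<le> q t * sqrt (x * y) + K / inverse (u n) * (x * y)" .
  have "\<forall>\<^sub>F n in sequentially. \<bar>real (rl n) * \<phi> n\<bar> < 1"
    using tendstoD[OF r\<phi>, of 1] by (simp add: dist_real_def)
  then have "\<forall>\<^sub>F n in sequentially. \<forall>s\<ge>1.
       (\<Sum>j\<in>{1..<rl n}. measure \<Omega> {\<omega> \<in> space \<Omega>. Z s \<omega> > x n \<and> Z (s + j) \<omega> > x n}) \<le> ((\<Sum>t. \<bar>q t\<bar>) + K * \<bar>c0\<bar>) * (1 - F (x n))"
    using ev2 u_pos x
  proof eventually_elim
    case (elim n)
    have u: "u n > 0" using elim by simp
    have J: "measure \<Omega> {\<omega> \<in> space \<Omega>. Z 1 \<omega> > x n \<and> Z (t + 1) \<omega> > x n} \<le> u n * (q t + K * u n)" if t: "t \<ge> 1" for t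
    proof -
      have "inverse (u n) * measure \<Omega> {\<omega> \<in> space \<Omega>. 1 - F (Z 1 \<omega>) \<le> 1 / inverse (u n) \<and> 1 - F (Z (t + 1) \<omega>) \<le> 1 / inverse (u n)}
             \<le> q t * sqrt (1 * 1) + K / inverse (u n) * (1 * 1)"
        using elim(2) t by (elim allE[of _ t] impE ballE[of _ _ 1]) auto
      then have "measure \<Omega> {\<omega> \<in> space \<Omega>. 1 - F (Z 1 \<omega>) \<le> u n \<and> 1 - F (Z (t + 1) \<omega>) \<le> u n} \<le> u n * (q t + K * u n)"
        using u by (simp add: field_simps)
      moreover have "measure \<Omega> {\<omega> \<in> space \<Omega>. Z 1 \<omega> > x n \<and> Z (t + 1) \<omega> > x n}
          \<le> measure \<Omega> {\<omega> \<in> space \<Omega>. 1 - F (Z 1 \<omega>) \<le> u n \<and> 1 - F (Z (t + 1) \<omega>) \<le> u n}"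
      proof (rule P.finite_measure_mono)
        have [measurable]: "F \<in> borel_measurable borel"
          by (intro borel_measurable_mono monoI cdf_nondecreasing)
        have [measurable]: "Z 1 \<in> borel_measurable \<Omega>" "Z (t + 1) \<in> borel_measurable \<Omega>" using Z by auto
        show "{\<omega> \<in> space \<Omega>. 1 - F (Z 1 \<omega>) \<le> u n \<and> 1 - F (Z (t + 1) \<omega>) \<le> u n} \<in> sets \<Omega>" by measurable
      qed (auto simp: u_def intro!: cdf_nondecreasing)
      ultimately show ?thesis by linarith
    qed
    show ?case
    proof (intro allI impI)
      fix s :: nat assume s: "1 \<le> s"
      have "(\<Sum>j\<in>{1..<rl n}. measure \<Omega> {\<omega> \<in> space \<Omega>. Z s \<omega> > x n \<and> Z (s + j) \<omega> > x n})
        = (\<Sum>j\<in>{1..<rl n}. measure \<Omega> {\<omega> \<in> space \<Omega>. Z 1 \<omega> > x n \<and> Z (j + 1) \<omega> > x n})"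
        by (intro sum.cong refl stationary_joint_tail Z stat s) auto
      also have "\<dots> \<le> (\<Sum>j\<in>{1..<rl n}. u n * (\<bar>q j\<bar> + K * u n))"
      proof (rule sum_mono)
        fix j assume "j \<in> {1..<rl n}"
        then show "measure \<Omega> {\<omega> \<in> space \<Omega>. Z 1 \<omega> > x n \<and> Z (j + 1) \<omega> > x n} \<le> u n * (\<bar>q j\<bar> + K * u n)"
          using J[of j] K(2)[of j] by simp
      qed
      also have "\<dots> = u n * ((\<Sum>j\<in>{1..<rl n}. \<bar>q j\<bar>) + real (rl n - 1) * (K * u n))"
        by (simp add: sum_distrib_left[symmetric] sum.distrib)
      also have "\<dots> \<le> u n * ((\<Sum>t. \<bar>q t\<bar>) + K * \<bar>c0\<bar>)"
      proof (intro mult_left_mono add_mono)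
        \<comment> \<open>The sign of \<open>q 0\<close> is unconstrained, so absolute values are
          summed; the two sequences agree from index 1 on.\<close>
        have "summable (\<lambda>t. \<bar>q t\<bar>)"
          using K(3) by (rule summable_cong[THEN iffD1, rotated]) (use K(2) in \<open>auto intro!: eventually_sequentiallyI[of 1]\<close>)
        then show "(\<Sum>j\<in>{1..<rl n}. \<bar>q j\<bar>) \<le> (\<Sum>t. \<bar>q t\<bar>)" by (intro sum_le_suminf) auto
        have "real (rl n - 1) * u n \<le> real (rl n) * (c0 * \<phi> n)"
          using elim u by (intro mult_mono) (auto simp: u_def)
        also have "\<dots> = c0 * (real (rl n) * \<phi> n)" by simp
        also have "\<dots> \<le> \<bar>c0 * (real (rl n) * \<phi> n)\<bar>" by simp
        also have "\<dots> \<le> \<bar>c0\<bar> * 1" unfolding abs_mult[of c0] using elim(1) by (intro mult_left_mono) auto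
        finally have "K * (real (rl n - 1) * u n) \<le> K * (\<bar>c0\<bar> * 1)" using K(1) by (rule mult_left_mono)
        then show "real (rl n - 1) * (K * u n) \<le> K * \<bar>c0\<bar>" by (simp add: mult_ac)
      qed (use u in simp)
      finally show "(\<Sum>j\<in>{1..<rl n}. measure \<Omega> {\<omega> \<in> space \<Omega>. Z s \<omega> > x n \<and> Z (s + j) \<omega> > x n})
          \<le> ((\<Sum>t. \<bar>q t\<bar>) + K * \<bar>c0\<bar>) * (1 - F (x n))"
        by (simp add: u_def mult.commute)
    qed
  qed
  then show ?thesis by blast
qed

end

section \<open>Asymptotic distribution of the extrapolated expectile\<close>

text \<open>From above \<open>X\<close> is bounded by the finite endpoint, so its square is at most
  \<open>xe\<^sup>2\<close> plus the square of its negative part.\<close>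

lemma (in second_order_distribution) square_integrable_of_negative_part:
  fixes \<Omega> :: "'b measure"
  assumes \<Omega>: "prob_space \<Omega>" and X[measurable]: "X \<in> borel_measurable \<Omega>" and M: "M = distr \<Omega> borel X"
    and neg: "integrable \<Omega> (\<lambda>\<omega>. \<bar>min (X \<omega>) 0\<bar>\<^sup>2)"
  shows "integrable M (\<lambda>z. z\<^sup>2)"
proof -
  interpret P: prob_space \<Omega> by fact
  have "AE z in distr \<Omega> borel X. z \<le> xe" unfolding M[symmetric] by (rule AE_le_xe)
  then have AE: "AE \<omega> in \<Omega>. X \<omega> \<le> xe" by (subst (asm) AE_distr_iff) auto
  have "integrable \<Omega> (\<lambda>\<omega>. (X \<omega>)\<^sup>2)"
  proof (rule Bochner_Integration.integrable_bound)
    show "integrable \<Omega> (\<lambda>\<omega>. xe\<^sup>2 + \<bar>min (X \<omega>) 0\<bar>\<^sup>2)" by (intro Bochner_Integration.integrable_add neg) auto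
    show "AE \<omega> in \<Omega>. norm ((X \<omega>)\<^sup>2) \<le> norm (xe\<^sup>2 + \<bar>min (X \<omega>) 0\<bar>\<^sup>2)"
      using AE
    proof eventually_elim
      case (elim \<omega>)
      have "(X \<omega>)\<^sup>2 \<le> xe\<^sup>2 + \<bar>min (X \<omega>) 0\<bar>\<^sup>2"
      proof (cases "X \<omega> \<le> 0")
        case False
        then have "(X \<omega>)\<^sup>2 \<le> xe\<^sup>2" using elim by (intro power_mono) auto
        then show ?thesis by (simp add: add_increasing2)
      qed simp
      then show ?case by simp
    qed
  qed simp
  then show ?thesis unfolding M by (subst integrable_distr_eq) auto
qed

lemma (in prob_space) negative_part_square_integrable:
  fixes X :: "'a \<Rightarrow> real"
  assumes X[measurable]: "X \<in> borel_measurable M" and \<delta>: "\<delta> > 0"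
    and int: "integrable M (\<lambda>\<omega>. \<bar>min (X \<omega>) 0\<bar> powr (2 + \<delta>)) \<or> (\<exists>B. AE \<omega> in M. \<bar>X \<omega>\<bar> \<le> B)"
  shows "integrable M (\<lambda>\<omega>. \<bar>min (X \<omega>) 0\<bar>\<^sup>2)"
  using int
proof
  assume int: "integrable M (\<lambda>\<omega>. \<bar>min (X \<omega>) 0\<bar> powr (2 + \<delta>))"
  show ?thesis
  proof (rule Bochner_Integration.integrable_bound)
    show "integrable M (\<lambda>\<omega>. 1 + \<bar>min (X \<omega>) 0\<bar> powr (2 + \<delta>))"
      by (intro Bochner_Integration.integrable_add int) auto
    have key: "y\<^sup>2 \<le> 1 + y powr (2 + \<delta>)" if "y \<ge> 0" for y :: real
    proof (cases "y \<le> 1")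
      case True
      then have "y\<^sup>2 \<le> 1" using that by (simp add: power_le_one)
      then show ?thesis by (simp add: add_increasing2)
    next
      case False
      then have "y powr 2 \<le> y powr (2 + \<delta>)" using \<delta> by (intro powr_mono) auto
      then show ?thesis using False by simp
    qed
    show "AE \<omega> in M. norm (\<bar>min (X \<omega>) 0\<bar>\<^sup>2) \<le> norm (1 + \<bar>min (X \<omega>) 0\<bar> powr (2 + \<delta>))"
      unfolding real_norm_def abs_power2 by (intro AE_I2 order_trans[OF key abs_ge_self]) simp
  qed simp
next
  assume "\<exists>B. AE \<omega> in M. \<bar>X \<omega>\<bar> \<le> B"
  then obtain B where "AE \<omega> in M. \<bar>X \<omega>\<bar> \<le> B" by blast
  then have "AE \<omega> in M. norm (\<bar>min (X \<omega>) 0\<bar>\<^sup>2) \<le> B\<^sup>2"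
  proof eventually_elim
    case (elim \<omega>)
    then have "\<bar>min (X \<omega>) 0\<bar> \<le> B" by (auto simp: min_def abs_if split: if_splits)
    then have "\<bar>min (X \<omega>) 0\<bar>\<^sup>2 \<le> B\<^sup>2" by (intro power_mono) auto
    then show ?case by simp
  qed
  then show ?thesis by (intro integrable_const_bound) auto
qed

theorem theorem2:
  fixes M :: "'a measure" and N :: "'b measure"
    and X :: "'a \<Rightarrow> real" and Z :: "nat \<Rightarrow> 'a \<Rightarrow> real"
    and \<Gamma> :: "'b \<Rightarrow> real"
    and F a A :: "real \<Rightarrow> real" and \<gamma> \<rho> :: real
    and \<tau> \<alpha> p \<xi> \<phi> :: "nat \<Rightarrow> real"
    and \<sigma>h \<gamma>h \<xi>h_star :: "nat \<Rightarrow> 'a \<Rightarrow> real"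
  assumes prob_M: "prob_space M" and prob_N: "prob_space N"
    and X: "X \<in> borel_measurable M"
    and F: "F = cdf (distr M borel X)"
    and C2: "condition_C2 F \<gamma> a \<rho> A"
    and tau: "\<forall>n. 0 < \<tau> n \<and> \<tau> n < 1" "incseq \<tau>" "\<tau> \<longlonglongrightarrow> 1"
    and alpha: "\<forall>n. 0 < \<alpha> n \<and> \<alpha> n < 1" "incseq \<alpha>" "\<alpha> \<longlonglongrightarrow> 1"
    and xi: "\<xi> = (\<lambda>n. expectile M X (\<tau> n))"
    and phi: "\<phi> = (\<lambda>n. 1 - F (\<xi> n))"
    and n_phi: "filterlim (\<lambda>n. real n * \<phi> n) at_top sequentially"
    and phi_alpha: "(\<lambda>n. \<phi> n / (1 - \<alpha> n)) \<longlonglongrightarrow> 1"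
    and bias_phi: "(\<lambda>n. sqrt (real n * \<phi> n) * A (1 / \<phi> n)) \<in> O(\<lambda>_. 1)"
    and data:
      "(strictly_stationary M Z \<and> copies_of M X Z \<and> continuous_on UNIV F \<and> condition_D M F Z \<and>
        (\<exists>l r. condition_M M Z l r \<and> (\<lambda>n. real (r n) * \<phi> n) \<longlonglongrightarrow> 0 \<and>
          (\<exists>\<delta>>0.
            ((integrable M (\<lambda>\<omega>. \<bar>min (X \<omega>) 0\<bar> powr (2 + \<delta>)) \<and>
              summable (\<lambda>k. real k powr (2 / \<delta>) * alpha_mixing M Z k)) \<or>
             ((\<exists>B. AE \<omega> in M. \<bar>X \<omega>\<bar> \<le> B) \<and> summable (alpha_mixing M Z))) \<and>
            (\<lambda>n. real (r n) * (real (r n) / sqrt (real n * \<phi> n)) powr \<delta>) \<longlonglongrightarrow> 0)))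
       \<or>
       (copies_of M X Z \<and> prob_space.indep_vars M (\<lambda>_. borel) Z {1..} \<and>
        integrable M (\<lambda>\<omega>. \<bar>min (X \<omega>) 0\<bar>\<^sup>2))"
    and rho: "\<rho> < 0"
    and p: "\<forall>n. 0 < p n \<and> p n < 1" "decseq p" "p \<longlonglongrightarrow> 0"
    and n_tau: "filterlim (\<lambda>n. real n * (1 - \<tau> n)) at_top sequentially"
    and tau_p: "filterlim (\<lambda>n. (1 - \<tau> n) / p n) at_top sequentially"
    and log_rate: "filterlim (\<lambda>n. sqrt (real n * (1 - \<tau> n)) / ln ((1 - \<tau> n) / p n)) at_top sequentially"
    and bias_endpoint:
      "(\<lambda>n. sqrt (real n * (1 - \<tau> n)) * (right_endpoint F - quantile F (\<tau> n)) powr (1 / (1 - \<gamma>)))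
         \<in> O(\<lambda>_. 1)"
    and bias_tau: "(\<lambda>n. sqrt (real n * (1 - \<tau> n)) * A (1 / (1 - \<tau> n))) \<in> O(\<lambda>_. 1)"
    and sigma_meas: "\<forall>n. \<sigma>h n \<in> borel_measurable M"
    and gamma_meas: "\<forall>n. \<gamma>h n \<in> borel_measurable M"
    and sigma_rate:
      "bounded_in_probability M (\<lambda>n \<omega>. sqrt (real n * \<phi> n) * (\<sigma>h n \<omega> / a (1 / \<phi> n) - 1))"
    and Gamma_meas: "\<Gamma> \<in> borel_measurable N"
    and Gamma_nondegenerate: "\<not> (\<exists>c. AE \<omega> in N. \<Gamma> \<omega> = c)"
    and gamma_conv:
      "converges_in_distribution M (\<lambda>n \<omega>. sqrt (real n * (1 - \<tau> n)) * (\<gamma>h n \<omega> - \<gamma>)) N \<Gamma>"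
    and xi_star:
      "\<xi>h_star = (\<lambda>n \<omega>. empirical_expectile (\<tau> n) n (\<lambda>t. Z t \<omega>) +
         \<sigma>h n \<omega> * ((((1 - \<tau> n) / p n) powr (\<gamma>h n \<omega> / (1 - \<gamma>h n \<omega>)) - 1) / \<gamma>h n \<omega>))"
  shows "converges_in_distribution M
           (\<lambda>n \<omega>. sqrt (real n * (1 - \<tau> n)) / a (1 / \<phi> n) * (\<xi>h_star n \<omega> - expectile M X (1 - p n)))
           N (\<lambda>\<omega>. \<Gamma> \<omega> / \<gamma>\<^sup>2)"
proof -
  interpret P: prob_space M by (rule prob_M)
  interpret N: prob_space N by (rule prob_N)
  note [measurable] = X Gamma_meas
  define D where "D = distr M borel X"
  have FD: "F = cdf D" by (simp add: F D_def)
  interpret real_distribution D unfolding D_def by (rule P.real_distribution_distr) fact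
  interpret D: second_order_distribution D a A \<gamma> \<rho>
    using C2 rho by unfold_locales (simp_all add: FD)
  have g: "\<gamma> < 0" by (rule D.g)
  have \<tau>: "0 < \<tau> n \<and> \<tau> n < 1" for n using tau by blast
  have \<xi>: "\<xi> n = D.expectile_at (\<tau> n)" and \<xi>': "expectile M X (1 - p n) = D.expectile_at (1 - p n)" for n
  proof -
    have "D.expectile_at t = expectile M X t" for t
      unfolding D.expectile_at_def unfolding D_def by (rule expectile_distr[OF X, symmetric])
    then show "\<xi> n = D.expectile_at (\<tau> n)" "expectile M X (1 - p n) = D.expectile_at (1 - p n)"
      by (simp_all add: xi)
  qed
  have \<phi>: "\<phi> n = 1 - cdf D (D.expectile_at (\<tau> n))" for n by (simp add: phi FD \<xi>)
  have S: "D.S (D.expectile_at (\<tau> n)) = 1 / \<phi> n" for n by (simp add: D.S_def \<phi>)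
  have copies: "copies_of M X Z" using data by blast
  have Z: "\<And>t. t \<ge> 1 \<Longrightarrow> Z t \<in> borel_measurable M" "\<And>t. t \<ge> 1 \<Longrightarrow> distr M borel (Z t) = D"
    using copies by (auto simp: copies_of_def D_def)
  have "integrable M (\<lambda>\<omega>. \<bar>min (X \<omega>) 0\<bar>\<^sup>2)"
    using data P.negative_part_square_integrable[OF X] by blast
  then have sq: "integrable D (\<lambda>z. z\<^sup>2)"
    using D.square_integrable_of_negative_part[OF prob_M X D_def] by blast
  note facts = D.expectile_sequence_facts[OF sq \<tau> tau(3)]
  have \<phi>0: "\<phi> \<longlonglongrightarrow> 0" using facts(3) by (simp add: \<phi>[abs_def])
  \<comment> \<open>Both data regimes are reduced to the same block requirements. Under mixing the
    blocks have length \<open>r n\<close> and the coefficient is \<open>alpha_mixing\<close> at the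
    shorter gap \<open>l n\<close>; under independence blocks of length 1 with coefficient 0
    suffice, and the sums of joint exceedances are empty.\<close>
  obtain rl \<alpha>' where rl: "\<forall>\<^sub>F n in sequentially. 1 \<le> rl n \<and> rl n \<le> n \<and> mixing_bound M Z (rl n) (\<alpha>' n)"
      "(\<lambda>n. (real n / real (rl n) + 1) * \<alpha>' n) \<longlonglongrightarrow> 0" "(\<lambda>n. real (rl n) * \<phi> n) \<longlonglongrightarrow> 0"
    and joint: "\<And>x c0. \<forall>\<^sub>F n in sequentially. x n < D.xe \<and> 1 - cdf D (x n) \<le> c0 * \<phi> n \<Longrightarrow>
      \<exists>C. \<forall>\<^sub>F n in sequentially. \<forall>s\<ge>1.
       (\<Sum>j\<in>{1..<rl n}. measure M {\<omega> \<in> space M. Z s \<omega> > x n \<and> Z (s + j) \<omega> > x n}) \<le> C * (1 - cdf D (x n))"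
    using data
  proof
    assume "strictly_stationary M Z \<and> copies_of M X Z \<and> continuous_on UNIV F \<and> condition_D M F Z \<and>
        (\<exists>l r. condition_M M Z l r \<and> (\<lambda>n. real (r n) * \<phi> n) \<longlonglongrightarrow> 0 \<and>
          (\<exists>\<delta>>0.
            ((integrable M (\<lambda>\<omega>. \<bar>min (X \<omega>) 0\<bar> powr (2 + \<delta>)) \<and>
              summable (\<lambda>k. real k powr (2 / \<delta>) * alpha_mixing M Z k)) \<or>
             ((\<exists>B. AE \<omega> in M. \<bar>X \<omega>\<bar> \<le> B) \<and> summable (alpha_mixing M Z))) \<and>
            (\<lambda>n. real (r n) * (real (r n) / sqrt (real n * \<phi> n)) powr \<delta>) \<longlonglongrightarrow> 0))"
    then obtain l r where stat: "strictly_stationary M Z" and CD: "condition_D M (cdf D) Z"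
      and CM: "condition_M M Z l r" and r\<phi>: "(\<lambda>n. real (r n) * \<phi> n) \<longlonglongrightarrow> 0"
      unfolding FD by blast
    have CM': "\<And>n. r n > 0" "(\<lambda>n. real (l n) / real (r n)) \<longlonglongrightarrow> 0" "(\<lambda>n. real (r n) / real n) \<longlonglongrightarrow> 0"
       "(\<lambda>n. real n * alpha_mixing M Z (l n) / real (r n)) \<longlonglongrightarrow> 0"
      using CM by (auto simp: condition_M_def)
    show thesis
    proof (rule that[of r "\<lambda>n. alpha_mixing M Z (l n)"])
      have "\<forall>\<^sub>F n in sequentially. real (l n) / real (r n) < 1" "\<forall>\<^sub>F n in sequentially. real (r n) / real n < 1"
        using order_tendstoD(2)[OF CM'(2), of 1] order_tendstoD(2)[OF CM'(3), of 1] by auto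
      then show "\<forall>\<^sub>F n in sequentially. 1 \<le> r n \<and> r n \<le> n \<and> mixing_bound M Z (r n) (alpha_mixing M Z (l n))"
        using eventually_gt_at_top[of 0]
      proof eventually_elim
        case (elim n)
        then have "l n \<le> r n" "r n \<le> n" using CM'(1)[of n] by (auto simp: divide_less_eq)
        then show ?case using CM'(1)[of n] P.mixing_bound_alpha_mixing[OF Z(1)] by auto
      qed
      \<comment> \<open>The product \<open>(n / r + 1) * \<alpha>\<close> is the last ratio in
        condition M plus that ratio times \<open>r / n\<close>.\<close>
      have "(\<lambda>n. real n * alpha_mixing M Z (l n) / real (r n)
          + real n * alpha_mixing M Z (l n) / real (r n) * (real (r n) / real n)) \<longlonglongrightarrow> 0 + 0 * 0"
        by (intro tendsto_intros CM')
      moreover have "\<forall>\<^sub>F n in sequentially. real n * alpha_mixing M Z (l n) / real (r n)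
          + real n * alpha_mixing M Z (l n) / real (r n) * (real (r n) / real n)
          = (real n / real (r n) + 1) * alpha_mixing M Z (l n)"
        using eventually_gt_at_top[of 0]
      proof eventually_elim
        case (elim n)
        then show ?case using CM'(1)[of n] by (simp add: field_simps)
      qed
      ultimately show "(\<lambda>n. (real n / real (r n) + 1) * alpha_mixing M Z (l n)) \<longlonglongrightarrow> 0"
        by (auto intro: Lim_transform_eventually)
    qed (fact r\<phi>, rule D.condition_D_joint_tail[OF prob_M Z(1) stat CD \<phi>0 r\<phi>])
  next
    assume "copies_of M X Z \<and> prob_space.indep_vars M (\<lambda>_. borel) Z {1..} \<and>
        integrable M (\<lambda>\<omega>. \<bar>min (X \<omega>) 0\<bar>\<^sup>2)"
    then have ind: "P.indep_vars (\<lambda>_. borel) Z {1..}" by blast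
    show thesis
    proof (rule that[of "\<lambda>_. 1" "\<lambda>_. 0"])
      show "\<forall>\<^sub>F n in sequentially. 1 \<le> (1::nat) \<and> 1 \<le> n \<and> mixing_bound M Z 1 0"
        using eventually_ge_at_top[of 1] P.mixing_bound_indep[OF ind] by (auto elim!: eventually_mono)
      fix x c0
      show "\<exists>C. \<forall>\<^sub>F n in sequentially. \<forall>s\<ge>1.
       (\<Sum>j\<in>{1..<1::nat}. measure M {\<omega> \<in> space M. Z s \<omega> > x n \<and> Z (s + j) \<omega> > x n}) \<le> C * (1 - cdf D (x n))"
        by (intro exI[of _ 0]) simp
    qed (use \<phi>0 in auto)
  qed
  define m where "m n = sqrt (real n * (1 - \<tau> n))" for n
  define v where "v n = a (1 / \<phi> n)" for n
  define d where "d n = (1 - \<tau> n) / p n" for n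
  define Q where "Q n y = extrapolation_factor (d n) y" for n y
  define eh where "eh n \<omega> = empirical_expectile (\<tau> n) n (\<lambda>t. Z t \<omega>)" for n \<omega>
  define T where "T n \<omega> = m n * (\<gamma>h n \<omega> - \<gamma>)" for n \<omega>
  define R where "R n \<omega> = sqrt (real n * \<phi> n) * (\<sigma>h n \<omega> / v n - 1)" for n \<omega>
  define E where "E n \<omega> = m n / v n * (eh n \<omega> - \<xi> n)" for n \<omega>
  define b where "b n = m n * (Q n \<gamma> - (expectile M X (1 - p n) - \<xi> n) / v n)" for n
  define Y where "Y n \<omega> = m n / v n * (\<xi>h_star n \<omega> - expectile M X (1 - p n))" for n \<omega>
  have [measurable]: "\<gamma>h n \<in> borel_measurable M" "\<sigma>h n \<in> borel_measurable M" for n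
    using sigma_meas gamma_meas by auto
  have eh_meas[measurable]: "eh n \<in> borel_measurable M" for n
    unfolding eh_def[abs_def] using \<tau>[of n] by (intro empirical_expectile_measurable Z(1)) auto
  have T_meas[measurable]: "T n \<in> borel_measurable M" for n unfolding T_def[abs_def] by measurable
  have R_meas[measurable]: "R n \<in> borel_measurable M" for n unfolding R_def[abs_def] by measurable
  have E_meas[measurable]: "E n \<in> borel_measurable M" for n unfolding E_def[abs_def] by measurable
  have star: "\<xi>h_star n \<omega> = eh n \<omega> + \<sigma>h n \<omega> * Q n (\<gamma>h n \<omega>)" for n \<omega>
    by (simp add: xi_star eh_def Q_def extrapolation_factor_def d_def)
  have Y_meas[measurable]: "Y n \<in> borel_measurable M" for n
    unfolding Y_def[abs_def] star Q_def extrapolation_factor_def by measurable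
  have E0: "to_zero_in_probability M E"
    using D.expectile_consistency[OF prob_M Z sq \<tau> tau(3) n_tau rl(1,2) rl(3)[unfolded \<phi>] joint[unfolded \<phi>]]
    unfolding E_def[abs_def] m_def v_def eh_def \<xi> S .
  have T_conv: "converges_in_distribution M T N \<Gamma>" using gamma_conv by (simp add: T_def[abs_def] m_def)
  have T_bd: "bounded_in_probability M T"
    by (rule P.converges_imp_bounded_in_probability[OF prob_N T_meas Gamma_meas T_conv])
  have R_bd: "bounded_in_probability M R" using sigma_rate by (simp add: R_def[abs_def] v_def)
  have m_lim: "filterlim m at_top sequentially"
    unfolding m_def by (rule filterlim_compose[OF sqrt_at_top n_tau])
  have d_lim: "filterlim d at_top sequentially" using tau_p by (simp add: d_def[abs_def])
  have b0: "b \<longlonglongrightarrow> 0"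
    using D.expectile_bias_to_zero[OF sq \<tau> tau(3) _ tau_p, folded \<phi> \<xi>] p bias_phi bias_endpoint
    by (simp add: b_def[abs_def] m_def v_def Q_def d_def \<xi>' FD D.xe_def)
  \<comment> \<open>The quotient is the square root of \<open>(1 - \<tau>) / \<phi>\<close>, at most
    \<open>sqrt (c * (xe - \<xi>))\<close>. This is what makes the scale estimator exact at the
    scale \<open>m\<close>.\<close>
  have ratio0: "(\<lambda>n. m n / sqrt (real n * \<phi> n)) \<longlonglongrightarrow> 0"
  proof -
    obtain c where c: "c > 0" "\<forall>\<^sub>F n in sequentially. 1 - \<tau> n \<le> c * (D.xe - \<xi> n) * \<phi> n"
      using facts(4) unfolding \<xi>[symmetric] \<phi>[symmetric, unfolded \<xi>[symmetric]] by blast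
    show ?thesis
    proof (rule Lim_null_comparison)
      have "(\<lambda>n. sqrt (c * (D.xe - \<xi> n))) \<longlonglongrightarrow> sqrt (c * 0)"
        using facts(2) by (intro tendsto_intros) (simp add: \<xi>)
      then show "(\<lambda>n. sqrt (c * (D.xe - \<xi> n))) \<longlonglongrightarrow> 0" by simp
      have "\<forall>\<^sub>F n in sequentially. real n * \<phi> n > 0" using n_phi by (simp add: filterlim_at_top_dense)
      then show "\<forall>\<^sub>F n in sequentially. norm (m n / sqrt (real n * \<phi> n)) \<le> sqrt (c * (D.xe - \<xi> n))"
        using c(2)
      proof eventually_elim
        case (elim n)
        have "\<phi> n > 0" "n > 0" using elim(1) by (auto simp: zero_less_mult_iff)
        have "norm (m n / sqrt (real n * \<phi> n)) = sqrt ((1 - \<tau> n) / \<phi> n)"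
          using \<tau>[of n] \<open>n > 0\<close> \<open>\<phi> n > 0\<close> by (simp add: m_def abs_divide real_sqrt_mult real_sqrt_divide)
        also have "\<dots> \<le> sqrt (c * (D.xe - \<xi> n))"
          using elim(2) \<open>\<phi> n > 0\<close> by (intro real_sqrt_le_mono) (simp add: divide_le_eq)
        finally show ?case .
      qed
    qed
  qed
  have "to_zero_in_probability M (\<lambda>n \<omega>. Y n \<omega> - 1 / \<gamma>\<^sup>2 * T n \<omega>)"
    unfolding to_zero_in_probability_def
  proof (intro allI impI)
    fix \<epsilon> :: real assume \<epsilon>: "\<epsilon> > 0"
    show "(\<lambda>n. P.prob {\<omega> \<in> space M. \<epsilon> < \<bar>Y n \<omega> - 1 / \<gamma>\<^sup>2 * T n \<omega>\<bar>}) \<longlonglongrightarrow> 0"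
    proof (rule tendstoI)
      fix e :: real assume e: "e > 0"
      obtain KT where KT: "\<forall>\<^sub>F n in sequentially. P.prob {\<omega> \<in> space M. \<bar>T n \<omega>\<bar> > KT} < e / 3"
        using T_bd e unfolding bounded_in_probability_def by (meson divide_pos_pos zero_less_numeral)
      obtain KR where KR: "\<forall>\<^sub>F n in sequentially. P.prob {\<omega> \<in> space M. \<bar>R n \<omega>\<bar> > KR} < e / 3"
        using R_bd e unfolding bounded_in_probability_def by (meson divide_pos_pos zero_less_numeral)
      have "(\<lambda>n. P.prob {\<omega> \<in> space M. \<epsilon> / 4 < \<bar>E n \<omega>\<bar>}) \<longlonglongrightarrow> 0"
        using E0[unfolded to_zero_in_probability_def, rule_format, of "\<epsilon> / 4"] \<epsilon> by simp
      then have KE: "\<forall>\<^sub>F n in sequentially. P.prob {\<omega> \<in> space M. \<epsilon> / 4 < \<bar>E n \<omega>\<bar>} < e / 3"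
        by (rule order_tendstoD) (use e in simp)
      \<comment> \<open>The linearisation is uniform over a bounded range of \<open>u\<close>, so it
        may be applied at the random value \<open>u = T n \<omega>\<close>; its radius must be
        positive, hence \<open>max KT 1\<close>. The budget \<epsilon> is divided into quarters for
        the four terms of the decomposition below.\<close>
      have lin: "\<forall>\<^sub>F n in sequentially. \<forall>u. \<bar>u\<bar> \<le> max KT 1 \<longrightarrow>
         \<bar>m n * (Q n (\<gamma> + u / m n) - Q n \<gamma>) - u / \<gamma>\<^sup>2\<bar> \<le> \<epsilon> / 4 \<and> \<bar>Q n (\<gamma> + u / m n)\<bar> \<le> 4 / - \<gamma>"
        unfolding Q_def using \<epsilon> by (intro extrapolation_factor_linearization g d_lim m_lim) auto
      have "(\<lambda>n. m n / sqrt (real n * \<phi> n) * (\<bar>KR\<bar> * (4 / - \<gamma>))) \<longlonglongrightarrow> 0 * (\<bar>KR\<bar> * (4 / - \<gamma>))"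
        by (intro tendsto_intros ratio0)
      then have rat: "\<forall>\<^sub>F n in sequentially. m n / sqrt (real n * \<phi> n) * (\<bar>KR\<bar> * (4 / - \<gamma>)) < \<epsilon> / 4"
        by (rule order_tendstoD) (use \<epsilon> in simp)
      have bs: "\<forall>\<^sub>F n in sequentially. \<bar>b n\<bar> < \<epsilon> / 4"
        using tendstoD[OF b0, of "\<epsilon> / 4"] \<epsilon> by (simp add: dist_real_def)
      have mp: "\<forall>\<^sub>F n in sequentially. m n > 0" "\<forall>\<^sub>F n in sequentially. real n * \<phi> n > 0"
        using m_lim n_phi by (simp_all add: filterlim_at_top_dense)
      have vp: "\<forall>\<^sub>F n in sequentially. v n > 0"
      proof -
        have "\<forall>\<^sub>F n in sequentially. \<phi> n < 1" using order_tendstoD(2)[OF \<phi>0, of 1] by simp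
        then show ?thesis using mp(2)
          by eventually_elim (auto simp: v_def zero_less_mult_iff intro!: D.a_pos)
      qed
      show "\<forall>\<^sub>F n in sequentially. dist (P.prob {\<omega> \<in> space M. \<epsilon> < \<bar>Y n \<omega> - 1 / \<gamma>\<^sup>2 * T n \<omega>\<bar>}) 0 < e"
        using KT KR KE lin rat bs mp vp
      proof eventually_elim
        case (elim n)
        define BT where "BT = {\<omega> \<in> space M. \<bar>T n \<omega>\<bar> > KT}"
        define BR where "BR = {\<omega> \<in> space M. \<bar>R n \<omega>\<bar> > KR}"
        define BE where "BE = {\<omega> \<in> space M. \<epsilon> / 4 < \<bar>E n \<omega>\<bar>}"
        have ev: "BT \<in> P.events" "BR \<in> P.events" "BE \<in> P.events"
          unfolding BT_def BR_def BE_def by measurable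
        have "{\<omega> \<in> space M. \<epsilon> < \<bar>Y n \<omega> - 1 / \<gamma>\<^sup>2 * T n \<omega>\<bar>} \<subseteq> BT \<union> BR \<union> BE"
        proof
          fix \<omega> assume \<omega>: "\<omega> \<in> {\<omega> \<in> space M. \<epsilon> < \<bar>Y n \<omega> - 1 / \<gamma>\<^sup>2 * T n \<omega>\<bar>}"
          show "\<omega> \<in> BT \<union> BR \<union> BE"
          proof (rule ccontr)
            assume "\<not> ?thesis"
            then have T: "\<bar>T n \<omega>\<bar> \<le> max KT 1" and R: "\<bar>R n \<omega>\<bar> \<le> \<bar>KR\<bar>" and E: "\<bar>E n \<omega>\<bar> \<le> \<epsilon> / 4"
              using \<omega> by (auto simp: BT_def BR_def BE_def)
            have gh: "\<gamma>h n \<omega> = \<gamma> + T n \<omega> / m n" using elim by (simp add: T_def)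
            define q where "q = Q n (\<gamma>h n \<omega>)"
            have l: "\<bar>m n * (q - Q n \<gamma>) - T n \<omega> / \<gamma>\<^sup>2\<bar> \<le> \<epsilon> / 4" "\<bar>q\<bar> \<le> 4 / - \<gamma>"
              using elim(4) T unfolding q_def gh by blast+
            define s where "s = sqrt (real n * \<phi> n)"
            have s: "s > 0" using elim by (simp add: s_def)
            \<comment> \<open>An exact identity: location error, scale error, linearisation error of
              the extrapolation factor, and deterministic bias. In the second term the square root
              of \<open>n * \<phi>\<close> contained in \<open>R\<close> leaves the vanishing
              quotient \<open>m n / s\<close>.\<close>
            have "Y n \<omega> - T n \<omega> / \<gamma>\<^sup>2 = E n \<omega> + m n / s * (R n \<omega> * q) + (m n * (q - Q n \<gamma>) - T n \<omega> / \<gamma>\<^sup>2) + b n"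
            proof -
              have "m n / s * (R n \<omega> * q) = m n * (\<sigma>h n \<omega> / v n - 1) * q"
                using s by (simp add: R_def s_def[symmetric])
              then show ?thesis using elim(9)
                unfolding Y_def E_def b_def star q_def[symmetric] by (simp add: field_simps)
            qed
            moreover have "\<bar>m n / s * (R n \<omega> * q)\<bar> \<le> m n / s * (\<bar>KR\<bar> * (4 / - \<gamma>))"
              unfolding abs_mult[of "m n / s"] abs_mult[of "R n \<omega>"]
              using elim(7) s R l(2) by (intro mult_mono) auto
            ultimately have "\<bar>Y n \<omega> - T n \<omega> / \<gamma>\<^sup>2\<bar> \<le> \<epsilon>"
              using E l(1) elim(5,6) unfolding s_def[symmetric] by linarith
            then show False using \<omega> by simp
          qed
        qed
        then have "P.prob {\<omega> \<in> space M. \<epsilon> < \<bar>Y n \<omega> - 1 / \<gamma>\<^sup>2 * T n \<omega>\<bar>} \<le> P.prob (BT \<union> BR \<union> BE)"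
          using ev by (intro P.finite_measure_mono) auto
        also have "\<dots> \<le> P.prob (BT \<union> BR) + P.prob BE" using ev by (intro measure_Un_le) auto
        also have "P.prob (BT \<union> BR) \<le> P.prob BT + P.prob BR" using ev by (intro measure_Un_le) auto
        finally have "P.prob {\<omega> \<in> space M. \<epsilon> < \<bar>Y n \<omega> - 1 / \<gamma>\<^sup>2 * T n \<omega>\<bar>} < e"
          using elim(1,2,3) unfolding BT_def[symmetric] BR_def[symmetric] BE_def[symmetric] by linarith
        then show ?case by (simp add: dist_real_def)
      qed
    qed
  qed
  then have "converges_in_distribution M Y N (\<lambda>\<omega>. 1 / \<gamma>\<^sup>2 * \<Gamma> \<omega>)"
    by (intro P.slutsky[OF prob_N T_meas Y_meas Gamma_meas T_conv])
  then show ?thesis by (simp add: Y_def[abs_def] m_def v_def)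
qed

end
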